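(* Let $\mathcal{D}_0=\{(X_i,Y_i,Z_i)\}_{i=1}^n$ be i.i.d. copies of $(X,Y,Z)$ with joint density $p_{X,Y,Z}$ on $\mathbb{R}^{d_X+d_Y+d_Z}$, suppose assumptions (A1), (A2), (A3) (stated in the context) hold, and fix $\alpha\in(0,1)$ and a weight function $a$. Let $p_{CRT}$ be the conditional randomization test $p$-value with $M$ resamples defined in the context. Then the test $\phi_{CRT}=\mathbf 1\{p_{CRT}<\alpha\}$ controls Type I error in finite samples: $\mathbb{P}_{H_0}(\phi_{CRT}=1)\le\alpha$, where $H_0$ is that $X$ and $Y$ are conditionally independent given $Z$. Moreover, if $M>(1-\alpha)/\alpha$, then $\lim_{n\to\infty}\mathbb{P}_{H_1}(\phi_{CRT}=1)=1$, where $H_1$ is that $X$ and $Y$ are not conditionally independent given $Z$.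
   Context: Marginals of $p_{X,Y,Z}$ are denoted $p_{X,Z},p_{Y,Z},p_Z$, etc. A weight function is a bounded measurable $a:\mathbb{R}^{d_Y}\times\mathbb{R}^{d_Z}\to[0,\infty)$ positive on the support of $p_{Y,Z}$. $\|\cdot\|$ is the Euclidean norm. Ball divergence: for probability measures $P,Q$ on $\mathbb{R}^d$, $\Theta^2(P,Q)=\int\int (P(\bar B)-Q(\bar B))^2\{dP(u)dP(v)+dQ(u)dQ(v)\}$ with $\bar B=\bar B(u,\|v-u\|)$ the closed ball of center $u$ and radius $\|v-u\|$. Test statistic: for a data set $\mathcal{D}=\{(X_i,Y_i,Z_i)\}_{i=1}^n$, kernel $K:[0,\infty)\to[0,\infty)$ and bandwidths $h_1,h_2>0$, let $$\tilde{\mathbb{P}}_{X|Y=y,Z=z}(A)=\frac{\sum_{i=1}^n K(\|(y,z)-(Y_i,Z_i)\|/h_1)\mathbf 1\{X_i\in A\}}{\sum_{i=1}^n K(\|(y,z)-(Y_i,Z_i)\|/h_1)},\qquad \tilde{\mathbb{P}}_{X|Z=z}(A)=\frac{\sum_{i=1}^n K(\|z-Z_i\|/h_2)\mathbf 1\{X_i\in A\}}{\sum_{i=1}^n K(\|z-Z_i\|/h_2)},$$ and $\hat\zeta_n(\mathcal{D})=\frac1n\sum_{s=1}^n\Theta^2(\tilde{\mathbb{P}}_{X|Y_s,Z_s},\tilde{\mathbb{P}}_{X|Z_s})\,a(Y_s,Z_s)$. Conditional randomization test: the conditional distribution of $X$ given $Z$ is known. Generate $X_i'\sim\mathbb{P}_{X|Z=Z_i}$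 for $1\le i\le n$ (independently of each other and of the remaining data given $Z_1,\dots,Z_n$), and put $\mathcal{D}'=\{(X_i',Y_i,Z_i)\}_{i=1}^n$. Repeat independently $M$ times to get $\mathcal{D}_1',\dots,\mathcal{D}_M'$. Then $p_{CRT}=\frac{1+\sum_{j=1}^M\mathbf 1\{\hat\zeta_n(\mathcal{D}_j')\ge\hat\zeta_n(\mathcal{D}_0)\}}{1+M}$. Niceness: a joint density $f(x,y)$ is nice with respect to $Y$ (its second argument) if, for any sequence $\delta_n\to0$, with $$R_n(x,y;u)=\frac1{\delta_n^2}\left\{\frac{f(x,y+\delta_n u)}{f(x,y)}-1-\delta_n\Big(\frac{\frac{\partial}{\partial y}f(x,y)}{f(x,y)}\Big)u^\top\right\},$$ the quantity $\sup_{u:\|u\|=1}\limsup_{n\to\infty}\int R_n(x,y;u)^2f(x,y)\,dx$ is uniformly bounded in $y$ (vectors are rows). (A1) $p_{X,Z}$ is nice with respect to $Z$, $p_{X,Y,Z}$ is nice with respect to $(Y,Z)$, and $p_{X,Y,Z}$ and its marginals are uniformly bounded. (A2) $K$ is uniformly bounded, non-negative, symmetric about zero, compactly supported, and $\int_{\mathbb{R}^d}K(\|u\|)du=1$, $\int_{\mathbb{R}^d}u^\top u\,K(\|u\|)du=\tau I_d$ for some constant $\tau>0$, where $d=d_Y+d_Z$ or $d=d_Z$ depending on the context in which $K$ is used. (A3) $h_1,h_2$ depend on $n$ such that, with $d_1=d_Y+d_Z$, $d_2=d_Z$: $h_1^{d_1}/h_2^{d_2}\to0$, $nh_i^{d_i}\to\infty$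 and $nh_i^{d_i+4}\to0$ for $i=1,2$, as $n\to\infty$. *)

theory Defs
  imports "HOL-Probability.Probability"
begin

(* Type class euclidean_space stands for R^d (d >= 1); the norm of a product type is the
   Euclidean norm of the concatenated vector.  A point (x, y, z) of R^(dX+dY+dZ) is nested
   as (x, (y, z)). *)

section \<open>Conditional independence and conditional distributions\<close>

definition cond_indep ::
  "'s measure \<Rightarrow> ('s \<Rightarrow> 'x::topological_space) \<Rightarrow> ('s \<Rightarrow> 'y::topological_space)
     \<Rightarrow> ('s \<Rightarrow> 'z::topological_space) \<Rightarrow> bool" where
  "cond_indep S X Y Z \<longleftrightarrow>
     (let F = vimage_algebra (space S) Z borel in
      \<forall>A\<in>sets borel. \<forall>B\<in>sets borel. AE \<omega> in S.
        real_cond_exp S F (\<lambda>\<omega>. indicator A (X \<omega>) * indicator B (Y \<omega>)) \<omega> =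
        real_cond_exp S F (\<lambda>\<omega>. indicator A (X \<omega>)) \<omega> *
        real_cond_exp S F (\<lambda>\<omega>. indicator B (Y \<omega>)) \<omega>)"

(* \<kappa> z is the conditional distribution of X given Z = z (any version of it). *)
definition cond_distribution ::
  "'s measure \<Rightarrow> ('s \<Rightarrow> 'x::topological_space) \<Rightarrow> ('s \<Rightarrow> 'z::topological_space)
     \<Rightarrow> ('z \<Rightarrow> 'x measure) \<Rightarrow> bool" where
  "cond_distribution S X Z \<kappa> \<longleftrightarrow>
     \<kappa> \<in> borel \<rightarrow>\<^sub>M prob_algebra borel \<and>
     (\<forall>A\<in>sets borel. \<forall>B\<in>sets borel.
        measure S {\<omega> \<in> space S. X \<omega> \<in> A \<and> Z \<omega> \<in> B} =
        (\<integral>\<omega>. indicator B (Z \<omega>) * measure (\<kappa> (Z \<omega>)) A \<partial>S))"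

section \<open>Densities\<close>

definition marg_XZ :: "('x::euclidean_space \<times> 'y::euclidean_space \<times> 'z \<Rightarrow> real) \<Rightarrow> 'x \<Rightarrow> 'z \<Rightarrow> real" where
  "marg_XZ p x z = (\<integral>y. p (x, y, z) \<partial>lborel)"

definition marg_YZ :: "('x::euclidean_space \<times> 'y \<times> 'z \<Rightarrow> real) \<Rightarrow> 'y \<Rightarrow> 'z \<Rightarrow> real" where
  "marg_YZ p y z = (\<integral>x. p (x, y, z) \<partial>lborel)"

(* Stated with the extended nonnegative integral so that boundedness includes convergence
   of the integrals that define the marginals. *)
definition bounded_with_marginals ::
  "('x::euclidean_space \<times> 'y::euclidean_space \<times> 'z::euclidean_space \<Rightarrow> real) \<Rightarrow> bool" where
  "bounded_with_marginals p \<longleftrightarrow> (\<exists>C::real.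
     (\<forall>w. p w \<le> C) \<and>
     (\<forall>y z. (\<integral>\<^sup>+x. ennreal (p (x, y, z)) \<partial>lborel) \<le> ennreal C) \<and>
     (\<forall>x z. (\<integral>\<^sup>+y. ennreal (p (x, y, z)) \<partial>lborel) \<le> ennreal C) \<and>
     (\<forall>x y. (\<integral>\<^sup>+z. ennreal (p (x, y, z)) \<partial>lborel) \<le> ennreal C) \<and>
     (\<forall>x. (\<integral>\<^sup>+(y, z). ennreal (p (x, y, z)) \<partial>lborel) \<le> ennreal C) \<and>
     (\<forall>y. (\<integral>\<^sup>+(x, z). ennreal (p (x, y, z)) \<partial>lborel) \<le> ennreal C) \<and>
     (\<forall>z. (\<integral>\<^sup>+(x, y). ennreal (p (x, y, z)) \<partial>lborel) \<le> ennreal C))"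

(* The Frechet derivative applied to u is the product of the gradient row vector with the
   transpose of u. *)
definition nice_remainder ::
  "('x \<Rightarrow> 'y::euclidean_space \<Rightarrow> real) \<Rightarrow> real \<Rightarrow> 'y \<Rightarrow> 'x \<Rightarrow> 'y \<Rightarrow> real" where
  "nice_remainder f \<delta> u x y =
     (1 / \<delta>\<^sup>2) * (f x (y + \<delta> *\<^sub>R u) / f x y - 1
        - \<delta> * (frechet_derivative (f x) (at y) u / f x y))"

(* The remainder only makes sense where f is positive; the factor f in the integrand
   annihilates the other points. *)
definition nice_density :: "('x::euclidean_space \<Rightarrow> 'y::euclidean_space \<Rightarrow> real) \<Rightarrow> bool" where
  "nice_density f \<longleftrightarrow>
     (\<forall>x y. f x y > 0 \<longrightarrow> f x differentiable (at y)) \<and>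
     (\<forall>\<delta>::nat \<Rightarrow> real. (\<forall>n. \<delta> n \<noteq> 0) \<and> \<delta> \<longlonglongrightarrow> 0 \<longrightarrow>
        (\<exists>C::real. \<forall>y.
           (SUP u\<in>sphere 0 1. limsup (\<lambda>n.
              \<integral>\<^sup>+x. ennreal ((nice_remainder f (\<delta> n) u x y)\<^sup>2 * f x y) \<partial>lborel)) \<le> ennreal C))"

definition assumption_A1 ::
  "('x::euclidean_space \<times> 'y::euclidean_space \<times> 'z::euclidean_space \<Rightarrow> real) \<Rightarrow> bool" where
  "assumption_A1 p \<longleftrightarrow>
     nice_density (marg_XZ p) \<and> nice_density (\<lambda>x yz. p (x, yz)) \<and> bounded_with_marginals p"

section \<open>Kernel, bandwidths and weight\<close>

definition kernel_moments :: "'d::euclidean_space itself \<Rightarrow> (real \<Rightarrow> real) \<Rightarrow> bool" where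
  "kernel_moments _ K \<longleftrightarrow>
     has_bochner_integral lborel (\<lambda>u::'d. K (norm u)) 1 \<and>
     (\<exists>\<tau>>0. \<forall>b\<in>Basis. \<forall>b'\<in>Basis.
        has_bochner_integral lborel (\<lambda>u::'d. (u \<bullet> b) * (u \<bullet> b') * K (norm u))
          (if b = b' then \<tau> else 0))"

(* K is defined on the whole line (extended evenly from [0, \<infinity>)); the same K is used in
   dimensions dY + dZ and dZ, with possibly different constants \<tau>. *)
definition assumption_A2 ::
  "'y::euclidean_space itself \<Rightarrow> 'z::euclidean_space itself \<Rightarrow> (real \<Rightarrow> real) \<Rightarrow> bool" where
  "assumption_A2 _ _ K \<longleftrightarrow>
     (\<forall>r. 0 \<le> K r) \<and> (\<exists>C. \<forall>r. K r \<le> C) \<and> (\<forall>r. K (- r) = K r) \<and>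
     (\<exists>R. \<forall>r. \<bar>r\<bar> > R \<longrightarrow> K r = 0) \<and>
     kernel_moments TYPE('y \<times> 'z) K \<and> kernel_moments TYPE('z) K"

definition assumption_A3 :: "nat \<Rightarrow> nat \<Rightarrow> (nat \<Rightarrow> real) \<Rightarrow> (nat \<Rightarrow> real) \<Rightarrow> bool" where
  "assumption_A3 d1 d2 h1 h2 \<longleftrightarrow>
     (\<forall>n. h1 n > 0) \<and> (\<forall>n. h2 n > 0) \<and>
     (\<lambda>n. h1 n ^ d1 / h2 n ^ d2) \<longlonglongrightarrow> 0 \<and>
     filterlim (\<lambda>n. real n * h1 n ^ d1) at_top sequentially \<and>
     filterlim (\<lambda>n. real n * h2 n ^ d2) at_top sequentially \<and>
     (\<lambda>n. real n * h1 n ^ (d1 + 4)) \<longlonglongrightarrow> 0 \<and>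
     (\<lambda>n. real n * h2 n ^ (d2 + 4)) \<longlonglongrightarrow> 0"

(* The support of p_YZ is read as the set where the density is positive; requiring positivity
   of the weight on its closure would be a stronger hypothesis. *)
definition weight_function ::
  "('x::euclidean_space \<times> 'y::euclidean_space \<times> 'z::euclidean_space \<Rightarrow> real)
     \<Rightarrow> ('y \<times> 'z \<Rightarrow> real) \<Rightarrow> bool" where
  "weight_function p a \<longleftrightarrow>
     a \<in> borel_measurable borel \<and> (\<forall>w. 0 \<le> a w) \<and> (\<exists>C. \<forall>w. a w \<le> C) \<and>
     (\<forall>y z. marg_YZ p y z > 0 \<longrightarrow> a (y, z) > 0)"

section \<open>Ball divergence and the test statistic\<close>

definition ball_divergence_sq :: "'d::euclidean_space measure \<Rightarrow> 'd measure \<Rightarrow> real" where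
  "ball_divergence_sq P Q =
     (let g = (\<lambda>u v. (measure P (cball u (norm (v - u))) - measure Q (cball u (norm (v - u))))\<^sup>2)
      in (\<integral>u. \<integral>v. g u v \<partial>P \<partial>P) + (\<integral>u. \<integral>v. g u v \<partial>Q \<partial>Q))"

(* If all weights vanish, this is the null measure (0 / 0 = 0). *)
definition weighted_empirical ::
  "nat \<Rightarrow> (nat \<Rightarrow> real) \<Rightarrow> (nat \<Rightarrow> 'x::euclidean_space) \<Rightarrow> 'x measure" where
  "weighted_empirical n w xs =
     distr (point_measure {..<n} (\<lambda>i. ennreal (w i / (\<Sum>k<n. w k)))) borel xs"

lemma measure_weighted_empirical:
  assumes "\<And>i. i < n \<Longrightarrow> 0 \<le> w i" and "A \<in> sets borel"
  shows "measure (weighted_empirical n w xs) A =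
     (\<Sum>i<n. w i * indicator A (xs i)) / (\<Sum>i<n. w i)"
proof -
  let ?s = "\<Sum>k<n. w k"
  have s: "0 \<le> ?s" using assms(1) by (auto intro: sum_nonneg)
  have fin: "finite {i \<in> {..<n}. xs i \<in> A}" by simp
  have "emeasure (weighted_empirical n w xs) A =
      emeasure (point_measure {..<n} (\<lambda>i. ennreal (w i / ?s))) {i \<in> {..<n}. xs i \<in> A}"
    unfolding weighted_empirical_def using assms(2)
    by (subst emeasure_distr)
      (auto simp: space_point_measure measurable_point_measure_eq1 intro!: arg_cong2[where f=emeasure])
  also have "\<dots> = (\<Sum>i\<in>{i \<in> {..<n}. xs i \<in> A}. ennreal (w i / ?s))"
    by (rule emeasure_point_measure_finite2) auto
  also have "\<dots> = ennreal (\<Sum>i\<in>{i \<in> {..<n}. xs i \<in> A}. w i / ?s)"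
    using assms(1) s by (intro sum_ennreal) auto
  also have "(\<Sum>i\<in>{i \<in> {..<n}. xs i \<in> A}. w i / ?s) = (\<Sum>i<n. w i * indicator A (xs i)) / ?s"
    unfolding sum_divide_distrib
    by (rule sum.mono_neutral_cong_left) (auto simp: indicator_def)
  finally have "emeasure (weighted_empirical n w xs) A =
      ennreal ((\<Sum>i<n. w i * indicator A (xs i)) / ?s)" .
  moreover have "0 \<le> (\<Sum>i<n. w i * indicator A (xs i)) / ?s"
    using assms(1) s by (intro divide_nonneg_nonneg sum_nonneg) auto
  ultimately show ?thesis by (simp only: measure_def enn2real_ennreal)
qed

type_synonym ('x, 'y, 'z) dataset = "nat \<Rightarrow> 'x \<times> 'y \<times> 'z"

abbreviation dX :: "('x, 'y, 'z) dataset \<Rightarrow> nat \<Rightarrow> 'x" where "dX D i \<equiv> fst (D i)"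
abbreviation dYZ :: "('x, 'y, 'z) dataset \<Rightarrow> nat \<Rightarrow> 'y \<times> 'z" where "dYZ D i \<equiv> snd (D i)"
abbreviation dZ :: "('x, 'y, 'z) dataset \<Rightarrow> nat \<Rightarrow> 'z" where "dZ D i \<equiv> snd (snd (D i))"

definition est_X_given_YZ ::
  "(real \<Rightarrow> real) \<Rightarrow> real \<Rightarrow> nat \<Rightarrow> ('x::euclidean_space, 'y::euclidean_space, 'z::euclidean_space) dataset
     \<Rightarrow> 'y \<times> 'z \<Rightarrow> 'x measure" where
  "est_X_given_YZ K h n D yz = weighted_empirical n (\<lambda>i. K (norm (yz - dYZ D i) / h)) (dX D)"

definition est_X_given_Z ::
  "(real \<Rightarrow> real) \<Rightarrow> real \<Rightarrow> nat \<Rightarrow> ('x::euclidean_space, 'y, 'z::euclidean_space) dataset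
     \<Rightarrow> 'z \<Rightarrow> 'x measure" where
  "est_X_given_Z K h n D z = weighted_empirical n (\<lambda>i. K (norm (z - dZ D i) / h)) (dX D)"

definition zeta_hat ::
  "(real \<Rightarrow> real) \<Rightarrow> real \<Rightarrow> real \<Rightarrow> ('y \<times> 'z \<Rightarrow> real) \<Rightarrow> nat
     \<Rightarrow> ('x::euclidean_space, 'y::euclidean_space, 'z::euclidean_space) dataset \<Rightarrow> real" where
  "zeta_hat K h1 h2 a n D =
     (1 / real n) * (\<Sum>s<n. ball_divergence_sq (est_X_given_YZ K h1 n D (dYZ D s))
                             (est_X_given_Z K h2 n D (dZ D s)) * a (dYZ D s))"

section \<open>The conditional randomization test\<close>

(* W i is the i-th observation and X' j i the i-th covariate of the j-th resample (indices
   start at 0).  The last clause says that, conditionally on the data, the X' j i are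
   independent with X' j i distributed as \<kappa> (Z_i). *)
definition crt_experiment ::
  "'w measure \<Rightarrow> ('x::euclidean_space \<times> 'y::euclidean_space \<times> 'z::euclidean_space \<Rightarrow> real)
     \<Rightarrow> ('z \<Rightarrow> 'x measure) \<Rightarrow> nat \<Rightarrow> nat \<Rightarrow> (nat \<Rightarrow> 'w \<Rightarrow> 'x \<times> 'y \<times> 'z)
     \<Rightarrow> (nat \<Rightarrow> nat \<Rightarrow> 'w \<Rightarrow> 'x) \<Rightarrow> bool" where
  "crt_experiment \<Omega> p \<kappa> M n W X' \<longleftrightarrow>
     prob_space \<Omega> \<and>
     prob_space.indep_vars \<Omega> (\<lambda>_. borel) W {..<n} \<and>
     (\<forall>i<n. distributed \<Omega> lborel (W i) (\<lambda>w. ennreal (p w))) \<and>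
     (\<forall>j<M. \<forall>i<n. X' j i \<in> borel_measurable \<Omega>) \<and>
     (\<forall>A\<in>sets (PiM {..<n} (\<lambda>_. borel)). \<forall>B. (\<forall>j<M. \<forall>i<n. B j i \<in> sets borel) \<longrightarrow>
        measure \<Omega> {\<omega> \<in> space \<Omega>. (\<lambda>i\<in>{..<n}. W i \<omega>) \<in> A \<and> (\<forall>j<M. \<forall>i<n. X' j i \<omega> \<in> B j i)} =
        (\<integral>\<omega>. indicator A (\<lambda>i\<in>{..<n}. W i \<omega>) *
              (\<Prod>j<M. \<Prod>i<n. measure (\<kappa> (snd (snd (W i \<omega>)))) (B j i)) \<partial>\<Omega>))"

definition p_CRT ::
  "(('x, 'y, 'z) dataset \<Rightarrow> real) \<Rightarrow> nat \<Rightarrow> ('x, 'y, 'z) dataset \<Rightarrow> (nat \<Rightarrow> ('x, 'y, 'z) dataset) \<Rightarrow> real" where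
  "p_CRT T M D0 D' = (1 + (\<Sum>j<M. of_bool (T (D' j) \<ge> T D0))) / (1 + real M)"

definition phi_CRT ::
  "(('x, 'y, 'z) dataset \<Rightarrow> real) \<Rightarrow> real \<Rightarrow> nat \<Rightarrow> ('x, 'y, 'z) dataset \<Rightarrow> (nat \<Rightarrow> ('x, 'y, 'z) dataset) \<Rightarrow> real" where
  "phi_CRT T \<alpha> M D0 D' = of_bool (p_CRT T M D0 D' < \<alpha>)"

definition crt_reject ::
  "'w measure \<Rightarrow> (('x, 'y, 'z) dataset \<Rightarrow> real) \<Rightarrow> real \<Rightarrow> nat \<Rightarrow> (nat \<Rightarrow> 'w \<Rightarrow> 'x \<times> 'y \<times> 'z)
     \<Rightarrow> (nat \<Rightarrow> nat \<Rightarrow> 'w \<Rightarrow> 'x) \<Rightarrow> 'w set" where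
  "crt_reject \<Omega> T \<alpha> M W X' =
     {\<omega> \<in> space \<Omega>. phi_CRT T \<alpha> M (\<lambda>i. W i \<omega>) (\<lambda>j i. (X' j i \<omega>, snd (W i \<omega>))) = 1}"

end

theory Submission
  imports Defs
begin

text \<open>
  Niceness of the density is not needed. By continuity of translations in mean, smoothing a density with
  the rescaled kernel converges in \<open>L\<^sup>1\<close>; together with a second moment computation this makes the kernel
  estimate of the conditional probability of each fixed Borel set consistent in mean at the sample points.
  Spheres are null sets, so on a fine finite grid the triples of cells for which membership in a ball is
  ambiguous carry little mass, and the consistency passes to the squared ball divergence. Hence the
  statistic converges in probability to the weighted mean of the squared divergence between the two
  conditional laws, both for the data and for a resample, whose density is
  \<open>p\<^sub>X\<^sub>Z p\<^sub>Y\<^sub>Z / p\<^sub>Z\<close> and whose limit is therefore 0. Under the alternative the limit for the data is positive: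
  if the ball divergence of two densities vanishes, then around almost every centre the laws of the
  distance to that centre have distribution functions that agree almost everywhere, hence everywhere, so
  the laws agree on balls, and averaging over small balls identifies the densities. Once the data beat all
  resamples, the p-value is \<open>1 / (1 + M) < \<alpha>\<close>. Under the null hypothesis the \<open>M + 1\<close> data sets are
  exchangeable, and for no configuration can more than \<open>c\<close> of the indices have rank below \<open>c\<close>.
\<close>

section \<open>Approximate identities\<close>

text \<open>The statistic evaluates its estimators at the sample points, so each estimator depends
  on the point where it is evaluated, and the balls are weighted by the estimated laws themselves.
  Uniformity over balls is avoided by two choices made before n grows: a truncation level for the
  marginal density in the denominator, and a grid whose ambiguous triples of cells are measured
  under the limit laws only. What is left are the masses of finitely many cells, for which a bound
  in mean, uniform over the sample points, suffices. The estimates are proved for a joint density r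
  of (x, u) and used for three densities: p with u = (y, z), the density of (X, Z), and the density
  q of a resampled triple. Conditional independence becomes equality almost everywhere of
  \<open>slice A\<close> for p and for q, for every Borel set A; this one reformulation yields the
  exchangeability under the null hypothesis and the positivity of the limit under the alternative.
  The law \<kappa> is an arbitrary version, so its relation to the densities holds only up to null
  sets.\<close>

lemma lborel_integral_translate:
  fixes f :: "'a::euclidean_space \<Rightarrow> real"
  shows "(\<integral>u. f (u + t) \<partial>lborel) = (\<integral>u. f u \<partial>lborel)"
    and "integrable lborel f \<Longrightarrow> integrable lborel (\<lambda>u. f (u + t))"
proof -
  have eq: "distr lborel borel ((+) t) = (lborel :: 'a measure)" by (rule lborel_distr_plus)
  show int: "integrable lborel (\<lambda>u. f (u + t))" if "integrable lborel f"
  proof -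
    have "f \<in> borel_measurable borel" using that by simp
    then show ?thesis
      using that integrable_distr_eq[of "(+) t" lborel borel f] by (simp add: eq add.commute)
  qed
  show "(\<integral>u. f (u + t) \<partial>lborel) = (\<integral>u. f u \<partial>lborel)"
  proof (cases "f \<in> borel_measurable borel")
    case True
    then show ?thesis
      using integral_distr[of "(+) t" lborel borel f] by (simp add: eq add.commute)
  next
    case False
    \<comment> \<open>Translating back would make f measurable, so neither side is integrable and
      both Bochner integrals have the default value 0.\<close>
    have "\<not> integrable lborel (\<lambda>u. f (u + t))"
    proof
      assume "integrable lborel (\<lambda>u. f (u + t))"
      then have "(\<lambda>u. f (u + t)) \<in> borel_measurable borel" by simp
      then have "(\<lambda>u. f ((u - t) + t)) \<in> borel_measurable borel"
        by (rule measurable_compose[rotated]) simp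
      with False show False by simp
    qed
    moreover have "\<not> integrable lborel f" using False by auto
    ultimately show ?thesis by (simp add: not_integrable_integral_eq)
  qed
qed

text \<open>Openness gives pointwise convergence at the points of U only; the boundary of U may have
  positive measure. This is enough: U and its translate have the same measure, so the mass lost
  inside U equals the mass gained outside, hence the factor 2 in the proof.\<close>

lemma L1_translation_open:
  fixes U :: "'a::euclidean_space set" and t :: "nat \<Rightarrow> 'a"
  assumes U: "open U" "emeasure lborel U < \<infinity>" and t: "t \<longlonglongrightarrow> 0"
  shows "(\<lambda>n. \<integral>u. \<bar>indicator U (u + t n) - indicator U u\<bar> \<partial>lborel) \<longlonglongrightarrow> (0::real)"
proof -
  let ?i = "indicator U :: 'a \<Rightarrow> real"
  have mU[measurable]: "U \<in> sets borel" using U by simp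
  have iU: "integrable lborel ?i" using U by (intro integrable_real_indicator) auto
  have iUt: "integrable lborel (\<lambda>u. ?i (u + s))" for s
    by (rule lborel_integral_translate(2)[OF iU])
  let ?p = "\<lambda>n u. ?i u * (1 - ?i (u + t n))"
  have lim: "(\<lambda>n. \<integral>u. ?p n u \<partial>lborel) \<longlonglongrightarrow> (\<integral>u. 0 \<partial>(lborel :: 'a measure))"
  proof (rule integral_dominated_convergence[where w = ?i])
    show "AE u in lborel. (\<lambda>n. ?p n u) \<longlonglongrightarrow> 0"
    proof (intro AE_I2)
      fix u
      show "(\<lambda>n. ?p n u) \<longlonglongrightarrow> 0"
      proof (cases "u \<in> U")
        case True
        have "(\<lambda>n. u + t n) \<longlonglongrightarrow> u + 0" by (intro tendsto_intros t)
        then have "eventually (\<lambda>n. u + t n \<in> U) sequentially"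
          using topological_tendstoD[OF _ U(1)] True by fastforce
        then have "eventually (\<lambda>n. ?p n u = 0) sequentially" by eventually_elim simp
        then show ?thesis by (rule tendsto_eventually)
      qed simp
    qed
  qed (use iU in \<open>auto simp: indicator_def intro!: AE_I2\<close>)
  have "(\<integral>u. \<bar>?i (u + t n) - ?i u\<bar> \<partial>lborel) = 2 * (\<integral>u. ?p n u \<partial>lborel)" for n
  proof -
    have ip: "integrable lborel (?p n)"
      by (rule Bochner_Integration.integrable_bound[OF iU]) (auto simp: indicator_def)
    have "(\<integral>u. \<bar>?i (u + t n) - ?i u\<bar> \<partial>lborel) = (\<integral>u. 2 * ?p n u + (?i (u + t n) - ?i u) \<partial>lborel)"
      by (intro Bochner_Integration.integral_cong) (auto simp: indicator_def)
    also have "\<dots> = 2 * (\<integral>u. ?p n u \<partial>lborel) + ((\<integral>u. ?i (u + t n) \<partial>lborel) - (\<integral>u. ?i u \<partial>lborel))"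
      by (subst Bochner_Integration.integral_add) (use ip iU iUt in auto)
    also have "\<dots> = 2 * (\<integral>u. ?p n u \<partial>lborel)"
      by (simp only: lborel_integral_translate(1)[of ?i])
    finally show ?thesis .
  qed
  then show ?thesis using tendsto_mult_right_zero[OF lim[simplified], of 2] by simp
qed

text \<open>Translation is an isometry of L1, so the functions with this property form a closed set
  in L1. Open sets of finite measure supply indicators of Borel sets, and these generate all
  integrable functions.\<close>

lemma L1_translation:
  fixes f :: "'a::euclidean_space \<Rightarrow> real" and t :: "nat \<Rightarrow> 'a"
  assumes "integrable lborel f" and t: "t \<longlonglongrightarrow> 0"
  shows "(\<lambda>n. \<integral>u. \<bar>f (u + t n) - f u\<bar> \<partial>lborel) \<longlonglongrightarrow> 0"
proof -
  \<comment> \<open>Closedness in L1. Of the three error terms, two are the distance of g to f, one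
    of them translated; each of the three is at most e / 4.\<close>
  have approx: "(\<lambda>n. \<integral>u. \<bar>f (u + t n) - f u\<bar> \<partial>lborel) \<longlonglongrightarrow> 0"
    if f: "integrable lborel f"
      and g: "\<And>e. 0 < e \<Longrightarrow> \<exists>g. integrable lborel g \<and>
        (\<lambda>n. \<integral>u. \<bar>g (u + t n) - g u\<bar> \<partial>lborel) \<longlonglongrightarrow> 0 \<and> (\<integral>u. \<bar>g u - f u\<bar> \<partial>lborel) \<le> e"
    for f :: "'a \<Rightarrow> real"
  proof (rule LIMSEQ_I)
    fix e :: real assume "0 < e"
    then obtain g where g1: "integrable lborel g" and g2: "(\<lambda>n. \<integral>u. \<bar>g (u + t n) - g u\<bar> \<partial>lborel) \<longlonglongrightarrow> 0"
      and g3: "(\<integral>u. \<bar>g u - f u\<bar> \<partial>lborel) \<le> e / 4" using g[of "e/4"] by auto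
    from LIMSEQ_D[OF g2, of "e/4"] \<open>0 < e\<close> obtain N
      where N: "\<And>n. n \<ge> N \<Longrightarrow> norm ((\<integral>u. \<bar>g (u + t n) - g u\<bar> \<partial>lborel) - 0) < e / 4" by auto
    have "norm ((\<integral>u. \<bar>f (u + t n) - f u\<bar> \<partial>lborel) - 0) < e" if "n \<ge> N" for n
    proof -
      note tr = lborel_integral_translate(2)
      have i1: "integrable lborel (\<lambda>u. \<bar>g u - f u\<bar>)" using g1 f by auto
      have i2: "integrable lborel (\<lambda>u. \<bar>g (u + t n) - f (u + t n)\<bar>)" by (rule tr[OF i1])
      have i3: "integrable lborel (\<lambda>u. \<bar>g (u + t n) - g u\<bar>)" using tr[OF g1] g1 by auto
      have i4: "integrable lborel (\<lambda>u. \<bar>f (u + t n) - f u\<bar>)" using tr[OF f] f by auto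
      have "(\<integral>u. \<bar>f (u + t n) - f u\<bar> \<partial>lborel) \<le>
        (\<integral>u. \<bar>g (u + t n) - f (u + t n)\<bar> + \<bar>g (u + t n) - g u\<bar> + \<bar>g u - f u\<bar> \<partial>lborel)"
        using i1 i2 i3 i4 by (intro integral_mono) auto
      also have "\<dots> = (\<integral>u. \<bar>g (u + t n) - f (u + t n)\<bar> \<partial>lborel) + (\<integral>u. \<bar>g (u + t n) - g u\<bar> \<partial>lborel)
         + (\<integral>u. \<bar>g u - f u\<bar> \<partial>lborel)"
        using i1 i2 i3 by simp
      also have "(\<integral>u. \<bar>g (u + t n) - f (u + t n)\<bar> \<partial>lborel) = (\<integral>u. \<bar>g u - f u\<bar> \<partial>lborel)"
        by (rule lborel_integral_translate(1)[of "\<lambda>u. \<bar>g u - f u\<bar>"])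
      finally have "(\<integral>u. \<bar>f (u + t n) - f u\<bar> \<partial>lborel) < e" using g3 N[OF that] \<open>0 < e\<close> by auto
      then show ?thesis by simp
    qed
    then show "\<exists>N. \<forall>n\<ge>N. norm ((\<integral>u. \<bar>f (u + t n) - f u\<bar> \<partial>lborel) - 0) < e" by blast
  qed
  show ?thesis using assms(1)
  proof (induction f rule: integrable_induct)
    case (base A c)
    have iA: "integrable lborel (indicator A :: 'a \<Rightarrow> real)"
      using base by (intro integrable_real_indicator) auto
    have "(\<lambda>n. \<integral>u. \<bar>indicator A (u + t n) - indicator A u\<bar> \<partial>lborel) \<longlonglongrightarrow> (0::real)"
    proof (rule approx[OF iA])
      fix e :: real assume "0 < e"
      \<comment> \<open>Outer regularity replaces the Borel set by an open superset, at a cost below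
        e in L1.\<close>
      obtain U where U: "open U" "A \<subseteq> U" "emeasure lborel (U - A) < ennreal e"
        using outer_regular_lborel[of A e] base(1) \<open>0 < e\<close> by auto
      have mU: "U \<in> sets borel" using U by simp
      have "emeasure lborel U = emeasure lborel A + emeasure lborel (U - A)"
        using plus_emeasure[of A lborel "U - A"] base mU U by (simp add: Un_absorb1)
      also have "\<dots> < \<infinity>" using base U(3) by (simp add: less_top[symmetric]) (use order_less_trans in fastforce)
      finally have fU: "emeasure lborel U < \<infinity>" .
      have iU: "integrable lborel (indicator U :: 'a \<Rightarrow> real)"
        using fU mU by (intro integrable_real_indicator) auto
      have "(\<integral>u. \<bar>indicator U u - indicator A u\<bar> \<partial>lborel) = (\<integral>u. indicator (U - A) u \<partial>(lborel :: 'a measure) :: real)"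
        by (intro Bochner_Integration.integral_cong) (use U in \<open>auto simp: indicator_def\<close>)
      also have "\<dots> = measure lborel (U - A)" using mU base by simp
      also have "\<dots> \<le> e"
        using U(3) \<open>0 < e\<close> by (simp add: measure_def enn2real_leI)
      finally show "\<exists>g. integrable lborel g \<and> (\<lambda>n. \<integral>u. \<bar>g (u + t n) - g u\<bar> \<partial>lborel) \<longlonglongrightarrow> (0::real) \<and>
         (\<integral>u. \<bar>g u - indicator A u\<bar> \<partial>lborel) \<le> e"
        using iU L1_translation_open[OF U(1) fU t] by blast
    qed
    from tendsto_mult_right_zero[OF this, of "\<bar>c\<bar>"] show ?case
      by (simp flip: left_diff_distrib integral_mult_right_zero add: abs_mult) (simp add: mult.commute)
  next
    case (add f g)
    have i: "integrable lborel (\<lambda>u. \<bar>f (u + t n) - f u\<bar>)" "integrable lborel (\<lambda>u. \<bar>g (u + t n) - g u\<bar>)" for n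
      using lborel_integral_translate(2)[OF add(1)] lborel_integral_translate(2)[OF add(2)] add(1,2) by auto
    have i': "integrable lborel (\<lambda>u. \<bar>(f (u + t n) + g (u + t n)) - (f u + g u)\<bar>)" for n
      using lborel_integral_translate(2)[OF add(1)] lborel_integral_translate(2)[OF add(2)] add(1,2) by auto
    show ?case
    proof (rule tendsto_sandwich[OF _ _ tendsto_const])
      show "(\<lambda>n. (\<integral>u. \<bar>f (u + t n) - f u\<bar> \<partial>lborel) + (\<integral>u. \<bar>g (u + t n) - g u\<bar> \<partial>lborel)) \<longlonglongrightarrow> 0"
        using tendsto_add[OF add.IH] by simp
      show "\<forall>\<^sub>F n in sequentially. (\<integral>u. \<bar>(f (u + t n) + g (u + t n)) - (f u + g u)\<bar> \<partial>lborel) \<le>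
         (\<integral>u. \<bar>f (u + t n) - f u\<bar> \<partial>lborel) + (\<integral>u. \<bar>g (u + t n) - g u\<bar> \<partial>lborel)"
      proof (intro always_eventually allI)
        fix n
        have "(\<integral>u. \<bar>(f (u + t n) + g (u + t n)) - (f u + g u)\<bar> \<partial>lborel) \<le>
          (\<integral>u. \<bar>f (u + t n) - f u\<bar> + \<bar>g (u + t n) - g u\<bar> \<partial>lborel)"
          using i i' by (intro integral_mono Bochner_Integration.integrable_add) auto
        then show "(\<integral>u. \<bar>(f (u + t n) + g (u + t n)) - (f u + g u)\<bar> \<partial>lborel) \<le>
          (\<integral>u. \<bar>f (u + t n) - f u\<bar> \<partial>lborel) + (\<integral>u. \<bar>g (u + t n) - g u\<bar> \<partial>lborel)"
          using i by simp
      qed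
    qed auto
  next
    case (lim f s)
    show ?case
    proof (rule approx[OF lim(4)])
      fix e :: real assume "0 < e"
      have "(\<lambda>i. \<integral>u. \<bar>s i u - f u\<bar> \<partial>lborel) \<longlonglongrightarrow> (\<integral>u. 0 \<partial>(lborel :: 'a measure))"
      \<comment> \<open>The approximants of \<open>integrable_induct\<close> satisfy |s| \<le> 2
        |f|, hence the dominating function 3 |f|.\<close>
      proof (rule integral_dominated_convergence[where w = "\<lambda>u. 3 * \<bar>f u\<bar>"])
        have [measurable]: "f \<in> borel_measurable borel" "s i \<in> borel_measurable borel" for i
          using lim(1,4) borel_measurable_integrable by auto
        show "(\<lambda>u. \<bar>s i u - f u\<bar>) \<in> borel_measurable lborel" for i by simp
        show "AE u in lborel. (\<lambda>i. \<bar>s i u - f u\<bar>) \<longlonglongrightarrow> 0"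
          using lim(2) by (auto intro!: AE_I2 tendsto_eq_intros)
        show "AE u in lborel. norm \<bar>s i u - f u\<bar> \<le> 3 * \<bar>f u\<bar>" for i
        proof (intro AE_I2)
          fix u show "norm \<bar>s i u - f u\<bar> \<le> 3 * \<bar>f u\<bar>" using lim(3)[of u i] by auto
        qed
      qed (use lim(4) in auto)
      from LIMSEQ_D[OF this \<open>0 < e\<close>] obtain i where "(\<integral>u. \<bar>s i u - f u\<bar> \<partial>lborel) < e"
        by (auto simp: abs_less_iff)
      then show "\<exists>g. integrable lborel g \<and> (\<lambda>n. \<integral>u. \<bar>g (u + t n) - g u\<bar> \<partial>lborel) \<longlonglongrightarrow> 0 \<and>
         (\<integral>u. \<bar>g u - f u\<bar> \<partial>lborel) \<le> e" using lim(1,5) by (intro exI[of _ "s i"]) auto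
    qed
  qed
qed

text \<open>Minkowski's inequality bounds the error by the k-average of the translation errors
  \<open>D n w\<close>. These tend to 0 for each w by \<open>L1_translation\<close> and are at most
  twice the L1 norm of f, so dominated convergence applies.\<close>

lemma L1_smoothing:
  fixes f k :: "'a::euclidean_space \<Rightarrow> real" and h :: "nat \<Rightarrow> real"
  assumes f: "integrable lborel f"
    and k: "integrable lborel k" "\<And>w. 0 \<le> k w" "(\<integral>w. k w \<partial>lborel) = 1"
    and h: "h \<longlonglongrightarrow> 0"
  shows "(\<lambda>n. \<integral>u. \<bar>(\<integral>w. k w * f (u + h n *\<^sub>R w) \<partial>lborel) - f u\<bar> \<partial>lborel) \<longlonglongrightarrow> 0"
proof -
  have [measurable]: "f \<in> borel_measurable borel" "k \<in> borel_measurable borel"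
    using f k(1) by (auto dest: borel_measurable_integrable)
  define D where "D n w = (\<integral>u. \<bar>f (u + h n *\<^sub>R w) - f u\<bar> \<partial>lborel)" for n w
  have [measurable]: "D n \<in> borel_measurable borel" for n
    unfolding D_def by measurable
  have iD: "integrable lborel (\<lambda>u. \<bar>f (u + s) - f u\<bar>)" for s
    using lborel_integral_translate(2)[OF f] f by auto
  have D0: "0 \<le> D n w" for n w unfolding D_def by simp
  have D_le: "D n w \<le> 2 * (\<integral>u. \<bar>f u\<bar> \<partial>lborel)" for n w
  proof -
    have "D n w \<le> (\<integral>u. \<bar>f (u + h n *\<^sub>R w)\<bar> + \<bar>f u\<bar> \<partial>lborel)"
      unfolding D_def using lborel_integral_translate(2)[OF f] f iD by (intro integral_mono) auto
    also have "\<dots> = (\<integral>u. \<bar>f (u + h n *\<^sub>R w)\<bar> \<partial>lborel) + (\<integral>u. \<bar>f u\<bar> \<partial>lborel)"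
      using lborel_integral_translate(2)[OF f] f by simp
    also have "(\<integral>u. \<bar>f (u + h n *\<^sub>R w)\<bar> \<partial>lborel) = (\<integral>u. \<bar>f u\<bar> \<partial>lborel)"
      by (rule lborel_integral_translate(1)[of "\<lambda>u. \<bar>f u\<bar>"])
    finally show ?thesis by simp
  qed
  have ikD: "integrable lborel (\<lambda>w. k w * D n w)" for n
    by (rule Bochner_Integration.integrable_bound[of _ "\<lambda>w. k w * (2 * (\<integral>u. \<bar>f u\<bar> \<partial>lborel))"])
      (use k D_le D0 in \<open>auto simp: abs_mult intro!: mult_left_mono AE_I2\<close>)
  have lim: "(\<lambda>n. \<integral>w. k w * D n w \<partial>lborel) \<longlonglongrightarrow> (\<integral>w. 0 \<partial>(lborel :: 'a measure))"
  proof (rule integral_dominated_convergence[where w = "\<lambda>w. k w * (2 * (\<integral>u. \<bar>f u\<bar> \<partial>lborel))"])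
    show "AE w in lborel. (\<lambda>n. k w * D n w) \<longlonglongrightarrow> 0"
    proof (intro AE_I2)
      fix w :: 'a
      have "(\<lambda>n. h n *\<^sub>R w) \<longlonglongrightarrow> 0" using tendsto_scaleR[OF h tendsto_const, of w] by simp
      from L1_translation[OF f this] show "(\<lambda>n. k w * D n w) \<longlonglongrightarrow> 0"
        unfolding D_def by (rule tendsto_mult_right_zero)
    qed
    show "AE w in lborel. norm (k w * D n w) \<le> k w * (2 * (\<integral>u. \<bar>f u\<bar> \<partial>lborel))" for n
      using k D_le D0 by (auto simp: abs_mult intro!: mult_left_mono AE_I2)
  qed (use k in auto)
  have bound: "(\<integral>u. \<bar>(\<integral>w. k w * f (u + h n *\<^sub>R w) \<partial>lborel) - f u\<bar> \<partial>lborel) \<le> (\<integral>w. k w * D n w \<partial>lborel)" for n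
  proof -
    let ?g = "\<lambda>u. \<bar>(\<integral>w. k w * f (u + h n *\<^sub>R w) \<partial>lborel) - f u\<bar>"
    have [measurable]: "?g \<in> borel_measurable borel" by measurable
    \<comment> \<open>The smoothing integral may diverge at some u. With the extended integral on
      the right nothing is lost: where it is infinite the inequality is trivial, and where it is
      finite all integrals exist.\<close>
    have pt: "ennreal (?g u) \<le> (\<integral>\<^sup>+w. ennreal (k w * \<bar>f (u + h n *\<^sub>R w) - f u\<bar>) \<partial>lborel)" for u
    proof (cases "(\<integral>\<^sup>+w. ennreal (k w * \<bar>f (u + h n *\<^sub>R w) - f u\<bar>) \<partial>lborel) < \<infinity>")
      case True
      then have i: "integrable lborel (\<lambda>w. k w * (f (u + h n *\<^sub>R w) - f u))"
        using k(2) by (intro integrableI_bounded) (auto simp: abs_mult)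
      have "integrable lborel (\<lambda>w. k w * (f (u + h n *\<^sub>R w) - f u) + k w * f u)"
        using i k(1) by auto
      then have i2: "integrable lborel (\<lambda>w. k w * f (u + h n *\<^sub>R w))"
        by (simp add: algebra_simps)
      have "(\<integral>w. k w * f (u + h n *\<^sub>R w) \<partial>lborel) - f u = (\<integral>w. k w * (f (u + h n *\<^sub>R w) - f u) \<partial>lborel)"
        using i2 k by (simp add: right_diff_distrib)
      also have "\<bar>\<dots>\<bar> \<le> (\<integral>w. \<bar>k w * (f (u + h n *\<^sub>R w) - f u)\<bar> \<partial>lborel)"
        by (rule integral_abs_bound)
      finally have "ennreal (?g u) \<le> ennreal (\<integral>w. \<bar>k w * (f (u + h n *\<^sub>R w) - f u)\<bar> \<partial>lborel)"
        by (rule ennreal_leI)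
      also have "\<dots> = (\<integral>\<^sup>+w. ennreal (\<bar>k w * (f (u + h n *\<^sub>R w) - f u)\<bar>) \<partial>lborel)"
        using i by (subst nn_integral_eq_integral) auto
      also have "\<dots> = (\<integral>\<^sup>+w. ennreal (k w * \<bar>f (u + h n *\<^sub>R w) - f u\<bar>) \<partial>lborel)"
        using k(2) by (simp add: abs_mult)
      finally show ?thesis .
    qed (auto simp: less_top[symmetric])
    have "(\<integral>\<^sup>+u. ennreal (?g u) \<partial>lborel) \<le>
      (\<integral>\<^sup>+u. (\<integral>\<^sup>+w. ennreal (k w * \<bar>f (u + h n *\<^sub>R w) - f u\<bar>) \<partial>lborel) \<partial>lborel)"
      by (intro nn_integral_mono pt)
    also have "\<dots> = (\<integral>\<^sup>+w. (\<integral>\<^sup>+u. ennreal (k w * \<bar>f (u + h n *\<^sub>R w) - f u\<bar>) \<partial>lborel) \<partial>lborel)"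
      by (rule lborel_pair.Fubini') measurable
    also have "\<dots> = (\<integral>\<^sup>+w. ennreal (k w * D n w) \<partial>lborel)"
    proof (intro nn_integral_cong)
      fix w :: 'a
      have "(\<integral>\<^sup>+u. ennreal (k w * \<bar>f (u + h n *\<^sub>R w) - f u\<bar>) \<partial>lborel) =
        ennreal (\<integral>u. k w * \<bar>f (u + h n *\<^sub>R w) - f u\<bar> \<partial>lborel)"
        using iD k(2) by (intro nn_integral_eq_integral) auto
      then show "(\<integral>\<^sup>+u. ennreal (k w * \<bar>f (u + h n *\<^sub>R w) - f u\<bar>) \<partial>lborel) = ennreal (k w * D n w)"
        by (simp add: D_def)
    qed
    also have "\<dots> = ennreal (\<integral>w. k w * D n w \<partial>lborel)"
      using ikD k(2) D0 by (intro nn_integral_eq_integral) auto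
    finally show ?thesis
      using k(2) D0 by (subst integral_eq_nn_integral) (auto intro!: enn2real_leI integral_nonneg_AE)
  qed
  show ?thesis
    by (rule tendsto_sandwich[OF _ _ tendsto_const, of _ _ _ "\<lambda>n. \<integral>w. k w * D n w \<partial>lborel"])
      (use lim bound in auto)
qed

section \<open>Mean square error of kernel averages\<close>

lemma (in prob_space) indep_vars_distr_pair:
  assumes "indep_vars (\<lambda>_. N) W I" "i \<in> I" "j \<in> I" "i \<noteq> j"
  shows "distr M (N \<Otimes>\<^sub>M N) (\<lambda>\<omega>. (W i \<omega>, W j \<omega>)) = distr M N (W i) \<Otimes>\<^sub>M distr M N (W j)"
proof -
  have "indep_var N ((\<lambda>f. f i) \<circ> (\<lambda>\<omega>. restrict (\<lambda>i. W i \<omega>) {i}))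
      N ((\<lambda>f. f j) \<circ> (\<lambda>\<omega>. restrict (\<lambda>i. W i \<omega>) {j}))"
    using assms by (intro indep_var_compose[OF indep_var_restrict[OF assms(1)]]) auto
  then have "indep_var N (W i) N (W j)" by (simp add: comp_def)
  then show ?thesis by (simp add: indep_var_distribution_eq)
qed

text \<open>Independence of the index blocks {s} and {i, j} reduces the triple to the pair.\<close>

lemma (in prob_space) indep_vars_distr_triple:
  assumes indep: "indep_vars (\<lambda>_. N) W I" and I: "s \<in> I" "i \<in> I" "j \<in> I" "s \<noteq> i" "s \<noteq> j" "i \<noteq> j"
  shows "distr M (N \<Otimes>\<^sub>M (N \<Otimes>\<^sub>M N)) (\<lambda>\<omega>. (W s \<omega>, W i \<omega>, W j \<omega>)) =
    distr M N (W s) \<Otimes>\<^sub>M (distr M N (W i) \<Otimes>\<^sub>M distr M N (W j))"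
proof -
  let ?S = "PiM {s} (\<lambda>_. N)" and ?T = "PiM {i, j} (\<lambda>_. N)"
  let ?X = "\<lambda>\<omega>. \<lambda>i\<in>{s}. W i \<omega>" and ?Y = "\<lambda>\<omega>. \<lambda>i\<in>{i, j}. W i \<omega>"
  have [measurable]: "W s \<in> measurable M N" "W i \<in> measurable M N" "W j \<in> measurable M N"
    using indep I by (auto simp: indep_vars_def)
  have mX[measurable]: "?X \<in> measurable M ?S" by (rule measurable_restrict) auto
  have mY[measurable]: "?Y \<in> measurable M ?T" by (rule measurable_restrict) auto
  have mp: "(\<lambda>f. f s) \<in> measurable ?S N" "(\<lambda>g. (g i, g j)) \<in> measurable ?T (N \<Otimes>\<^sub>M N)" by auto
  have ind: "indep_var ?S ?X ?T ?Y"
    using I by (intro indep_var_restrict[OF indep]) auto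
  have XY: "distr M ?S ?X \<Otimes>\<^sub>M distr M ?T ?Y = distr M (?S \<Otimes>\<^sub>M ?T) (\<lambda>\<omega>. (?X \<omega>, ?Y \<omega>))"
    using ind by (simp add: indep_var_distribution_eq)
  interpret Y: prob_space "distr M (N \<Otimes>\<^sub>M N) (\<lambda>\<omega>. (W i \<omega>, W j \<omega>))" by (rule prob_space_distr) simp
  have "distr M N (W s) \<Otimes>\<^sub>M (distr M N (W i) \<Otimes>\<^sub>M distr M N (W j)) =
      distr M N (W s) \<Otimes>\<^sub>M distr M (N \<Otimes>\<^sub>M N) (\<lambda>\<omega>. (W i \<omega>, W j \<omega>))"
    using I indep by (subst indep_vars_distr_pair[OF indep]) auto
  also have "\<dots> = distr (distr M ?S ?X) N (\<lambda>f. f s) \<Otimes>\<^sub>M distr (distr M ?T ?Y) (N \<Otimes>\<^sub>M N) (\<lambda>g. (g i, g j))"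
    using mp by (simp add: distr_distr comp_def I)
  also have "\<dots> = distr (distr M ?S ?X \<Otimes>\<^sub>M distr M ?T ?Y) (N \<Otimes>\<^sub>M (N \<Otimes>\<^sub>M N)) (\<lambda>(f, g). (f s, (g i, g j)))"
  proof (rule pair_measure_distr)
    have "distr (distr M ?T ?Y) (N \<Otimes>\<^sub>M N) (\<lambda>g. (g i, g j)) = distr M (N \<Otimes>\<^sub>M N) (\<lambda>\<omega>. (W i \<omega>, W j \<omega>))"
      using mp by (simp add: distr_distr comp_def I)
    then show "sigma_finite_measure (distr (distr M ?T ?Y) (N \<Otimes>\<^sub>M N) (\<lambda>g. (g i, g j)))"
      using Y.sigma_finite_measure_axioms by simp
  qed (use mp in auto)
  also have "\<dots> = distr M (N \<Otimes>\<^sub>M (N \<Otimes>\<^sub>M N)) (\<lambda>\<omega>. (W s \<omega>, W i \<omega>, W j \<omega>))"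
    unfolding XY by (subst distr_distr) (auto simp: comp_def)
  finally show ?thesis by simp
qed

lemma borel_fst[measurable]:
  "fst \<in> borel_measurable (borel :: ('a::second_countable_topology \<times> 'b::second_countable_topology) measure)"
  by (subst borel_prod[symmetric]) simp

lemma borel_snd[measurable]:
  "snd \<in> borel_measurable (borel :: ('a::second_countable_topology \<times> 'b::second_countable_topology) measure)"
  by (subst borel_prod[symmetric]) simp

text \<open>Bookkeeping for \<open>second_moment\<close>: a for every pair, an extra \<beta> on the
  diagonal and on the row and the column of s, an extra \<gamma> at (s, s).\<close>

lemma sum_index_bound:
  fixes a \<beta> \<gamma> :: real and s n :: nat
  assumes s: "s < n"
  shows "(\<Sum>i<n. \<Sum>j<n. a + (if i = j then \<beta> else 0) + (if i = s then \<beta> else 0)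
      + (if j = s then \<beta> else 0) + (if i = s then if j = s then \<gamma> else 0 else 0)) =
    n\<^sup>2 * a + 3 * n * \<beta> + \<gamma>"
proof -
  have e0: "(\<Sum>i<n. \<Sum>j<n. if i = j then \<beta> else 0) = n * \<beta>" using s by simp
  have e1: "(\<Sum>i<n. \<Sum>j<n. if j = s then \<beta> else 0) = n * \<beta>" using s by simp
  have "(\<Sum>j<n. if i = s then if j = s then \<gamma> else 0 else 0) = (if i = s then \<gamma> else 0)" for i
    using s by simp
  then have e2: "(\<Sum>i<n. \<Sum>j<n. if i = s then if j = s then \<gamma> else 0 else 0) = \<gamma>" using s by simp
  have e3: "(\<Sum>i<n. \<Sum>j<n. if i = s then \<beta> else 0) = n * \<beta>"
    using e1 sum.swap[of "\<lambda>i j. if i = s then \<beta> else 0" "{..<n}" "{..<n}"] by metis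
  show ?thesis unfolding sum.distrib e0 e1 e2 e3 by (simp add: power2_eq_square)
qed

section \<open>Joint densities and their slices\<close>

locale joint_density =
  fixes r :: "'x::euclidean_space \<times> 'u::euclidean_space \<Rightarrow> real" and C :: real
  assumes meas[measurable]: "r \<in> borel_measurable borel"
    and nonneg: "\<And>w. 0 \<le> r w"
    and total: "(\<integral>\<^sup>+w. ennreal (r w) \<partial>lborel) = 1"
    and marg_le: "\<And>u. (\<integral>\<^sup>+x. ennreal (r (x, u)) \<partial>lborel) \<le> ennreal C"
    and C_nonneg: "0 \<le> C"
begin

lemma meas_pair[measurable]: "r \<in> borel_measurable (borel \<Otimes>\<^sub>M borel)"
  using meas by (simp add: borel_prod)

text \<open>The density in u of the measure that takes B to \<nu>(A \<times> B); in particular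
  \<open>slice UNIV\<close> is the marginal density of u.\<close>

definition slice :: "'x set \<Rightarrow> 'u \<Rightarrow> real" where
  "slice A u = (\<integral>x. indicator A x * r (x, u) \<partial>lborel)"

definition \<nu> :: "('x \<times> 'u) measure" where
  "\<nu> = density lborel (\<lambda>w. ennreal (r w))"

lemma sets_\<nu>[measurable_cong, simp]: "sets \<nu> = sets borel"
  by (simp add: \<nu>_def)

lemma space_\<nu>[simp]: "space \<nu> = UNIV"
  by (simp add: \<nu>_def)

lemma prob_space_\<nu>: "prob_space \<nu>"
  by (rule prob_spaceI) (simp add: \<nu>_def emeasure_density total)

lemma measure_\<nu>_UNIV[simp]: "measure \<nu> UNIV = 1"
  using prob_space.prob_space[OF prob_space_\<nu>] by simp

lemma slice_integrable:
  assumes [measurable]: "A \<in> sets borel"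
  shows "integrable lborel (\<lambda>x. indicator A x * r (x, u))"
proof (rule integrableI_bounded)
  have "(\<integral>\<^sup>+x. ennreal (norm (indicator A x * r (x, u))) \<partial>lborel) \<le> (\<integral>\<^sup>+x. ennreal (r (x, u)) \<partial>lborel)"
    using nonneg by (intro nn_integral_mono) (auto simp: indicator_def)
  also have "\<dots> < \<infinity>" using marg_le[of u] by (rule le_less_trans) simp
  finally show "(\<integral>\<^sup>+x. ennreal (norm (indicator A x * r (x, u))) \<partial>lborel) < \<infinity>" .
qed simp

lemma ennreal_slice:
  assumes "A \<in> sets borel"
  shows "ennreal (slice A u) = (\<integral>\<^sup>+x. indicator A x * ennreal (r (x, u)) \<partial>lborel)"
  unfolding slice_def using nonneg
  by (subst nn_integral_eq_integral[symmetric, OF slice_integrable[OF assms]])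
    (auto simp: indicator_def intro!: nn_integral_cong)

lemma slice_measurable[measurable]:
  assumes [measurable]: "A \<in> sets borel" shows "slice A \<in> borel_measurable borel"
proof -
  have "(\<lambda>u. \<integral>x. indicator A x * r (x, u) \<partial>lborel) \<in> borel_measurable lborel"
    by (rule lborel.borel_measurable_lebesgue_integral) measurable
  then show ?thesis by (simp add: slice_def[abs_def])
qed

lemma slice_nonneg: "0 \<le> slice A u"
  unfolding slice_def using nonneg by (intro integral_nonneg_AE) (auto simp: indicator_def)

lemma slice_mono: "A \<in> sets borel \<Longrightarrow> B \<in> sets borel \<Longrightarrow> A \<subseteq> B \<Longrightarrow> slice A u \<le> slice B u"
  unfolding slice_def using nonneg
  by (intro integral_mono slice_integrable) (auto simp: indicator_def)

lemma slice_le_C: assumes A: "A \<in> sets borel" shows "slice A u \<le> C"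
proof -
  have "slice A u \<le> slice UNIV u" using A by (intro slice_mono) auto
  moreover have "ennreal (slice UNIV u) \<le> ennreal C"
    using marg_le[of u] by (subst ennreal_slice) auto
  ultimately show ?thesis using C_nonneg by simp
qed

lemma nn_integral_\<nu>:
  assumes [measurable]: "A \<in> sets borel" "F \<in> borel_measurable borel"
  shows "(\<integral>\<^sup>+w. indicator A (fst w) * F (snd w) \<partial>\<nu>) = (\<integral>\<^sup>+u. F u * ennreal (slice A u) \<partial>lborel)"
proof -
  have "(\<integral>\<^sup>+w. indicator A (fst w) * F (snd w) \<partial>\<nu>) =
      (\<integral>\<^sup>+w. ennreal (r w) * (indicator A (fst w) * F (snd w)) \<partial>(lborel \<Otimes>\<^sub>M lborel))"
    unfolding \<nu>_def by (subst nn_integral_density) (auto simp: lborel_prod)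
  also have "\<dots> = (\<integral>\<^sup>+u. \<integral>\<^sup>+x. ennreal (r (x, u)) * (indicator A x * F u) \<partial>lborel \<partial>lborel)"
    by (subst lborel_pair.nn_integral_snd[symmetric]) auto
  also have "\<dots> = (\<integral>\<^sup>+u. F u * ennreal (slice A u) \<partial>lborel)"
    by (intro nn_integral_cong, subst ennreal_slice, simp, subst nn_integral_cmult[symmetric])
      (auto intro!: nn_integral_cong simp: ac_simps)
  finally show ?thesis .
qed

lemma nn_integral_slice: "A \<in> sets borel \<Longrightarrow> (\<integral>\<^sup>+u. ennreal (slice A u) \<partial>lborel) \<le> 1"
proof -
  assume A: "A \<in> sets borel"
  interpret prob_space \<nu> by (rule prob_space_\<nu>)
  have "(\<integral>\<^sup>+u. ennreal (slice A u) \<partial>lborel) = (\<integral>\<^sup>+w. indicator A (fst w) \<partial>\<nu>)"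
    using nn_integral_\<nu>[OF A, of "\<lambda>_. 1"] by simp
  also have "\<dots> \<le> (\<integral>\<^sup>+w. 1 \<partial>\<nu>)" by (intro nn_integral_mono) (auto simp: indicator_def)
  also have "\<dots> = 1" using emeasure_space_1 by simp
  finally show ?thesis .
qed

lemma integrable_slice: "A \<in> sets borel \<Longrightarrow> integrable lborel (slice A)"
  using nn_integral_slice[of A] slice_nonneg[of A]
  by (intro integrableI_bounded) (auto simp: le_less_trans)

lemma integral_\<nu>:
  assumes [measurable]: "A \<in> sets borel" "F \<in> borel_measurable borel" and F: "\<And>u. 0 \<le> F u"
  shows "(\<integral>w. indicator A (fst w) * F (snd w) \<partial>\<nu>) = (\<integral>u. F u * slice A u \<partial>lborel)"
proof -
  have "(\<integral>w. indicator A (fst w) * F (snd w) \<partial>\<nu>) =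
      enn2real (\<integral>\<^sup>+w. indicator A (fst w) * ennreal (F (snd w)) \<partial>\<nu>)"
    using F by (subst integral_eq_nn_integral) (auto simp: indicator_def intro!: arg_cong[where f=enn2real] nn_integral_cong)
  also have "\<dots> = enn2real (\<integral>\<^sup>+u. ennreal (F u * slice A u) \<partial>lborel)"
    using F slice_nonneg by (subst nn_integral_\<nu>) (auto simp: ennreal_mult)
  also have "\<dots> = (\<integral>u. F u * slice A u \<partial>lborel)"
    using F slice_nonneg by (subst integral_eq_nn_integral) auto
  finally show ?thesis .
qed

end

section \<open>Second moment of a kernel average at a sample point\<close>

locale iid_sample = joint_density r C + prob_space M
  for r :: "'x::euclidean_space \<times> 'u::euclidean_space \<Rightarrow> real" and C and M :: "'w measure" +
  fixes W :: "nat \<Rightarrow> 'w \<Rightarrow> 'x \<times> 'u" and n :: nat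
  assumes indep: "indep_vars (\<lambda>_. borel) W {..<n}"
    and dist: "\<And>i. i < n \<Longrightarrow> distributed M lborel (W i) (\<lambda>w. ennreal (r w))"
begin

lemma W_meas[measurable]: "i < n \<Longrightarrow> W i \<in> borel_measurable M"
  using distributed_measurable[OF dist] by simp

lemma distr_W: "i < n \<Longrightarrow> distr M borel (W i) = \<nu>"
  using distributed_distr_eq_density[OF dist, of i] unfolding \<nu>_def by (simp cong: distr_cong)

lemma integral_W: "i < n \<Longrightarrow> f \<in> borel_measurable borel \<Longrightarrow> (\<integral>\<omega>. f (W i \<omega>) \<partial>M) = (\<integral>w. f w \<partial>\<nu>)"
  for f :: "_ \<Rightarrow> real"
  by (subst distr_W[symmetric], assumption, subst integral_distr) auto

lemma integral_pair:
  fixes f :: "('x \<times> 'u) \<times> ('x \<times> 'u) \<Rightarrow> real"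
  assumes "i < n" "j < n" "i \<noteq> j"
    and f[measurable]: "f \<in> borel_measurable (borel \<Otimes>\<^sub>M borel)" and B: "\<And>w. \<bar>f w\<bar> \<le> B"
  shows "(\<integral>\<omega>. f (W i \<omega>, W j \<omega>) \<partial>M) = (\<integral>a. \<integral>b. f (a, b) \<partial>\<nu> \<partial>\<nu>)"
proof -
  interpret N: prob_space \<nu> by (rule prob_space_\<nu>)
  interpret P: pair_prob_space \<nu> \<nu> ..
  have mW[measurable]: "W i \<in> borel_measurable M" "W j \<in> borel_measurable M" using assms by auto
  have [measurable]: "f \<in> borel_measurable (\<nu> \<Otimes>\<^sub>M \<nu>)"
    using f by (simp cong: measurable_cong_sets)
  have "(\<integral>\<omega>. f (W i \<omega>, W j \<omega>) \<partial>M) = (\<integral>w. f w \<partial>(distr M (borel \<Otimes>\<^sub>M borel) (\<lambda>\<omega>. (W i \<omega>, W j \<omega>))))"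
    by (subst integral_distr) auto
  also have "\<dots> = (\<integral>w. f w \<partial>(\<nu> \<Otimes>\<^sub>M \<nu>))"
    using assms by (subst indep_vars_distr_pair[OF indep]) (auto simp: distr_W)
  also have "\<dots> = (\<integral>a. \<integral>b. f (a, b) \<partial>\<nu> \<partial>\<nu>)"
    by (rule P.integral_fst'[symmetric]) (rule P.integrable_const_bound[of _ B], use B in auto)
  finally show ?thesis .
qed

lemma integral_triple:
  fixes f :: "('x \<times> 'u) \<times> ('x \<times> 'u) \<times> ('x \<times> 'u) \<Rightarrow> real"
  assumes "s < n" "i < n" "j < n" "s \<noteq> i" "s \<noteq> j" "i \<noteq> j"
    and f[measurable]: "f \<in> borel_measurable (borel \<Otimes>\<^sub>M (borel \<Otimes>\<^sub>M borel))" and B: "\<And>w. \<bar>f w\<bar> \<le> B"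
  shows "(\<integral>\<omega>. f (W s \<omega>, W i \<omega>, W j \<omega>) \<partial>M) = (\<integral>a. \<integral>b. \<integral>c. f (a, b, c) \<partial>\<nu> \<partial>\<nu> \<partial>\<nu>)"
proof -
  interpret N: prob_space \<nu> by (rule prob_space_\<nu>)
  interpret P: pair_prob_space \<nu> \<nu> ..
  interpret Q: pair_prob_space \<nu> "\<nu> \<Otimes>\<^sub>M \<nu>" ..
  have mW[measurable]: "W s \<in> borel_measurable M" "W i \<in> borel_measurable M" "W j \<in> borel_measurable M"
    using assms by auto
  have fm[measurable]: "f \<in> borel_measurable (\<nu> \<Otimes>\<^sub>M (\<nu> \<Otimes>\<^sub>M \<nu>))"
    using f by (simp cong: measurable_cong_sets)
  have "(\<integral>\<omega>. f (W s \<omega>, W i \<omega>, W j \<omega>) \<partial>M) =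
      (\<integral>w. f w \<partial>(distr M (borel \<Otimes>\<^sub>M (borel \<Otimes>\<^sub>M borel)) (\<lambda>\<omega>. (W s \<omega>, W i \<omega>, W j \<omega>))))"
    by (subst integral_distr) auto
  also have "\<dots> = (\<integral>w. f w \<partial>(\<nu> \<Otimes>\<^sub>M (\<nu> \<Otimes>\<^sub>M \<nu>)))"
    using assms by (subst indep_vars_distr_triple[OF indep]) (auto simp: distr_W)
  also have "\<dots> = (\<integral>a. \<integral>v. f (a, v) \<partial>(\<nu> \<Otimes>\<^sub>M \<nu>) \<partial>\<nu>)"
    by (rule Q.integral_fst'[symmetric]) (rule Q.integrable_const_bound[of _ B], use B in auto)
  also have "\<dots> = (\<integral>a. \<integral>b. \<integral>c. f (a, b, c) \<partial>\<nu> \<partial>\<nu> \<partial>\<nu>)"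
  proof (intro Bochner_Integration.integral_cong refl)
    fix a
    have "(\<lambda>v. f (a, v)) \<in> borel_measurable (\<nu> \<Otimes>\<^sub>M \<nu>)"
      by (rule measurable_compose[OF _ fm]) simp
    then show "(\<integral>v. f (a, v) \<partial>(\<nu> \<Otimes>\<^sub>M \<nu>)) = (\<integral>b. \<integral>c. f (a, b, c) \<partial>\<nu> \<partial>\<nu>)"
      by (intro P.integral_fst'[symmetric] P.integrable_const_bound[of _ B]) (use B in auto)
  qed
  finally show ?thesis .
qed

context
  fixes A :: "'x set" and k :: "'u \<Rightarrow> 'u \<Rightarrow> real" and b :: real
  assumes A[measurable]: "A \<in> sets borel"
    and k[measurable]: "case_prod k \<in> borel_measurable (borel \<Otimes>\<^sub>M borel)"
    and k0: "\<And>u v. 0 \<le> k u v" and kb: "\<And>u v. k u v \<le> b"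
    and k1: "\<And>u. (\<integral>\<^sup>+v. ennreal (k u v) \<partial>lborel) \<le> 1"
    and k_sym: "\<And>u v. k u v = k v u"
begin

text \<open>The mean of one summand of the kernel average, see \<open>integral_k_le\<close>; its
  distance to \<open>slice A\<close> is the bias.\<close>

definition smoothed :: "'u \<Rightarrow> real" where
  "smoothed u = (\<integral>v. k u v * slice A v \<partial>lborel)"

text \<open>Centred at the target \<open>slice A u\<close> instead of the mean
  \<open>smoothed u\<close>, so that averages of deviations carry bias and fluctuation
  together.\<close>

definition dev :: "'u \<Rightarrow> 'x \<times> 'u \<Rightarrow> real" where
  "dev u w = indicator A (fst w) * k u (snd w) - slice A u"

lemma k_meas2: "k u \<in> borel_measurable borel"
  by (rule measurable_compose[OF _ k, of "\<lambda>v. (u, v)", simplified]) simp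

lemma dev_meas: "case_prod dev \<in> borel_measurable (borel \<Otimes>\<^sub>M borel)"
proof -
  have "(\<lambda>x :: 'u \<times> 'x \<times> 'u. k (fst x) (snd (snd x))) \<in> borel_measurable (borel \<Otimes>\<^sub>M borel)"
    by (rule measurable_compose[OF _ k, of "\<lambda>x. (fst x, snd (snd x))", simplified]) measurable
  then show ?thesis unfolding dev_def[abs_def] split_beta' by measurable
qed

lemma b0: "0 \<le> b" using k0[of undefined undefined] kb[of undefined undefined] by simp

lemma dev_bound: "\<bar>dev u w\<bar> \<le> b + C"
  using k0[of u "snd w"] kb[of u "snd w"] slice_nonneg[of A u] slice_le_C[OF A, of u] b0 C_nonneg
  by (auto simp: dev_def indicator_def)

lemma smoothed_0: "0 \<le> smoothed u"
  unfolding smoothed_def using k0 slice_nonneg by (intro integral_nonneg_AE) auto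

lemma integral_k_le:
  shows "integrable \<nu> (\<lambda>w. indicator A (fst w) * k u (snd w))"
    and "(\<integral>w. indicator A (fst w) * k u (snd w) \<partial>\<nu>) = smoothed u"
    and "smoothed u \<le> C"
proof -
  interpret N: prob_space \<nu> by (rule prob_space_\<nu>)
  note k_meas2[of u, measurable]
  show "integrable \<nu> (\<lambda>w. indicator A (fst w) * k u (snd w))"
    by (rule N.integrable_const_bound[of _ b]) (use k0 kb b0 in \<open>auto simp: indicator_def\<close>)
  show "(\<integral>w. indicator A (fst w) * k u (snd w) \<partial>\<nu>) = smoothed u"
    unfolding smoothed_def using k0 by (intro integral_\<nu>) auto
  have "(\<integral>\<^sup>+v. ennreal (k u v * slice A v) \<partial>lborel) \<le> (\<integral>\<^sup>+v. ennreal C * ennreal (k u v) \<partial>lborel)"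
    using k0 slice_le_C[OF A] C_nonneg
    by (intro nn_integral_mono)
      (auto simp: ennreal_mult[symmetric] mult.commute[of C] intro!: mult_left_mono ennreal_leI)
  also have "\<dots> \<le> ennreal C * 1"
    using mult_left_mono[OF k1[of u], of "ennreal C"] k_meas2[of u]
    by (subst nn_integral_cmult) auto
  finally show "smoothed u \<le> C"
    unfolding smoothed_def using k0 slice_nonneg C_nonneg
    by (subst integral_eq_nn_integral) (auto intro!: enn2real_leI)
qed

lemma integral_dev: "(\<integral>w. dev u w \<partial>\<nu>) = smoothed u - slice A u"
proof -
  interpret N: prob_space \<nu> by (rule prob_space_\<nu>)
  show ?thesis unfolding dev_def using integral_k_le(1,2)[of u]
    by simp
qed

lemma dev_meas2: "dev u \<in> borel_measurable borel"
  by (rule measurable_compose[OF _ dev_meas, of "\<lambda>v. (u, v)", simplified]) simp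

lemma integral_dev_abs: "(\<integral>w. \<bar>dev u w\<bar> \<partial>\<nu>) \<le> 2 * C"
proof -
  interpret N: prob_space \<nu> by (rule prob_space_\<nu>)
  note dev_meas2[measurable]
  have "(\<integral>w. \<bar>dev u w\<bar> \<partial>\<nu>) \<le> (\<integral>w. indicator A (fst w) * k u (snd w) + C \<partial>\<nu>)"
  proof (rule integral_mono)
    show "integrable \<nu> (\<lambda>w. \<bar>dev u w\<bar>)"
      by (rule N.integrable_const_bound[of _ "b + C"]) (use dev_bound in auto)
    show "\<bar>dev u w\<bar> \<le> indicator A (fst w) * k u (snd w) + C" for w
      using k0[of u "snd w"] slice_nonneg[of A u] slice_le_C[OF A, of u] C_nonneg
      by (auto simp: dev_def indicator_def)
  qed (use integral_k_le(1) in simp)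
  also have "\<dots> = smoothed u + C" using integral_k_le(1,2)[of u] by simp
  also have "\<dots> \<le> 2 * C" using integral_k_le(3)[of u] by simp
  finally show ?thesis .
qed

text \<open>One factor is bounded by b + C, the other is integrated by
  \<open>integral_dev_abs\<close>, whose bound is free of b. Thus a square costs a single power of
  b. For the scaled kernel b is of order h^(-d), with d the dimension of u, and b / n vanishes when
  n h^d tends to infinity.\<close>

lemma integral_dev_sq: "(\<integral>w. (dev u w)\<^sup>2 \<partial>\<nu>) \<le> (b + C) * (2 * C)"
proof -
  interpret N: prob_space \<nu> by (rule prob_space_\<nu>)
  note dev_meas2[measurable]
  have "(\<integral>w. (dev u w)\<^sup>2 \<partial>\<nu>) \<le> (\<integral>w. (b + C) * \<bar>dev u w\<bar> \<partial>\<nu>)"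
  proof (rule integral_mono)
    show "integrable \<nu> (\<lambda>w. (dev u w)\<^sup>2)"
      by (rule N.integrable_const_bound[of _ "(b + C)\<^sup>2"])
        (use dev_bound in \<open>auto simp: power2_le_iff_abs_le b0 C_nonneg abs_le_square_iff[symmetric]\<close>)
    show "integrable \<nu> (\<lambda>w. (b + C) * \<bar>dev u w\<bar>)"
      by (intro integrable_mult_right N.integrable_const_bound[of _ "b + C"]) (use dev_bound in auto)
    show "(dev u w)\<^sup>2 \<le> (b + C) * \<bar>dev u w\<bar>" for w
      using mult_right_mono[OF dev_bound[of u w] abs_ge_zero[of "dev u w"]] by (simp add: power2_eq_square)
  qed
  also have "\<dots> \<le> (b + C) * (2 * C)" using integral_dev_abs[of u] b0 C_nonneg by (auto intro!: mult_left_mono)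
  finally show ?thesis .
qed

definition bias :: real where
  "bias = (\<integral>u. \<bar>smoothed u - slice A u\<bar> \<partial>lborel)"

lemma smoothed_meas: "smoothed \<in> borel_measurable borel"
proof -
  have "(\<lambda>u. \<integral>v. case_prod k (u, v) * slice A v \<partial>lborel) \<in> borel_measurable lborel"
    by (rule lborel.borel_measurable_lebesgue_integral) measurable
  then show ?thesis by (simp add: smoothed_def[abs_def])
qed

lemma integrable_bias: "integrable lborel (\<lambda>u. \<bar>smoothed u - slice A u\<bar>)"
proof -
  have "(\<integral>\<^sup>+u. ennreal (smoothed u) \<partial>lborel) \<le> (\<integral>\<^sup>+u. \<integral>\<^sup>+v. ennreal (case_prod k (u, v) * slice A v) \<partial>lborel \<partial>lborel)"
  proof (intro nn_integral_mono)
    fix u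
    have le: "ennreal (enn2real x) \<le> x" for x :: ennreal by (cases x) auto
    have "smoothed u = enn2real (\<integral>\<^sup>+v. ennreal (k u v * slice A v) \<partial>lborel)"
      unfolding smoothed_def using k0 slice_nonneg k_meas2[of u, measurable]
      by (intro integral_eq_nn_integral) auto
    then show "ennreal (smoothed u) \<le> (\<integral>\<^sup>+v. ennreal (case_prod k (u, v) * slice A v) \<partial>lborel)"
      using le by simp
  qed
  also have "\<dots> = (\<integral>\<^sup>+v. \<integral>\<^sup>+u. ennreal (case_prod k (u, v) * slice A v) \<partial>lborel \<partial>lborel)"
    by (rule lborel_pair.Fubini'[symmetric]) measurable
  also have "\<dots> \<le> (\<integral>\<^sup>+v. 1 * ennreal (slice A v) \<partial>lborel)"
  proof (intro nn_integral_mono)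
    \<comment> \<open>After the exchange of integrals the kernel has to be integrated in its first
      argument; symmetry reduces this to the mass bound \<open>k1\<close>.\<close>
    fix v
    have "(\<integral>\<^sup>+u. ennreal (case_prod k (u, v) * slice A v) \<partial>lborel) = (\<integral>\<^sup>+u. ennreal (k v u) * ennreal (slice A v) \<partial>lborel)"
      using k0 slice_nonneg by (auto simp: ennreal_mult k_sym[of _ v])
    also have "\<dots> = (\<integral>\<^sup>+u. ennreal (k v u) \<partial>lborel) * ennreal (slice A v)"
      by (rule nn_integral_multc) (use k_meas2[of v] in auto)
    also have "\<dots> \<le> 1 * ennreal (slice A v)" by (rule mult_right_mono[OF k1]) simp
    finally show "(\<integral>\<^sup>+u. ennreal (case_prod k (u, v) * slice A v) \<partial>lborel) \<le> 1 * ennreal (slice A v)" .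
  qed
  also have "\<dots> < \<infinity>" using nn_integral_slice[OF A] by (simp add: le_less_trans)
  finally have "integrable lborel smoothed"
    using smoothed_meas smoothed_0 by (intro integrableI_bounded) auto
  with integrable_slice[OF A] show ?thesis by auto
qed

context
  fixes s assumes s: "s < n"
begin

text \<open>The evaluation point is the sample point with index s. The summand i = s compares this
  point with itself; it is not centred and is only bounded.\<close>

definition Y :: "nat \<Rightarrow> 'w \<Rightarrow> real" where
  "Y i \<omega> = dev (snd (W s \<omega>)) (W i \<omega>)"

lemma Y_meas[measurable]: "i < n \<Longrightarrow> Y i \<in> borel_measurable M"
proof -
  assume i: "i < n"
  note W_meas[OF s, measurable] W_meas[OF i, measurable]
  show ?thesis unfolding Y_def[abs_def]
    by (rule measurable_compose[OF _ dev_meas, of "\<lambda>\<omega>. (snd (W s \<omega>), W i \<omega>)", simplified]) measurable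
qed

lemma Y_bound: "\<bar>Y i \<omega>\<bar> \<le> b + C" by (simp add: Y_def dev_bound)

text \<open>Given observation s, the two deviations are independent with the same mean, the bias at
  u_s. Both terms of the bias lie in [0, C], so its square is at most C times its absolute value;
  the marginal density of u_s contributes the second factor C.\<close>

lemma E_distinct:
  assumes "i < n" "j < n" "s \<noteq> i" "s \<noteq> j" "i \<noteq> j"
  shows "(\<integral>\<omega>. Y i \<omega> * Y j \<omega> \<partial>M) \<le> C\<^sup>2 * bias"
proof -
  interpret N: prob_space \<nu> by (rule prob_space_\<nu>)
  note smoothed_meas[measurable]
  let ?f = "\<lambda>(a :: 'x \<times> 'u, b, c). dev (snd a) b * dev (snd a) c"
  have mf: "?f \<in> borel_measurable (borel \<Otimes>\<^sub>M (borel \<Otimes>\<^sub>M borel))"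
  proof -
    have [measurable]: "(\<lambda>x :: ('x \<times> 'u) \<times> ('x \<times> 'u) \<times> ('x \<times> 'u). dev (snd (fst x)) (fst (snd x))) \<in> borel_measurable (borel \<Otimes>\<^sub>M (borel \<Otimes>\<^sub>M borel))"
      by (rule measurable_compose[OF _ dev_meas, of "\<lambda>x. (snd (fst x), fst (snd x))", simplified]) measurable
    have [measurable]: "(\<lambda>x :: ('x \<times> 'u) \<times> ('x \<times> 'u) \<times> ('x \<times> 'u). dev (snd (fst x)) (snd (snd x))) \<in> borel_measurable (borel \<Otimes>\<^sub>M (borel \<Otimes>\<^sub>M borel))"
      by (rule measurable_compose[OF _ dev_meas, of "\<lambda>x. (snd (fst x), snd (snd x))", simplified]) measurable
    show ?thesis unfolding split_beta' by measurable
  qed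
  have "(\<integral>\<omega>. Y i \<omega> * Y j \<omega> \<partial>M) = (\<integral>\<omega>. ?f (W s \<omega>, W i \<omega>, W j \<omega>) \<partial>M)" by (simp add: Y_def)
  also have "\<dots> = (\<integral>a. \<integral>b. \<integral>c. ?f (a, b, c) \<partial>\<nu> \<partial>\<nu> \<partial>\<nu>)"
    by (rule integral_triple[OF s assms(1-5) mf, of "(b + C) * (b + C)"])
      (auto simp: abs_mult intro!: mult_mono dev_bound add_nonneg_nonneg b0 C_nonneg)
  also have "\<dots> = (\<integral>a. (smoothed (snd a) - slice A (snd a))\<^sup>2 \<partial>\<nu>)"
    by (simp add: integral_dev power2_eq_square)
  also have "\<dots> = (\<integral>a. indicator UNIV (fst a) * (smoothed (snd a) - slice A (snd a))\<^sup>2 \<partial>\<nu>)" by simp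
  also have "\<dots> = (\<integral>u. (smoothed u - slice A u)\<^sup>2 * slice UNIV u \<partial>lborel)"
    by (subst integral_\<nu>) auto
  also have "\<dots> \<le> (\<integral>u. C\<^sup>2 * \<bar>smoothed u - slice A u\<bar> \<partial>lborel)"
  proof -
    have le: "(smoothed u - slice A u)\<^sup>2 * slice UNIV u \<le> C\<^sup>2 * \<bar>smoothed u - slice A u\<bar>" for u
    proof -
      have "\<bar>smoothed u - slice A u\<bar> \<le> C"
        using smoothed_0[of u] integral_k_le(3)[of u] slice_nonneg[of A u] slice_le_C[OF A, of u] by linarith
      then have "(smoothed u - slice A u)\<^sup>2 \<le> C * \<bar>smoothed u - slice A u\<bar>"
        using mult_right_mono[of "\<bar>smoothed u - slice A u\<bar>" C "\<bar>smoothed u - slice A u\<bar>"]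
        by (simp add: power2_eq_square)
      then have "(smoothed u - slice A u)\<^sup>2 * slice UNIV u \<le> (C * \<bar>smoothed u - slice A u\<bar>) * C"
        using slice_le_C[of UNIV u] slice_nonneg[of UNIV u] C_nonneg by (intro mult_mono) auto
      then show ?thesis by (simp add: power2_eq_square ac_simps)
    qed
    show ?thesis
      by (rule integral_mono')
        (use le integrable_bias slice_nonneg in \<open>auto intro!: integrable_mult_right\<close>)
  qed
  also have "\<dots> = C\<^sup>2 * bias" by (simp add: bias_def)
  finally show ?thesis .
qed

lemma E_abs:
  assumes "i < n" "s \<noteq> i"
  shows "(\<integral>\<omega>. \<bar>Y i \<omega>\<bar> \<partial>M) \<le> 2 * C" and "(\<integral>\<omega>. (Y i \<omega>)\<^sup>2 \<partial>M) \<le> (b + C) * (2 * C)"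
proof -
  interpret N: prob_space \<nu> by (rule prob_space_\<nu>)
  have m[measurable]: "(\<lambda>x :: ('x \<times> 'u) \<times> ('x \<times> 'u). dev (snd (fst x)) (snd x)) \<in> borel_measurable (borel \<Otimes>\<^sub>M borel)"
    by (rule measurable_compose[OF _ dev_meas, of "\<lambda>x. (snd (fst x), snd x)", simplified]) measurable
  have "(\<integral>\<omega>. \<bar>Y i \<omega>\<bar> \<partial>M) = (\<integral>\<omega>. (\<lambda>(a, b). \<bar>dev (snd a) b\<bar>) (W s \<omega>, W i \<omega>) \<partial>M)" by (simp add: Y_def)
  also have "\<dots> = (\<integral>a. \<integral>b. \<bar>dev (snd a) b\<bar> \<partial>\<nu> \<partial>\<nu>)"
    using assms s by (subst integral_pair[where B = "b + C"]) (auto simp: split_beta' dev_bound)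
  also have "\<dots> \<le> (\<integral>a. 2 * C \<partial>\<nu>)"
    by (rule integral_mono') (use integral_dev_abs C_nonneg in auto)
  also have "\<dots> = 2 * C" by simp
  finally show "(\<integral>\<omega>. \<bar>Y i \<omega>\<bar> \<partial>M) \<le> 2 * C" .
  have "(\<integral>\<omega>. (Y i \<omega>)\<^sup>2 \<partial>M) = (\<integral>\<omega>. (\<lambda>(a, b). (dev (snd a) b)\<^sup>2) (W s \<omega>, W i \<omega>) \<partial>M)" by (simp add: Y_def)
  also have "\<dots> = (\<integral>a. \<integral>b. (dev (snd a) b)\<^sup>2 \<partial>\<nu> \<partial>\<nu>)"
    using assms s by (subst integral_pair[where B = "(b + C)\<^sup>2"])
     (auto simp: split_beta' b0 C_nonneg abs_le_square_iff[symmetric] dev_bound)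
  also have "\<dots> \<le> (\<integral>a. (b + C) * (2 * C) \<partial>\<nu>)"
    by (rule integral_mono') (use integral_dev_sq C_nonneg b0 in auto)
  also have "\<dots> = (b + C) * (2 * C)" by simp
  finally show "(\<integral>\<omega>. (Y i \<omega>)\<^sup>2 \<partial>M) \<le> (b + C) * (2 * C)" .
qed

lemma Y_integrable:
  assumes "i < n" "j < n" shows "integrable M (\<lambda>\<omega>. Y i \<omega> * Y j \<omega>)"
  using assms by (intro integrable_const_bound[of _ "(b + C) * (b + C)"])
      (auto simp: abs_mult intro!: mult_mono Y_bound add_nonneg_nonneg b0 C_nonneg)

text \<open>The square expands into expectations of products. Distinct indices different from s give
  the bias term. The diagonal and the pairs of distinct indices that contain s cost one power of b
  each, and there are at most 3 n of them; only the pair (s, s) costs the square of b.\<close>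

lemma second_moment:
  shows "(\<integral>\<omega>. ((\<Sum>i<n. Y i \<omega>) / n)\<^sup>2 \<partial>M) \<le>
    C\<^sup>2 * bias + 3 * ((b + C) * (2 * C)) / n + ((b + C) / n)\<^sup>2"
proof -
  let ?\<beta> = "(b + C) * (2 * C)" and ?\<gamma> = "(b + C)\<^sup>2"
  have \<beta>: "0 \<le> ?\<beta>" using b0 C_nonneg by simp
  have \<eta>: "0 \<le> C\<^sup>2 * bias" unfolding bias_def by simp
  have \<gamma>: "0 \<le> ?\<gamma>" by simp
  have tm: "(\<integral>\<omega>. Y i \<omega> * Y j \<omega> \<partial>M) \<le> C\<^sup>2 * bias + (if i = j then ?\<beta> else 0)
      + (if i = s then ?\<beta> else 0) + (if j = s then ?\<beta> else 0) + (if i = s then if j = s then ?\<gamma> else 0 else 0)"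
    if ij: "i < n" "j < n" for i j
  proof -
    have ab: "(\<integral>\<omega>. Y s \<omega> * Y l \<omega> \<partial>M) \<le> ?\<beta>" if l: "l < n" "s \<noteq> l" for l
    proof -
      have pt: "Y s \<omega> * Y l \<omega> \<le> (b + C) * \<bar>Y l \<omega>\<bar>" for \<omega>
      proof -
        have "Y s \<omega> * Y l \<omega> \<le> \<bar>Y s \<omega>\<bar> * \<bar>Y l \<omega>\<bar>" by (metis abs_ge_self abs_mult)
        also have "\<dots> \<le> (b + C) * \<bar>Y l \<omega>\<bar>" by (rule mult_right_mono[OF Y_bound]) simp
        finally show ?thesis .
      qed
      have "integrable M (\<lambda>\<omega>. (b + C) * \<bar>Y l \<omega>\<bar>)"
        by (intro integrable_mult_right integrable_const_bound[of _ "b + C"]) (use l in \<open>auto simp: Y_bound\<close>)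
      then have "(\<integral>\<omega>. Y s \<omega> * Y l \<omega> \<partial>M) \<le> (\<integral>\<omega>. (b + C) * \<bar>Y l \<omega>\<bar> \<partial>M)"
        by (intro integral_mono Y_integrable s l pt)
      also have "\<dots> \<le> ?\<beta>" using mult_left_mono[OF E_abs(1)[OF l], of "b + C"] b0 C_nonneg by simp
      finally show ?thesis .
    qed
    have mono1: "(\<integral>\<omega>. Y i \<omega> * Y j \<omega> \<partial>M) \<le> ?\<beta>" if "i = s \<or> j = s" "i \<noteq> j"
    proof (cases "i = s")
      case True with that ab[of j] ij show ?thesis by simp
    next
      case False
      then have "(\<integral>\<omega>. Y s \<omega> * Y i \<omega> \<partial>M) \<le> ?\<beta>" using that ab[of i] ij by simp
      then show ?thesis using that False by (simp add: mult.commute)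
    qed
    show ?thesis
    proof (cases "i = j")
      case True
      show ?thesis
      proof (cases "i = s")
        case True
        have "Y s \<omega> * Y s \<omega> \<le> ?\<gamma>" for \<omega>
          using power_mono[OF Y_bound[of s \<omega>], of 2] by (simp add: power2_eq_square)
        then have "(\<integral>\<omega>. Y s \<omega> * Y s \<omega> \<partial>M) \<le> (\<integral>\<omega>. ?\<gamma> \<partial>M)"
          by (intro integral_mono Y_integrable s) simp_all
        then have "(\<integral>\<omega>. Y i \<omega> * Y j \<omega> \<partial>M) \<le> ?\<gamma>"
          using True \<open>i = j\<close> by (simp add: prob_space)
        then show ?thesis using True \<open>i = j\<close> \<eta> \<beta> by simp
      next
        case False
        then have "(\<integral>\<omega>. Y i \<omega> * Y j \<omega> \<partial>M) \<le> ?\<beta>"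
          using E_abs(2)[of i] ij \<open>i = j\<close> by (simp add: power2_eq_square)
        then show ?thesis using False \<open>i = j\<close> \<eta> by simp
      qed
    next
      case False
      show ?thesis
      proof (cases "i = s \<or> j = s")
        case True
        from mono1[OF this False] True False \<eta> \<beta> \<gamma> show ?thesis by (elim disjE) simp_all
      next
        case False
        then show ?thesis using E_distinct[of i j] ij \<open>i \<noteq> j\<close> by simp
      qed
    qed
  qed
  have n0: "0 < n" using s by simp
  have "(\<integral>\<omega>. (\<Sum>i<n. \<Sum>j<n. Y i \<omega> * Y j \<omega>) \<partial>M) = (\<Sum>i<n. \<Sum>j<n. (\<integral>\<omega>. Y i \<omega> * Y j \<omega> \<partial>M))"
  proof -
    have "(\<integral>\<omega>. (\<Sum>i<n. \<Sum>j<n. Y i \<omega> * Y j \<omega>) \<partial>M) = (\<Sum>i<n. (\<integral>\<omega>. (\<Sum>j<n. Y i \<omega> * Y j \<omega>) \<partial>M))"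
      by (intro Bochner_Integration.integral_sum Bochner_Integration.integrable_sum Y_integrable) auto
    also have "\<dots> = (\<Sum>i<n. \<Sum>j<n. (\<integral>\<omega>. Y i \<omega> * Y j \<omega> \<partial>M))"
      by (intro sum.cong refl Bochner_Integration.integral_sum Y_integrable) auto
    finally show ?thesis .
  qed
  also have "\<dots> \<le> (\<Sum>i<n. \<Sum>j<n. C\<^sup>2 * bias + (if i = j then ?\<beta> else 0)
      + (if i = s then ?\<beta> else 0) + (if j = s then ?\<beta> else 0) + (if i = s then if j = s then ?\<gamma> else 0 else 0))"
    by (intro sum_mono tm) auto
  also have "\<dots> = n\<^sup>2 * (C\<^sup>2 * bias) + 3 * n * ?\<beta> + ?\<gamma>"
  proof -
    show ?thesis using sum_index_bound[OF s, of "C\<^sup>2 * bias" ?\<beta> ?\<gamma>] .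
  qed
  finally have le: "(\<integral>\<omega>. (\<Sum>i<n. \<Sum>j<n. Y i \<omega> * Y j \<omega>) \<partial>M) \<le> n\<^sup>2 * (C\<^sup>2 * bias) + 3 * n * ?\<beta> + ?\<gamma>" .
  have "(\<integral>\<omega>. ((\<Sum>i<n. Y i \<omega>) / n)\<^sup>2 \<partial>M) = (\<integral>\<omega>. (\<Sum>i<n. \<Sum>j<n. Y i \<omega> * Y j \<omega>) \<partial>M) / n\<^sup>2"
    by (simp add: power2_eq_square sum_product)
  also have "\<dots> \<le> (n\<^sup>2 * (C\<^sup>2 * bias) + 3 * n * ?\<beta> + ?\<gamma>) / n\<^sup>2"
    by (rule divide_right_mono[OF le]) simp
  also have "\<dots> = C\<^sup>2 * bias + 3 * ?\<beta> / n + ((b + C) / n)\<^sup>2"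
  proof -
    have "(real (n\<^sup>2) * x + 3 * n * y + z\<^sup>2) / n\<^sup>2 = x + 3 * y / n + (z / n)\<^sup>2" for x y z :: real
      using n0 by (simp add: field_simps power2_eq_square)
    then show ?thesis .
  qed
  finally show ?thesis .
qed

end
end
end

section \<open>Kernel estimates of conditional laws\<close>

lemma nn_integral_lborel_affine:
  fixes F :: "'a::euclidean_space \<Rightarrow> ennreal"
  assumes [measurable]: "F \<in> borel_measurable borel" and h: "0 < h"
  shows "(\<integral>\<^sup>+v. F v \<partial>lborel) = (\<integral>\<^sup>+w. ennreal (h ^ DIM('a)) * F (u + h *\<^sub>R w) \<partial>lborel)"
  using h by (subst lborel_affine[of h u]) (auto simp: nn_integral_density nn_integral_distr)

lemma integral_lborel_affine:
  fixes F :: "'a::euclidean_space \<Rightarrow> real"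
  assumes [measurable]: "F \<in> borel_measurable borel" and h: "0 < h"
  shows "(\<integral>v. F v \<partial>lborel) = (\<integral>w. h ^ DIM('a) * F (u + h *\<^sub>R w) \<partial>lborel)"
  using h by (subst lborel_affine[of h u]) (auto simp: integral_density integral_distr)

locale radial_kernel =
  fixes K :: "real \<Rightarrow> real" and CK :: real and ty :: "'u::euclidean_space itself"
  assumes K_nonneg: "\<And>t. 0 \<le> K t" and K_le: "\<And>t. K t \<le> CK"
    and K_int: "has_bochner_integral lborel (\<lambda>u::'u. K (norm u)) 1"
begin

definition scaled :: "real \<Rightarrow> 'u \<Rightarrow> 'u \<Rightarrow> real" where
  "scaled h u v = K (norm (u - v) / h) / h ^ DIM('u)"

lemma K_norm_measurable: "(\<lambda>u::'u. K (norm u)) \<in> borel_measurable borel"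
  using K_int by (auto simp: has_bochner_integral_iff dest: borel_measurable_integrable)

text \<open>Measurability is known for the composition of K with the norm on the whole space, as
  part of its integrability; the factor 1 / h is therefore moved inside the norm.\<close>

lemma K_dist_measurable:
  assumes "0 < h" "f \<in> borel_measurable N" "g \<in> borel_measurable N"
  shows "(\<lambda>x. K (norm (f x - g x :: 'u) / h)) \<in> borel_measurable N"
proof -
  have "(\<lambda>x. K (norm ((1 / h) *\<^sub>R (f x - g x)))) \<in> borel_measurable N"
    using assms(2,3) by (intro measurable_compose[OF _ K_norm_measurable]) measurable
  then show ?thesis using assms(1) by simp
qed

lemma scaled_measurable: "0 < h \<Longrightarrow> case_prod (scaled h) \<in> borel_measurable (borel \<Otimes>\<^sub>M borel)"
  unfolding scaled_def split_beta' by (intro borel_measurable_divide K_dist_measurable) auto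

lemma scaled_nonneg: "0 < h \<Longrightarrow> 0 \<le> scaled h u v"
  by (simp add: scaled_def K_nonneg)

lemma scaled_le: "0 < h \<Longrightarrow> scaled h u v \<le> CK / h ^ DIM('u)"
  by (auto simp: scaled_def intro!: divide_right_mono K_le)

lemma scaled_sym: "scaled h u v = scaled h v u"
  by (simp add: scaled_def norm_minus_commute)

lemma nn_integral_scaled:
  assumes h: "0 < h" shows "(\<integral>\<^sup>+v. ennreal (scaled h u v) \<partial>lborel) = 1"
proof -
  have [measurable]: "(\<lambda>v. K (norm (u - v) / h)) \<in> borel_measurable borel"
    by (intro K_dist_measurable h) auto
  have "(\<integral>\<^sup>+v. ennreal (scaled h u v) \<partial>lborel) = (\<integral>\<^sup>+w. ennreal (K (norm w)) \<partial>(lborel :: 'u measure))"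
    using h K_nonneg by (subst nn_integral_lborel_affine[OF _ h, of _ u])
      (auto simp: scaled_def ennreal_mult[symmetric])
  also have "\<dots> = ennreal 1"
    using K_int K_nonneg by (subst nn_integral_eq_integral) (auto simp: has_bochner_integral_iff)
  finally show ?thesis by simp
qed

lemma integral_scaled:
  assumes h: "0 < h" and [measurable]: "f \<in> borel_measurable borel"
  shows "(\<integral>v. scaled h u v * f v \<partial>lborel) = (\<integral>w. K (norm w) * f (u + h *\<^sub>R w) \<partial>(lborel :: 'u measure))"
proof -
  have [measurable]: "(\<lambda>v. K (norm (u - v) / h)) \<in> borel_measurable borel"
    by (intro K_dist_measurable h) auto
  show ?thesis
    using h by (subst integral_lborel_affine[OF _ h, of _ u]) (auto simp: scaled_def)
qed

end

text \<open>Nonnegativity of the variance of |X|.\<close>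

lemma (in prob_space) expectation_abs_le_sqrt:
  assumes [measurable]: "X \<in> borel_measurable M" and B: "\<And>\<omega>. \<bar>X \<omega>\<bar> \<le> B"
  shows "expectation (\<lambda>\<omega>. \<bar>X \<omega>\<bar>) \<le> sqrt (expectation (\<lambda>\<omega>. (X \<omega>)\<^sup>2))"
proof -
  have i1: "integrable M (\<lambda>\<omega>. \<bar>X \<omega>\<bar>)" by (rule integrable_const_bound[of _ B]) (use B in auto)
  have B0: "0 \<le> B" using B[of undefined] by linarith
  have i2: "integrable M (\<lambda>\<omega>. \<bar>X \<omega>\<bar>\<^sup>2)"
    by (rule integrable_const_bound[of _ "B\<^sup>2"]) (use B B0 in \<open>auto simp: abs_le_square_iff[symmetric]\<close>)
  have "(expectation (\<lambda>\<omega>. \<bar>X \<omega>\<bar>))\<^sup>2 \<le> expectation (\<lambda>\<omega>. \<bar>X \<omega>\<bar>\<^sup>2)"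
    using variance_positive[of "\<lambda>\<omega>. \<bar>X \<omega>\<bar>"] variance_eq[OF i1 i2] by linarith
  then show ?thesis by (intro real_le_rsqrt) simp
qed

section \<open>Conditional laws and quotients of kernel averages\<close>

context joint_density begin

text \<open>Where the marginal density vanishes, x / 0 = 0 makes this the null measure.\<close>

definition cond :: "'u \<Rightarrow> 'x measure" where
  "cond u = density lborel (\<lambda>x. ennreal (r (x, u) / slice UNIV u))"

lemma sets_cond[simp, measurable_cong]: "sets (cond u) = sets borel" by (simp add: cond_def)

lemma emeasure_cond:
  assumes [measurable]: "A \<in> sets borel"
  shows "emeasure (cond u) A = ennreal (slice A u / slice UNIV u)"
proof -
  have "emeasure (cond u) A = (\<integral>\<^sup>+x. ennreal (1 / slice UNIV u) * ennreal (indicator A x * r (x, u)) \<partial>lborel)"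
    unfolding cond_def using nonneg slice_nonneg
    by (subst emeasure_density)
      (auto simp: ennreal_mult[symmetric] indicator_def intro!: nn_integral_cong)
  also have "\<dots> = ennreal (1 / slice UNIV u) * ennreal (slice A u)"
    by (subst nn_integral_cmult) (auto simp: ennreal_slice ennreal_mult' ennreal_indicator nonneg)
  also have "\<dots> = ennreal (slice A u / slice UNIV u)"
    using slice_nonneg by (subst ennreal_mult[symmetric]) auto
  finally show ?thesis .
qed

lemma measure_cond: "A \<in> sets borel \<Longrightarrow> measure (cond u) A = slice A u / slice UNIV u"
  using slice_nonneg by (simp add: measure_def emeasure_cond)

lemma slice_snd_measurable: "(\<lambda>w :: 'x \<times> 'u. slice UNIV (snd w)) \<in> borel_measurable borel"
  by (rule measurable_compose[OF borel_snd slice_measurable]) simp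

lemma AE_slice_pos: "AE w in \<nu>. 0 < slice UNIV (snd w)"
proof (rule AE_I')
  let ?N = "{w :: 'x \<times> 'u. slice UNIV (snd w) = 0}"
  have [measurable]: "?N \<in> sets borel"
    using measurable_sets[OF slice_snd_measurable, of "{0}"] by (simp add: vimage_def)
  have "emeasure \<nu> ?N = (\<integral>\<^sup>+w. indicator UNIV (fst w) * indicator {u. slice UNIV u = 0} (snd w) \<partial>\<nu>)"
  proof -
    have "emeasure \<nu> ?N = (\<integral>\<^sup>+w. indicator ?N w \<partial>\<nu>)" by simp
    also have "\<dots> = (\<integral>\<^sup>+w. indicator UNIV (fst w) * indicator {u. slice UNIV u = 0} (snd w) \<partial>\<nu>)"
      by (intro nn_integral_cong) (auto simp: indicator_def)
    finally show ?thesis .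
  qed
  also have "\<dots> = (\<integral>\<^sup>+u. indicator {u. slice UNIV u = 0} u * ennreal (slice UNIV u) \<partial>lborel)"
    by (rule nn_integral_\<nu>) auto
  also have "\<dots> = (\<integral>\<^sup>+u. 0 \<partial>(lborel :: 'u measure))"
    by (intro nn_integral_cong) (auto simp: indicator_def)
  finally show "?N \<in> null_sets \<nu>" by (auto simp: null_sets_def)
  show "{w \<in> space \<nu>. \<not> 0 < slice UNIV (snd w)} \<subseteq> ?N"
    using slice_nonneg[of UNIV] by (auto simp: less_le)
qed

text \<open>Supplies the truncation level. A quotient with a small denominator is unstable; the sets
  where the marginal density is at most 1 / (m + 1) decrease to a \<nu>-null set.\<close>

lemma small_slice:
  assumes "0 < e"
  obtains \<eta> where "0 < \<eta>" "measure \<nu> {w. slice UNIV (snd w) \<le> \<eta>} < e"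
proof -
  interpret prob_space \<nu> by (rule prob_space_\<nu>)
  let ?A = "\<lambda>m::nat. {w :: 'x \<times> 'u. slice UNIV (snd w) \<le> 1 / Suc m}"
  have "(\<lambda>m. measure \<nu> (?A m)) \<longlonglongrightarrow> measure \<nu> (\<Inter>m. ?A m)"
  proof (rule finite_Lim_measure_decseq)
    have "?A m \<in> sets borel" for m
      using measurable_sets[OF slice_snd_measurable, of "{..1 / Suc m}"] by (simp add: vimage_def)
    then show "range ?A \<subseteq> sets \<nu>" by auto
    show "decseq ?A" unfolding decseq_def
      by (auto intro: order_trans simp: frac_le)
  qed
  also have "measure \<nu> (\<Inter>m. ?A m) = 0"
  proof -
    have "(\<Inter>m. ?A m) = {w. \<not> 0 < slice UNIV (snd w)}"
    proof (safe)
      fix w assume w: "w \<in> (\<Inter>m. ?A m)" "0 < slice UNIV (snd w)"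
      then obtain m where "1 / Suc m < slice UNIV (snd w)"
        using reals_Archimedean[of "slice UNIV (snd w)"] by (auto simp: inverse_eq_divide)
      then show False using w(1) by (auto simp: not_le[symmetric])
    qed (use slice_nonneg[of UNIV] in \<open>auto simp: not_less intro: order_trans\<close>)
    moreover have "emeasure \<nu> {w. \<not> 0 < slice UNIV (snd w)} = 0"
      using AE_slice_pos by (subst (asm) AE_iff_measurable[OF _ refl]) auto
    ultimately show ?thesis by (simp add: measure_def)
  qed
  finally have "(\<lambda>m. measure \<nu> (?A m)) \<longlonglongrightarrow> 0" .
  from order_tendstoD(2)[OF this assms] obtain m where "measure \<nu> (?A m) < e"
    by (auto simp: eventually_sequentially)
  then show thesis using that[of "1 / Suc m"] by auto
qed

end

text \<open>Rests on g (S / T) - m = (S / T) (g - T) + (S - m) and S / T \<le> 1. The weight g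
  removes the denominators from the bound; the cases g = 0 and T = 0 hold by the convention x / 0 =
  0.\<close>

lemma ratio_error:
  fixes S T m g :: real
  assumes "0 \<le> S" "S \<le> T" "0 \<le> m" "m \<le> g"
  shows "g * \<bar>S / T - m / g\<bar> \<le> \<bar>T - g\<bar> + \<bar>S - m\<bar>"
proof (cases "g = 0 \<or> T = 0")
  case True then show ?thesis using assms by (auto simp: abs_if)
next
  case False
  have "g * \<bar>S / T - m / g\<bar> = \<bar>g * (S / T) - m\<bar>"
  proof -
    have "g * \<bar>S / T - m / g\<bar> = \<bar>g * (S / T - m / g)\<bar>" using assms by (simp add: abs_mult)
    also have "g * (S / T - m / g) = g * (S / T) - m" using False by (simp add: right_diff_distrib)
    finally show ?thesis .
  qed
  also have "g * (S / T) - m = (S / T) * (g - T) + (S - m)" using False by (simp add: field_simps)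
  also have "\<bar>\<dots>\<bar> \<le> (S / T) * \<bar>g - T\<bar> + \<bar>S - m\<bar>"
    using assms by (intro order_trans[OF abs_triangle_ineq]) (simp add: abs_mult)
  also have "\<dots> \<le> 1 * \<bar>g - T\<bar> + \<bar>S - m\<bar>"
    using assms False by (intro add_mono mult_right_mono) auto
  finally show ?thesis by simp
qed

locale joint_kernel = joint_density r C + radial_kernel K CK "TYPE('u)"
  for r :: "'x::euclidean_space \<times> 'u::euclidean_space \<Rightarrow> real" and C K CK
begin

text \<open>The bound of \<open>second_moment\<close> for the scaled kernel, whose supremum is at
  most b = CK / h^d.\<close>

definition mse_bound :: "real \<Rightarrow> nat \<Rightarrow> 'x set \<Rightarrow> real" where
  "mse_bound h n A = C\<^sup>2 * (LBINT u. \<bar>(LBINT v. scaled h u v * slice A v) - slice A u\<bar>)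
     + 3 * ((CK / h ^ DIM('u) + C) * (2 * C)) / n + ((CK / h ^ DIM('u) + C) / n)\<^sup>2"

lemma CK_nonneg: "0 \<le> CK"
  using K_nonneg[of 0] K_le[of 0] by simp

text \<open>The substitution v = u + h w turns the bias into the L1 error of smoothing
  \<open>slice A\<close> at scale h. The other two terms are multiples of the first and second power
  of (CK / h^d + C) / n.\<close>

lemma mse_bound_tendsto:
  assumes h: "\<And>n. 0 < h n" "h \<longlonglongrightarrow> 0" "filterlim (\<lambda>n. real n * h n ^ DIM('u)) at_top sequentially"
    and A: "A \<in> sets borel"
  shows "(\<lambda>n. mse_bound (h n) n A) \<longlonglongrightarrow> 0"
proof -
  let ?b = "\<lambda>n. (CK / h n ^ DIM('u) + C) / real n"
  have 1: "(\<lambda>n. LBINT u. \<bar>(LBINT v. scaled (h n) u v * slice A v) - slice A u\<bar>) \<longlonglongrightarrow> 0"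
    unfolding integral_scaled[OF h(1) slice_measurable[OF A]]
    using K_int K_nonneg h(2)
    by (intro L1_smoothing integrable_slice[OF A]) (auto simp: has_bochner_integral_iff)
  have "(\<lambda>n. CK / (real n * h n ^ DIM('u)) + C / real n) \<longlonglongrightarrow> 0 + 0"
    by (intro tendsto_add tendsto_divide_0[OF tendsto_const] filterlim_at_top_imp_at_infinity h(3)
        filterlim_real_sequentially)
  then have 2: "?b \<longlonglongrightarrow> 0"
    by (simp add: add_divide_distrib mult.commute)
  have "(\<lambda>n. C\<^sup>2 * (LBINT u. \<bar>(LBINT v. scaled (h n) u v * slice A v) - slice A u\<bar>)
      + 3 * (2 * C) * ?b n + (?b n)\<^sup>2) \<longlonglongrightarrow> C\<^sup>2 * 0 + 3 * (2 * C) * 0 + 0\<^sup>2"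
    by (intro tendsto_intros 1 2)
  then show ?thesis by (simp add: mse_bound_def mult.assoc mult.left_commute mult.commute)
qed

end

locale iid_kernel = iid_sample r C M W n + joint_kernel r C K CK
  for r :: "'x::euclidean_space \<times> 'u::euclidean_space \<Rightarrow> real" and C and M :: "'w measure" and W n K CK
begin

lemma kernel_mean_error:
  assumes h: "0 < h" and A: "A \<in> sets borel" and s: "s < n"
  shows "expectation (\<lambda>\<omega>. \<bar>(\<Sum>i<n. indicator A (fst (W i \<omega>)) * scaled h (snd (W s \<omega>)) (snd (W i \<omega>))) / n
      - slice A (snd (W s \<omega>))\<bar>) \<le> sqrt (mse_bound h n A)" (is ?E)
    and "integrable M (\<lambda>\<omega>. \<bar>(\<Sum>i<n. indicator A (fst (W i \<omega>)) * scaled h (snd (W s \<omega>)) (snd (W i \<omega>))) / n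
      - slice A (snd (W s \<omega>))\<bar>)" (is ?I)
proof -
  note k = scaled_measurable[OF h] scaled_nonneg[OF h] scaled_le[OF h] eq_refl[OF nn_integral_scaled[OF h]] scaled_sym[of h]
  let ?D = "\<lambda>\<omega>. (\<Sum>i<n. Y A (scaled h) s i \<omega>) / n"
  have n0: "0 < n" using s by simp
  have D: "?D = (\<lambda>\<omega>. (\<Sum>i<n. indicator A (fst (W i \<omega>)) * scaled h (snd (W s \<omega>)) (snd (W i \<omega>))) / n
      - slice A (snd (W s \<omega>)))"
    using n0 by (simp add: Y_def[OF A k s] dev_def[OF A k] sum_subtractf diff_divide_distrib)
  have b: "mse_bound h n A = C\<^sup>2 * bias A (scaled h) + 3 * ((CK / h ^ DIM('u) + C) * (2 * C)) / n
       + ((CK / h ^ DIM('u) + C) / n)\<^sup>2"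
    unfolding mse_bound_def bias_def[OF A k] smoothed_def[OF A k] ..
  have mD[measurable]: "?D \<in> borel_measurable M"
    by (intro borel_measurable_divide borel_measurable_sum) (auto intro: Y_meas[OF A k s])
  have DB: "\<bar>?D \<omega>\<bar> \<le> CK / h ^ DIM('u) + C" for \<omega>
  proof -
    have "\<bar>\<Sum>i<n. Y A (scaled h) s i \<omega>\<bar> \<le> (\<Sum>i<n. CK / h ^ DIM('u) + C)"
      by (rule order_trans[OF sum_abs]) (intro sum_mono Y_bound[OF A k s])
    then show ?thesis using n0 by (simp add: field_simps)
  qed
  have "expectation (\<lambda>\<omega>. \<bar>?D \<omega>\<bar>) \<le> sqrt (expectation (\<lambda>\<omega>. (?D \<omega>)\<^sup>2))"
    by (rule expectation_abs_le_sqrt[OF mD DB])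
  also have "\<dots> \<le> sqrt (mse_bound h n A)"
    unfolding b by (intro real_sqrt_le_mono second_moment[OF A k s])
  finally show ?E unfolding fun_cong[OF D] .
  have "integrable M (\<lambda>\<omega>. \<bar>?D \<omega>\<bar>)"
  proof (rule integrable_const_bound)
    show "AE \<omega> in M. norm \<bar>?D \<omega>\<bar> \<le> CK / h ^ DIM('u) + C" using DB by (intro AE_I2) simp
    show "(\<lambda>\<omega>. \<bar>?D \<omega>\<bar>) \<in> borel_measurable M" by (intro borel_measurable_abs mD)
  qed
  then show ?I unfolding fun_cong[OF D] .
qed

definition estimate :: "real \<Rightarrow> nat \<Rightarrow> 'w \<Rightarrow> 'x measure" where
  "estimate h s \<omega> = weighted_empirical n (\<lambda>i. K (norm (snd (W s \<omega>) - snd (W i \<omega>)) / h)) (\<lambda>i. fst (W i \<omega>))"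

text \<open>The normalisation n h^d cancels in the quotient, which exhibits the estimate as a ratio
  of two kernel averages, for A and for the whole space.\<close>

lemma measure_estimate:
  assumes "0 < h" "A \<in> sets borel" "s < n"
  shows "measure (estimate h s \<omega>) A =
    ((\<Sum>i<n. indicator A (fst (W i \<omega>)) * scaled h (snd (W s \<omega>)) (snd (W i \<omega>))) / n) /
    ((\<Sum>i<n. indicator UNIV (fst (W i \<omega>)) * scaled h (snd (W s \<omega>)) (snd (W i \<omega>))) / n)"
proof -
  have eq: "(\<Sum>i<n. indicator B (fst (W i \<omega>)) * scaled h (snd (W s \<omega>)) (snd (W i \<omega>))) / n =
      (\<Sum>i<n. K (norm (snd (W s \<omega>) - snd (W i \<omega>)) / h) * indicator B (fst (W i \<omega>))) / (h ^ DIM('u) * n)" for B :: "'x set"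
    unfolding scaled_def sum_divide_distrib by (intro sum.cong) (simp_all add: field_simps)
  have "h ^ DIM('u) * n \<noteq> 0" using assms by simp
  then show ?thesis unfolding eq estimate_def using assms K_nonneg
    by (subst measure_weighted_empirical) auto
qed

text \<open>Where the marginal density at the sample point is at most \<eta>, the error is bounded
  by 1. Elsewhere \<open>ratio_error\<close> can be divided by \<eta>; its two terms are the kernel
  errors for the whole space and for A.\<close>

lemma estimate_error:
  assumes h: "0 < h" and A[measurable]: "A \<in> sets borel" and s: "s < n" and \<eta>: "0 < \<eta>"
  shows "integrable M (\<lambda>\<omega>. \<bar>measure (estimate h s \<omega>) A - measure (cond (snd (W s \<omega>))) A\<bar>)"
    and "expectation (\<lambda>\<omega>. \<bar>measure (estimate h s \<omega>) A - measure (cond (snd (W s \<omega>))) A\<bar>) \<le>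
    measure \<nu> {w. slice UNIV (snd w) \<le> \<eta>} + (sqrt (mse_bound h n UNIV) + sqrt (mse_bound h n A)) / \<eta>"
proof -
  define S where "S B \<omega> = (\<Sum>i<n. indicator B (fst (W i \<omega>)) * scaled h (snd (W s \<omega>)) (snd (W i \<omega>))) / n" for B \<omega>
  let ?g = "\<lambda>\<omega>. slice UNIV (snd (W s \<omega>))" and ?m = "\<lambda>\<omega>. slice A (snd (W s \<omega>))"
  let ?d = "\<lambda>\<omega>. \<bar>measure (estimate h s \<omega>) A - measure (cond (snd (W s \<omega>))) A\<bar>"
  note W_meas[OF s, measurable]
  have S0: "0 \<le> S A \<omega>" "S A \<omega> \<le> S UNIV \<omega>" for \<omega>
  proof -
    show "0 \<le> S A \<omega>" unfolding S_def using scaled_nonneg[OF h]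
      by (intro divide_nonneg_nonneg sum_nonneg) auto
    show "S A \<omega> \<le> S UNIV \<omega>" unfolding S_def using scaled_nonneg[OF h]
      by (intro divide_right_mono sum_mono) (auto simp: indicator_def)
  qed
  have m: "0 \<le> ?m \<omega>" "?m \<omega> \<le> ?g \<omega>" for \<omega>
    by (auto intro!: slice_nonneg slice_mono)
  have d: "?d \<omega> = \<bar>S A \<omega> / S UNIV \<omega> - ?m \<omega> / ?g \<omega>\<bar>" for \<omega>
    using measure_estimate[OF h A s] by (simp add: S_def measure_cond)
  have d1: "?d \<omega> \<le> 1" for \<omega>
  proof -
    have "0 \<le> S A \<omega> / S UNIV \<omega>" "S A \<omega> / S UNIV \<omega> \<le> 1" "0 \<le> ?m \<omega> / ?g \<omega>" "?m \<omega> / ?g \<omega> \<le> 1"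
      using S0[of \<omega>] m[of \<omega>] by (auto simp: divide_le_eq_1)
    then show ?thesis unfolding d by linarith
  qed
  have le: "?d \<omega> \<le> indicator {w. slice UNIV (snd w) \<le> \<eta>} (W s \<omega>) + (\<bar>S UNIV \<omega> - ?g \<omega>\<bar> + \<bar>S A \<omega> - ?m \<omega>\<bar>) / \<eta>" for \<omega>
  proof (cases "?g \<omega> \<le> \<eta>")
    case True
    have "0 \<le> (\<bar>S UNIV \<omega> - ?g \<omega>\<bar> + \<bar>S A \<omega> - ?m \<omega>\<bar>) / \<eta>" using \<eta> by auto
    then show ?thesis using True d1[of \<omega>] by (simp add: indicator_def)
  next
    case False
    have "\<eta> * ?d \<omega> \<le> ?g \<omega> * ?d \<omega>" using False by (intro mult_right_mono) auto
    also have "\<dots> \<le> \<bar>S UNIV \<omega> - ?g \<omega>\<bar> + \<bar>S A \<omega> - ?m \<omega>\<bar>"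
      unfolding d by (rule ratio_error[OF S0 m])
    finally show ?thesis using False \<eta> by (simp add: indicator_def field_simps)
  qed
  note err = kernel_mean_error[OF h _ s, folded S_def]
  have smeas[measurable]: "S B \<in> borel_measurable M" if [measurable]: "B \<in> sets borel" for B
  proof -
    have [measurable]: "W i \<in> borel_measurable M" if "i < n" for i using that by (rule W_meas)
    have [measurable]: "(\<lambda>\<omega>. scaled h (snd (W s \<omega>)) (snd (W i \<omega>))) \<in> borel_measurable M" if i: "i < n" for i
    proof -
      note W_meas[OF i, measurable]
      show ?thesis
        by (rule measurable_compose[OF _ scaled_measurable[OF h], of "\<lambda>\<omega>. (snd (W s \<omega>), snd (W i \<omega>))", simplified]) measurable
    qed
    show ?thesis unfolding S_def[abs_def]
      by (intro borel_measurable_divide borel_measurable_sum borel_measurable_times) auto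
  qed
  have [measurable]: "?d \<in> borel_measurable M" unfolding d by measurable
  show id: "integrable M ?d" by (rule integrable_const_bound[of _ 1]) (use d1 in auto)
  have N: "{w :: 'x \<times> 'u. slice UNIV (snd w) \<le> \<eta>} \<in> sets borel"
    using measurable_sets[OF slice_snd_measurable, of "{..\<eta>}"] by (simp add: vimage_def)
  have iN: "integrable M (\<lambda>\<omega>. indicator {w. slice UNIV (snd w) \<le> \<eta>} (W s \<omega>) :: real)"
    by (rule integrable_const_bound[of _ 1]) (use N in \<open>auto simp: indicator_def\<close>)
  have "expectation ?d \<le> expectation (\<lambda>\<omega>. indicator {w. slice UNIV (snd w) \<le> \<eta>} (W s \<omega>)
      + (\<bar>S UNIV \<omega> - ?g \<omega>\<bar> + \<bar>S A \<omega> - ?m \<omega>\<bar>) / \<eta>)"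
    using id iN err(2) A by (intro integral_mono le) auto
  also have "\<dots> = expectation (\<lambda>\<omega>. indicator {w. slice UNIV (snd w) \<le> \<eta>} (W s \<omega>))
      + (expectation (\<lambda>\<omega>. \<bar>S UNIV \<omega> - ?g \<omega>\<bar>) + expectation (\<lambda>\<omega>. \<bar>S A \<omega> - ?m \<omega>\<bar>)) / \<eta>"
    using iN err(2) A by simp
  also have "expectation (\<lambda>\<omega>. indicator {w. slice UNIV (snd w) \<le> \<eta>} (W s \<omega>)) = measure \<nu> {w. slice UNIV (snd w) \<le> \<eta>}"
    using N by (subst integral_W[OF s]) auto
  also have "(expectation (\<lambda>\<omega>. \<bar>S UNIV \<omega> - ?g \<omega>\<bar>) + expectation (\<lambda>\<omega>. \<bar>S A \<omega> - ?m \<omega>\<bar>)) / \<eta> \<le>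
      (sqrt (mse_bound h n UNIV) + sqrt (mse_bound h n A)) / \<eta>"
    using \<eta> err(1) A by (intro divide_right_mono add_mono) auto
  finally show "expectation ?d \<le>
    measure \<nu> {w. slice UNIV (snd w) \<le> \<eta>} + (sqrt (mse_bound h n UNIV) + sqrt (mse_bound h n A)) / \<eta>" by simp
qed

end

text \<open>The level \<eta> is fixed before n grows. The error bound is the same for every s, so
  one threshold for n serves all sample points; only a bound on each mean is claimed, not one on the
  maximum.\<close>

lemma (in joint_kernel) estimator_consistent:
  assumes h: "\<And>n. 0 < h n" "h \<longlonglongrightarrow> 0" "filterlim (\<lambda>n. real n * h n ^ DIM('u)) at_top sequentially"
    and iid: "\<And>n. n \<ge> 1 \<Longrightarrow> iid_sample r C (M n) (W n) n"
    and A: "A \<in> sets borel" and e: "0 < e"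
  shows "\<forall>\<^sub>F n in sequentially. \<forall>s<n.
    (\<integral>\<omega>. \<bar>measure (weighted_empirical n (\<lambda>i. K (norm (snd (W n s \<omega>) - snd (W n i \<omega>)) / h n))
        (\<lambda>i. fst (W n i \<omega>))) A - measure (cond (snd (W n s \<omega>))) A\<bar> \<partial>M n) \<le> e"
proof -
  from e obtain \<eta> where \<eta>: "0 < \<eta>" "measure \<nu> {w. slice UNIV (snd w) \<le> \<eta>} < e / 2"
    using small_slice[of "e/2"] by auto
  have "(\<lambda>n. (sqrt (mse_bound (h n) n UNIV) + sqrt (mse_bound (h n) n A)) / \<eta>) \<longlonglongrightarrow> (sqrt 0 + sqrt 0) / \<eta>"
    using \<eta> by (intro tendsto_intros mse_bound_tendsto h A) auto
  then have "\<forall>\<^sub>F n in sequentially. (sqrt (mse_bound (h n) n UNIV) + sqrt (mse_bound (h n) n A)) / \<eta> < e / 2"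
    using e by (intro order_tendstoD) auto
  moreover have "\<forall>\<^sub>F n in sequentially. n \<ge> (1::nat)" by (rule eventually_ge_at_top)
  ultimately show ?thesis
  proof eventually_elim
    case (elim n)
    interpret S: iid_sample r C "M n" "W n" n by (rule iid[OF elim(2)])
    interpret iid_kernel r C "M n" "W n" n K CK ..
    show ?case
    proof (intro allI impI)
      fix s assume "s < n"
      from estimate_error(2)[OF h(1)[of n] A this \<eta>(1), unfolded estimate_def] elim(1) \<eta>(2)
      show "(\<integral>\<omega>. \<bar>measure (weighted_empirical n (\<lambda>i. K (norm (snd (W n s \<omega>) - snd (W n i \<omega>)) / h n))
        (\<lambda>i. fst (W n i \<omega>))) A - measure (cond (snd (W n s \<omega>))) A\<bar> \<partial>M n) \<le> e"
        by linarith
    qed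
  qed
qed

section \<open>Discretisation of the ball divergence\<close>

definition in_ball :: "'x::euclidean_space \<Rightarrow> 'x \<Rightarrow> 'x \<Rightarrow> real" where
  "in_ball u v x = indicator (cball u (norm (v - u))) x"

text \<open>Mass at most 1 rather than equal to 1, because weighted empirical laws with vanishing
  weights and \<open>cond\<close> at a zero of the marginal density are null measures.\<close>

locale sub_prob =
  fixes M :: "'x::euclidean_space measure"
  assumes sets_M[simp, measurable_cong]: "sets M = sets borel"
    and emeasure_le_1: "emeasure M UNIV \<le> 1"
begin

lemma space_M[simp]: "space M = UNIV"
  using sets_eq_imp_space_eq[OF sets_M] by simp

sublocale finite_measure M
proof
  show "emeasure M (space M) \<noteq> \<infinity>" using emeasure_le_1 by (auto simp: top_unique)
qed

lemma measure_le_1: "measure M A \<le> 1"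
proof -
  have "measure M A \<le> measure M UNIV" using bounded_measure[of A] by simp
  also have "\<dots> \<le> 1" unfolding measure_def using emeasure_le_1 by (intro enn2real_leI) auto
  finally show ?thesis .
qed

lemma integral_le_bound:
  fixes f :: "'x \<Rightarrow> real"
  assumes "\<And>x. f x \<le> B" "0 \<le> B" shows "(\<integral>x. f x \<partial>M) \<le> B"
proof -
  have "(\<integral>x. f x \<partial>M) \<le> (\<integral>x. B \<partial>M)"
    by (rule integral_mono') (use assms in auto)
  also have "\<dots> = measure M UNIV * B" by simp
  also have "\<dots> \<le> 1 * B" by (rule mult_right_mono[OF measure_le_1]) (use assms in auto)
  finally show ?thesis by simp
qed

end

lemma in_ball_measurable:
  "(\<lambda>w :: 'x \<times> 'x \<times> 'x::euclidean_space. in_ball (fst w) (fst (snd w)) (snd (snd w))) \<in> borel_measurable (borel \<Otimes>\<^sub>M (borel \<Otimes>\<^sub>M borel))"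
proof -
  have "in_ball u v x = (if dist u x \<le> norm (v - u) then 1 else 0)" for u v x :: 'x
    by (simp add: in_ball_def indicator_def)
  then show ?thesis by simp
qed

lemma (in sub_prob) measure_ball: "measure M (cball u (norm (v - u))) = (\<integral>x. in_ball u v x \<partial>M)"
  by (simp add: in_ball_def)

lemma (in sub_prob) measure_ball_measurable:
  "(\<lambda>w :: 'x \<times> 'x. measure M (cball (fst w) (norm (snd w - fst w)))) \<in> borel_measurable (borel \<Otimes>\<^sub>M borel)"
proof -
  have "(\<lambda>w :: ('x \<times> 'x) \<times> 'x. in_ball (fst (fst w)) (snd (fst w)) (snd w)) \<in> borel_measurable ((borel \<Otimes>\<^sub>M borel) \<Otimes>\<^sub>M M)"
    by (rule measurable_compose[OF _ in_ball_measurable, of "\<lambda>w. (fst (fst w), snd (fst w), snd w)", simplified]) measurable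
  then show ?thesis unfolding measure_ball
    by (intro borel_measurable_lebesgue_integral) (simp add: split_beta')
qed

text \<open>\<open>c\<close> replaces a point by the representative of its cell, and \<open>G\<close> dominates the error this causes in
  the ball indicator; it is later the indicator of those triples of cells on which that indicator is not constant.\<close>

locale cells =
  fixes c :: "'x::euclidean_space \<Rightarrow> 'x" and F :: "'x set" and G :: "'x \<Rightarrow> 'x \<Rightarrow> 'x \<Rightarrow> real"
  assumes c_meas[measurable]: "c \<in> borel_measurable borel"
    and finF: "finite F" and c_F: "\<And>x. c x \<in> F"
    and G0: "\<And>a b d. 0 \<le> G a b d" and G1: "\<And>a b d. G a b d \<le> 1"
    and G: "\<And>u v x. \<bar>in_ball u v x - in_ball (c u) (c v) (c x)\<bar> \<le> G (c u) (c v) (c x)"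
begin

definition mass :: "'x measure \<Rightarrow> 'x \<Rightarrow> real" where
  "mass M a = measure M (c -` {a})"

lemma cell_sets[measurable]: "c -` {a} \<in> sets borel"
  using measurable_sets[OF c_meas, of "{a}"] by simp

text \<open>Since c takes finitely many values on Borel cells, every function of c is simple,
  whatever f is; measurability of f never has to be discussed.\<close>

lemma fun_c: "f (c x) = (\<Sum>a\<in>F. f a * indicator (c -` {a}) x)" for f :: "'x \<Rightarrow> real"
proof -
  have "(\<Sum>a\<in>F. f a * indicator (c -` {a}) x) = (\<Sum>a\<in>F. if a = c x then f a else 0)"
    by (intro sum.cong) (auto simp: indicator_def)
  then show ?thesis using finF c_F by (simp add: sum.delta)
qed

lemma fun_c_measurable[measurable]: "(\<lambda>x. f (c x)) \<in> borel_measurable borel" for f :: "'x \<Rightarrow> real"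
  unfolding fun_c[of f] by measurable

lemma mass_nonneg: "0 \<le> mass M a" by (simp add: mass_def)

lemma integral_fun_c:
  fixes f :: "'x \<Rightarrow> real"
  assumes "sub_prob M"
  shows "(\<integral>x. f (c x) \<partial>M) = (\<Sum>a\<in>F. f a * mass M a)" and "integrable M (\<lambda>x. f (c x))"
proof -
  interpret sub_prob M by fact
  show "(\<integral>x. f (c x) \<partial>M) = (\<Sum>a\<in>F. f a * mass M a)"
    unfolding fun_c[of f] by (subst Bochner_Integration.integral_sum) (auto simp: mass_def emeasure_finite less_top[symmetric])
  show "integrable M (\<lambda>x. f (c x))"
    unfolding fun_c[of f] by (intro Bochner_Integration.integrable_sum integrable_mult_right integrable_real_indicator)
      (auto simp: emeasure_finite less_top[symmetric])
qed

lemma mass_sum: "sub_prob M \<Longrightarrow> (\<Sum>a\<in>F. mass M a) \<le> 1"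
  using integral_fun_c(1)[of M "\<lambda>_. 1"] sub_prob.integral_le_bound[of M "\<lambda>_. 1" 1] by simp

text \<open>The difference of the two ball masses when every cell is concentrated in its
  representative.\<close>

definition dsc :: "'x measure \<Rightarrow> 'x measure \<Rightarrow> 'x \<Rightarrow> 'x \<Rightarrow> real" where
  "dsc P Q a b = (\<Sum>d\<in>F. in_ball a b d * (mass P d - mass Q d))"

text \<open>The mass, under P and Q together, of the cells for which the pair (a, b) does not decide
  membership in the ball.\<close>

definition amb :: "'x measure \<Rightarrow> 'x measure \<Rightarrow> 'x \<Rightarrow> 'x \<Rightarrow> real" where
  "amb P Q a b = (\<Sum>d\<in>F. G a b d * (mass P d + mass Q d))"

text \<open>The double integral against R of a function of two cells, see
  \<open>integral_c_c\<close>.\<close>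

definition quad :: "'x measure \<Rightarrow> ('x \<Rightarrow> 'x \<Rightarrow> real) \<Rightarrow> real" where
  "quad R \<phi> = (\<Sum>a\<in>F. \<Sum>b\<in>F. mass R a * mass R b * \<phi> a b)"

definition cell_dist :: "'x measure \<Rightarrow> 'x measure \<Rightarrow> real" where
  "cell_dist P P' = (\<Sum>a\<in>F. \<bar>mass P a - mass P' a\<bar>)"

definition ball_form :: "'x measure \<Rightarrow> 'x measure \<Rightarrow> 'x measure \<Rightarrow> real" where
  "ball_form R P Q = (\<integral>u. \<integral>v. (measure P (cball u (norm (v - u))) - measure Q (cball u (norm (v - u))))\<^sup>2 \<partial>R \<partial>R)"

lemma integral_c_c:
  assumes R: "sub_prob R" shows "(\<integral>u. \<integral>v. \<phi> (c u) (c v) \<partial>R \<partial>R) = quad R \<phi>"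
proof -
  have "(\<integral>u. \<integral>v. \<phi> (c u) (c v) \<partial>R \<partial>R) = (\<integral>u. (\<Sum>b\<in>F. \<phi> (c u) b * mass R b) \<partial>R)"
    by (subst integral_fun_c(1)[OF R]) simp
  also have "\<dots> = (\<Sum>a\<in>F. (\<Sum>b\<in>F. \<phi> a b * mass R b) * mass R a)"
    by (rule integral_fun_c(1)[OF R])
  also have "\<dots> = quad R \<phi>" unfolding quad_def
    by (intro sum.cong refl, subst sum_distrib_right) (simp add: mult_ac)
  finally show ?thesis .
qed

lemma abs_dsc: assumes "sub_prob P" "sub_prob Q" shows "\<bar>dsc P Q a b\<bar> \<le> 1"
proof -
  have "0 \<le> (\<Sum>d\<in>F. in_ball a b d * mass P d)" "(\<Sum>d\<in>F. in_ball a b d * mass P d) \<le> 1" if "sub_prob P" for P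
  proof -
    show "0 \<le> (\<Sum>d\<in>F. in_ball a b d * mass P d)"
      by (intro sum_nonneg mult_nonneg_nonneg mass_nonneg) (simp add: in_ball_def)
    have "(\<Sum>d\<in>F. in_ball a b d * mass P d) \<le> (\<Sum>d\<in>F. mass P d)"
      using mass_nonneg by (intro sum_mono) (auto simp: in_ball_def indicator_def)
    then show "(\<Sum>d\<in>F. in_ball a b d * mass P d) \<le> 1" using mass_sum[OF that] by linarith
  qed
  from this[OF assms(1)] this[OF assms(2)] show ?thesis
    unfolding dsc_def right_diff_distrib sum_subtractf by linarith
qed

text \<open>The ball mass of P or of Q differs from its discretised value by at most the ambiguous
  mass. The factor 2 comes from the difference of two squares of numbers in [-1, 1].\<close>

lemma ball_dsc:
  assumes "sub_prob P" "sub_prob Q"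
  shows "\<bar>(measure P (cball u (norm (v - u))) - measure Q (cball u (norm (v - u))))\<^sup>2 - (dsc P Q (c u) (c v))\<^sup>2\<bar>
    \<le> 2 * amb P Q (c u) (c v)"
proof -
  have one: "\<bar>measure P (cball u (norm (v - u))) - (\<Sum>d\<in>F. in_ball (c u) (c v) d * mass P d)\<bar> \<le>
    (\<Sum>d\<in>F. G (c u) (c v) d * mass P d)" if "sub_prob P" for P
  proof -
    interpret sub_prob P by fact
    have i: "integrable P (in_ball u v)"
      unfolding in_ball_def by (intro integrable_real_indicator) (auto simp: emeasure_finite less_top[symmetric])
    have "measure P (cball u (norm (v - u))) - (\<Sum>d\<in>F. in_ball (c u) (c v) d * mass P d) =
        (\<integral>x. in_ball u v x - in_ball (c u) (c v) (c x) \<partial>P)"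
      using i integral_fun_c[OF that] by (simp add: measure_ball)
    also have "\<bar>\<dots>\<bar> \<le> (\<integral>x. \<bar>in_ball u v x - in_ball (c u) (c v) (c x)\<bar> \<partial>P)" by (rule integral_abs_bound)
    also have "\<dots> \<le> (\<integral>x. G (c u) (c v) (c x) \<partial>P)"
      using i integral_fun_c(2)[OF that] G by (intro integral_mono) auto
    also have "\<dots> = (\<Sum>d\<in>F. G (c u) (c v) d * mass P d)" by (rule integral_fun_c(1)[OF that])
    finally show ?thesis .
  qed
  define x where "x = measure P (cball u (norm (v - u))) - measure Q (cball u (norm (v - u)))"
  have x1: "\<bar>x\<bar> \<le> 1"
    using sub_prob.measure_le_1[OF assms(1)] sub_prob.measure_le_1[OF assms(2)] unfolding x_def
    by (smt (verit) measure_nonneg)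
  have d: "\<bar>x - dsc P Q (c u) (c v)\<bar> \<le> amb P Q (c u) (c v)"
    using one[OF assms(1)] one[OF assms(2)] unfolding x_def dsc_def amb_def
    by (simp add: right_diff_distrib distrib_left sum_subtractf sum.distrib)
  have "\<bar>x\<^sup>2 - (dsc P Q (c u) (c v))\<^sup>2\<bar> = \<bar>x + dsc P Q (c u) (c v)\<bar> * \<bar>x - dsc P Q (c u) (c v)\<bar>"
    unfolding power2_eq_square square_diff_square_factored abs_mult ..
  also have "\<dots> \<le> 2 * amb P Q (c u) (c v)"
    using x1 abs_dsc[OF assms, of "c u" "c v"] d by (intro mult_mono) auto
  finally show ?thesis by (simp add: x_def)
qed

lemma ball_form_dsc:
  assumes R: "sub_prob R" and P: "sub_prob P" and Q: "sub_prob Q"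
  shows "\<bar>ball_form R P Q - quad R (\<lambda>a b. (dsc P Q a b)\<^sup>2)\<bar> \<le> 2 * quad R (amb P Q)"
proof -
  interpret R: sub_prob R by fact
  interpret P: sub_prob P by fact
  interpret Q: sub_prob Q by fact
  define x where "x u v = (measure P (cball u (norm (v - u))) - measure Q (cball u (norm (v - u))))\<^sup>2" for u v
  have mx: "(\<lambda>w. x (fst w) (snd w)) \<in> borel_measurable (borel \<Otimes>\<^sub>M borel)"
    unfolding x_def using P.measure_ball_measurable Q.measure_ball_measurable by simp
  have x1: "x u v \<le> 1" "0 \<le> x u v" for u v
  proof -
    have "\<bar>measure P (cball u (norm (v - u))) - measure Q (cball u (norm (v - u)))\<bar> \<le> 1"
      using P.measure_le_1[of "cball u (norm (v - u))"] Q.measure_le_1[of "cball u (norm (v - u))"]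
      by (smt (verit) measure_nonneg)
    then show "x u v \<le> 1" unfolding x_def by (simp add: abs_square_le_1)
  qed (simp add: x_def)
  have i1: "integrable R (\<lambda>v. x u v)" for u
  proof (rule R.integrable_const_bound[of _ 1])
    show "(\<lambda>v. x u v) \<in> borel_measurable R"
      using measurable_compose[OF _ mx, of "\<lambda>v. (u, v)" borel] by simp
  qed (use x1 in auto)
  have i2: "integrable R (\<lambda>u. \<integral>v. x u v \<partial>R)"
  proof (rule R.integrable_const_bound[of _ 1])
    have "(\<lambda>(u, v). x u v) \<in> borel_measurable (borel \<Otimes>\<^sub>M R)"
      using mx by (simp add: split_beta' cong: measurable_cong_sets)
    then have "(\<lambda>u. \<integral>v. x u v \<partial>R) \<in> borel_measurable borel"
      by (rule R.borel_measurable_lebesgue_integral)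
    then show "(\<lambda>u. \<integral>v. x u v \<partial>R) \<in> borel_measurable R" by simp
    show "AE u in R. norm (\<integral>v. x u v \<partial>R) \<le> 1"
    proof (rule AE_I2)
      fix u
      have "0 \<le> (\<integral>v. x u v \<partial>R)" by (rule integral_nonneg_AE) (simp add: x1)
      moreover have "(\<integral>v. x u v \<partial>R) \<le> 1" by (rule R.integral_le_bound[OF x1(1)]) simp
      ultimately show "norm (\<integral>v. x u v \<partial>R) \<le> 1" by simp
    qed
  qed
  have j1: "integrable R (\<lambda>v. \<phi> (c u) (c v))" for u and \<phi> :: "'x \<Rightarrow> 'x \<Rightarrow> real" by (rule integral_fun_c(2)[OF R])
  have j2: "integrable R (\<lambda>u. \<integral>v. \<phi> (c u) (c v) \<partial>R)" for \<phi> :: "'x \<Rightarrow> 'x \<Rightarrow> real"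
    using integral_fun_c(2)[OF R, of "\<lambda>a. \<integral>v. \<phi> a (c v) \<partial>R"] .
  have "ball_form R P Q - quad R (\<lambda>a b. (dsc P Q a b)\<^sup>2) =
      (\<integral>u. (\<integral>v. x u v - (dsc P Q (c u) (c v))\<^sup>2 \<partial>R) \<partial>R)"
    unfolding ball_form_def x_def[symmetric] integral_c_c[OF R, symmetric]
    using i1 i2 j1[where \<phi> = "\<lambda>a b. (dsc P Q a b)\<^sup>2"] j2[where \<phi> = "\<lambda>a b. (dsc P Q a b)\<^sup>2"] by simp
  also have "\<bar>\<dots>\<bar> \<le> (\<integral>u. \<bar>\<integral>v. x u v - (dsc P Q (c u) (c v))\<^sup>2 \<partial>R\<bar> \<partial>R)" by (rule integral_abs_bound)
  also have "\<dots> \<le> (\<integral>u. \<integral>v. 2 * amb P Q (c u) (c v) \<partial>R \<partial>R)"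
  proof (rule integral_mono)
    show "integrable R (\<lambda>u. \<bar>\<integral>v. x u v - (dsc P Q (c u) (c v))\<^sup>2 \<partial>R\<bar>)"
      using i1 i2 j1[where \<phi> = "\<lambda>a b. (dsc P Q a b)\<^sup>2"] j2[where \<phi> = "\<lambda>a b. (dsc P Q a b)\<^sup>2"] by simp
    show "integrable R (\<lambda>u. \<integral>v. 2 * amb P Q (c u) (c v) \<partial>R)" by (rule j2)
    fix u
    have "\<bar>\<integral>v. x u v - (dsc P Q (c u) (c v))\<^sup>2 \<partial>R\<bar> \<le> (\<integral>v. \<bar>x u v - (dsc P Q (c u) (c v))\<^sup>2\<bar> \<partial>R)"
      by (rule integral_abs_bound)
    also have "\<dots> \<le> (\<integral>v. 2 * amb P Q (c u) (c v) \<partial>R)"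
      using i1 j1[where \<phi> = "\<lambda>a b. (dsc P Q a b)\<^sup>2"] j1[where \<phi> = "\<lambda>a b. 2 * amb P Q a b"] ball_dsc[OF P Q, folded x_def]
      by (intro integral_mono) auto
    finally show "\<bar>\<integral>v. x u v - (dsc P Q (c u) (c v))\<^sup>2 \<partial>R\<bar> \<le> (\<integral>v. 2 * amb P Q (c u) (c v) \<partial>R)" .
  qed
  also have "\<dots> = 2 * quad R (amb P Q)"
    unfolding integral_c_c[OF R, of "\<lambda>a b. 2 * amb P Q a b"] quad_def sum_distrib_left
    by (intro sum.cong refl) simp
  finally show ?thesis .
qed

text \<open>The product of two masses and \<phi> is changed one factor at a time. Total masses are
  at most 1, so each change of a mass costs m times \<open>cell_dist\<close>, and the change of
  \<phi> costs \<eta>.\<close>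

lemma quad_lipschitz:
  assumes R: "sub_prob R" "sub_prob R'" and \<phi>: "\<And>a b. \<bar>\<phi>' a b\<bar> \<le> m" "\<And>a b. \<bar>\<phi>' a b - \<phi> a b\<bar> \<le> \<eta>"
  shows "\<bar>quad R' \<phi>' - quad R \<phi>\<bar> \<le> 2 * m * cell_dist R R' + \<eta>"
proof -
  let ?r = "mass R" and ?s = "mass R'"
  have m0: "0 \<le> m" using \<phi>(1)[of undefined undefined] by linarith
  have \<eta>0: "0 \<le> \<eta>" using \<phi>(2)[of undefined undefined] by linarith
  have eq: "quad R' \<phi>' - quad R \<phi> = (\<Sum>a\<in>F. \<Sum>b\<in>F. (?s a - ?r a) * ?s b * \<phi>' a b + ?r a * (?s b - ?r b) * \<phi>' a b
      + ?r a * ?r b * (\<phi>' a b - \<phi> a b))"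
    unfolding quad_def sum_subtractf[symmetric] by (intro sum.cong refl) (simp add: algebra_simps)
  have "\<bar>quad R' \<phi>' - quad R \<phi>\<bar> \<le> (\<Sum>a\<in>F. \<Sum>b\<in>F. \<bar>?r a - ?s a\<bar> * ?s b * m + ?r a * \<bar>?r b - ?s b\<bar> * m + ?r a * ?r b * \<eta>)"
  unfolding eq
  proof (intro order_trans[OF sum_abs] sum_mono)
    fix a b
    have h: "\<bar>x * y * z\<bar> \<le> \<bar>x\<bar> * \<bar>y\<bar> * k" if "\<bar>z\<bar> \<le> k" for x y z k :: real
      unfolding abs_mult by (rule mult_left_mono[OF that]) simp
    have "\<bar>(?s a - ?r a) * ?s b * \<phi>' a b\<bar> \<le> \<bar>?r a - ?s a\<bar> * ?s b * m"
      using h[OF \<phi>(1)[of a b], of "?s a - ?r a" "?s b"] mass_nonneg[of R' b] by (simp add: abs_minus_commute)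
    moreover have "\<bar>?r a * (?s b - ?r b) * \<phi>' a b\<bar> \<le> ?r a * \<bar>?r b - ?s b\<bar> * m"
      using h[OF \<phi>(1)[of a b], of "?r a" "?s b - ?r b"] mass_nonneg[of R a] by (simp add: abs_minus_commute)
    moreover have "\<bar>?r a * ?r b * (\<phi>' a b - \<phi> a b)\<bar> \<le> ?r a * ?r b * \<eta>"
      using h[OF \<phi>(2)[of a b], of "?r a" "?r b"] mass_nonneg[of R a] mass_nonneg[of R b] by simp
    ultimately show "\<bar>(?s a - ?r a) * ?s b * \<phi>' a b + ?r a * (?s b - ?r b) * \<phi>' a b + ?r a * ?r b * (\<phi>' a b - \<phi> a b)\<bar>
      \<le> \<bar>?r a - ?s a\<bar> * ?s b * m + ?r a * \<bar>?r b - ?s b\<bar> * m + ?r a * ?r b * \<eta>" by linarith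
  qed
  also have "\<dots> = cell_dist R R' * (\<Sum>b\<in>F. ?s b) * m + (\<Sum>a\<in>F. ?r a) * cell_dist R R' * m
      + (\<Sum>a\<in>F. ?r a) * (\<Sum>b\<in>F. ?r b) * \<eta>"
  proof -
    have "(\<Sum>a\<in>F. \<Sum>b\<in>F. f a * g b * k) = sum f F * sum g F * k" for f g :: "'x \<Rightarrow> real" and k
      unfolding sum_product by (simp only: sum_distrib_right)
    then show ?thesis unfolding cell_dist_def sum.distrib by simp
  qed
  also have "\<dots> \<le> cell_dist R R' * 1 * m + 1 * cell_dist R R' * m + 1 * 1 * \<eta>"
  proof -
    have c0: "0 \<le> cell_dist R R'" unfolding cell_dist_def by (rule sum_nonneg) simp
    have s0: "0 \<le> sum ?s F" "0 \<le> sum ?r F" by (auto intro: sum_nonneg mass_nonneg)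
    have "cell_dist R R' * sum ?s F * m \<le> cell_dist R R' * 1 * m"
      by (intro mult_right_mono mult_left_mono mass_sum[OF R(2)] c0 m0)
    moreover have "sum ?r F * cell_dist R R' * m \<le> 1 * cell_dist R R' * m"
      by (intro mult_right_mono mass_sum[OF R(1)] c0 m0)
    moreover have "sum ?r F * sum ?r F * \<eta> \<le> 1 * 1 * \<eta>"
      by (intro mult_right_mono mult_mono mass_sum[OF R(1)] s0 \<eta>0) simp_all
    ultimately show ?thesis by linarith
  qed
  finally show ?thesis by (simp add: algebra_simps)
qed

text \<open>Later P', Q', R' are random estimates, so only the ambiguity of the fixed P, Q, R may
  remain; that of the primed measures is compared with it by \<open>quad_lipschitz\<close>. Two
  discretisation errors and one comparison of the discrete forms give the constants 4 = 2 + 2, 10 =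
  2 + 8 and 4 = 2 + 2.\<close>

lemma ball_form_close:
  assumes R: "sub_prob R" "sub_prob R'" and P: "sub_prob P" "sub_prob P'" and Q: "sub_prob Q" "sub_prob Q'"
  shows "\<bar>ball_form R' P' Q' - ball_form R P Q\<bar> \<le>
    4 * quad R (amb P Q) + 10 * cell_dist R R' + 4 * (cell_dist P P' + cell_dist Q Q')"
proof -
  let ?\<delta> = "cell_dist P P' + cell_dist Q Q'"
  have dd: "\<bar>dsc P' Q' a b - dsc P Q a b\<bar> \<le> ?\<delta>" for a b
  proof -
    have "\<bar>dsc P' Q' a b - dsc P Q a b\<bar> = \<bar>\<Sum>d\<in>F. in_ball a b d * ((mass P' d - mass P d) - (mass Q' d - mass Q d))\<bar>"
      unfolding dsc_def sum_subtractf[symmetric] by (simp add: algebra_simps)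
    also have "\<dots> \<le> (\<Sum>d\<in>F. \<bar>mass P d - mass P' d\<bar> + \<bar>mass Q d - mass Q' d\<bar>)"
      by (intro order_trans[OF sum_abs] sum_mono) (auto simp: in_ball_def indicator_def)
    finally show ?thesis by (simp add: cell_dist_def sum.distrib)
  qed
  have sq: "\<bar>(dsc P' Q' a b)\<^sup>2 - (dsc P Q a b)\<^sup>2\<bar> \<le> 2 * ?\<delta>" for a b
  proof -
    have "\<bar>(dsc P' Q' a b)\<^sup>2 - (dsc P Q a b)\<^sup>2\<bar> = \<bar>dsc P' Q' a b + dsc P Q a b\<bar> * \<bar>dsc P' Q' a b - dsc P Q a b\<bar>"
      unfolding power2_eq_square square_diff_square_factored abs_mult ..
    also have "\<dots> \<le> 2 * ?\<delta>"
      using abs_dsc[OF P(1) Q(1), of a b] abs_dsc[OF P(2) Q(2), of a b] dd[of a b] by (intro mult_mono) auto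
    finally show ?thesis .
  qed
  have q1: "\<bar>quad R' (\<lambda>a b. (dsc P' Q' a b)\<^sup>2) - quad R (\<lambda>a b. (dsc P Q a b)\<^sup>2)\<bar> \<le> 2 * 1 * cell_dist R R' + 2 * ?\<delta>"
    using abs_dsc[OF P(2) Q(2)] sq by (intro quad_lipschitz R) (auto simp: abs_square_le_1)
  have da: "\<bar>amb P' Q' a b - amb P Q a b\<bar> \<le> ?\<delta>" for a b
  proof -
    have "\<bar>amb P' Q' a b - amb P Q a b\<bar> = \<bar>\<Sum>d\<in>F. G a b d * ((mass P' d - mass P d) + (mass Q' d - mass Q d))\<bar>"
      unfolding amb_def sum_subtractf[symmetric] by (simp add: algebra_simps)
    also have "\<dots> \<le> (\<Sum>d\<in>F. 1 * (\<bar>mass P d - mass P' d\<bar> + \<bar>mass Q d - mass Q' d\<bar>))"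
    proof (intro order_trans[OF sum_abs] sum_mono)
      fix d
      have "\<bar>(mass P' d - mass P d) + (mass Q' d - mass Q d)\<bar> \<le> \<bar>mass P d - mass P' d\<bar> + \<bar>mass Q d - mass Q' d\<bar>"
        by linarith
      then show "\<bar>G a b d * ((mass P' d - mass P d) + (mass Q' d - mass Q d))\<bar> \<le>
          1 * (\<bar>mass P d - mass P' d\<bar> + \<bar>mass Q d - mass Q' d\<bar>)"
        unfolding abs_mult using G0[of a b d] G1[of a b d] by (intro mult_mono) auto
    qed
    finally show ?thesis by (simp add: cell_dist_def sum.distrib)
  qed
  have a2: "\<bar>amb P' Q' a b\<bar> \<le> 2" for a b
  proof -
    have "\<bar>amb P' Q' a b\<bar> \<le> (\<Sum>d\<in>F. 1 * (mass P' d + mass Q' d))"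
      unfolding amb_def
    proof (intro order_trans[OF sum_abs] sum_mono)
      fix d
      show "\<bar>G a b d * (mass P' d + mass Q' d)\<bar> \<le> 1 * (mass P' d + mass Q' d)"
        unfolding abs_mult using G0[of a b d] G1[of a b d] mass_nonneg[of P' d] mass_nonneg[of Q' d]
        by (intro mult_mono) auto
    qed
    also have "\<dots> \<le> 2" using mass_sum[OF P(2)] mass_sum[OF Q(2)] by (simp add: sum.distrib)
    finally show ?thesis .
  qed
  have q2: "\<bar>quad R' (amb P' Q') - quad R (amb P Q)\<bar> \<le> 2 * 2 * cell_dist R R' + ?\<delta>"
    by (intro quad_lipschitz R a2 da)
  show ?thesis
  proof -
    have "\<bar>x' - x\<bar> \<le> 4 * e + 10 * r + 4 * d"
      if "\<bar>x - y\<bar> \<le> 2 * e" "\<bar>x' - y'\<bar> \<le> 2 * e'" "\<bar>y' - y\<bar> \<le> 2 * 1 * r + 2 * d" "\<bar>e' - e\<bar> \<le> 2 * 2 * r + d"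
      for x y x' y' e e' r d :: real using that by argo
    from this[OF ball_form_dsc[OF R(1) P(1) Q(1)] ball_form_dsc[OF R(2) P(2) Q(2)] q1 q2] show ?thesis .
  qed
qed

text \<open>\<open>ball_form_close\<close> with R = P and with R = Q; each cell distance is counted
  10 + 4 + 4 = 18 times.\<close>

lemma ball_divergence_close:
  assumes P: "sub_prob P" "sub_prob P'" and Q: "sub_prob Q" "sub_prob Q'"
  shows "\<bar>ball_divergence_sq P' Q' - ball_divergence_sq P Q\<bar> \<le>
    4 * (quad P (amb P Q) + quad Q (amb P Q)) + 18 * (cell_dist P P' + cell_dist Q Q')"
proof -
  have eq: "ball_divergence_sq P Q = ball_form P P Q + ball_form Q P Q" for P Q
    by (simp add: ball_divergence_sq_def Let_def ball_form_def)
  show ?thesis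
  proof -
    have "\<bar>(a' + b') - (a + b)\<bar> \<le> 4 * (x + y) + 18 * (p + q)"
      if "\<bar>a' - a\<bar> \<le> 4 * x + 10 * p + 4 * (p + q)" "\<bar>b' - b\<bar> \<le> 4 * y + 10 * q + 4 * (p + q)"
      for a b a' b' x y p q :: real using that by argo
    from this[OF ball_form_close[OF P P Q] ball_form_close[OF Q P Q]] show ?thesis unfolding eq .
  qed
qed

end

section \<open>Finite grids and the cells cut by a sphere\<close>

definition grid1 :: "nat \<Rightarrow> real \<Rightarrow> real" where
  "grid1 N t = max (- real N) (min (real N) (of_int \<lfloor>real N * t\<rfloor> / real N))"

text \<open>A single parameter sets both the mesh 1 / N and the cut-off N of each coordinate: the
  range is finite for positive N, and each fixed point is resolved once N is large. Below,
  \<open>Suc N\<close> keeps the parameter positive.\<close>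

definition grid :: "nat \<Rightarrow> 'x::euclidean_space \<Rightarrow> 'x" where
  "grid N x = (\<Sum>b\<in>Basis. grid1 N (x \<bullet> b) *\<^sub>R b)"

lemma grid_measurable[measurable]: "grid N \<in> borel_measurable borel"
  unfolding grid_def[abs_def] grid1_def[abs_def] by measurable

lemma finite_range_grid1: assumes "0 < N" shows "finite (range (grid1 N))"
proof (rule finite_subset)
  let ?V = "insert (- real N) (insert (real N) ((\<lambda>k. of_int k / real N) ` {- ((int N)\<^sup>2) .. (int N)\<^sup>2}))"
  show "finite ?V" by simp
  show "range (grid1 N) \<subseteq> ?V"
  proof
    fix g assume "g \<in> range (grid1 N)"
    then obtain t where g: "g = grid1 N t" by auto
    let ?k = "\<lfloor>real N * t\<rfloor>"
    have "g = - real N \<or> g = real N \<or> (g = of_int ?k / real N \<and> - real N \<le> of_int ?k / real N \<and> of_int ?k / real N \<le> real N)"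
      unfolding g grid1_def by linarith
    moreover have "?k \<in> {- ((int N)\<^sup>2) .. (int N)\<^sup>2}"
      if k: "- real N \<le> of_int ?k / real N" "of_int ?k / real N \<le> real N"
    proof -
      have "- (real N)\<^sup>2 \<le> of_int ?k" "of_int ?k \<le> (real N)\<^sup>2"
        using k assms by (auto simp: field_simps power2_eq_square)
      then have "real_of_int (- (int N)\<^sup>2) \<le> of_int ?k" "of_int ?k \<le> real_of_int ((int N)\<^sup>2)" by simp_all
      then show ?thesis by (simp only: of_int_le_iff atLeastAtMost_iff)
    qed
    ultimately show "g \<in> ?V" by blast
  qed
qed

lemma finite_range_grid: assumes "0 < N" shows "finite (range (grid N :: 'x::euclidean_space \<Rightarrow> 'x))"
proof (rule finite_subset)
  let ?P = "Basis \<rightarrow>\<^sub>E range (grid1 N) :: ('x \<Rightarrow> real) set"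
  show "finite ((\<lambda>f. \<Sum>b\<in>Basis. f b *\<^sub>R b :: 'x) ` ?P)"
    by (intro finite_imageI finite_PiE finite_range_grid1 assms) auto
  show "range (grid N) \<subseteq> (\<lambda>f. \<Sum>b\<in>Basis. f b *\<^sub>R b :: 'x) ` ?P"
  proof
    fix y :: 'x assume "y \<in> range (grid N)"
    then obtain x where y: "y = grid N x" by auto
    show "y \<in> (\<lambda>f. \<Sum>b\<in>Basis. f b *\<^sub>R b :: 'x) ` ?P"
      by (rule image_eqI[of _ _ "\<lambda>b\<in>Basis. grid1 N (x \<bullet> b)"]) (auto simp: y grid_def)
  qed
qed

lemma grid1_close:
  assumes N: "0 < N" and t: "\<bar>t\<bar> \<le> real N - 1"
  shows "\<bar>grid1 N t - t\<bar> \<le> 1 / real N" and "grid1 N s = grid1 N t \<Longrightarrow> \<bar>s - t\<bar> \<le> 1 / real N"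
proof -
  have fl: "of_int \<lfloor>real N * x\<rfloor> / real N \<le> x" "x - 1 / real N < of_int \<lfloor>real N * x\<rfloor> / real N" for x
  proof -
    have *: "of_int \<lfloor>real N * x\<rfloor> \<le> x * real N" "x * real N - 1 < of_int \<lfloor>real N * x\<rfloor>"
      unfolding mult.commute[of x] by linarith+
    have N': "0 < real N" using N by simp
    show "of_int \<lfloor>real N * x\<rfloor> / real N \<le> x"
      unfolding pos_divide_le_eq[OF N'] by (rule *(1))
    show "x - 1 / real N < of_int \<lfloor>real N * x\<rfloor> / real N"
      unfolding pos_less_divide_eq[OF N'] using *(2) N' by (simp add: left_diff_distrib)
  qed
  \<comment> \<open>The margin of 1 in the bound on |t| keeps the rounded value strictly inside the
    cut-off. A point s with the same grid value is therefore not clamped either, and its floor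
    agrees with that of t.\<close>
  have "1 / real N \<le> 1" using N by simp
  then have g: "grid1 N t = of_int \<lfloor>real N * t\<rfloor> / real N" "- real N < grid1 N t" "grid1 N t < real N"
    using fl[of t] t unfolding grid1_def by linarith+
  show "\<bar>grid1 N t - t\<bar> \<le> 1 / real N" using fl[of t] g(1) by linarith
  assume "grid1 N s = grid1 N t"
  then have "of_int \<lfloor>real N * s\<rfloor> / real N = of_int \<lfloor>real N * t\<rfloor> / real N"
    using g unfolding grid1_def by linarith
  then show "\<bar>s - t\<bar> \<le> 1 / real N" using fl[of s] fl[of t] by linarith
qed

lemma grid_inner: "b \<in> Basis \<Longrightarrow> grid N x \<bullet> b = grid1 N (x \<bullet> b)"
  by (simp add: grid_def)

lemma grid_close:
  fixes x :: "'x::euclidean_space"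
  assumes e: "0 < e"
  shows "\<forall>\<^sub>F N in sequentially. norm (grid (Suc N) x - x) \<le> e \<and>
    (\<forall>y. grid (Suc N) y = grid (Suc N) x \<longrightarrow> norm (y - x) \<le> e)"
proof -
  have "\<forall>\<^sub>F N in sequentially. real DIM('x) / e < real N"
    using filterlim_real_sequentially unfolding filterlim_at_top_dense by auto
  moreover have "\<forall>\<^sub>F N in sequentially. norm x < real N"
    using filterlim_real_sequentially unfolding filterlim_at_top_dense by auto
  ultimately show ?thesis
  proof eventually_elim
    case (elim N)
    have t: "\<bar>x \<bullet> b\<bar> \<le> real (Suc N) - 1" if "b \<in> Basis" for b
      using Basis_le_norm[OF that, of x] elim(2) by simp
    have le: "real DIM('x) * (1 / real (Suc N)) \<le> e"
    proof -
      have "real DIM('x) < e * real N" using elim(1) e by (simp add: field_simps)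
      also have "\<dots> \<le> e * real (Suc N)" using e by simp
      finally show ?thesis by (simp add: field_simps)
    qed
    have "norm (y - x) \<le> e" if "\<And>b. b \<in> Basis \<Longrightarrow> \<bar>y \<bullet> b - x \<bullet> b\<bar> \<le> 1 / real (Suc N)" for y
    proof -
      have "norm (y - x) \<le> (\<Sum>b\<in>Basis. \<bar>(y - x) \<bullet> b\<bar>)" by (rule norm_le_l1)
      also have "\<dots> \<le> (\<Sum>b\<in>(Basis :: 'x set). 1 / real (Suc N))"
        using that by (intro sum_mono) (simp add: inner_diff_left)
      also have "\<dots> \<le> e" using le by simp
      finally show ?thesis .
    qed
    then show ?case
      using grid1_close[OF _ t] grid_inner[of _ "Suc N"] by (metis zero_less_Suc)
  qed
qed

definition ambiguous :: "nat \<Rightarrow> 'x::euclidean_space \<Rightarrow> 'x \<Rightarrow> 'x \<Rightarrow> real" where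
  "ambiguous N a b d = of_bool (\<exists>u v x. grid (Suc N) u = a \<and> grid (Suc N) v = b \<and> grid (Suc N) x = d \<and>
     in_ball u v x \<noteq> in_ball a b d)"

lemma cells_grid: "cells (grid (Suc N)) (range (grid (Suc N))) (ambiguous N)"
proof
  fix u v x :: 'a
  show "\<bar>in_ball u v x - in_ball (grid (Suc N) u) (grid (Suc N) v) (grid (Suc N) x)\<bar>
    \<le> ambiguous N (grid (Suc N) u) (grid (Suc N) v) (grid (Suc N) x)"
  proof (cases "in_ball u v x = in_ball (grid (Suc N) u) (grid (Suc N) v) (grid (Suc N) x)")
    case True then show ?thesis by (simp add: ambiguous_def)
  next
    case False
    then have "ambiguous N (grid (Suc N) u) (grid (Suc N) v) (grid (Suc N) x) = 1"
      unfolding ambiguous_def by auto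
    then show ?thesis by (auto simp: in_ball_def indicator_def)
  qed
qed (auto simp: ambiguous_def finite_range_grid)

text \<open>Off the sphere, the distances of x and of v to u differ by a positive gap. Moving each
  of the three points by at most gap / 8 changes either distance by at most gap / 4, which cannot
  reverse their order. On a fine grid this covers the representatives and all points of the three
  cells.\<close>

lemma ambiguous_eventually_0:
  fixes u v x :: "'x::euclidean_space"
  assumes x: "x \<notin> sphere u (norm (v - u))"
  shows "\<forall>\<^sub>F N in sequentially. ambiguous N (grid (Suc N) u) (grid (Suc N) v) (grid (Suc N) x) = 0"
proof -
  define gap where "gap = \<bar>norm (x - u) - norm (v - u)\<bar>"
  have g0: "0 < gap" using x by (auto simp: gap_def dist_norm norm_minus_commute)
  then have e: "0 < gap / 8" by simp
  have key: "in_ball u' v' x' = in_ball u v x"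
    if n: "norm (u' - u) \<le> gap / 8" "norm (v' - v) \<le> gap / 8" "norm (x' - x) \<le> gap / 8" for u' v' x'
  proof -
    have "\<bar>norm (x' - u') - norm (x - u)\<bar> \<le> norm ((x' - u') - (x - u))" by (rule norm_triangle_ineq3)
    also have "(x' - u') - (x - u) = (x' - x) - (u' - u)" by simp
    also have "norm \<dots> \<le> gap / 4" using n norm_triangle_ineq4[of "x' - x" "u' - u"] by linarith
    finally have 1: "\<bar>norm (x' - u') - norm (x - u)\<bar> \<le> gap / 4" .
    have "\<bar>norm (v' - u') - norm (v - u)\<bar> \<le> norm ((v' - u') - (v - u))" by (rule norm_triangle_ineq3)
    also have "(v' - u') - (v - u) = (v' - v) - (u' - u)" by simp
    also have "norm \<dots> \<le> gap / 4" using n norm_triangle_ineq4[of "v' - v" "u' - u"] by linarith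
    finally have 2: "\<bar>norm (v' - u') - norm (v - u)\<bar> \<le> gap / 4" .
    have "norm (x' - u') \<le> norm (v' - u') \<longleftrightarrow> norm (x - u) \<le> norm (v - u)"
      using 1 2 g0 unfolding gap_def by (simp add: abs_if split: if_splits)
    then show ?thesis by (simp add: in_ball_def indicator_def dist_norm norm_minus_commute)
  qed
  show ?thesis using grid_close[OF e, of u] grid_close[OF e, of v] grid_close[OF e, of x]
  proof eventually_elim
    case (elim N)
    have "in_ball u' v' x' = in_ball (grid (Suc N) u) (grid (Suc N) v) (grid (Suc N) x)"
      if "grid (Suc N) u' = grid (Suc N) u" "grid (Suc N) v' = grid (Suc N) v" "grid (Suc N) x' = grid (Suc N) x" for u' v' x'
      using that key[of u' v' x'] key[of "grid (Suc N) u" "grid (Suc N) v" "grid (Suc N) x"] elim by auto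
    then show ?case unfolding ambiguous_def by auto
  qed
qed

definition amb_grid :: "nat \<Rightarrow> 'x::euclidean_space measure \<Rightarrow> 'x measure \<Rightarrow> 'x measure \<Rightarrow> real" where
  "amb_grid N R P Q = cells.quad (grid (Suc N)) (range (grid (Suc N))) R
     (cells.amb (grid (Suc N)) (range (grid (Suc N))) (ambiguous N) P Q)"

text \<open>For fixed u and v, only points of the sphere about u through v can stay ambiguous on all
  fine grids, and P and Q do not charge it. The constant 2 bounds the masses of P and Q together and
  dominates the integrals over v and then over u.\<close>

lemma amb_grid_tendsto:
  fixes P Q R :: "'x::euclidean_space measure"
  assumes R: "sub_prob R" and P: "sub_prob P" and Q: "sub_prob Q"
    and null: "\<And>u \<rho>. emeasure P (sphere u \<rho>) = 0" "\<And>u \<rho>. emeasure Q (sphere u \<rho>) = 0"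
  shows "(\<lambda>N. amb_grid N R P Q) \<longlonglongrightarrow> 0"
proof -
  interpret R: sub_prob R by fact
  interpret C: cells "grid (Suc N)" "range (grid (Suc N))" "ambiguous N" for N
    by (rule cells_grid)
  define am where "am N u v = cells.amb (grid (Suc N)) (range (grid (Suc N))) (ambiguous N) P Q (grid (Suc N) u) (grid (Suc N) v)" for N u v
  have one: "(\<lambda>N. \<Sum>d\<in>range (grid (Suc N)). ambiguous N (grid (Suc N) u) (grid (Suc N) v) d * cells.mass (grid (Suc N)) P d) \<longlonglongrightarrow> 0"
    if P: "sub_prob P" and null: "\<And>u \<rho>. emeasure P (sphere u \<rho>) = 0" for P :: "'x measure" and u v
  proof -
    interpret P: sub_prob P by fact
    have "(\<lambda>N. \<integral>x. ambiguous N (grid (Suc N) u) (grid (Suc N) v) (grid (Suc N) x) \<partial>P) \<longlonglongrightarrow> (\<integral>x. 0 \<partial>P)"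
    proof (rule integral_dominated_convergence[where w = "\<lambda>_. 1"])
      show "AE x in P. (\<lambda>N. ambiguous N (grid (Suc N) u) (grid (Suc N) v) (grid (Suc N) x)) \<longlonglongrightarrow> 0"
      proof (rule AE_I')
        show "sphere u (norm (v - u)) \<in> null_sets P" using null by (auto simp: null_sets_def)
        show "{x \<in> space P. \<not> (\<lambda>N. ambiguous N (grid (Suc N) u) (grid (Suc N) v) (grid (Suc N) x)) \<longlonglongrightarrow> 0} \<subseteq> sphere u (norm (v - u))"
          using ambiguous_eventually_0[of _ u v] by (auto intro: tendsto_eventually)
      qed
      show "(\<lambda>x. ambiguous N (grid (Suc N) u) (grid (Suc N) v) (grid (Suc N) x)) \<in> borel_measurable P" for N
        using C.fun_c_measurable[where f = "ambiguous N (grid (Suc N) u) (grid (Suc N) v)"] by (simp cong: measurable_cong_sets)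
    qed (auto simp: ambiguous_def)
    then show ?thesis using C.integral_fun_c(1)[OF P] by simp
  qed
  have am0: "(\<lambda>N. am N u v) \<longlonglongrightarrow> 0" for u v
    using tendsto_add[OF one[OF P null(1)] one[OF Q null(2)], of u v u v]
    unfolding am_def C.amb_def by (simp add: distrib_left sum.distrib)
  have am2: "\<bar>am N u v\<bar> \<le> 2" for N u v
  proof -
    have "0 \<le> am N u v" unfolding am_def C.amb_def
      by (intro sum_nonneg mult_nonneg_nonneg add_nonneg_nonneg C.G0 C.mass_nonneg)
    moreover have "am N u v \<le> (\<Sum>d\<in>range (grid (Suc N)). 1 * (cells.mass (grid (Suc N)) P d + cells.mass (grid (Suc N)) Q d))"
      unfolding am_def C.amb_def
      by (intro sum_mono mult_right_mono add_nonneg_nonneg C.G1 C.mass_nonneg)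
    moreover have "\<dots> \<le> 2" using C.mass_sum[OF P, of N] C.mass_sum[OF Q, of N] by (simp add: sum.distrib)
    ultimately show ?thesis by linarith
  qed
  have eq: "amb_grid N R P Q = (\<integral>u. \<integral>v. am N u v \<partial>R \<partial>R)" for N
    unfolding amb_grid_def am_def C.integral_c_c[OF R] ..
  have inner: "(\<lambda>N. \<integral>v. am N u v \<partial>R) \<longlonglongrightarrow> (\<integral>v. 0 \<partial>R)" for u
    by (rule integral_dominated_convergence[where w = "\<lambda>_. 2"])
      (use am0 am2 C.fun_c_measurable in \<open>auto simp: am_def cong: measurable_cong_sets\<close>)
  have "(\<lambda>N. \<integral>u. \<integral>v. am N u v \<partial>R \<partial>R) \<longlonglongrightarrow> (\<integral>u. 0 \<partial>R)"
  proof (rule integral_dominated_convergence[where w = "\<lambda>_. 2"])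
    show "(\<lambda>u. \<integral>v. am N u v \<partial>R) \<in> borel_measurable R" for N
      unfolding am_def using C.fun_c_measurable[where f = "\<lambda>a. \<integral>v. cells.amb (grid (Suc N)) (range (grid (Suc N))) (ambiguous N) P Q a (grid (Suc N) v) \<partial>R"]
      by (simp cong: measurable_cong_sets)
    show "AE u in R. (\<lambda>N. \<integral>v. am N u v \<partial>R) \<longlonglongrightarrow> 0" using inner by simp
    show "AE u in R. norm (\<integral>v. am N u v \<partial>R) \<le> 2" for N
    proof (rule AE_I2)
      fix u
      have "norm (\<integral>v. am N u v \<partial>R) \<le> (\<integral>v. \<bar>am N u v\<bar> \<partial>R)" by simp
      also have "\<dots> \<le> 2" by (rule R.integral_le_bound[OF am2]) simp
      finally show "norm (\<integral>v. am N u v \<partial>R) \<le> 2" .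
    qed
  qed auto
  then show ?thesis unfolding eq by simp
qed

section \<open>Convergence of the test statistic\<close>

lemma sub_prob_weighted_empirical:
  assumes w: "\<And>i. i < n \<Longrightarrow> 0 \<le> w i"
  shows "sub_prob (weighted_empirical n w xs)"
proof
  let ?s = "\<Sum>k<n. w k"
  show "sets (weighted_empirical n w xs) = sets borel" by (simp add: weighted_empirical_def)
  have s: "0 \<le> ?s" using w by (auto intro: sum_nonneg)
  have "emeasure (weighted_empirical n w xs) UNIV = emeasure (point_measure {..<n} (\<lambda>i. ennreal (w i / ?s))) {..<n}"
    unfolding weighted_empirical_def
    by (subst emeasure_distr) (auto simp: space_point_measure measurable_point_measure_eq1)
  also have "\<dots> = (\<Sum>i<n. ennreal (w i / ?s))" by (rule emeasure_point_measure_finite2) auto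
  also have "\<dots> = ennreal (\<Sum>i<n. w i / ?s)" using w s by (intro sum_ennreal) auto
  also have "\<dots> \<le> ennreal 1"
    using s by (intro ennreal_leI) (simp add: sum_divide_distrib[symmetric] divide_le_eq_1)
  finally show "emeasure (weighted_empirical n w xs) UNIV \<le> 1" by simp
qed

lemma integral_weighted_empirical:
  fixes f :: "'x::euclidean_space \<Rightarrow> real"
  assumes w: "\<And>i. i < n \<Longrightarrow> 0 \<le> w i" and f: "f \<in> borel_measurable borel"
  shows "(\<integral>x. f x \<partial>(weighted_empirical n w xs)) = (\<Sum>i<n. w i / (\<Sum>k<n. w k) * f (xs i))"
proof -
  have s: "0 \<le> (\<Sum>k<n. w k)" using w by (auto intro: sum_nonneg)
  have "(\<integral>x. f x \<partial>(weighted_empirical n w xs)) =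
      (\<integral>i. f (xs i) \<partial>(point_measure {..<n} (\<lambda>i. ennreal (w i / (\<Sum>k<n. w k)))))"
    unfolding weighted_empirical_def using f
    by (subst integral_distr) (auto simp: measurable_point_measure_eq1)
  also have "\<dots> = (\<Sum>i<n. (w i / (\<Sum>k<n. w k)) *\<^sub>R f (xs i))"
    using w s by (intro lebesgue_integral_point_measure_finite) auto
  finally show ?thesis by simp
qed

lemma ball_difference_measurable:
  fixes P Q R :: "'x::euclidean_space measure"
  assumes "sub_prob P" "sub_prob Q" and R: "sub_prob R"
  shows "(\<lambda>v. (measure P (cball u (norm (v - u))) - measure Q (cball u (norm (v - u))))\<^sup>2) \<in> borel_measurable borel"
    and "(\<lambda>u. \<integral>v. (measure P (cball u (norm (v - u))) - measure Q (cball u (norm (v - u))))\<^sup>2 \<partial>R) \<in> borel_measurable borel"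
proof -
  interpret R: sub_prob R by fact
  have m: "(\<lambda>w. (measure P (cball (fst w) (norm (snd w - fst w))) - measure Q (cball (fst w) (norm (snd w - fst w))))\<^sup>2)
      \<in> borel_measurable (borel \<Otimes>\<^sub>M borel)"
    using sub_prob.measure_ball_measurable[OF assms(1)] sub_prob.measure_ball_measurable[OF assms(2)] by simp
  show "(\<lambda>v. (measure P (cball u (norm (v - u))) - measure Q (cball u (norm (v - u))))\<^sup>2) \<in> borel_measurable borel"
    using measurable_compose[OF _ m, of "\<lambda>v. (u, v)" borel] by simp
  have "(\<lambda>(u, v). (measure P (cball u (norm (v - u))) - measure Q (cball u (norm (v - u))))\<^sup>2)
      \<in> borel_measurable (borel \<Otimes>\<^sub>M R)"
    using m by (simp add: split_beta' cong: measurable_cong_sets)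
  then show "(\<lambda>u. \<integral>v. (measure P (cball u (norm (v - u))) - measure Q (cball u (norm (v - u))))\<^sup>2 \<partial>R) \<in> borel_measurable borel"
    by (rule R.borel_measurable_lebesgue_integral)
qed

lemma ball_divergence_bounds:
  assumes P: "sub_prob P" and Q: "sub_prob Q"
  shows "0 \<le> ball_divergence_sq P Q" "ball_divergence_sq P Q \<le> 2"
proof -
  have x1: "(measure P A - measure Q A)\<^sup>2 \<le> 1" for A
  proof -
    have "\<bar>measure P A - measure Q A\<bar> \<le> 1"
      using sub_prob.measure_le_1[OF P, of A] sub_prob.measure_le_1[OF Q, of A]
        measure_nonneg[of P A] measure_nonneg[of Q A] by linarith
    then show ?thesis by (simp add: abs_square_le_1)
  qed
  have "0 \<le> (\<integral>u. \<integral>v. (measure P (cball u (norm (v - u))) - measure Q (cball u (norm (v - u))))\<^sup>2 \<partial>R \<partial>R)" for R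
    by (intro integral_nonneg_AE AE_I2) auto
  then show "0 \<le> ball_divergence_sq P Q" unfolding ball_divergence_sq_def Let_def by (intro add_nonneg_nonneg)
  have "(\<integral>u. \<integral>v. (measure P (cball u (norm (v - u))) - measure Q (cball u (norm (v - u))))\<^sup>2 \<partial>R \<partial>R) \<le> 1"
    if R: "sub_prob R" for R
    by (intro sub_prob.integral_le_bound[OF R] x1) simp_all
  from this[OF P] this[OF Q] show "ball_divergence_sq P Q \<le> 2"
    unfolding ball_divergence_sq_def Let_def by linarith
qed

definition empirical_mass :: "nat \<Rightarrow> (nat \<Rightarrow> real) \<Rightarrow> (nat \<Rightarrow> 'x::euclidean_space) \<Rightarrow> nat \<Rightarrow> nat \<Rightarrow> real" where
  "empirical_mass n w xs i j = (\<Sum>k<n. w k * in_ball (xs i) (xs j) (xs k)) / (\<Sum>k<n. w k)"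

text \<open>The measures are random, so measurability of the statistic in the data is read off from
  this explicit double sum; it also shows that only the first n observations enter.\<close>

lemma ball_divergence_weighted_empirical:
  fixes xs :: "nat \<Rightarrow> 'x::euclidean_space"
  assumes w: "\<And>i. i < n \<Longrightarrow> 0 \<le> w i" and w': "\<And>i. i < n \<Longrightarrow> 0 \<le> w' i"
  shows "ball_divergence_sq (weighted_empirical n w xs) (weighted_empirical n w' xs) =
    (\<Sum>i<n. w i / (\<Sum>k<n. w k) * (\<Sum>j<n. w j / (\<Sum>k<n. w k) * (empirical_mass n w xs i j - empirical_mass n w' xs i j)\<^sup>2)) +
    (\<Sum>i<n. w' i / (\<Sum>k<n. w' k) * (\<Sum>j<n. w' j / (\<Sum>k<n. w' k) * (empirical_mass n w xs i j - empirical_mass n w' xs i j)\<^sup>2))"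
proof -
  let ?P = "weighted_empirical n w xs" and ?Q = "weighted_empirical n w' xs"
  have P: "sub_prob ?P" and Q: "sub_prob ?Q" using w w' by (auto intro: sub_prob_weighted_empirical)
  have em: "measure (weighted_empirical n v xs) (cball (xs i) (norm (xs j - xs i))) = empirical_mass n v xs i j"
    if "\<And>i. i < n \<Longrightarrow> 0 \<le> v i" for v i j
    using that by (subst measure_weighted_empirical) (auto simp: empirical_mass_def in_ball_def)
  have "(\<integral>u. \<integral>v. (measure ?P (cball u (norm (v - u))) - measure ?Q (cball u (norm (v - u))))\<^sup>2
      \<partial>(weighted_empirical n v xs) \<partial>(weighted_empirical n v xs)) =
    (\<Sum>i<n. v i / (\<Sum>k<n. v k) * (\<Sum>j<n. v j / (\<Sum>k<n. v k) * (empirical_mass n w xs i j - empirical_mass n w' xs i j)\<^sup>2))"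
    if v: "\<And>i. i < n \<Longrightarrow> 0 \<le> v i" for v
    by (subst integral_weighted_empirical[OF v ball_difference_measurable(2)[OF P Q sub_prob_weighted_empirical[OF v]]])
      (simp_all only: integral_weighted_empirical[OF v ball_difference_measurable(1)[OF P Q sub_prob_weighted_empirical[OF v]]]
        em[OF w] em[OF w'])
  from this[OF w] this[OF w'] show ?thesis unfolding ball_divergence_sq_def Let_def by simp
qed

lemma
  fixes a :: "'y::euclidean_space \<times> 'z::euclidean_space \<Rightarrow> real"
  assumes K0: "\<And>t. 0 \<le> K t" and a[measurable]: "a \<in> borel_measurable borel"
    and K1: "\<And>i j. i < n \<Longrightarrow> j < n \<Longrightarrow> (\<lambda>\<omega>. K (norm (dYZ (D \<omega>) i - dYZ (D \<omega>) j) / h1)) \<in> borel_measurable N"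
    and K2: "\<And>i j. i < n \<Longrightarrow> j < n \<Longrightarrow> (\<lambda>\<omega>. K (norm (dZ (D \<omega>) i - dZ (D \<omega>) j) / h2)) \<in> borel_measurable N"
    and D: "\<And>i. i < n \<Longrightarrow> (\<lambda>\<omega>. D \<omega> i :: 'x::euclidean_space \<times> 'y \<times> 'z) \<in> borel_measurable N"
  shows estimated_divergence_measurable: "s < n \<Longrightarrow> (\<lambda>\<omega>. ball_divergence_sq (est_X_given_YZ K h1 n (D \<omega>) (dYZ (D \<omega>) s))
      (est_X_given_Z K h2 n (D \<omega>) (dZ (D \<omega>) s))) \<in> borel_measurable N" (is "s < n \<Longrightarrow> ?B s")
    and zeta_hat_measurable: "(\<lambda>\<omega>. zeta_hat K h1 h2 a n (D \<omega>)) \<in> borel_measurable N"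
proof -
  have dX: "(\<lambda>\<omega>. dX (D \<omega>) i) \<in> borel_measurable N" if "i < n" for i
    by (rule measurable_compose[OF D[OF that] borel_fst])
  have dYZ: "(\<lambda>\<omega>. dYZ (D \<omega>) i) \<in> borel_measurable N" if "i < n" for i
    by (rule measurable_compose[OF D[OF that] borel_snd])
  have ib: "(\<lambda>\<omega>. in_ball (dX (D \<omega>) i) (dX (D \<omega>) j) (dX (D \<omega>) k)) \<in> borel_measurable N"
    if "i < n" "j < n" "k < n" for i j k
    using measurable_compose[OF _ in_ball_measurable, of "\<lambda>\<omega>. (dX (D \<omega>) i, dX (D \<omega>) j, dX (D \<omega>) k)" N]
      dX[OF that(1)] dX[OF that(2)] dX[OF that(3)] by simp
  show B: "?B s" if "s < n" for s
    unfolding est_X_given_YZ_def est_X_given_Z_def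
      ball_divergence_weighted_empirical[OF K0 K0] empirical_mass_def
    using that by (intro borel_measurable_times borel_measurable_sum borel_measurable_add borel_measurable_divide
        borel_measurable_power borel_measurable_diff K1 K2 ib) auto
  show "(\<lambda>\<omega>. zeta_hat K h1 h2 a n (D \<omega>)) \<in> borel_measurable N"
    unfolding zeta_hat_def
    by (intro borel_measurable_times borel_measurable_sum borel_measurable_const B
        measurable_compose[OF dYZ a]) auto
qed

text \<open>A data set is a function on all natural numbers. Overwriting the entries from n on gives
  a normal form in which both sides can be compared.\<close>

lemma zeta_hat_cong:
  assumes K0: "\<And>t. 0 \<le> K t" and "\<And>i. i < n \<Longrightarrow> D i = D' i"
  shows "zeta_hat K h1 h2 a n D = zeta_hat K h1 h2 a n D'"
proof -
  have "zeta_hat K h1 h2 a n D = zeta_hat K h1 h2 a n (\<lambda>i. if i < n then D i else undefined)" for D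
    unfolding zeta_hat_def est_X_given_YZ_def est_X_given_Z_def
      ball_divergence_weighted_empirical[OF K0 K0] empirical_mass_def
    by (simp cong: sum.cong_simp)
  from this[of D] this[of D'] show ?thesis using assms(2) by (simp cong: if_cong)
qed

lemma sphere_null_lborel: "sphere u \<rho> \<in> null_sets (lborel :: 'x::euclidean_space measure)"
  using negligible_sphere[of u \<rho>]
  by (auto simp: null_sets_completion_iff negligible_iff_null_sets)

lemma (in joint_density) sub_prob_cond: "sub_prob (cond u)"
proof
  show "emeasure (cond u) UNIV \<le> 1"
    by (subst emeasure_cond) (auto simp: divide_self_if)
qed simp

lemma (in joint_density) cond_sphere_null: "emeasure (cond u) (sphere v \<rho>) = 0"
proof -
  have "emeasure (cond u) (sphere v \<rho>) = (\<integral>\<^sup>+x. ennreal (r (x, u) / slice UNIV u) * indicator (sphere v \<rho>) x \<partial>lborel)"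
    unfolding cond_def by (rule emeasure_density) auto
  also have "\<dots> = 0" by (rule nn_integral_null_set[OF sphere_null_lborel])
  finally show ?thesis .
qed

definition grid_divergence :: "nat \<Rightarrow> 'x::euclidean_space measure \<Rightarrow> 'x measure \<Rightarrow> 'x measure \<Rightarrow> real" where
  "grid_divergence N R P Q = cells.quad (grid (Suc N)) (range (grid (Suc N))) R
     (\<lambda>a b. (cells.dsc (grid (Suc N)) (range (grid (Suc N))) P Q a b)\<^sup>2)"

text \<open>Serves the measurability of the limit \<open>T\<close>: the grid version depends on the
  two laws through finitely many cell masses, which are measurable in the conditioning
  value.\<close>

lemma grid_divergence_tendsto:
  fixes P Q :: "'x::euclidean_space measure"
  assumes P: "sub_prob P" and Q: "sub_prob Q"
    and null: "\<And>u \<rho>. emeasure P (sphere u \<rho>) = 0" "\<And>u \<rho>. emeasure Q (sphere u \<rho>) = 0"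
  shows "(\<lambda>N. grid_divergence N P P Q + grid_divergence N Q P Q) \<longlonglongrightarrow> ball_divergence_sq P Q"
proof -
  have one: "(\<lambda>N. grid_divergence N R P Q) \<longlonglongrightarrow> cells.ball_form R P Q" if R: "sub_prob R" for R
  proof (rule LIM_zero_cancel, rule Lim_null_comparison)
    show "\<forall>\<^sub>F N in sequentially. norm (grid_divergence N R P Q - cells.ball_form R P Q) \<le> 2 * amb_grid N R P Q"
    proof (intro always_eventually allI)
      fix N
      interpret C: cells "grid (Suc N)" "range (grid (Suc N))" "ambiguous N" by (rule cells_grid)
      show "norm (grid_divergence N R P Q - cells.ball_form R P Q) \<le> 2 * amb_grid N R P Q"
        using C.ball_form_dsc[OF R P Q] unfolding grid_divergence_def amb_grid_def by (simp add: abs_minus_commute)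
    qed
    show "(\<lambda>N. 2 * amb_grid N R P Q) \<longlonglongrightarrow> 0"
      using tendsto_mult_right_zero[OF amb_grid_tendsto[OF R P Q null], of 2] by simp
  qed
  have "ball_divergence_sq P Q = cells.ball_form P P Q + cells.ball_form Q P Q"
    unfolding ball_divergence_sq_def Let_def cells.ball_form_def[OF cells_grid[of 0]] ..
  with tendsto_add[OF one[OF P] one[OF Q]] show ?thesis by simp
qed

section \<open>The limit of the statistic\<close>

locale two_kernels = J1: joint_kernel q C K CK + J2: joint_kernel qZ C K CK
  for q :: "'x::euclidean_space \<times> 'y::euclidean_space \<times> 'z::euclidean_space \<Rightarrow> real"
    and qZ :: "'x \<times> 'z \<Rightarrow> real" and C K CK +
  fixes a :: "'y \<times> 'z \<Rightarrow> real" and Ca :: real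
  assumes a_meas[measurable]: "a \<in> borel_measurable borel" and a0: "\<And>v. 0 \<le> a v" and a_le: "\<And>v. a v \<le> Ca"
    and Ca: "0 < Ca"
begin

definition T :: "'y \<times> 'z \<Rightarrow> real" where
  "T v = ball_divergence_sq (J1.cond v) (J2.cond (snd v))"

text \<open>The limit in probability of the statistic. The locale is used with q the density of the
  data and with q the density of a resample; in both cases \<open>qZ\<close> is the density of (X,
  Z).\<close>

definition zeta :: real where
  "zeta = (\<integral>w. T (snd w) * a (snd w) \<partial>J1.\<nu>)"

lemmas sub1 = J1.sub_prob_cond and sub2 = J2.sub_prob_cond
lemmas null1 = J1.cond_sphere_null and null2 = J2.cond_sphere_null

lemma mass_measurable:
  "(\<lambda>v. cells.mass (grid (Suc N)) (J1.cond v) b) \<in> borel_measurable borel"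
  "(\<lambda>v. cells.mass (grid (Suc N)) (J2.cond (snd v)) b) \<in> borel_measurable (borel :: ('y \<times> 'z) measure)"
proof -
  interpret C: cells "grid (Suc N)" "range (grid (Suc N))" "ambiguous N" by (rule cells_grid)
  show "(\<lambda>v. C.mass (J1.cond v) b) \<in> borel_measurable borel"
    unfolding C.mass_def using C.cell_sets by (simp add: J1.measure_cond)
  have "(\<lambda>z. C.mass (J2.cond z) b) \<in> borel_measurable borel"
    unfolding C.mass_def using C.cell_sets by (simp add: J2.measure_cond)
  then show "(\<lambda>v. C.mass (J2.cond (snd v)) b) \<in> borel_measurable (borel :: ('y \<times> 'z) measure)"
    by (rule measurable_compose[OF borel_snd])
qed

lemma T_measurable[measurable]: "T \<in> borel_measurable borel"
proof (rule borel_measurable_LIMSEQ_real)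
  let ?G = "\<lambda>N v. grid_divergence N (J1.cond v) (J1.cond v) (J2.cond (snd v)) +
    grid_divergence N (J2.cond (snd v)) (J1.cond v) (J2.cond (snd v))"
  show "(\<lambda>N. ?G N v) \<longlonglongrightarrow> T v" for v
    unfolding T_def by (rule grid_divergence_tendsto[OF sub1 sub2 null1 null2])
  show "?G N \<in> borel_measurable borel" for N
  proof -
    interpret C: cells "grid (Suc N)" "range (grid (Suc N))" "ambiguous N" by (rule cells_grid)
    show ?thesis unfolding grid_divergence_def C.quad_def C.dsc_def
      by (intro borel_measurable_add borel_measurable_sum borel_measurable_times borel_measurable_power
          borel_measurable_diff borel_measurable_const mass_measurable)
  qed
qed

lemma T_bounds: "0 \<le> T v" "T v \<le> 2"
  unfolding T_def using ball_divergence_bounds[OF sub1 sub2] by auto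

definition amb_total :: "nat \<Rightarrow> 'y \<times> 'z \<Rightarrow> real" where
  "amb_total N v = amb_grid N (J1.cond v) (J1.cond v) (J2.cond (snd v)) +
    amb_grid N (J2.cond (snd v)) (J1.cond v) (J2.cond (snd v))"

lemma amb_total_measurable[measurable]: "amb_total N \<in> borel_measurable borel"
proof -
  interpret C: cells "grid (Suc N)" "range (grid (Suc N))" "ambiguous N" by (rule cells_grid)
  show ?thesis unfolding amb_total_def[abs_def] amb_grid_def C.quad_def C.amb_def
    by (intro borel_measurable_add borel_measurable_sum borel_measurable_times
        borel_measurable_const mass_measurable)
qed

lemma amb_grid_bounds:
  fixes P Q R :: "'x measure"
  assumes R: "sub_prob R" and P: "sub_prob P" and Q: "sub_prob Q"
  shows "0 \<le> amb_grid N R P Q" "amb_grid N R P Q \<le> 2"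
proof -
  interpret C: cells "grid (Suc N)" "range (grid (Suc N))" "ambiguous N" by (rule cells_grid)
  have amb0: "0 \<le> C.amb P Q x y" for x y unfolding C.amb_def
    by (intro sum_nonneg mult_nonneg_nonneg add_nonneg_nonneg C.G0 C.mass_nonneg)
  have amb2: "C.amb P Q x y \<le> 2" for x y
  proof -
    have "C.amb P Q x y \<le> (\<Sum>d\<in>range (grid (Suc N)). 1 * (C.mass P d + C.mass Q d))"
      unfolding C.amb_def by (intro sum_mono mult_right_mono add_nonneg_nonneg C.G1 C.mass_nonneg)
    also have "\<dots> \<le> 2" using C.mass_sum[OF P] C.mass_sum[OF Q] by (simp add: sum.distrib)
    finally show ?thesis .
  qed
  have eq: "amb_grid N R P Q = (\<integral>u. \<integral>v. C.amb P Q (grid (Suc N) u) (grid (Suc N) v) \<partial>R \<partial>R)"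
    unfolding amb_grid_def C.integral_c_c[OF R] ..
  show "0 \<le> amb_grid N R P Q" unfolding eq by (intro integral_nonneg_AE AE_I2 amb0)
  show "amb_grid N R P Q \<le> 2" unfolding eq by (intro sub_prob.integral_le_bound[OF R] amb2) simp_all
qed

lemma amb_total_tendsto: "(\<lambda>N. \<integral>w. amb_total N (snd w) \<partial>J1.\<nu>) \<longlonglongrightarrow> 0"
proof -
  interpret N: prob_space J1.\<nu> by (rule J1.prob_space_\<nu>)
  have "(\<lambda>N. \<integral>w. amb_total N (snd w) \<partial>J1.\<nu>) \<longlonglongrightarrow> (\<integral>w. 0 \<partial>J1.\<nu>)"
  proof (rule integral_dominated_convergence[where w = "\<lambda>_. 4"])
    show "(\<lambda>w. amb_total N (snd w)) \<in> borel_measurable J1.\<nu>" for N by measurable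
    show "AE w in J1.\<nu>. (\<lambda>N. amb_total N (snd w)) \<longlonglongrightarrow> 0"
    proof (rule AE_I2)
      fix w :: "'x \<times> 'y \<times> 'z"
      show "(\<lambda>N. amb_total N (snd w)) \<longlonglongrightarrow> 0"
        using tendsto_add[OF amb_grid_tendsto[OF sub1 sub1 sub2 null1 null2] amb_grid_tendsto[OF sub2 sub1 sub2 null1 null2]]
        unfolding amb_total_def by simp
    qed
    show "AE w in J1.\<nu>. norm (amb_total N (snd w)) \<le> 4" for N
    proof (rule AE_I2)
      fix w :: "'x \<times> 'y \<times> 'z"
      show "norm (amb_total N (snd w)) \<le> 4"
        using amb_grid_bounds[OF sub1 sub1 sub2, of N "snd w" "snd w" "snd (snd w)"]
          amb_grid_bounds[OF sub2 sub1 sub2, of N "snd (snd w)" "snd w" "snd (snd w)"]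
        unfolding amb_total_def by simp
    qed
  qed auto
  then show ?thesis by simp
qed

end

locale two_samples = two_kernels q qZ C K CK a Ca
  for q :: "'x::euclidean_space \<times> 'y::euclidean_space \<times> 'z::euclidean_space \<Rightarrow> real"
    and qZ :: "'x \<times> 'z \<Rightarrow> real" and C K CK a Ca +
  fixes M :: "nat \<Rightarrow> 'w measure" and W :: "nat \<Rightarrow> nat \<Rightarrow> 'w \<Rightarrow> 'x \<times> 'y \<times> 'z" and h1 h2 :: "nat \<Rightarrow> real"
  assumes iid1: "\<And>n. n \<ge> 1 \<Longrightarrow> iid_sample q C (M n) (W n) n"
    and iid2: "\<And>n. n \<ge> 1 \<Longrightarrow> iid_sample qZ C (M n) (\<lambda>i \<omega>. (fst (W n i \<omega>), snd (snd (W n i \<omega>)))) n"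
    and h1: "\<And>n. 0 < h1 n" "h1 \<longlonglongrightarrow> 0" "filterlim (\<lambda>n. real n * h1 n ^ DIM('y \<times> 'z)) at_top sequentially"
    and h2: "\<And>n. 0 < h2 n" "h2 \<longlonglongrightarrow> 0" "filterlim (\<lambda>n. real n * h2 n ^ DIM('z)) at_top sequentially"
begin

abbreviation P' where "P' n s \<omega> \<equiv> est_X_given_YZ K (h1 n) n (\<lambda>i. W n i \<omega>) (dYZ (\<lambda>i. W n i \<omega>) s)"
abbreviation Q' where "Q' n s \<omega> \<equiv> est_X_given_Z K (h2 n) n (\<lambda>i. W n i \<omega>) (dZ (\<lambda>i. W n i \<omega>) s)"

definition err :: "nat \<Rightarrow> nat \<Rightarrow> 'w \<Rightarrow> real" where
  "err n s \<omega> = \<bar>ball_divergence_sq (P' n s \<omega>) (Q' n s \<omega>) - T (snd (W n s \<omega>))\<bar>"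

lemma sub_est: "sub_prob (P' n s \<omega>)" "sub_prob (Q' n s \<omega>)"
  unfolding est_X_given_YZ_def est_X_given_Z_def
  by (intro sub_prob_weighted_empirical J1.K_nonneg)+

lemma W_measurable: "1 \<le> n \<Longrightarrow> i < n \<Longrightarrow> W n i \<in> borel_measurable (M n)"
  using iid_sample.W_meas[OF iid1] by blast

lemma K_measurable:
  assumes "1 \<le> n" "i < n" "j < n"
  shows "(\<lambda>\<omega>. K (norm (snd (W n i \<omega>) - snd (W n j \<omega>)) / h1 n)) \<in> borel_measurable (M n)"
    and "(\<lambda>\<omega>. K (norm (snd (snd (W n i \<omega>)) - snd (snd (W n j \<omega>))) / h2 n)) \<in> borel_measurable (M n)"
  using assms
  by (intro J1.K_dist_measurable J2.K_dist_measurable h1 h2 measurable_compose[OF W_measurable]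
        borel_snd measurable_compose[OF measurable_compose[OF W_measurable borel_snd]]; simp)+

lemma err_measurable:
  assumes "1 \<le> n" "s < n" shows "err n s \<in> borel_measurable (M n)"
proof -
  have "(\<lambda>\<omega>. T (snd (W n s \<omega>))) \<in> borel_measurable (M n)"
    by (rule measurable_compose[OF measurable_compose[OF W_measurable[OF assms] borel_snd] T_measurable])
  then show ?thesis unfolding err_def[abs_def] using assms
    by (intro borel_measurable_abs borel_measurable_diff estimated_divergence_measurable[OF _ a_meas]
       J1.K_nonneg K_measurable W_measurable)
qed

lemma err_bound: "0 \<le> err n s \<omega>" "err n s \<omega> \<le> 2"
  unfolding err_def using ball_divergence_bounds[OF sub_est(1)[of n \<omega> s] sub_est(2)[of n \<omega> s]] T_bounds[of "snd (W n s \<omega>)"] by auto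

text \<open>The order of choices matters: first a grid on which the limit laws have small mean
  ambiguity, then n so large that the finitely many cell masses are consistent in mean. Both bounds
  are uniform in s, because all sample points have the same law.\<close>

lemma err_small:
  assumes e: "0 < e"
  shows "\<forall>\<^sub>F n in sequentially. \<forall>s<n. (\<integral>\<omega>. err n s \<omega> \<partial>(M n)) \<le> e"
proof -
  from order_tendstoD(2)[OF amb_total_tendsto, of "e / 8"] e
  obtain N where N: "(\<integral>w. amb_total N (snd w) \<partial>J1.\<nu>) < e / 8" by (auto simp: eventually_sequentially)
  interpret C: cells "grid (Suc N)" "range (grid (Suc N)) :: 'x set" "ambiguous N" by (rule cells_grid)
  let ?F = "range (grid (Suc N)) :: 'x set"
  \<comment> \<open>The ambiguity uses 4 (e / 8), one half of e. The factor 18 with two estimators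
    costs 36 e' per cell, which has to stay within the other half.\<close>
  define e' where "e' = e / (72 * (1 + card ?F))"
  have e': "0 < e'" using e unfolding e'_def by simp
  let ?d1 = "\<lambda>n s b \<omega>. \<bar>measure (P' n s \<omega>) (grid (Suc N) -` {b}) - measure (J1.cond (snd (W n s \<omega>))) (grid (Suc N) -` {b})\<bar>"
  let ?d2 = "\<lambda>n s b \<omega>. \<bar>measure (Q' n s \<omega>) (grid (Suc N) -` {b}) - measure (J2.cond (snd (snd (W n s \<omega>)))) (grid (Suc N) -` {b})\<bar>"
  have ev1: "\<forall>\<^sub>F n in sequentially. \<forall>b\<in>?F. \<forall>s<n. (\<integral>\<omega>. ?d1 n s b \<omega> \<partial>M n) \<le> e'"
  proof (intro eventually_ball_finite ballI)
    fix b
    show "\<forall>\<^sub>F n in sequentially. \<forall>s<n. (\<integral>\<omega>. ?d1 n s b \<omega> \<partial>M n) \<le> e'"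
      using J1.estimator_consistent[OF h1 iid1 C.cell_sets e', of b] unfolding est_X_given_YZ_def .
  qed (rule C.finF)
  have ev2: "\<forall>\<^sub>F n in sequentially. \<forall>b\<in>?F. \<forall>s<n. (\<integral>\<omega>. ?d2 n s b \<omega> \<partial>M n) \<le> e'"
  proof (intro eventually_ball_finite ballI)
    fix b
    show "\<forall>\<^sub>F n in sequentially. \<forall>s<n. (\<integral>\<omega>. ?d2 n s b \<omega> \<partial>M n) \<le> e'"
      using J2.estimator_consistent[OF h2 iid2 C.cell_sets e', of b] unfolding est_X_given_Z_def by simp
  qed (rule C.finF)
  show ?thesis using ev1 ev2 eventually_ge_at_top[of "1::nat"]
  proof eventually_elim
    case (elim n)
    interpret I1: iid_sample q C "M n" "W n" n by (rule iid1[OF elim(3)])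
    interpret I1: iid_kernel q C "M n" "W n" n K CK ..
    interpret I2: iid_sample qZ C "M n" "\<lambda>i \<omega>. (fst (W n i \<omega>), snd (snd (W n i \<omega>)))" n by (rule iid2[OF elim(3)])
    interpret I2: iid_kernel qZ C "M n" "\<lambda>i \<omega>. (fst (W n i \<omega>), snd (snd (W n i \<omega>)))" n K CK ..
    show ?case
    proof (intro allI impI)
      fix s assume s: "s < n"
      have i1: "integrable (M n) (?d1 n s b)" for b
        using I1.estimate_error(1)[OF h1(1) C.cell_sets s zero_less_one, of n b]
        unfolding I1.estimate_def est_X_given_YZ_def .
      have i2: "integrable (M n) (?d2 n s b)" for b
        using I2.estimate_error(1)[OF h2(1) C.cell_sets s zero_less_one, of n b]
        unfolding I2.estimate_def est_X_given_Z_def by simp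
      have ia: "integrable (M n) (\<lambda>\<omega>. amb_total N (snd (W n s \<omega>)))"
      proof (rule I1.integrable_const_bound[of _ 4])
        show "AE \<omega> in M n. norm (amb_total N (snd (W n s \<omega>))) \<le> 4"
          using amb_grid_bounds[OF sub1 sub1 sub2, of N] amb_grid_bounds[OF sub2 sub1 sub2, of N]
          unfolding amb_total_def by (intro AE_I2) (smt (verit) real_norm_def)
        show "(\<lambda>\<omega>. amb_total N (snd (W n s \<omega>))) \<in> borel_measurable (M n)"
          by (rule measurable_compose[OF measurable_compose[OF I1.W_meas[OF s] borel_snd] amb_total_measurable])
      qed
      have le: "err n s \<omega> \<le> 4 * amb_total N (snd (W n s \<omega>)) + 18 * ((\<Sum>b\<in>?F. ?d1 n s b \<omega>) + (\<Sum>b\<in>?F. ?d2 n s b \<omega>))" for \<omega>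
        using C.ball_divergence_close[OF sub1[of "snd (W n s \<omega>)"] sub_est(1)[of n \<omega> s]
            sub2[of "snd (snd (W n s \<omega>))"] sub_est(2)[of n \<omega> s]]
        unfolding err_def T_def amb_total_def amb_grid_def C.cell_dist_def C.mass_def
        by (simp only: abs_minus_commute)
      have "(\<integral>\<omega>. err n s \<omega> \<partial>(M n)) \<le> (\<integral>\<omega>. 4 * amb_total N (snd (W n s \<omega>)) + 18 * ((\<Sum>b\<in>?F. ?d1 n s b \<omega>) + (\<Sum>b\<in>?F. ?d2 n s b \<omega>)) \<partial>(M n))"
      proof (rule integral_mono[OF _ _ le])
        show "integrable (M n) (err n s)"
          by (rule I1.integrable_const_bound[of _ 2]) (use err_bound err_measurable[OF elim(3) s] in auto)
      qed (intro Bochner_Integration.integrable_add integrable_mult_right Bochner_Integration.integrable_sum i1 i2 ia)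
      also have "\<dots> = 4 * (\<integral>\<omega>. amb_total N (snd (W n s \<omega>)) \<partial>(M n)) +
          18 * ((\<Sum>b\<in>?F. (\<integral>\<omega>. ?d1 n s b \<omega> \<partial>(M n))) + (\<Sum>b\<in>?F. (\<integral>\<omega>. ?d2 n s b \<omega> \<partial>(M n))))"
        using i1 i2 ia by simp
      also have "(\<integral>\<omega>. amb_total N (snd (W n s \<omega>)) \<partial>(M n)) = (\<integral>w. amb_total N (snd w) \<partial>J1.\<nu>)"
        by (rule I1.integral_W[OF s]) (rule measurable_compose[OF borel_snd amb_total_measurable])
      also have "4 * (\<integral>w. amb_total N (snd w) \<partial>J1.\<nu>) +
          18 * ((\<Sum>b\<in>?F. (\<integral>\<omega>. ?d1 n s b \<omega> \<partial>(M n))) + (\<Sum>b\<in>?F. (\<integral>\<omega>. ?d2 n s b \<omega> \<partial>(M n))))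
          \<le> 4 * (e / 8) + 18 * ((\<Sum>b\<in>?F. e') + (\<Sum>b\<in>?F. e'))"
        using N elim(1,2) s by (intro add_mono mult_left_mono sum_mono) auto
      also have "\<dots> \<le> e"
      proof -
        have "72 * e' * (1 + card ?F) = e" unfolding e'_def by (simp add: field_simps)
        then have "72 * e' + 72 * (card ?F * e') = e" by (simp add: algebra_simps)
        moreover have "4 * (e / 8) + 18 * (c + c) \<le> e" if "72 * e' + 72 * c = e" for c
          using that e' by argo
        ultimately show ?thesis unfolding sum_constant by blast
      qed
      finally show "(\<integral>\<omega>. err n s \<omega> \<partial>(M n)) \<le> e" .
    qed
  qed
qed

text \<open>Replacing every estimated divergence by its limit T costs the average A, which has small
  mean by \<open>err_small\<close>, so Markov's inequality applies. What remains is an average L of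
  independent bounded variables with mean \<open>zeta\<close>, handled by Hoeffding's
  inequality.\<close>

lemma zeta_hat_tendsto:
  assumes e: "0 < e"
  shows "(\<lambda>n. measure (M n) {\<omega> \<in> space (M n). \<bar>zeta_hat K (h1 n) (h2 n) a n (\<lambda>i. W n i \<omega>) - zeta\<bar> \<ge> e}) \<longlonglongrightarrow> 0"
proof -
  define A where "A n \<omega> = (\<Sum>s<n. a (snd (W n s \<omega>)) * err n s \<omega>) / n" for n \<omega>
  define L where "L n \<omega> = (\<Sum>s<n. T (snd (W n s \<omega>)) * a (snd (W n s \<omega>))) / n" for n \<omega>
  have le: "\<bar>zeta_hat K (h1 n) (h2 n) a n (\<lambda>i. W n i \<omega>) - zeta\<bar> \<le> A n \<omega> + \<bar>L n \<omega> - zeta\<bar>" for n \<omega>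
  proof -
    have "\<bar>zeta_hat K (h1 n) (h2 n) a n (\<lambda>i. W n i \<omega>) - L n \<omega>\<bar> =
        \<bar>\<Sum>s<n. (ball_divergence_sq (P' n s \<omega>) (Q' n s \<omega>) - T (snd (W n s \<omega>))) * a (snd (W n s \<omega>))\<bar> / n"
      unfolding zeta_hat_def L_def
      by (simp add: sum_subtractf left_diff_distrib flip: diff_divide_distrib)
    also have "\<dots> \<le> (\<Sum>s<n. \<bar>(ball_divergence_sq (P' n s \<omega>) (Q' n s \<omega>) - T (snd (W n s \<omega>))) * a (snd (W n s \<omega>))\<bar>) / n"
      by (intro divide_right_mono sum_abs) simp
    also have "\<dots> = A n \<omega>" unfolding A_def err_def using a0 by (simp add: abs_mult mult.commute)
    finally show ?thesis by linarith
  qed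
  have A_lim: "(\<lambda>n. measure (M n) {\<omega> \<in> space (M n). A n \<omega> \<ge> e / 2}) \<longlonglongrightarrow> 0"
  proof (rule order_tendstoI)
    fix x :: real assume "x < 0"
    then show "\<forall>\<^sub>F n in sequentially. x < measure (M n) {\<omega> \<in> space (M n). A n \<omega> \<ge> e / 2}"
      by (intro always_eventually allI less_le_trans[OF _ measure_nonneg])
  next
    fix x :: real assume x: "0 < x"
    \<comment> \<open>The mean of A is then at most x e / 4, and Markov's inequality at level e / 2
      gives x / 2.\<close>
    define e' where "e' = x * e / (4 * Ca)"
    have e': "0 < e'" using x e Ca unfolding e'_def by simp
    show "\<forall>\<^sub>F n in sequentially. measure (M n) {\<omega> \<in> space (M n). A n \<omega> \<ge> e / 2} < x"
      using err_small[OF e'] eventually_ge_at_top[of "1::nat"]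
    proof eventually_elim
      case (elim n)
      interpret I1: iid_sample q C "M n" "W n" n by (rule iid1[OF elim(2)])
      have am: "(\<lambda>\<omega>. a (snd (W n s \<omega>))) \<in> borel_measurable (M n)" if "s < n" for s
        by (rule measurable_compose[OF measurable_compose[OF W_measurable[OF elim(2) that] borel_snd] a_meas])
      have i0: "integrable (M n) (\<lambda>\<omega>. Ca * err n s \<omega>)" if "s < n" for s
        by (rule integrable_mult_right, rule I1.integrable_const_bound[of _ 2])
          (use err_bound err_measurable[OF elim(2) that] in auto)
      have i1: "integrable (M n) (\<lambda>\<omega>. a (snd (W n s \<omega>)) * err n s \<omega>)" if "s < n" for s
      proof (rule Bochner_Integration.integrable_bound[OF i0[OF that]])
        show "(\<lambda>\<omega>. a (snd (W n s \<omega>)) * err n s \<omega>) \<in> borel_measurable (M n)"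
          by (intro borel_measurable_times am err_measurable elim(2) that)
        show "AE \<omega> in M n. norm (a (snd (W n s \<omega>)) * err n s \<omega>) \<le> norm (Ca * err n s \<omega>)"
          using a0 a_le err_bound(1) Ca by (intro AE_I2) (simp add: abs_mult mult_right_mono)
      qed
      have iA: "integrable (M n) (A n)"
        unfolding A_def by (intro Bochner_Integration.integrable_divide Bochner_Integration.integrable_sum i1) simp
      have "(\<integral>\<omega>. A n \<omega> \<partial>(M n)) = (\<Sum>s<n. (\<integral>\<omega>. a (snd (W n s \<omega>)) * err n s \<omega> \<partial>(M n))) / n"
        unfolding A_def using i1 by simp
      also have "\<dots> \<le> (\<Sum>s<n. Ca * e') / n"
      proof (intro divide_right_mono sum_mono)
        fix s assume "s \<in> {..<n}" then have s: "s < n" by simp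
        have "(\<integral>\<omega>. a (snd (W n s \<omega>)) * err n s \<omega> \<partial>(M n)) \<le> (\<integral>\<omega>. Ca * err n s \<omega> \<partial>(M n))"
          by (intro integral_mono i0 i1 s mult_right_mono a_le err_bound)
        also have "\<dots> \<le> Ca * e'" using elim(1) s Ca by simp
        finally show "(\<integral>\<omega>. a (snd (W n s \<omega>)) * err n s \<omega> \<partial>(M n)) \<le> Ca * e'" .
      qed simp
      also have "\<dots> = x * e / 4" using elim(2) Ca unfolding e'_def by simp
      finally have E: "(\<integral>\<omega>. A n \<omega> \<partial>(M n)) \<le> x * e / 4" .
      have "measure (M n) {\<omega> \<in> space (M n). A n \<omega> \<ge> e / 2} \<le> (\<integral>\<omega>. A n \<omega> \<partial>(M n)) / (e / 2)"
      proof (rule integral_Markov_inequality_measure[OF iA sets.empty_sets])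
        show "AE \<omega> in M n. 0 \<le> A n \<omega>"
          unfolding A_def by (intro AE_I2 divide_nonneg_nonneg sum_nonneg mult_nonneg_nonneg a0 err_bound) simp
      qed (use e in simp)
      also have "\<dots> \<le> (x * e / 4) / (e / 2)" using E e by (intro divide_right_mono) auto
      also have "\<dots> < x" using e x by simp
      finally show ?case .
    qed
  qed
  have L_lim: "(\<lambda>n. measure (M n) {\<omega> \<in> space (M n). \<bar>L n \<omega> - zeta\<bar> \<ge> e / 2}) \<longlonglongrightarrow> 0"
  proof (rule tendsto_sandwich[OF _ _ tendsto_const])
    \<comment> \<open>Range of the summands: the divergence is at most 2 and the weight at most
      \<open>Ca\<close>.\<close>
    let ?b = "2 * Ca"
    show "\<forall>\<^sub>F n in sequentially. measure (M n) {\<omega> \<in> space (M n). \<bar>L n \<omega> - zeta\<bar> \<ge> e / 2} \<le>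
        2 * exp (- 2 * real n * (e / 2)\<^sup>2 / (?b - 0)\<^sup>2)"
      using eventually_ge_at_top[of "1::nat"]
    proof eventually_elim
      case (elim n)
      interpret I1: iid_sample q C "M n" "W n" n by (rule iid1[OF elim])
      let ?f = "\<lambda>w :: 'x \<times> 'y \<times> 'z. T (snd w) * a (snd w)"
      have f[measurable]: "?f \<in> borel_measurable borel" by measurable
      have n0: "0 < n" using elim by simp
      have z: "zeta = I1.expectation (\<lambda>\<omega>. ?f (W n 0 \<omega>))"
        unfolding zeta_def by (rule I1.integral_W[OF n0 f, symmetric])
      have W0: "W n 0 \<in> borel_measurable (M n)" using n0 by (rule I1.W_meas)
      interpret H: iid_interval_bounded_random_variables "M n" "{..<n}" "\<lambda>i \<omega>. ?f (W n i \<omega>)" "\<lambda>\<omega>. ?f (W n 0 \<omega>)" 0 ?b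
      proof
        show "I1.indep_vars (\<lambda>_. borel) (\<lambda>i \<omega>. ?f (W n i \<omega>)) {..<n}"
          by (rule I1.indep_vars_compose2[OF I1.indep]) (rule f)
        show "distr (M n) borel (\<lambda>\<omega>. ?f (W n i \<omega>)) = distr (M n) borel (\<lambda>\<omega>. ?f (W n 0 \<omega>))" if "i \<in> {..<n}" for i
        proof -
          have "distr (M n) borel (\<lambda>\<omega>. ?f (W n i \<omega>)) = distr J1.\<nu> borel ?f" if "i < n" for i
            unfolding I1.distr_W[OF that, symmetric]
            by (subst distr_distr[OF f I1.W_meas[OF that]]) (simp add: comp_def)
          then show ?thesis using that n0 by simp
        qed
        show "(\<lambda>\<omega>. ?f (W n 0 \<omega>)) \<in> borel_measurable (M n)" by (rule measurable_compose[OF W0 f])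
        show "AE \<omega> in M n. ?f (W n 0 \<omega>) \<in> {0..?b}"
        proof (rule AE_I2)
          fix \<omega>
          have "?f (W n 0 \<omega>) \<le> 2 * Ca" using T_bounds a0 a_le by (intro mult_mono) auto
          then show "?f (W n 0 \<omega>) \<in> {0..?b}" using T_bounds(1) a0 by simp
        qed
      qed simp
      interpret H: Hoeffding_ineq_iid "M n" "{..<n}" "\<lambda>i \<omega>. ?f (W n i \<omega>)" "\<lambda>\<omega>. ?f (W n 0 \<omega>)" 0 ?b zeta
        by unfold_locales (simp add: z)
      show ?case
        using H.Hoeffding_ineq_abs_ge'[of "e / 2"] e Ca n0 unfolding L_def by auto
    qed
    have "(\<lambda>n. 2 * exp (- (real n * (2 * (e / 2)\<^sup>2 / (?b - 0)\<^sup>2)))) \<longlonglongrightarrow> 2 * 0"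
    proof (intro tendsto_mult tendsto_const filterlim_compose[OF exp_at_bot] filterlim_compose[OF filterlim_uminus_at_bot_at_top])
      show "filterlim (\<lambda>n. real n * (2 * (e / 2)\<^sup>2 / (?b - 0)\<^sup>2)) at_top sequentially"
        using e Ca by (intro filterlim_at_top_mult_tendsto_pos[OF tendsto_const] filterlim_real_sequentially) simp_all
    qed
    then show "(\<lambda>n. 2 * exp (- 2 * real n * (e / 2)\<^sup>2 / (?b - 0)\<^sup>2)) \<longlonglongrightarrow> 0"
      by (simp add: mult_ac)
  qed simp
  show ?thesis
  proof (rule tendsto_sandwich[OF _ _ tendsto_const])
    show "(\<lambda>n. measure (M n) {\<omega> \<in> space (M n). A n \<omega> \<ge> e / 2} + measure (M n) {\<omega> \<in> space (M n). \<bar>L n \<omega> - zeta\<bar> \<ge> e / 2}) \<longlonglongrightarrow> 0"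
      using tendsto_add[OF A_lim L_lim] by simp
    show "\<forall>\<^sub>F n in sequentially. measure (M n) {\<omega> \<in> space (M n). \<bar>zeta_hat K (h1 n) (h2 n) a n (\<lambda>i. W n i \<omega>) - zeta\<bar> \<ge> e} \<le>
      measure (M n) {\<omega> \<in> space (M n). A n \<omega> \<ge> e / 2} + measure (M n) {\<omega> \<in> space (M n). \<bar>L n \<omega> - zeta\<bar> \<ge> e / 2}"
      using eventually_ge_at_top[of "1::nat"]
    proof eventually_elim
      case (elim n)
      interpret I1: iid_sample q C "M n" "W n" n by (rule iid1[OF elim])
      have am: "(\<lambda>\<omega>. a (snd (W n s \<omega>))) \<in> borel_measurable (M n)" "(\<lambda>\<omega>. T (snd (W n s \<omega>))) \<in> borel_measurable (M n)" if "s < n" for s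
        by (intro measurable_compose[OF measurable_compose[OF W_measurable[OF elim that] borel_snd]] a_meas T_measurable)+
      have mA: "A n \<in> borel_measurable (M n)" unfolding A_def[abs_def]
        by (intro borel_measurable_divide borel_measurable_sum borel_measurable_times am err_measurable elim) auto
      have mL: "L n \<in> borel_measurable (M n)" unfolding L_def[abs_def]
        by (intro borel_measurable_divide borel_measurable_sum borel_measurable_times am) auto
      have s1: "{\<omega> \<in> space (M n). A n \<omega> \<ge> e / 2} \<in> sets (M n)" using mA by measurable
      have s2: "{\<omega> \<in> space (M n). \<bar>L n \<omega> - zeta\<bar> \<ge> e / 2} \<in> sets (M n)" using mL by measurable
      have "measure (M n) {\<omega> \<in> space (M n). \<bar>zeta_hat K (h1 n) (h2 n) a n (\<lambda>i. W n i \<omega>) - zeta\<bar> \<ge> e} \<le>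
        measure (M n) ({\<omega> \<in> space (M n). A n \<omega> \<ge> e / 2} \<union> {\<omega> \<in> space (M n). \<bar>L n \<omega> - zeta\<bar> \<ge> e / 2})"
      proof (rule I1.finite_measure_mono)
        show "{\<omega> \<in> space (M n). \<bar>zeta_hat K (h1 n) (h2 n) a n (\<lambda>i. W n i \<omega>) - zeta\<bar> \<ge> e} \<subseteq>
            {\<omega> \<in> space (M n). A n \<omega> \<ge> e / 2} \<union> {\<omega> \<in> space (M n). \<bar>L n \<omega> - zeta\<bar> \<ge> e / 2}"
        proof
          fix \<omega> assume "\<omega> \<in> {\<omega> \<in> space (M n). \<bar>zeta_hat K (h1 n) (h2 n) a n (\<lambda>i. W n i \<omega>) - zeta\<bar> \<ge> e}"
          then show "\<omega> \<in> {\<omega> \<in> space (M n). A n \<omega> \<ge> e / 2} \<union> {\<omega> \<in> space (M n). \<bar>L n \<omega> - zeta\<bar> \<ge> e / 2}"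
            using le[of n \<omega>] by simp argo
        qed
      qed (use s1 s2 in auto)
      also have "\<dots> \<le> measure (M n) {\<omega> \<in> space (M n). A n \<omega> \<ge> e / 2} + measure (M n) {\<omega> \<in> space (M n). \<bar>L n \<omega> - zeta\<bar> \<ge> e / 2}"
        by (rule measure_Un_le[OF s1 s2])
      finally show ?case .
    qed
  qed simp
qed

end

section \<open>Positivity of the ball divergence\<close>

text \<open>Write F1 and F2 for the two functions. They agree on a closed set whose complement has
  no M1-mass. Let b be the first point of agreement to the right of t: no M1-mass lies between t and
  b, so F2(t) \<le> F2(b) = F1(b) = F1(t). The last point of agreement to the left of t gives the
  converse. If there is no such point, F1(t) is 1 or 0 respectively.\<close>

lemma cdf_eq_of_AE_eq:
  fixes M1 M2 :: "real measure"
  assumes "real_distribution M1" "real_distribution M2"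
    and cont: "\<And>x. isCont (cdf M1) x" "\<And>x. isCont (cdf M2) x"
    and ae: "AE x in M1. cdf M1 x = cdf M2 x"
  shows "cdf M1 t = cdf M2 t"
proof -
  interpret M1: real_distribution M1 by fact
  interpret M2: real_distribution M2 by fact
  have pt: "measure M1 {x} = 0" for x using cont(1)[of x] by (simp add: M1.isCont_cdf)
  have closed: "closed {r \<in> S. cdf M1 r = cdf M2 r}" if "closed S" for S
  proof -
    have "closed {r. cdf M1 r = cdf M2 r}"
      using cont by (intro closed_Collect_eq continuous_at_imp_continuous_on) auto
    moreover have "{r \<in> S. cdf M1 r = cdf M2 r} = S \<inter> {r. cdf M1 r = cdf M2 r}" by auto
    ultimately show ?thesis using that by auto
  qed
  have null: "measure M1 A = 0" if "A \<in> sets borel" "\<And>x. x \<in> A \<Longrightarrow> cdf M1 x \<noteq> cdf M2 x" for A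
  proof -
    have "AE x in M1. x \<notin> A" using ae by eventually_elim (use that in auto)
    then have "emeasure M1 A = 0" using that(1) by (subst (asm) AE_iff_measurable[of A]) auto
    then show ?thesis by (simp add: measure_def)
  qed
  have "cdf M2 t \<le> cdf M1 t"
  proof (cases "\<exists>r\<ge>t. cdf M1 r = cdf M2 r")
    case True
    let ?E = "{r \<in> {t..}. cdf M1 r = cdf M2 r}"
    define \<beta> where "\<beta> = Inf ?E"
    have bdd: "bdd_below ?E" by (auto intro: bdd_belowI[of _ t])
    have "\<beta> \<in> ?E" unfolding \<beta>_def using True bdd by (intro closed_contains_Inf closed) auto
    then have \<beta>: "t \<le> \<beta>" "cdf M1 \<beta> = cdf M2 \<beta>" by auto
    have "cdf M1 r \<noteq> cdf M2 r" if "t < r" "r < \<beta>" for r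
      using that cInf_lower[OF _ bdd, of r] unfolding \<beta>_def by force
    then have n: "measure M1 {t<..<\<beta>} = 0" by (intro null) auto
    have "cdf M1 \<beta> = cdf M1 t"
    proof (cases "t < \<beta>")
      case True
      have "cdf M1 \<beta> - cdf M1 t = measure M1 {t<..\<beta>}" using True by (rule M1.cdf_diff_eq)
      also have "{t<..\<beta>} = {t<..<\<beta>} \<union> {\<beta>}" using True by auto
      also have "measure M1 \<dots> \<le> measure M1 {t<..<\<beta>} + measure M1 {\<beta>}" by (intro measure_Un_le) auto
      also have "\<dots> = 0" using n pt by simp
      finally show ?thesis using M1.cdf_nondecreasing[OF \<beta>(1)] by simp
    qed (use \<beta> in simp)
    then show ?thesis using \<beta> M2.cdf_nondecreasing[OF \<beta>(1)] by simp
  next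
    case False
    have "measure M1 {t<..} = 0" by (intro null) (use False in auto)
    moreover have "measure M1 UNIV = 1" using M1.prob_space by simp
    moreover have "measure M1 UNIV \<le> measure M1 {..t} + measure M1 {t<..}"
    proof -
      have "UNIV = {..t} \<union> {t<..}" by auto
      then show ?thesis using measure_Un_le[of "{..t}" M1 "{t<..}"] by simp
    qed
    ultimately have "1 \<le> cdf M1 t" unfolding cdf_def by linarith
    then show ?thesis using M2.cdf_bounded_prob[of t] by linarith
  qed
  moreover have "cdf M1 t \<le> cdf M2 t"
  proof (cases "\<exists>r\<le>t. cdf M1 r = cdf M2 r")
    case True
    let ?E = "{r \<in> {..t}. cdf M1 r = cdf M2 r}"
    define \<beta> where "\<beta> = Sup ?E"
    have bdd: "bdd_above ?E" by (auto intro: bdd_aboveI[of _ t])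
    have "\<beta> \<in> ?E" unfolding \<beta>_def using True bdd by (intro closed_contains_Sup closed) auto
    then have \<beta>: "\<beta> \<le> t" "cdf M1 \<beta> = cdf M2 \<beta>" by auto
    have "cdf M1 r \<noteq> cdf M2 r" if "\<beta> < r" "r \<le> t" for r
      using that cSup_upper[OF _ bdd, of r] unfolding \<beta>_def by force
    then have n: "measure M1 {\<beta><..t} = 0" by (intro null) auto
    have "cdf M1 \<beta> = cdf M1 t"
    proof (cases "\<beta> < t")
      case True
      then show ?thesis using M1.cdf_diff_eq[OF True] n by simp
    qed (use \<beta> in simp)
    then show ?thesis using \<beta> M2.cdf_nondecreasing[OF \<beta>(1)] by simp
  next
    case False
    have "measure M1 {..t} = 0" by (intro null) (use False in auto)
    then show ?thesis by (simp add: cdf_def)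
  qed
  ultimately show ?thesis by simp
qed

text \<open>Atoms of the law of \<open>dist u\<close> are masses of spheres, so both distribution
  functions are continuous, as \<open>cdf_eq_of_AE_eq\<close> requires; their values are masses of
  balls.\<close>

lemma ball_measures_eq:
  fixes P Q :: "'x::euclidean_space measure"
  assumes P: "sub_prob P" "prob_space P" and Q: "sub_prob Q" "prob_space Q"
    and null: "\<And>u \<rho>. emeasure P (sphere u \<rho>) = 0" "\<And>u \<rho>. emeasure Q (sphere u \<rho>) = 0"
    and ae: "AE v in P. measure P (cball u (norm (v - u))) = measure Q (cball u (norm (v - u)))"
  shows "measure P (cball u \<rho>) = measure Q (cball u \<rho>)"
proof -
  define D where "D R = distr R borel (dist u)" for R :: "'x measure"
  have rd: "real_distribution (D R)" "cdf (D R) t = measure R (cball u t)" "\<And>x. isCont (cdf (D R)) x"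
    if R: "sub_prob R" "prob_space R" and null: "\<And>u \<rho>. emeasure R (sphere u \<rho>) = 0" for R t
  proof -
    interpret R: sub_prob R by fact
    interpret R': prob_space R by fact
    have m[measurable]: "dist u \<in> borel_measurable R" by measurable
    show rd: "real_distribution (D R)"
      unfolding D_def by (intro R'.real_distribution_distr m)
    interpret D: real_distribution "D R" by (rule rd)
    show "cdf (D R) t = measure R (cball u t)"
      unfolding cdf_def D_def by (subst measure_distr) (auto simp: cball_def vimage_def)
    show "isCont (cdf (D R)) x" for x
    proof -
      have "measure (D R) {x} = measure R (sphere u x)"
        unfolding D_def by (subst measure_distr) (auto simp: sphere_def vimage_def)
      then show ?thesis using null[of u x] by (simp add: D.isCont_cdf measure_def)
    qed
  qed
  note rP = rd[OF P null(1)] and rQ = rd[OF Q null(2)]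
  interpret P: sub_prob P by (rule P(1))
  have "cdf (D P) \<rho> = cdf (D Q) \<rho>"
  proof (rule cdf_eq_of_AE_eq[OF rP(1) rQ(1) rP(3) rQ(3)])
    have [measurable]: "cdf (D P) \<in> borel_measurable borel" "cdf (D Q) \<in> borel_measurable borel"
      using rP(3) rQ(3) by (auto intro!: borel_measurable_continuous_onI continuous_at_imp_continuous_on)
    have [measurable]: "Measurable.pred borel (\<lambda>x. cdf (D P) x = cdf (D Q) x)" by measurable
    show "AE x in D P. cdf (D P) x = cdf (D Q) x"
    proof -
      have "AE v in P. cdf (D P) (dist u v) = cdf (D Q) (dist u v)"
        using ae by eventually_elim (simp add: rP(2) rQ(2) dist_norm norm_minus_commute)
      moreover have "dist u \<in> measurable P borel" by measurable
      moreover have "{x \<in> space borel. cdf (D P) x = cdf (D Q) x} \<in> sets borel" by measurable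
      ultimately have "AE x in distr P borel (dist u). cdf (D P) x = cdf (D Q) x"
        by (simp only: AE_distr_iff)
      then show ?thesis by (simp only: D_def[of P])
    qed
  qed
  then show ?thesis by (simp add: rP(2) rQ(2))
qed

lemma smoothing_integrable:
  fixes f k :: "'a::euclidean_space \<Rightarrow> real"
  assumes f: "integrable lborel f" and k: "integrable lborel k" "\<And>w. 0 \<le> k w"
  shows "integrable lborel (\<lambda>u. \<integral>w. k w * f (u + h *\<^sub>R w) \<partial>lborel)"
proof -
  have [measurable]: "f \<in> borel_measurable borel" "k \<in> borel_measurable borel"
    using f k(1) by (auto dest: borel_measurable_integrable)
  have "integrable (lborel \<Otimes>\<^sub>M lborel) (\<lambda>x. k (snd x) * f (fst x + h *\<^sub>R snd x))"
  proof (rule integrableI_bounded)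
    have "(\<integral>\<^sup>+x. ennreal (norm (k (snd x) * f (fst x + h *\<^sub>R snd x))) \<partial>(lborel \<Otimes>\<^sub>M lborel)) =
        (\<integral>\<^sup>+w. \<integral>\<^sup>+u. ennreal (norm (k w * f (u + h *\<^sub>R w))) \<partial>lborel \<partial>lborel)"
      by (subst lborel_pair.nn_integral_snd[symmetric]) auto
    also have "\<dots> = (\<integral>\<^sup>+w. ennreal (k w * (\<integral>u. \<bar>f u\<bar> \<partial>lborel)) \<partial>lborel)"
    proof (intro nn_integral_cong)
      fix w
      have "(\<integral>\<^sup>+u. ennreal (norm (k w * f (u + h *\<^sub>R w))) \<partial>lborel) = ennreal (\<integral>u. norm (k w * f (u + h *\<^sub>R w)) \<partial>lborel)"
        using lborel_integral_translate(2)[OF f] by (intro nn_integral_eq_integral) auto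
      also have "(\<integral>u. norm (k w * f (u + h *\<^sub>R w)) \<partial>lborel) = k w * (\<integral>u. \<bar>f u\<bar> \<partial>lborel)"
        using k(2) lborel_integral_translate(1)[of "\<lambda>u. \<bar>f u\<bar>" "h *\<^sub>R w"] by (simp add: abs_mult)
      finally show "(\<integral>\<^sup>+u. ennreal (norm (k w * f (u + h *\<^sub>R w))) \<partial>lborel) = ennreal (k w * (\<integral>u. \<bar>f u\<bar> \<partial>lborel))" .
    qed
    also have "\<dots> < \<infinity>"
      using k by (subst nn_integral_eq_integral) auto
    finally show "(\<integral>\<^sup>+x. ennreal (norm (k (snd x) * f (fst x + h *\<^sub>R snd x))) \<partial>(lborel \<Otimes>\<^sub>M lborel)) < \<infinity>" .
  qed simp
  from lborel_pair.integrable_fst'[OF this] show ?thesis by simp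
qed

text \<open>Vanishing of the half integrated against P gives information only at centres with f > 0.
  Equality is proved there first and then extended by comparing total masses.\<close>

lemma densities_eq_of_ball_divergence_0:
  fixes f g :: "'x::euclidean_space \<Rightarrow> real"
  assumes [measurable]: "f \<in> borel_measurable borel" "g \<in> borel_measurable borel"
    and f0: "\<And>x. 0 \<le> f x" and g0: "\<And>x. 0 \<le> g x"
    and f1: "(\<integral>\<^sup>+x. ennreal (f x) \<partial>lborel) = 1" and g1: "(\<integral>\<^sup>+x. ennreal (g x) \<partial>lborel) = 1"
    and zero: "ball_divergence_sq (density lborel (\<lambda>x. ennreal (f x))) (density lborel (\<lambda>x. ennreal (g x))) = 0"
      (is "ball_divergence_sq ?P ?Q = 0")
  shows "AE x in lborel. f x = g x"
proof -
  have sp: "sub_prob (density lborel (\<lambda>x. ennreal (f x)))" "prob_space (density lborel (\<lambda>x. ennreal (f x)))"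
    "emeasure (density lborel (\<lambda>x. ennreal (f x))) (sphere u \<rho>) = 0"
    if [measurable]: "f \<in> borel_measurable borel" and f1: "(\<integral>\<^sup>+x. ennreal (f x) \<partial>lborel) = 1" for f :: "'x \<Rightarrow> real" and u \<rho>
  proof -
    have e: "emeasure (density lborel (\<lambda>x. ennreal (f x))) UNIV = 1"
      using f1 by (simp add: emeasure_density)
    show "prob_space (density lborel (\<lambda>x. ennreal (f x)))" by (rule prob_spaceI) (use e in simp)
    show "sub_prob (density lborel (\<lambda>x. ennreal (f x)))" by unfold_locales (use e in auto)
    have "emeasure (density lborel (\<lambda>x. ennreal (f x))) (sphere u \<rho>) = (\<integral>\<^sup>+x. ennreal (f x) * indicator (sphere u \<rho>) x \<partial>lborel)"
      by (rule emeasure_density) auto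
    also have "\<dots> = 0" by (rule nn_integral_null_set[OF sphere_null_lborel])
    finally show "emeasure (density lborel (\<lambda>x. ennreal (f x))) (sphere u \<rho>) = 0" .
  qed
  note P = sp[OF _ f1, simplified] and Q = sp[OF _ g1, simplified]
  interpret P: sub_prob ?P by (rule P(1))
  let ?x = "\<lambda>u v. (measure ?P (cball u (norm (v - u))) - measure ?Q (cball u (norm (v - u))))\<^sup>2"
  have meas: "(\<lambda>v. ?x u v) \<in> borel_measurable borel" "(\<lambda>u. \<integral>v. ?x u v \<partial>?P) \<in> borel_measurable borel" for u
    by (rule ball_difference_measurable[OF P(1) Q(1) P(1)])+
  have x1: "?x u v \<le> 1" for u v
  proof -
    have "\<bar>measure ?P (cball u (norm (v - u))) - measure ?Q (cball u (norm (v - u)))\<bar> \<le> 1"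
      using sub_prob.measure_le_1[OF P(1), of "cball u (norm (v - u))"] sub_prob.measure_le_1[OF Q(1), of "cball u (norm (v - u))"]
        measure_nonneg[of ?P "cball u (norm (v - u))"] measure_nonneg[of ?Q "cball u (norm (v - u))"] by linarith
    then show ?thesis by (simp add: abs_square_le_1)
  qed
  have i1: "integrable ?P (\<lambda>v. ?x u v)" for u
    by (rule P.integrable_const_bound[of _ 1]) (use meas(1)[of u] x1 in auto)
  have b0: "0 \<le> (\<integral>v. ?x u v \<partial>R)" for u R by (rule integral_nonneg_AE) simp
  have i2: "integrable ?P (\<lambda>u. \<integral>v. ?x u v \<partial>?P)"
  proof (rule P.integrable_const_bound[of _ 1])
    show "AE u in ?P. norm (\<integral>v. ?x u v \<partial>?P) \<le> 1"
    proof (rule AE_I2)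
      fix u
      have "(\<integral>v. ?x u v \<partial>?P) \<le> 1" by (rule P.integral_le_bound[OF x1]) simp
      then show "norm (\<integral>v. ?x u v \<partial>?P) \<le> 1" using b0[of ?P u] by simp
    qed
  qed (use meas(2) in simp)
  \<comment> \<open>Both halves of the divergence are nonnegative, so the half integrated against P
    vanishes by itself.\<close>
  have z: "(\<integral>u. \<integral>v. ?x u v \<partial>?P \<partial>?P) = 0"
  proof -
    have "0 \<le> (\<integral>u. \<integral>v. ?x u v \<partial>R \<partial>R)" for R by (intro integral_nonneg_AE AE_I2 b0)
    from this[of ?P] this[of ?Q] zero show ?thesis unfolding ball_divergence_sq_def Let_def by linarith
  qed
  have "AE u in ?P. (\<integral>v. ?x u v \<partial>?P) = 0"
    using z integral_nonneg_eq_0_iff_AE[OF i2] b0 by simp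
  then have "AE u in ?P. \<forall>\<rho>. measure ?P (cball u \<rho>) = measure ?Q (cball u \<rho>)"
  proof eventually_elim
    case (elim u)
    have "AE v in ?P. ?x u v = 0"
      using elim integral_nonneg_eq_0_iff_AE[OF i1[of u]] by simp
    then have "AE v in ?P. measure ?P (cball u (norm (v - u))) = measure ?Q (cball u (norm (v - u)))" by simp
    then show ?case using ball_measures_eq[OF P(1,2) Q(1,2) P(3) Q(3)] by blast
  qed
  then have balls: "AE u in lborel. 0 < f u \<longrightarrow> (\<forall>\<rho>. measure ?P (cball u \<rho>) = measure ?Q (cball u \<rho>))"
    by (subst (asm) AE_density) (auto simp: ennreal_less_zero_iff)
  \<comment> \<open>Smoothing with the uniform density on the unit ball is averaging over a small
    ball, up to scaling. Ball averages of f and g coincide almost everywhere where f > 0, and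
    \<open>L1_smoothing\<close> lets the radius tend to 0 for both.\<close>
  define V where "V = measure lborel (cball 0 1 :: 'x set)"
  have V: "0 < V" unfolding V_def by (simp add: content_cball_pos)
  define k where "k w = indicator (cball 0 1) w / V" for w :: 'x
  have k: "integrable lborel k" "\<And>w. 0 \<le> k w" "(\<integral>w. k w \<partial>lborel) = 1"
  proof -
    have i: "integrable lborel (indicator (cball 0 1) :: 'x \<Rightarrow> real)"
      using emeasure_bounded_finite[OF bounded_cball, of "0 :: 'x" 1] by (intro integrable_real_indicator) auto
    then show "integrable lborel k" unfolding k_def[abs_def] by simp
    show "0 \<le> k w" for w using V by (simp add: k_def)
    show "(\<integral>w. k w \<partial>lborel) = 1" unfolding k_def using V by (simp add: V_def)
  qed
  define h where "h n = 1 / real (Suc n)" for n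
  have h: "\<And>n. 0 < h n" "h \<longlonglongrightarrow> 0" unfolding h_def[abs_def] using LIMSEQ_inverse_real_of_nat
    by (simp_all add: inverse_eq_divide)
  define S where "S \<phi> n u = (\<integral>w. k w * \<phi> (u + h n *\<^sub>R w) \<partial>lborel)" for \<phi> :: "'x \<Rightarrow> real" and n u
  have S: "S \<phi> n u = measure (density lborel (\<lambda>x. ennreal (\<phi> x))) (cball u (h n)) / (V * h n ^ DIM('x))"
    if [measurable]: "\<phi> \<in> borel_measurable borel" and \<phi>0: "\<And>x. 0 \<le> \<phi> x" for \<phi> n u
  proof -
    have "measure (density lborel (\<lambda>x. ennreal (\<phi> x))) (cball u (h n)) = (\<integral>x. indicator (cball u (h n)) x * \<phi> x \<partial>lborel)"
      using \<phi>0 unfolding measure_def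
      by (subst emeasure_density, simp, simp, subst integral_eq_nn_integral)
        (auto intro!: arg_cong[where f = enn2real] nn_integral_cong simp: indicator_def)
    also have "\<dots> = (\<integral>w. h n ^ DIM('x) * (indicator (cball u (h n)) (u + h n *\<^sub>R w) * \<phi> (u + h n *\<^sub>R w)) \<partial>lborel)"
      by (intro integral_lborel_affine borel_measurable_times borel_measurable_indicator that h) simp
    also have "\<dots> = (\<integral>w. (V * h n ^ DIM('x)) * (k w * \<phi> (u + h n *\<^sub>R w)) \<partial>lborel)"
      using h(1)[of n] V by (intro Bochner_Integration.integral_cong) (auto simp: k_def indicator_def dist_norm)
    also have "\<dots> = (V * h n ^ DIM('x)) * S \<phi> n u" unfolding S_def by (rule integral_mult_right_zero)
    finally show ?thesis using V h(1)[of n] by simp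
  qed
  have S_eq: "AE u in lborel. 0 < f u \<longrightarrow> S f n u = S g n u" for n
    using balls by eventually_elim (simp add: S f0 g0)
  have fi: "integrable lborel f" "integrable lborel g"
    using f0 g0 f1 g1 by (auto intro!: integrableI_bounded)
  have Si: "integrable lborel (\<lambda>u. \<bar>S \<phi> n u - \<phi> u\<bar>)" if "integrable lborel \<phi>" for \<phi> n
    using that smoothing_integrable[OF that k(1,2)] unfolding S_def by auto
  have Sl: "(\<lambda>n. \<integral>u. \<bar>S \<phi> n u - \<phi> u\<bar> \<partial>lborel) \<longlonglongrightarrow> 0" if "integrable lborel \<phi>" for \<phi>
    unfolding S_def by (rule L1_smoothing[OF that k h(2)])
  let ?d = "\<lambda>u. if 0 < f u then \<bar>f u - g u\<bar> else 0"
  have di: "integrable lborel ?d"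
    by (rule Bochner_Integration.integrable_bound[of _ "\<lambda>u. \<bar>f u - g u\<bar>"]) (use fi in auto)
  have "(\<integral>u. ?d u \<partial>lborel) \<le> 0"
  proof (rule LIMSEQ_le_const)
    show "(\<lambda>n. (\<integral>u. \<bar>S f n u - f u\<bar> \<partial>lborel) + (\<integral>u. \<bar>S g n u - g u\<bar> \<partial>lborel)) \<longlonglongrightarrow> 0"
      using tendsto_add[OF Sl[OF fi(1)] Sl[OF fi(2)]] by simp
    have "(\<integral>u. ?d u \<partial>lborel) \<le> (\<integral>u. \<bar>S f n u - f u\<bar> \<partial>lborel) + (\<integral>u. \<bar>S g n u - g u\<bar> \<partial>lborel)" for n
    proof -
      have "(\<integral>u. ?d u \<partial>lborel) \<le> (\<integral>u. \<bar>S f n u - f u\<bar> + \<bar>S g n u - g u\<bar> \<partial>lborel)"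
      proof (rule integral_mono_AE[OF di])
        show "AE u in lborel. ?d u \<le> \<bar>S f n u - f u\<bar> + \<bar>S g n u - g u\<bar>"
          using S_eq[of n] by eventually_elim auto
      qed (use Si fi in auto)
      also have "\<dots> = (\<integral>u. \<bar>S f n u - f u\<bar> \<partial>lborel) + (\<integral>u. \<bar>S g n u - g u\<bar> \<partial>lborel)"
        using Si fi by simp
      finally show ?thesis .
    qed
    then show "\<exists>N. \<forall>n\<ge>N. (\<integral>u. ?d u \<partial>lborel) \<le> (\<integral>u. \<bar>S f n u - f u\<bar> \<partial>lborel) + (\<integral>u. \<bar>S g n u - g u\<bar> \<partial>lborel)" by blast
  qed
  moreover have "0 \<le> (\<integral>u. ?d u \<partial>lborel)" by (rule integral_nonneg_AE) auto
  ultimately have "(\<integral>u. ?d u \<partial>lborel) = 0" by linarith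
  then have "AE u in lborel. ?d u = 0"
    using integral_nonneg_eq_0_iff_AE[OF di] by simp
  then have pos: "AE u in lborel. 0 < f u \<longrightarrow> f u = g u" by eventually_elim (auto split: if_splits)
  \<comment> \<open>On the zeros of f nothing is known about g except its sign. So g - f is
    nonnegative almost everywhere, and its integral is 1 - 1 = 0.\<close>
  have gi: "integrable lborel (\<lambda>u. g u - f u)" using fi by auto
  have nn: "AE u in lborel. 0 \<le> g u - f u"
    using pos by eventually_elim (metis diff_ge_0_iff_ge f0 g0 less_eq_real_def)
  have "(\<integral>u. g u - f u \<partial>lborel) = 0"
  proof -
    have "(\<integral>u. f u \<partial>lborel) = 1" "(\<integral>u. g u \<partial>lborel) = 1"
      using f0 g0 f1 g1 by (simp_all add: integral_eq_nn_integral)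
    then show ?thesis using fi by simp
  qed
  then have "AE u in lborel. g u - f u = 0" using integral_nonneg_eq_0_iff_AE[OF gi nn] by simp
  then show ?thesis by eventually_elim simp
qed

section \<open>Conditional independence and the resampling density\<close>

lemma measure_eqI_rectangles:
  fixes P Q :: "('a::second_countable_topology \<times> 'b::second_countable_topology) measure"
  assumes P: "finite_measure P" "sets P = sets borel" and Q: "sets Q = sets borel"
    and eq: "\<And>A B. A \<in> sets borel \<Longrightarrow> B \<in> sets borel \<Longrightarrow> emeasure P (A \<times> B) = emeasure Q (A \<times> B)"
  shows "P = Q"
proof (rule measure_eqI_generator_eq[where \<Omega> = "UNIV \<times> UNIV" and A = "\<lambda>_. UNIV \<times> UNIV"])
  let ?E = "{a \<times> b | a b. a \<in> sets (borel :: 'a measure) \<and> b \<in> sets (borel :: 'b measure)}"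
  show "Int_stable ?E" by (rule Int_stable_pair_measure_generator)
  have s: "sets (borel :: ('a \<times> 'b) measure) = sigma_sets (UNIV \<times> UNIV) ?E"
    unfolding borel_prod[symmetric] sets_pair_measure by simp
  show "sets P = sigma_sets (UNIV \<times> UNIV) ?E" "sets Q = sigma_sets (UNIV \<times> UNIV) ?E"
    using P Q s by simp_all
  show "emeasure P X = emeasure Q X" if "X \<in> ?E" for X using that eq by auto
  show "emeasure P (UNIV \<times> UNIV) \<noteq> \<infinity>" using finite_measure.emeasure_finite[OF P(1)] by simp
  show "range (\<lambda>_. UNIV \<times> UNIV) \<subseteq> ?E" by (auto intro!: exI[of _ UNIV])
qed auto

text \<open>The law of the resampling experiment is prescribed on boxes in which the covariate and
  the remaining coordinates are constrained separately, so uniqueness is needed for products of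
  rectangles.\<close>

lemma measure_eqI_PiM_rectangles:
  fixes P Q :: "('i \<Rightarrow> 'a::second_countable_topology \<times> 'b::second_countable_topology) measure"
  assumes I: "finite I" and P: "finite_measure P" "sets P = sets (PiM I (\<lambda>_. borel))" and Q: "sets Q = sets (PiM I (\<lambda>_. borel))"
    and eq: "\<And>A B. (\<And>i. i \<in> I \<Longrightarrow> A i \<in> sets borel) \<Longrightarrow> (\<And>i. i \<in> I \<Longrightarrow> B i \<in> sets borel) \<Longrightarrow>
      emeasure P (\<Pi>\<^sub>E i\<in>I. A i \<times> B i) = emeasure Q (\<Pi>\<^sub>E i\<in>I. A i \<times> B i)"
  shows "P = Q"
proof -
  define R where "R = {a \<times> b | a b. a \<in> sets (borel :: 'a measure) \<and> b \<in> sets (borel :: 'b measure)}"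
  let ?\<Omega> = "\<Pi>\<^sub>E i\<in>I. UNIV :: ('a \<times> 'b) set"
  \<comment> \<open>\<open>sets_PiM_sigma\<close> speaks of a family of finite index blocks; here I
    is the only block.\<close>
  let ?E = "{{f \<in> ?\<Omega>. \<forall>i\<in>j. f i \<in> A i} | A j. j \<in> {I} \<and> A \<in> Pi j (\<lambda>_. R)}"
  have UR: "UNIV \<in> R" unfolding R_def by (auto intro!: exI[of _ UNIV])
  have s: "sets (borel :: ('a \<times> 'b) measure) = sets (sigma UNIV R)"
    unfolding R_def borel_prod[symmetric] sets_pair_measure by simp
  have "sets (PiM I (\<lambda>_. borel :: ('a \<times> 'b) measure)) = sets (PiM I (\<lambda>_. sigma UNIV R))"
    by (rule sets_PiM_cong) (auto simp: s)
  also have "\<dots> = sets (sigma ?\<Omega> ?E)"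
  proof (rule sets_PiM_sigma)
    show "\<exists>S\<subseteq>R. countable S \<and> UNIV = \<Union>S" for i
      by (rule exI[of _ "{UNIV}"]) (use UR in simp)
  qed (use I in auto)
  also have "\<dots> = sigma_sets ?\<Omega> ?E" by (rule sets_measure_of) auto
  finally have S: "sets (PiM I (\<lambda>_. borel :: ('a \<times> 'b) measure)) = sigma_sets ?\<Omega> ?E" .
  have E_box: "\<exists>A B. (\<forall>i\<in>I. A i \<in> sets borel) \<and> (\<forall>i\<in>I. B i \<in> sets borel) \<and> X = (\<Pi>\<^sub>E i\<in>I. A i \<times> B i)" if "X \<in> ?E" for X
  proof -
    from that obtain F where F: "F \<in> Pi I (\<lambda>_. R)" "X = {f \<in> ?\<Omega>. \<forall>i\<in>I. f i \<in> F i}" by auto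
    then have "\<forall>i\<in>I. \<exists>a b. a \<in> sets borel \<and> b \<in> sets borel \<and> F i = a \<times> b" by (auto simp: Pi_iff R_def) blast
    from bchoice[OF this] obtain A where "\<forall>i\<in>I. \<exists>b. A i \<in> sets borel \<and> b \<in> sets borel \<and> F i = A i \<times> b" ..
    from bchoice[OF this] obtain B where AB: "\<forall>i\<in>I. A i \<in> sets borel \<and> B i \<in> sets borel \<and> F i = A i \<times> B i" ..
    have "X = (\<Pi>\<^sub>E i\<in>I. F i)" unfolding F(2) by (auto simp: PiE_iff extensional_def)
    also have "\<dots> = (\<Pi>\<^sub>E i\<in>I. A i \<times> B i)" by (rule PiE_cong) (use AB in auto)
    finally show ?thesis using AB by blast
  qed
  have box_E: "(\<Pi>\<^sub>E i\<in>I. A i \<times> B i) \<in> ?E" if "\<forall>i\<in>I. A i \<in> sets borel" "\<forall>i\<in>I. B i \<in> sets borel" for A B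
  proof -
    have eq: "(\<Pi>\<^sub>E i\<in>I. A i \<times> B i) = {f \<in> ?\<Omega>. \<forall>i\<in>I. f i \<in> A i \<times> B i}"
      by (auto simp: PiE_iff extensional_def)
    have mem: "(\<lambda>i. A i \<times> B i) \<in> Pi I (\<lambda>_. R)" unfolding R_def using that by blast
    show ?thesis unfolding eq
      by (rule CollectI, rule exI[of _ "\<lambda>i. A i \<times> B i"], rule exI[of _ I]) (use mem in simp)
  qed
  show ?thesis
  proof (rule measure_eqI_generator_eq[where \<Omega> = ?\<Omega> and E = ?E and A = "\<lambda>_. ?\<Omega>"])
    show "Int_stable ?E"
    proof (rule Int_stableI)
      fix X Y assume X: "X \<in> ?E" and Y: "Y \<in> ?E"
      from E_box[OF X] obtain A B where 1: "\<forall>i\<in>I. A i \<in> sets borel" "\<forall>i\<in>I. B i \<in> sets borel"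
        "X = (\<Pi>\<^sub>E i\<in>I. A i \<times> B i)" by (elim exE conjE)
      from E_box[OF Y] obtain A' B' where 2: "\<forall>i\<in>I. A' i \<in> sets borel" "\<forall>i\<in>I. B' i \<in> sets borel"
        "Y = (\<Pi>\<^sub>E i\<in>I. A' i \<times> B' i)" by (elim exE conjE)
      note * = 1 2
      have eq: "X \<inter> Y = (\<Pi>\<^sub>E i\<in>I. (A i \<inter> A' i) \<times> (B i \<inter> B' i))"
        unfolding *(3,6) PiE_Int Times_Int_Times ..
      show "X \<inter> Y \<in> ?E" unfolding eq by (rule box_E) (use * in auto)
    qed
    show "emeasure P X = emeasure Q X" if "X \<in> ?E" for X
    proof -
      from E_box[OF that] obtain A B where AB: "\<forall>i\<in>I. A i \<in> sets borel" "\<forall>i\<in>I. B i \<in> sets borel"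
        "X = (\<Pi>\<^sub>E i\<in>I. A i \<times> B i)" by (elim exE conjE)
      show ?thesis unfolding AB(3) by (rule eq) (use AB in simp_all)
    qed
    show "emeasure P ?\<Omega> \<noteq> \<infinity>" using finite_measure.emeasure_finite[OF P(1)] by simp
    have "(\<Pi>\<^sub>E i\<in>I. UNIV \<times> UNIV) \<in> ?E" by (rule box_E) auto
    then show "range (\<lambda>_. ?\<Omega>) \<subseteq> ?E" unfolding UNIV_Times_UNIV by blast
    show "sets P = sigma_sets ?\<Omega> ?E" by (rule trans[OF P(2) S])
    show "sets Q = sigma_sets ?\<Omega> ?E" by (rule trans[OF Q S])
    show "?E \<subseteq> Pow ?\<Omega>" by blast
    show "(\<Union>i. ?\<Omega>) = ?\<Omega>" by simp
  qed
qed

text \<open>By uniqueness on boxes the joint law is the product measure, from which both the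
  marginals and independence are read off.\<close>

lemma (in prob_space) iid_of_rectangles:
  fixes D :: "nat \<Rightarrow> 'a \<Rightarrow> 'b::second_countable_topology \<times> 'c::second_countable_topology"
  assumes n: "0 < n" and D: "\<And>i. i < n \<Longrightarrow> D i \<in> borel_measurable M"
    and \<mu>: "prob_space \<mu>" "sets \<mu> = sets borel"
    and eq: "\<And>A B. (\<And>i. i < n \<Longrightarrow> A i \<in> sets borel) \<Longrightarrow> (\<And>i. i < n \<Longrightarrow> B i \<in> sets borel) \<Longrightarrow>
      measure M {\<omega> \<in> space M. \<forall>i<n. D i \<omega> \<in> A i \<times> B i} = (\<Prod>i<n. measure \<mu> (A i \<times> B i))"
  shows "indep_vars (\<lambda>_. borel) D {..<n}" and "\<And>i. i < n \<Longrightarrow> distr M borel (D i) = \<mu>"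
proof -
  interpret \<mu>: prob_space \<mu> by fact
  interpret P: product_prob_space "\<lambda>_. \<mu>" "{..<n}" ..
  let ?P = "PiM {..<n} (\<lambda>_. \<mu>)" and ?D = "\<lambda>\<omega>. \<lambda>i\<in>{..<n}. D i \<omega>"
  have sP: "sets ?P = sets (PiM {..<n} (\<lambda>_. borel))" by (intro sets_PiM_cong) (auto simp: \<mu>)
  have mD: "?D \<in> measurable M (PiM {..<n} (\<lambda>_. borel))" by (rule measurable_restrict) (use D in auto)
  have rect: "A \<times> B \<in> sets (borel :: ('b \<times> 'c) measure)" if "A \<in> sets borel" "B \<in> sets borel" for A B
    using that by (simp add: borel_prod[symmetric])
  have law: "distr M (PiM {..<n} (\<lambda>_. borel)) ?D = ?P"
  proof (rule measure_eqI_PiM_rectangles)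
    show "finite_measure (distr M (PiM {..<n} (\<lambda>_. borel)) ?D)"
      using prob_space_distr[OF mD] by (simp add: prob_space.finite_measure)
    fix A :: "nat \<Rightarrow> 'b set" and B :: "nat \<Rightarrow> 'c set"
    assume AB: "\<And>i. i \<in> {..<n} \<Longrightarrow> A i \<in> sets borel" "\<And>i. i \<in> {..<n} \<Longrightarrow> B i \<in> sets borel"
    have "emeasure (distr M (PiM {..<n} (\<lambda>_. borel)) ?D) (\<Pi>\<^sub>E i\<in>{..<n}. A i \<times> B i) =
        emeasure M {\<omega> \<in> space M. \<forall>i<n. D i \<omega> \<in> A i \<times> B i}"
    proof -
      have "(\<Pi>\<^sub>E i\<in>{..<n}. A i \<times> B i) \<in> sets (PiM {..<n} (\<lambda>_. borel))"
        by (intro sets_PiM_I_finite) (use AB rect in auto)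
      moreover have "?D -` (\<Pi>\<^sub>E i\<in>{..<n}. A i \<times> B i) \<inter> space M = {\<omega> \<in> space M. \<forall>i<n. D i \<omega> \<in> A i \<times> B i}"
      proof (rule set_eqI)
        fix \<omega>
        have "?D \<omega> \<in> (\<Pi>\<^sub>E i\<in>{..<n}. A i \<times> B i) \<longleftrightarrow> (\<forall>i<n. D i \<omega> \<in> A i \<times> B i)"
          unfolding PiE_iff Ball_def lessThan_iff by simp
        then show "\<omega> \<in> ?D -` (\<Pi>\<^sub>E i\<in>{..<n}. A i \<times> B i) \<inter> space M \<longleftrightarrow>
            \<omega> \<in> {\<omega> \<in> space M. \<forall>i<n. D i \<omega> \<in> A i \<times> B i}" unfolding Int_iff vimage_eq mem_Collect_eq by blast
      qed
      ultimately show ?thesis by (simp only: emeasure_distr[OF mD])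
    qed
    also have "\<dots> = ennreal (\<Prod>i<n. measure \<mu> (A i \<times> B i))"
      unfolding emeasure_eq_measure by (subst eq) (use AB in auto)
    also have "\<dots> = (\<Prod>i<n. ennreal (measure \<mu> (A i \<times> B i)))"
      by (rule prod_ennreal[symmetric]) simp
    also have "\<dots> = (\<Prod>i<n. emeasure \<mu> (A i \<times> B i))"
      unfolding \<mu>.emeasure_eq_measure ..
    also have "\<dots> = emeasure ?P (\<Pi>\<^sub>E i\<in>{..<n}. A i \<times> B i)"
    proof (rule P.emeasure_PiM[symmetric])
      show "A i \<times> B i \<in> sets \<mu>" if "i \<in> {..<n}" for i
        unfolding \<mu>(2) using AB[OF that] by (rule rect)
    qed simp
    finally show "emeasure (distr M (PiM {..<n} (\<lambda>_. borel)) ?D) (\<Pi>\<^sub>E i\<in>{..<n}. A i \<times> B i) =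
       emeasure ?P (\<Pi>\<^sub>E i\<in>{..<n}. A i \<times> B i)" .
  qed (use sP in auto)
  show di: "distr M borel (D i) = \<mu>" if i: "i < n" for i
  proof -
    have "distr M borel (D i) = distr (distr M (PiM {..<n} (\<lambda>_. borel)) ?D) borel (\<lambda>f. f i)"
      using i mD by (subst distr_distr) (auto simp: comp_def)
    also have "\<dots> = distr ?P \<mu> (\<lambda>f. f i)" unfolding law by (rule distr_cong) (use \<mu> in auto)
    also have "\<dots> = \<mu>" using i by (intro P.PiM_component) simp
    finally show ?thesis .
  qed
  have "distr M (PiM {..<n} (\<lambda>_. borel)) ?D = PiM {..<n} (\<lambda>i. distr M borel (D i))"
    unfolding law by (rule PiM_cong) (auto simp: di)
  then show "indep_vars (\<lambda>_. borel) D {..<n}"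
    using n D by (subst indep_vars_iff_distr_eq_PiM') auto
qed

text \<open>The function \<kappa>(Z)(A) is a version of the conditional probability of X \<in> A
  given Z. Conditional independence therefore says that the product of the two indicators has
  conditional expectation \<kappa>(Z)(A) times that of the Y-indicator. Testing with events of Z and
  moving the Z-measurable factor inside removes the conditional expectations.\<close>

lemma cond_indep_iff:
  fixes S :: "'s measure"
    and X :: "'s \<Rightarrow> 'x::euclidean_space" and Y :: "'s \<Rightarrow> 'y::euclidean_space" and Z :: "'s \<Rightarrow> 'z::euclidean_space"
  assumes S: "prob_space S" and X[measurable]: "X \<in> borel_measurable S" and Y[measurable]: "Y \<in> borel_measurable S"
    and Z[measurable]: "Z \<in> borel_measurable S" and \<kappa>: "cond_distribution S X Z \<kappa>"
  shows "cond_indep S X Y Z \<longleftrightarrow> (\<forall>A\<in>sets borel. \<forall>B\<in>sets borel. \<forall>C\<in>sets borel.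
    (\<integral>\<omega>. indicator C (Z \<omega>) * (indicator A (X \<omega>) * indicator B (Y \<omega>)) \<partial>S) =
    (\<integral>\<omega>. indicator C (Z \<omega>) * (measure (\<kappa> (Z \<omega>)) A * indicator B (Y \<omega>)) \<partial>S))" (is "_ \<longleftrightarrow> ?CI")
proof -
  interpret prob_space S by fact
  define F where "F = vimage_algebra (space S) Z borel"
  have mF: "Z \<in> measurable F borel" unfolding F_def by (rule measurable_vimage_algebra1) simp
  have sF: "sets F = {Z -` C \<inter> space S | C. C \<in> sets borel}"
    unfolding F_def by (subst sets_vimage_algebra2) auto
  have sub: "subalgebra S F"
    unfolding subalgebra_def using sF by (auto simp: F_def)
  interpret F: finite_measure_subalgebra S F by unfold_locales (rule sub)
  have \<kappa>m: "\<kappa> \<in> measurable borel (prob_algebra borel)" using \<kappa> by (simp add: cond_distribution_def)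
  have \<kappa>1: "measure (\<kappa> z) A \<le> 1" "0 \<le> measure (\<kappa> z) A" for z A
    using measurable_space[OF \<kappa>m, of z] by (auto simp: space_prob_algebra prob_space.prob_le_1)
  have \<kappa>A[measurable]: "(\<lambda>z. measure (\<kappa> z) A) \<in> borel_measurable borel" if "A \<in> sets borel" for A
    unfolding measure_def
    by (intro measurable_compose[OF measurable_compose[OF measurable_prob_algebraD[OF \<kappa>m]
        measurable_emeasure_subprob_algebra[OF that]]] borel_measurable_enn2real) simp
  have ib: "integrable S f" if "f \<in> borel_measurable S" "\<And>\<omega>. \<bar>f \<omega>\<bar> \<le> 1" for f :: "'s \<Rightarrow> real"
    using that by (intro integrable_const_bound[of _ 1]) auto
  have law: "(\<integral>\<omega>. indicator C (Z \<omega>) * indicator A (X \<omega>) \<partial>S) = (\<integral>\<omega>. indicator C (Z \<omega>) * measure (\<kappa> (Z \<omega>)) A \<partial>S)"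
    if [measurable]: "A \<in> sets borel" "C \<in> sets borel" for A C
  proof -
    have "(\<integral>\<omega>. indicator C (Z \<omega>) * indicator A (X \<omega>) \<partial>S) = (\<integral>\<omega>. (indicator {\<omega> \<in> space S. X \<omega> \<in> A \<and> Z \<omega> \<in> C} \<omega> :: real) \<partial>S)"
      by (intro Bochner_Integration.integral_cong) (auto simp: indicator_def)
    also have "\<dots> = measure S {\<omega> \<in> space S. X \<omega> \<in> A \<and> Z \<omega> \<in> C}" by simp
    also have "\<dots> = (\<integral>\<omega>. indicator C (Z \<omega>) * measure (\<kappa> (Z \<omega>)) A \<partial>S)"
      using \<kappa> that by (auto simp: cond_distribution_def)
    finally show ?thesis .
  qed
  have ceX: "AE \<omega> in S. real_cond_exp S F (\<lambda>\<omega>. indicator A (X \<omega>)) \<omega> = measure (\<kappa> (Z \<omega>)) A" if A[measurable]: "A \<in> sets borel" for A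
  proof (rule F.real_cond_exp_charact)
    fix E assume "E \<in> sets F"
    then obtain C where C[measurable]: "C \<in> sets borel" and E: "E = Z -` C \<inter> space S" using sF by auto
    have "(\<integral>\<omega>\<in>E. g \<omega> \<partial>S) = (\<integral>\<omega>. indicator C (Z \<omega>) * g \<omega> \<partial>S)" for g :: "'s \<Rightarrow> real"
      unfolding set_lebesgue_integral_def E by (intro Bochner_Integration.integral_cong) (auto simp: indicator_def)
    then show "(\<integral>\<omega>\<in>E. indicator A (X \<omega>) \<partial>S) = (\<integral>\<omega>\<in>E. measure (\<kappa> (Z \<omega>)) A \<partial>S)"
      using law[OF A C] by simp
  next
    show "(\<lambda>\<omega>. measure (\<kappa> (Z \<omega>)) A) \<in> borel_measurable F"
      by (rule measurable_compose[OF mF \<kappa>A[OF A]])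
    show "integrable S (\<lambda>\<omega>. indicator A (X \<omega>) :: real)" by (rule ib) (auto simp: indicator_def)
    show "integrable S (\<lambda>\<omega>. measure (\<kappa> (Z \<omega>)) A)" by (rule ib) (auto simp: \<kappa>1)
  qed
  have mK: "(\<lambda>\<omega>. measure (\<kappa> (Z \<omega>)) A) \<in> borel_measurable F" if "A \<in> sets borel" for A
    by (rule measurable_compose[OF mF \<kappa>A[OF that]])
  have mC: "(\<lambda>\<omega>. indicator C (Z \<omega>) :: real) \<in> borel_measurable F" if "C \<in> sets borel" for C
    by (rule measurable_compose[OF mF borel_measurable_indicator[OF that]])
  let ?ceY = "\<lambda>B. real_cond_exp S F (\<lambda>\<omega>. indicator B (Y \<omega>))"
  have pull: "(\<integral>\<omega>. indicator C (Z \<omega>) * (measure (\<kappa> (Z \<omega>)) A * ?ceY B \<omega>) \<partial>S) =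
      (\<integral>\<omega>. indicator C (Z \<omega>) * (measure (\<kappa> (Z \<omega>)) A * indicator B (Y \<omega>)) \<partial>S)"
    "integrable S (\<lambda>\<omega>. measure (\<kappa> (Z \<omega>)) A * ?ceY B \<omega>)"
    if [measurable]: "A \<in> sets borel" "B \<in> sets borel" "C \<in> sets borel" for A B C
  proof -
    have "(\<integral>\<omega>. (indicator C (Z \<omega>) * measure (\<kappa> (Z \<omega>)) A) * ?ceY B \<omega> \<partial>S) =
      (\<integral>\<omega>. (indicator C (Z \<omega>) * measure (\<kappa> (Z \<omega>)) A) * indicator B (Y \<omega>) \<partial>S)"
    proof (rule F.real_cond_exp_intg(2))
      show "integrable S (\<lambda>\<omega>. indicator C (Z \<omega>) * measure (\<kappa> (Z \<omega>)) A * indicator B (Y \<omega>))"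
        by (rule ib) (auto simp: \<kappa>1 indicator_def)
    qed (use mK mC that in auto)
    then show "(\<integral>\<omega>. indicator C (Z \<omega>) * (measure (\<kappa> (Z \<omega>)) A * ?ceY B \<omega>) \<partial>S) =
      (\<integral>\<omega>. indicator C (Z \<omega>) * (measure (\<kappa> (Z \<omega>)) A * indicator B (Y \<omega>)) \<partial>S)" by (simp add: mult.assoc)
    show "integrable S (\<lambda>\<omega>. measure (\<kappa> (Z \<omega>)) A * ?ceY B \<omega>)"
    proof (rule F.real_cond_exp_intg(1))
      show "integrable S (\<lambda>\<omega>. measure (\<kappa> (Z \<omega>)) A * indicator B (Y \<omega>))"
        by (rule ib) (auto simp: \<kappa>1 indicator_def)
    qed (use mK that in auto)
  qed
  have ceXY: "(AE \<omega> in S. real_cond_exp S F (\<lambda>\<omega>. indicator A (X \<omega>) * indicator B (Y \<omega>)) \<omega> = measure (\<kappa> (Z \<omega>)) A * ?ceY B \<omega>)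
    \<longleftrightarrow> (\<forall>C\<in>sets borel. (\<integral>\<omega>. indicator C (Z \<omega>) * (indicator A (X \<omega>) * indicator B (Y \<omega>)) \<partial>S) =
      (\<integral>\<omega>. indicator C (Z \<omega>) * (measure (\<kappa> (Z \<omega>)) A * indicator B (Y \<omega>)) \<partial>S))" (is "?L \<longleftrightarrow> ?R")
    if A[measurable]: "A \<in> sets borel" and B[measurable]: "B \<in> sets borel" for A B
  proof
    assume L: ?L
    show ?R
    proof
      fix C :: "'z set" assume C[measurable]: "C \<in> sets borel"
      have "(\<integral>\<omega>. indicator C (Z \<omega>) * (indicator A (X \<omega>) * indicator B (Y \<omega>)) \<partial>S) =
          (\<integral>\<omega>. indicator C (Z \<omega>) * real_cond_exp S F (\<lambda>\<omega>. indicator A (X \<omega>) * indicator B (Y \<omega>)) \<omega> \<partial>S)"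
      proof (rule F.real_cond_exp_intg(2)[symmetric])
        show "integrable S (\<lambda>\<omega>. indicator C (Z \<omega>) * (indicator A (X \<omega>) * indicator B (Y \<omega>)) :: real)"
          by (rule ib) (auto simp: indicator_def)
      qed (use mC in auto)
      also have "\<dots> = (\<integral>\<omega>. indicator C (Z \<omega>) * (measure (\<kappa> (Z \<omega>)) A * ?ceY B \<omega>) \<partial>S)"
      proof (rule integral_cong_AE)
        show "AE \<omega> in S. indicator C (Z \<omega>) * real_cond_exp S F (\<lambda>\<omega>. indicator A (X \<omega>) * indicator B (Y \<omega>)) \<omega> =
          indicator C (Z \<omega>) * (measure (\<kappa> (Z \<omega>)) A * ?ceY B \<omega>)"
          using L by eventually_elim simp
      qed (use borel_measurable_cond_exp2[of S F] in simp_all)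
      also have "\<dots> = (\<integral>\<omega>. indicator C (Z \<omega>) * (measure (\<kappa> (Z \<omega>)) A * indicator B (Y \<omega>)) \<partial>S)"
        by (rule pull(1)[OF A B C])
      finally show "(\<integral>\<omega>. indicator C (Z \<omega>) * (indicator A (X \<omega>) * indicator B (Y \<omega>)) \<partial>S) =
        (\<integral>\<omega>. indicator C (Z \<omega>) * (measure (\<kappa> (Z \<omega>)) A * indicator B (Y \<omega>)) \<partial>S)" .
    qed
  next
    assume R: ?R
    show ?L
    proof (rule F.real_cond_exp_charact)
      fix E assume "E \<in> sets F"
      then obtain C where C[measurable]: "C \<in> sets borel" and E: "E = Z -` C \<inter> space S" using sF by auto
      have "(\<integral>\<omega>\<in>E. g \<omega> \<partial>S) = (\<integral>\<omega>. indicator C (Z \<omega>) * g \<omega> \<partial>S)" for g :: "'s \<Rightarrow> real"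
        unfolding set_lebesgue_integral_def E by (intro Bochner_Integration.integral_cong) (auto simp: indicator_def)
      then show "(\<integral>\<omega>\<in>E. indicator A (X \<omega>) * indicator B (Y \<omega>) \<partial>S) = (\<integral>\<omega>\<in>E. measure (\<kappa> (Z \<omega>)) A * ?ceY B \<omega> \<partial>S)"
        using R C pull(1)[OF A B C] by simp
    next
      show "(\<lambda>\<omega>. measure (\<kappa> (Z \<omega>)) A * ?ceY B \<omega>) \<in> borel_measurable F"
        by (rule borel_measurable_times[OF mK[OF A] borel_measurable_cond_exp])
      show "integrable S (\<lambda>\<omega>. measure (\<kappa> (Z \<omega>)) A * ?ceY B \<omega>)" by (rule pull(2)[OF A B sets.top])
      show "integrable S (\<lambda>\<omega>. indicator A (X \<omega>) * indicator B (Y \<omega>) :: real)" by (rule ib) (auto simp: indicator_def)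
    qed
  qed
  have ce_swap: "(AE \<omega> in S. real_cond_exp S F (\<lambda>\<omega>. indicator A (X \<omega>) * indicator B (Y \<omega>)) \<omega> =
        real_cond_exp S F (\<lambda>\<omega>. indicator A (X \<omega>)) \<omega> * ?ceY B \<omega>) \<longleftrightarrow>
      (AE \<omega> in S. real_cond_exp S F (\<lambda>\<omega>. indicator A (X \<omega>) * indicator B (Y \<omega>)) \<omega> = measure (\<kappa> (Z \<omega>)) A * ?ceY B \<omega>)"
    if "A \<in> sets borel" for A B
  proof
    assume "AE \<omega> in S. real_cond_exp S F (\<lambda>\<omega>. indicator A (X \<omega>) * indicator B (Y \<omega>)) \<omega> =
        real_cond_exp S F (\<lambda>\<omega>. indicator A (X \<omega>)) \<omega> * ?ceY B \<omega>"
    with ceX[OF that] show "AE \<omega> in S. real_cond_exp S F (\<lambda>\<omega>. indicator A (X \<omega>) * indicator B (Y \<omega>)) \<omega> =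
      measure (\<kappa> (Z \<omega>)) A * ?ceY B \<omega>" by eventually_elim simp
  next
    assume "AE \<omega> in S. real_cond_exp S F (\<lambda>\<omega>. indicator A (X \<omega>) * indicator B (Y \<omega>)) \<omega> =
      measure (\<kappa> (Z \<omega>)) A * ?ceY B \<omega>"
    with ceX[OF that] show "AE \<omega> in S. real_cond_exp S F (\<lambda>\<omega>. indicator A (X \<omega>) * indicator B (Y \<omega>)) \<omega> =
        real_cond_exp S F (\<lambda>\<omega>. indicator A (X \<omega>)) \<omega> * ?ceY B \<omega>" by eventually_elim simp
  qed
  show ?thesis unfolding cond_indep_def Let_def F_def[symmetric]
    by (intro ball_cong refl) (simp only: ce_swap ceXY)
qed

section \<open>The density of a resampled triple\<close>

locale crt_model = J1: joint_density p C
  for p :: "'x::euclidean_space \<times> 'y::euclidean_space \<times> 'z::euclidean_space \<Rightarrow> real" and C +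
  fixes \<kappa> :: "'z \<Rightarrow> 'x measure"
  assumes \<kappa>_meas: "\<kappa> \<in> measurable borel (prob_algebra borel)"
    and y_marg: "\<And>x z. (\<integral>\<^sup>+y. ennreal (p (x, y, z)) \<partial>lborel) \<le> ennreal C"
    and xy_marg: "\<And>z. (\<integral>\<^sup>+w. ennreal (p (fst w, snd w, z)) \<partial>lborel) \<le> ennreal C"
    and \<kappa>_law: "\<And>A B. A \<in> sets borel \<Longrightarrow> B \<in> sets borel \<Longrightarrow>
      measure J1.\<nu> {w. fst w \<in> A \<and> snd (snd w) \<in> B} =
      (\<integral>w. indicator B (snd (snd w)) * measure (\<kappa> (snd (snd w))) A \<partial>J1.\<nu>)"
begin

definition pXZ :: "'x \<times> 'z \<Rightarrow> real" where
  "pXZ w = (\<integral>y. p (fst w, y, snd w) \<partial>lborel)"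

lemma p_triple_measurable[measurable (raw)]:
  assumes "f \<in> borel_measurable N" "g \<in> borel_measurable N" "h \<in> borel_measurable N"
  shows "(\<lambda>x. p (f x, g x, h x)) \<in> borel_measurable N"
  using measurable_compose[OF borel_measurable_Pair[OF assms(1) borel_measurable_Pair[OF assms(2,3)]] J1.meas] .

lemma ennreal_pXZ: "ennreal (pXZ (x, z)) = (\<integral>\<^sup>+y. ennreal (p (x, y, z)) \<partial>lborel)"
proof -
  have "integrable lborel (\<lambda>y. p (x, y, z))"
    using J1.nonneg y_marg[of x z] by (intro integrableI_bounded) (auto simp: le_less_trans)
  then show ?thesis unfolding pXZ_def using J1.nonneg
    by (subst nn_integral_eq_integral) auto
qed

lemma pXZ_nonneg: "0 \<le> pXZ w"
  unfolding pXZ_def using J1.nonneg by (intro integral_nonneg_AE) auto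

lemma pXZ_measurable[measurable]: "pXZ \<in> borel_measurable borel"
proof -
  have "(\<lambda>w. \<integral>y. p (fst w, y, snd w) \<partial>lborel) \<in> borel_measurable (borel :: ('x \<times> 'z) measure)"
    by (rule lborel.borel_measurable_lebesgue_integral) measurable
  then show ?thesis by (simp add: pXZ_def[abs_def])
qed

text \<open>With y innermost, the inner integral of p is \<open>pXZ\<close>.\<close>

lemma nn_integral_triple:
  assumes f[measurable]: "f \<in> borel_measurable (borel :: ('x \<times> 'y \<times> 'z) measure)"
  shows "(\<integral>\<^sup>+w. f w \<partial>lborel) = (\<integral>\<^sup>+x. \<integral>\<^sup>+z. \<integral>\<^sup>+y. f (x, y, z) \<partial>lborel \<partial>lborel \<partial>lborel)"
proof -
  have m[measurable]: "f \<in> borel_measurable (lborel \<Otimes>\<^sub>M lborel)" by (simp add: lborel_prod)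
  have m2: "(\<lambda>v. f (x, v)) \<in> borel_measurable (lborel \<Otimes>\<^sub>M lborel)" for x
    by (simp add: lborel_prod)
  have "(\<integral>\<^sup>+w. f w \<partial>lborel) = (\<integral>\<^sup>+w. f w \<partial>(lborel \<Otimes>\<^sub>M lborel))" by (simp add: lborel_prod)
  also have "\<dots> = (\<integral>\<^sup>+x. \<integral>\<^sup>+v. f (x, v) \<partial>lborel \<partial>lborel)"
    by (rule lborel.nn_integral_fst[OF m, symmetric])
  also have "\<dots> = (\<integral>\<^sup>+x. \<integral>\<^sup>+z. \<integral>\<^sup>+y. f (x, y, z) \<partial>lborel \<partial>lborel \<partial>lborel)"
  proof (rule nn_integral_cong)
    fix x
    have "(\<integral>\<^sup>+v. f (x, v) \<partial>lborel) = (\<integral>\<^sup>+v. f (x, v) \<partial>(lborel \<Otimes>\<^sub>M lborel))" by (simp add: lborel_prod)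
    also have "\<dots> = (\<integral>\<^sup>+z. \<integral>\<^sup>+y. f (x, y, z) \<partial>lborel \<partial>lborel)"
      by (rule lborel_pair.nn_integral_snd[OF m2, symmetric])
    finally show "(\<integral>\<^sup>+v. f (x, v) \<partial>lborel) = (\<integral>\<^sup>+z. \<integral>\<^sup>+y. f (x, y, z) \<partial>lborel \<partial>lborel)" .
  qed
  finally show ?thesis .
qed

sublocale J2: joint_density pXZ C
proof
  show "pXZ \<in> borel_measurable borel" by simp
  show "0 \<le> pXZ w" for w by (rule pXZ_nonneg)
  show "0 \<le> C" by (rule J1.C_nonneg)
  have "(\<integral>\<^sup>+w. ennreal (pXZ w) \<partial>lborel) = (\<integral>\<^sup>+x. \<integral>\<^sup>+z. ennreal (pXZ (x, z)) \<partial>lborel \<partial>lborel)"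
    unfolding lborel_prod[symmetric] by (subst lborel.nn_integral_fst[symmetric]) (simp_all add: lborel_prod)
  also have "\<dots> = 1"
    unfolding ennreal_pXZ nn_integral_triple[of "\<lambda>w. ennreal (p w)", simplified, symmetric] by (rule J1.total)
  finally show "(\<integral>\<^sup>+w. ennreal (pXZ w) \<partial>lborel) = 1" .
  show "(\<integral>\<^sup>+x. ennreal (pXZ (x, z)) \<partial>lborel) \<le> ennreal C" for z
  proof -
    have "(\<integral>\<^sup>+x. ennreal (pXZ (x, z)) \<partial>lborel) = (\<integral>\<^sup>+w. ennreal (p (fst w, snd w, z)) \<partial>lborel)"
      unfolding ennreal_pXZ lborel_prod[symmetric]
      by (subst lborel.nn_integral_fst[symmetric]) (simp_all add: lborel_prod)
    also have "\<dots> \<le> ennreal C" by (rule xy_marg)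
    finally show ?thesis .
  qed
qed

lemma rect_XZ_measurable: "A \<in> sets borel \<Longrightarrow> B \<in> sets borel \<Longrightarrow> {w :: 'x \<times> 'y \<times> 'z. fst w \<in> A \<and> snd (snd w) \<in> B} \<in> sets borel"
proof -
  assume A: "A \<in> sets borel" and B: "B \<in> sets borel"
  have "{w :: 'x \<times> 'y \<times> 'z. fst w \<in> A \<and> snd (snd w) \<in> B} = fst -` A \<inter> (\<lambda>w. snd (snd w)) -` B" by auto
  moreover have "fst -` A \<in> sets (borel :: ('x \<times> 'y \<times> 'z) measure)"
    using measurable_sets[OF borel_fst A] by simp
  moreover have "(\<lambda>w :: 'x \<times> 'y \<times> 'z. snd (snd w)) -` B \<in> sets borel"
    using measurable_sets[OF measurable_compose[OF borel_snd borel_snd] B] by simp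
  ultimately show ?thesis by auto
qed

lemma law_XZ: "distr J1.\<nu> borel (\<lambda>w. (fst w, snd (snd w))) = J2.\<nu>"
proof (rule measure_eqI_rectangles)
  interpret N: prob_space J1.\<nu> by (rule J1.prob_space_\<nu>)
  have m: "(\<lambda>w. (fst w, snd (snd w))) \<in> measurable J1.\<nu> (borel :: ('x \<times> 'z) measure)"
    by (intro borel_measurable_Pair) measurable
  show "finite_measure (distr J1.\<nu> borel (\<lambda>w. (fst w, snd (snd w))))"
    using N.prob_space_distr[OF m] by (simp add: prob_space.finite_measure)
  fix A :: "'x set" and B :: "'z set" assume A[measurable]: "A \<in> sets borel" and B[measurable]: "B \<in> sets borel"
  have AB: "A \<times> B \<in> sets borel" using A B by (simp add: borel_prod[symmetric])
  have "emeasure (distr J1.\<nu> borel (\<lambda>w. (fst w, snd (snd w)))) (A \<times> B) = emeasure J1.\<nu> {w. fst w \<in> A \<and> snd (snd w) \<in> B}"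
    by (subst emeasure_distr[OF m AB]) (auto intro!: arg_cong[where f = "emeasure J1.\<nu>"])
  also have "\<dots> = (\<integral>\<^sup>+w. ennreal (p w) * indicator {w. fst w \<in> A \<and> snd (snd w) \<in> B} w \<partial>lborel)"
    unfolding J1.\<nu>_def using rect_XZ_measurable[OF A B] by (intro emeasure_density) auto
  also have "\<dots> = (\<integral>\<^sup>+x. \<integral>\<^sup>+z. \<integral>\<^sup>+y. ennreal (p (x, y, z)) * indicator {w. fst w \<in> A \<and> snd (snd w) \<in> B} (x, y, z) \<partial>lborel \<partial>lborel \<partial>lborel)"
    by (rule nn_integral_triple) (use rect_XZ_measurable[OF A B] in auto)
  also have "\<dots> = (\<integral>\<^sup>+x. \<integral>\<^sup>+z. \<integral>\<^sup>+y. (indicator A x * indicator B z) * ennreal (p (x, y, z)) \<partial>lborel \<partial>lborel \<partial>lborel)"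
    by (intro nn_integral_cong) (auto simp: indicator_def)
  also have "\<dots> = (\<integral>\<^sup>+x. \<integral>\<^sup>+z. (indicator A x * indicator B z) * ennreal (pXZ (x, z)) \<partial>lborel \<partial>lborel)"
    unfolding ennreal_pXZ by (intro nn_integral_cong nn_integral_cmult) measurable
  also have "\<dots> = (\<integral>\<^sup>+w. ennreal (pXZ w) * indicator (A \<times> B) w \<partial>(lborel \<Otimes>\<^sub>M lborel))"
    using AB by (subst lborel.nn_integral_fst[symmetric])
      (auto simp: lborel_prod indicator_def intro!: nn_integral_cong)
  also have "\<dots> = emeasure J2.\<nu> (A \<times> B)"
    unfolding J2.\<nu>_def lborel_prod using AB by (intro emeasure_density[symmetric]) auto
  finally show "emeasure (distr J1.\<nu> borel (\<lambda>w. (fst w, snd (snd w)))) (A \<times> B) = emeasure J2.\<nu> (A \<times> B)" .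
qed simp_all

lemma integral_XZ:
  fixes f :: "'x \<times> 'z \<Rightarrow> real"
  assumes "f \<in> borel_measurable borel"
  shows "(\<integral>w. f (fst w, snd (snd w)) \<partial>J1.\<nu>) = (\<integral>w. f w \<partial>J2.\<nu>)"
  unfolding law_XZ[symmetric] using assms
  by (subst integral_distr) (auto intro!: borel_measurable_Pair)

lemma AE_XZ:
  assumes "AE w in J2.\<nu>. P w" shows "AE w in J1.\<nu>. P (fst w, snd (snd w))"
proof -
  have m: "(\<lambda>w. (fst w, snd (snd w))) \<in> measurable J1.\<nu> (borel :: ('x \<times> 'z) measure)"
    by (intro borel_measurable_Pair) measurable
  show ?thesis using assms unfolding law_XZ[symmetric] by (rule AE_distrD[OF m])
qed

text \<open>The density of a resampled triple; it is 0 where the density of \<open>Z\<close> vanishes, as \<open>x / 0 = 0\<close>.\<close>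

definition q :: "'x \<times> 'y \<times> 'z \<Rightarrow> real" where
  "q w = pXZ (fst w, snd (snd w)) * (J1.slice UNIV (snd w) / J2.slice UNIV (snd (snd w)))"

lemma kappa_measurable[measurable]: "A \<in> sets borel \<Longrightarrow> (\<lambda>z. measure (\<kappa> z) A) \<in> borel_measurable borel"
  unfolding measure_def
  by (intro measurable_compose[OF measurable_compose[OF measurable_prob_algebraD[OF \<kappa>_meas]
        measurable_emeasure_subprob_algebra]] borel_measurable_enn2real) simp_all

lemma kappa_bounds: "measure (\<kappa> z) A \<le> 1" "0 \<le> measure (\<kappa> z) A" "measure (\<kappa> z) UNIV = 1"
proof -
  have k: "prob_space (\<kappa> z)" "sets (\<kappa> z) = sets borel"
    using measurable_space[OF \<kappa>_meas, of z] by (auto simp: space_prob_algebra)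
  then show "measure (\<kappa> z) A \<le> 1" "0 \<le> measure (\<kappa> z) A" by (auto simp: prob_space.prob_le_1)
  show "measure (\<kappa> z) UNIV = 1" using prob_space.prob_space[OF k(1)] sets_eq_imp_space_eq[OF k(2)] by simp
qed

text \<open>Both sides have the same integral over every Borel set of z, by
  \<open>\<kappa>_law\<close>. The exceptional null set may depend on A. Multiplying by the density
  of Z instead of dividing keeps the identity meaningful at its zeros.\<close>

lemma kappa_slice:
  assumes A[measurable]: "A \<in> sets borel"
  shows "AE z in lborel. measure (\<kappa> z) A * J2.slice UNIV z = J2.slice A z"
proof (rule density_unique_real)
  have U: "UNIV \<in> sets (borel :: 'x measure)" by simp
  show "integrable lborel (\<lambda>z. measure (\<kappa> z) A * J2.slice UNIV z)"
  proof (rule Bochner_Integration.integrable_bound[OF J2.integrable_slice[OF U]])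
    show "AE z in lborel. norm (measure (\<kappa> z) A * J2.slice UNIV z) \<le> norm (J2.slice UNIV z)"
      using kappa_bounds J2.slice_nonneg by (intro AE_I2) (auto simp: abs_mult intro!: mult_left_le_one_le)
  qed (use A in measurable)
  show "integrable lborel (J2.slice A)" by (rule J2.integrable_slice[OF A])
  fix B :: "'z set" assume "B \<in> sets lborel"
  then have B[measurable]: "B \<in> sets borel" by simp
  have "(\<integral>z\<in>B. measure (\<kappa> z) A * J2.slice UNIV z \<partial>lborel) = (\<integral>z. (indicator B z * measure (\<kappa> z) A) * J2.slice UNIV z \<partial>lborel)"
    unfolding set_lebesgue_integral_def by (simp add: mult.assoc)
  also have "\<dots> = (\<integral>w. indicator UNIV (fst w) * (indicator B (snd w) * measure (\<kappa> (snd w)) A) \<partial>J2.\<nu>)"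
    by (rule J2.integral_\<nu>[symmetric]) (auto simp: kappa_bounds)
  also have "\<dots> = (\<integral>w. indicator B (snd (snd w)) * measure (\<kappa> (snd (snd w))) A \<partial>J1.\<nu>)"
    by (subst integral_XZ[symmetric]) auto
  also have "\<dots> = measure J1.\<nu> {w. fst w \<in> A \<and> snd (snd w) \<in> B}" by (rule \<kappa>_law[OF A B, symmetric])
  also have "\<dots> = (\<integral>w. indicator {w. fst w \<in> A \<and> snd (snd w) \<in> B} w \<partial>J1.\<nu>)"
    using rect_XZ_measurable[OF A B] by simp
  also have "\<dots> = (\<integral>w. (\<lambda>w. indicator A (fst w) * indicator B (snd w)) (fst w, snd (snd w)) \<partial>J1.\<nu>)"
    by (intro Bochner_Integration.integral_cong) (auto simp: indicator_def)
  also have "\<dots> = (\<integral>w. indicator A (fst w) * indicator B (snd w) \<partial>J2.\<nu>)"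
    by (rule integral_XZ) measurable
  also have "\<dots> = (\<integral>z. indicator B z * J2.slice A z \<partial>lborel)"
    by (rule J2.integral_\<nu>) auto
  also have "\<dots> = (\<integral>z\<in>B. J2.slice A z \<partial>lborel)" unfolding set_lebesgue_integral_def by simp
  finally show "(\<integral>z\<in>B. measure (\<kappa> z) A * J2.slice UNIV z \<partial>lborel) = (\<integral>z\<in>B. J2.slice A z \<partial>lborel)" .
qed

lemma AE_slice_Z_pos: "AE w in J1.\<nu>. 0 < J2.slice UNIV (snd (snd w))"
  using AE_XZ[OF J2.AE_slice_pos] by simp

text \<open>The previous identity, moved from Lebesgue measure to the law of the data; there the
  density of Z is positive almost everywhere, and division is possible.\<close>

lemma AE_kappa:
  assumes A[measurable]: "A \<in> sets borel"
  shows "AE w in J1.\<nu>. measure (\<kappa> (snd (snd w))) A = J2.slice A (snd (snd w)) / J2.slice UNIV (snd (snd w))"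
proof -
  let ?D = "\<lambda>z. \<bar>measure (\<kappa> z) A * J2.slice UNIV z - J2.slice A z\<bar>"
  have "(\<integral>\<^sup>+w. indicator UNIV (fst w) * ennreal (?D (snd w)) \<partial>J2.\<nu>) = (\<integral>\<^sup>+z. ennreal (?D z) * ennreal (J2.slice UNIV z) \<partial>lborel)"
    by (rule J2.nn_integral_\<nu>) auto
  also have "\<dots> = (\<integral>\<^sup>+z. 0 \<partial>(lborel :: 'z measure))"
  proof (rule nn_integral_cong_AE)
    show "AE z in lborel. ennreal (?D z) * ennreal (J2.slice UNIV z) = 0"
      using kappa_slice[OF A] by eventually_elim simp
  qed
  finally have "(\<integral>\<^sup>+w. ennreal (?D (snd w)) \<partial>J2.\<nu>) = 0" by simp
  then have "AE w in J2.\<nu>. ennreal (?D (snd w)) = 0"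
    by (subst (asm) nn_integral_0_iff_AE) auto
  then have "AE w in J1.\<nu>. ennreal (?D (snd (snd w))) = 0" using AE_XZ by fastforce
  with AE_slice_Z_pos show ?thesis by eventually_elim (auto simp: field_simps)
qed

lemma q_nonneg: "0 \<le> q w"
  unfolding q_def using pXZ_nonneg J1.slice_nonneg J2.slice_nonneg
  by (intro mult_nonneg_nonneg divide_nonneg_nonneg) auto

lemma q_measurable[measurable]: "q \<in> borel_measurable borel"
proof -
  have "(\<lambda>w :: 'x \<times> 'y \<times> 'z. pXZ (fst w, snd (snd w))) \<in> borel_measurable borel"
    by (rule measurable_compose[OF _ pXZ_measurable], intro borel_measurable_Pair) measurable
  moreover have "(\<lambda>w :: 'x \<times> 'y \<times> 'z. J2.slice UNIV (snd (snd w))) \<in> borel_measurable borel"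
    by (rule measurable_compose[OF measurable_compose[OF borel_snd borel_snd] J2.slice_measurable]) simp
  ultimately show ?thesis unfolding q_def[abs_def]
    using J1.slice_snd_measurable by (intro borel_measurable_times borel_measurable_divide)
qed

lemma nn_integral_q_slice:
  assumes A[measurable]: "A \<in> sets borel"
  shows "(\<integral>\<^sup>+x. indicator A x * ennreal (q (x, v)) \<partial>lborel) =
    ennreal (J2.slice A (snd v) / J2.slice UNIV (snd v) * J1.slice UNIV v)"
proof -
  let ?c = "J1.slice UNIV v / J2.slice UNIV (snd v)"
  have c: "0 \<le> ?c" using J1.slice_nonneg J2.slice_nonneg by simp
  have [measurable]: "(\<lambda>x. pXZ (x, snd v)) \<in> borel_measurable borel"
    using measurable_compose[OF _ pXZ_measurable, of "\<lambda>x. (x, snd v)"] by simp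
  have "(\<integral>\<^sup>+x. indicator A x * ennreal (q (x, v)) \<partial>lborel) = (\<integral>\<^sup>+x. ennreal ?c * (indicator A x * ennreal (pXZ (x, snd v))) \<partial>lborel)"
    using c pXZ_nonneg unfolding q_def by (intro nn_integral_cong) (simp add: ennreal_mult' mult_ac flip: ennreal_mult')
  also have "\<dots> = ennreal ?c * (\<integral>\<^sup>+x. indicator A x * ennreal (pXZ (x, snd v)) \<partial>lborel)"
    by (rule nn_integral_cmult) measurable
  also have "\<dots> = ennreal ?c * ennreal (J2.slice A (snd v))" by (simp only: J2.ennreal_slice[OF A])
  also have "\<dots> = ennreal (J2.slice A (snd v) / J2.slice UNIV (snd v) * J1.slice UNIV v)"
    using c J2.slice_nonneg by (simp add: ennreal_mult[symmetric] mult.commute)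
  finally show ?thesis .
qed

text \<open>Identifies q as the density of a triple whose covariate is drawn from \<kappa> at z:
  integrating an indicator of the covariate against q averages its \<kappa>-probability over the
  data.\<close>

lemma nn_integral_q:
  assumes A[measurable]: "A \<in> sets borel" and F[measurable]: "F \<in> borel_measurable borel"
  shows "(\<integral>\<^sup>+w. indicator A (fst w) * F (snd w) * ennreal (q w) \<partial>lborel) =
    (\<integral>\<^sup>+w. ennreal (measure (\<kappa> (snd (snd w))) A) * F (snd w) \<partial>J1.\<nu>)"
proof -
  have [measurable]: "q \<in> borel_measurable (borel \<Otimes>\<^sub>M borel)" using q_measurable by (simp add: borel_prod)
  have m2: "(\<lambda>v :: 'y \<times> 'z. J2.slice A (snd v)) \<in> borel_measurable borel" if "A \<in> sets borel" for A
    by (rule measurable_compose[OF borel_snd J2.slice_measurable[OF that]])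
  note m2[OF A, measurable] m2[of UNIV, simplified, measurable]
  let ?G = "\<lambda>v. ennreal (J2.slice A (snd v) / J2.slice UNIV (snd v)) * F v"
  have qv: "(\<lambda>x. q (x, v)) \<in> borel_measurable borel" for v
    using measurable_compose[OF _ q_measurable, of "\<lambda>x. (x, v)"] by simp
  have "(\<integral>\<^sup>+w. indicator A (fst w) * F (snd w) * ennreal (q w) \<partial>lborel) =
      (\<integral>\<^sup>+v. \<integral>\<^sup>+x. indicator A x * F v * ennreal (q (x, v)) \<partial>lborel \<partial>lborel)"
  proof -
    let ?f = "\<lambda>w. indicator A (fst w) * F (snd w) * ennreal (q w)"
    have "?f \<in> borel_measurable (lborel \<Otimes>\<^sub>M lborel)" by measurable
    from lborel_pair.nn_integral_snd[OF this] show ?thesis by (simp add: lborel_prod)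
  qed
  also have "\<dots> = (\<integral>\<^sup>+v. F v * ennreal (J2.slice A (snd v) / J2.slice UNIV (snd v) * J1.slice UNIV v) \<partial>lborel)"
  proof (rule nn_integral_cong)
    fix v
    have "(\<integral>\<^sup>+x. indicator A x * F v * ennreal (q (x, v)) \<partial>lborel) = (\<integral>\<^sup>+x. F v * (indicator A x * ennreal (q (x, v))) \<partial>lborel)"
      by (intro nn_integral_cong) (simp add: mult_ac)
    also have "\<dots> = F v * (\<integral>\<^sup>+x. indicator A x * ennreal (q (x, v)) \<partial>lborel)"
      by (rule nn_integral_cmult) (use qv[of v] in measurable)
    finally show "(\<integral>\<^sup>+x. indicator A x * F v * ennreal (q (x, v)) \<partial>lborel) =
      F v * ennreal (J2.slice A (snd v) / J2.slice UNIV (snd v) * J1.slice UNIV v)"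
      by (simp only: nn_integral_q_slice[OF A])
  qed
  also have "\<dots> = (\<integral>\<^sup>+v. ?G v * ennreal (J1.slice UNIV v) \<partial>lborel)"
  proof (rule nn_integral_cong)
    fix v
    have "ennreal (J2.slice A (snd v) / J2.slice UNIV (snd v) * J1.slice UNIV v) =
        ennreal (J2.slice A (snd v) / J2.slice UNIV (snd v)) * ennreal (J1.slice UNIV v)"
      by (rule ennreal_mult) (use J1.slice_nonneg J2.slice_nonneg in simp_all)
    then show "F v * ennreal (J2.slice A (snd v) / J2.slice UNIV (snd v) * J1.slice UNIV v) = ?G v * ennreal (J1.slice UNIV v)"
      by (simp only: mult_ac)
  qed
  also have "\<dots> = (\<integral>\<^sup>+w. indicator UNIV (fst w) * ?G (snd w) \<partial>J1.\<nu>)"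
    by (rule J1.nn_integral_\<nu>[symmetric]) measurable
  also have "\<dots> = (\<integral>\<^sup>+w. ennreal (measure (\<kappa> (snd (snd w))) A) * F (snd w) \<partial>J1.\<nu>)"
  proof (rule nn_integral_cong_AE)
    show "AE w in J1.\<nu>. indicator UNIV (fst w) * ?G (snd w) = ennreal (measure (\<kappa> (snd (snd w))) A) * F (snd w)"
      using AE_kappa[OF A] by eventually_elim simp
  qed
  finally show ?thesis .
qed

sublocale J3: joint_density q C
proof
  interpret N: prob_space J1.\<nu> by (rule J1.prob_space_\<nu>)
  show "q \<in> borel_measurable borel" by simp
  show "0 \<le> q w" for w by (rule q_nonneg)
  show "0 \<le> C" by (rule J1.C_nonneg)
  show "(\<integral>\<^sup>+w. ennreal (q w) \<partial>lborel) = 1"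
    using nn_integral_q[of UNIV "\<lambda>_. 1"] N.emeasure_space_1 by (simp add: kappa_bounds)
  show "(\<integral>\<^sup>+x. ennreal (q (x, v)) \<partial>lborel) \<le> ennreal C" for v
  proof -
    have "J2.slice UNIV (snd v) / J2.slice UNIV (snd v) * J1.slice UNIV v \<le> C"
      using J1.slice_le_C[of UNIV v] J1.C_nonneg by (cases "J2.slice UNIV (snd v) = 0") auto
    then show ?thesis using nn_integral_q_slice[of UNIV v] by (simp add: ennreal_leI)
  qed
qed

lemma slice_q: "A \<in> sets borel \<Longrightarrow> J3.slice A v = J2.slice A (snd v) / J2.slice UNIV (snd v) * J1.slice UNIV v"
  using J3.ennreal_slice[of A v] nn_integral_q_slice[of A v] J3.slice_nonneg[of A v]
    J1.slice_nonneg[of UNIV v] J2.slice_nonneg[of A "snd v"] J2.slice_nonneg[of UNIV "snd v"]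
  by simp

lemma integral_q:
  assumes A[measurable]: "A \<in> sets borel" and F[measurable]: "F \<in> borel_measurable borel" and F0: "\<And>v. 0 \<le> F v"
  shows "(\<integral>w. indicator A (fst w) * F (snd w) \<partial>J3.\<nu>) = (\<integral>w. measure (\<kappa> (snd (snd w))) A * F (snd w) \<partial>J1.\<nu>)"
proof -
  have "(\<integral>w. indicator A (fst w) * F (snd w) \<partial>J3.\<nu>) = enn2real (\<integral>\<^sup>+w. ennreal (indicator A (fst w) * F (snd w)) \<partial>J3.\<nu>)"
    using F0 by (intro integral_eq_nn_integral) auto
  also have "(\<integral>\<^sup>+w. ennreal (indicator A (fst w) * F (snd w)) \<partial>J3.\<nu>) =
      (\<integral>\<^sup>+w. ennreal (q w) * ennreal (indicator A (fst w) * F (snd w)) \<partial>lborel)"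
    unfolding J3.\<nu>_def by (rule nn_integral_density) measurable
  also have "\<dots> = (\<integral>\<^sup>+w. indicator A (fst w) * ennreal (F (snd w)) * ennreal (q w) \<partial>lborel)"
    by (intro nn_integral_cong) (auto simp: indicator_def mult.commute)
  also have "\<dots> = (\<integral>\<^sup>+w. ennreal (measure (\<kappa> (snd (snd w))) A) * ennreal (F (snd w)) \<partial>J1.\<nu>)"
    by (rule nn_integral_q) measurable
  also have "\<dots> = (\<integral>\<^sup>+w. ennreal (measure (\<kappa> (snd (snd w))) A * F (snd w)) \<partial>J1.\<nu>)"
    using F0 kappa_bounds by (intro nn_integral_cong) (simp add: ennreal_mult)
  also have "enn2real \<dots> = (\<integral>w. measure (\<kappa> (snd (snd w))) A * F (snd w) \<partial>J1.\<nu>)"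
    using F0 kappa_bounds by (intro integral_eq_nn_integral[symmetric]) auto
  finally show ?thesis .
qed

text \<open>The marginal density of (y, z) cancels in the quotient, so a resampled covariate depends
  on (y, z) through z alone.\<close>

lemma cond_q: "0 < J3.slice UNIV v \<Longrightarrow> J3.cond v = J2.cond (snd v)"
proof -
  assume pos: "0 < J3.slice UNIV v"
  then have nz: "J2.slice UNIV (snd v) \<noteq> 0" "J1.slice UNIV v \<noteq> 0" by (auto simp: slice_q)
  then have "q (x, v) / J3.slice UNIV v = pXZ (x, snd v) / J2.slice UNIV (snd v)" for x
    unfolding slice_q[OF sets.top[of borel, unfolded space_borel]] q_def by simp
  then show ?thesis unfolding J3.cond_def J2.cond_def by simp
qed

text \<open>The right-hand side of \<open>cond_indep_iff\<close>, expressed through the law of the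
  triple.\<close>

definition kappa_factorizes :: bool where
  "kappa_factorizes \<longleftrightarrow> (\<forall>A\<in>sets borel. \<forall>B\<in>sets borel. \<forall>D\<in>sets borel.
    (\<integral>w. indicator D (snd (snd w)) * (indicator A (fst w) * indicator B (fst (snd w))) \<partial>J1.\<nu>) =
    (\<integral>w. indicator D (snd (snd w)) * (measure (\<kappa> (snd (snd w))) A * indicator B (fst (snd w))) \<partial>J1.\<nu>))"

text \<open>Translates the factorization into a comparison of the slices of p and of q over
  rectangles in (y, z).\<close>

lemma rect_eq:
  assumes [measurable]: "A \<in> sets borel" "B \<in> sets borel" "D \<in> sets borel"
  shows "(\<integral>w. indicator D (snd (snd w)) * (indicator A (fst w) * indicator B (fst (snd w))) \<partial>J1.\<nu>) =
      (\<integral>v. indicator (B \<times> D) v * J1.slice A v \<partial>lborel)" (is ?a)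
    and "(\<integral>w. indicator D (snd (snd w)) * (measure (\<kappa> (snd (snd w))) A * indicator B (fst (snd w))) \<partial>J1.\<nu>) =
      (\<integral>v. indicator (B \<times> D) v * J3.slice A v \<partial>lborel)" (is ?b)
proof -
  have BD: "B \<times> D \<in> sets borel" by (simp add: borel_prod[symmetric])
  have "(\<integral>w. indicator D (snd (snd w)) * (indicator A (fst w) * indicator B (fst (snd w))) \<partial>J1.\<nu>) =
      (\<integral>w. (indicator A (fst w) :: real) * indicator (B \<times> D) (snd w) \<partial>J1.\<nu>)"
    by (intro Bochner_Integration.integral_cong) (auto simp: indicator_def)
  also have "\<dots> = (\<integral>v. indicator (B \<times> D) v * J1.slice A v \<partial>lborel)"
    using BD by (intro J1.integral_\<nu>) auto
  finally show ?a .
  have "(\<integral>w. indicator D (snd (snd w)) * (measure (\<kappa> (snd (snd w))) A * indicator B (fst (snd w))) \<partial>J1.\<nu>) =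
      (\<integral>w. measure (\<kappa> (snd (snd w))) A * indicator (B \<times> D) (snd w) \<partial>J1.\<nu>)"
    by (intro Bochner_Integration.integral_cong) (auto simp: indicator_def)
  also have "\<dots> = (\<integral>w. indicator A (fst w) * indicator (B \<times> D) (snd w) \<partial>J3.\<nu>)"
    using BD by (intro integral_q[symmetric]) auto
  also have "\<dots> = (\<integral>v. indicator (B \<times> D) v * J3.slice A v \<partial>lborel)"
    using BD by (intro J3.integral_\<nu>) auto
  finally show ?b .
qed

text \<open>The hypothesis covers rectangles in (y, z) only. It makes the slices of p and q
  densities of the same finite measure, hence equal almost everywhere, which admits every F. In
  \<open>copy_box_measure\<close> F contains a product of values of \<kappa>.\<close>

lemma integral_factorizes:
  assumes fac: kappa_factorizes
    and A[measurable]: "A \<in> sets borel" and F[measurable]: "F \<in> borel_measurable borel" and F0: "\<And>v. 0 \<le> F v"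
  shows "(\<integral>w. indicator A (fst w) * F (snd w) \<partial>J1.\<nu>) = (\<integral>w. measure (\<kappa> (snd (snd w))) A * F (snd w) \<partial>J1.\<nu>)"
proof -
  have fin: "finite_measure (density lborel (\<lambda>v. ennreal (J1.slice A v)))"
    using J1.nn_integral_slice[OF A] by (intro finite_measureI) (auto simp: emeasure_density top_unique)
  have "density lborel (\<lambda>v. ennreal (J1.slice A v)) = density lborel (\<lambda>v. ennreal (J3.slice A v))"
  proof (rule measure_eqI_rectangles)
    fix B :: "'y set" and D :: "'z set" assume B: "B \<in> sets borel" and D: "D \<in> sets borel"
    then have BD: "B \<times> D \<in> sets borel" by (simp add: borel_prod[symmetric])
    have e: "emeasure (density lborel (\<lambda>v. ennreal (s v))) (B \<times> D) = ennreal (\<integral>v. indicator (B \<times> D) v * s v \<partial>lborel)"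
      if s: "integrable lborel s" "\<And>v. 0 \<le> s v" for s :: "'y \<times> 'z \<Rightarrow> real"
    proof -
      have i: "integrable lborel (\<lambda>v. indicator (B \<times> D) v * s v)"
        by (rule Bochner_Integration.integrable_bound[OF s(1)]) (use BD s in \<open>auto simp: indicator_def\<close>)
      have "emeasure (density lborel (\<lambda>v. ennreal (s v))) (B \<times> D) = (\<integral>\<^sup>+v. ennreal (indicator (B \<times> D) v * s v) \<partial>lborel)"
        using s BD by (subst emeasure_density) (auto simp: indicator_def intro!: nn_integral_cong)
      then show ?thesis using i s by (simp add: nn_integral_eq_integral)
    qed
    have "(\<integral>v. indicator (B \<times> D) v * J1.slice A v \<partial>lborel) = (\<integral>v. indicator (B \<times> D) v * J3.slice A v \<partial>lborel)"
      using fac A B D unfolding kappa_factorizes_def rect_eq[OF A B D, symmetric] by blast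
    then show "emeasure (density lborel (\<lambda>v. ennreal (J1.slice A v))) (B \<times> D) = emeasure (density lborel (\<lambda>v. ennreal (J3.slice A v))) (B \<times> D)"
      by (simp add: e J1.integrable_slice[OF A] J3.integrable_slice[OF A] J1.slice_nonneg J3.slice_nonneg)
  qed (use fin in simp_all)
  then have "AE v in lborel. ennreal (J1.slice A v) = ennreal (J3.slice A v)"
    using J1.nn_integral_slice[OF A] by (subst (asm) finite_density_unique) (auto simp: top_unique)
  then have ae: "AE v in lborel. J1.slice A v = J3.slice A v"
    by eventually_elim (simp add: J1.slice_nonneg J3.slice_nonneg)
  have "(\<integral>w. indicator A (fst w) * F (snd w) \<partial>J1.\<nu>) = (\<integral>v. F v * J1.slice A v \<partial>lborel)"
    by (rule J1.integral_\<nu>[OF A F F0])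
  also have "\<dots> = (\<integral>v. F v * J3.slice A v \<partial>lborel)"
  proof (rule integral_cong_AE)
    show "AE v in lborel. F v * J1.slice A v = F v * J3.slice A v" using ae by eventually_elim simp
  qed measurable
  also have "\<dots> = (\<integral>w. indicator A (fst w) * F (snd w) \<partial>J3.\<nu>)" by (rule J3.integral_\<nu>[OF A F F0, symmetric])
  also have "\<dots> = (\<integral>w. measure (\<kappa> (snd (snd w))) A * F (snd w) \<partial>J1.\<nu>)" by (rule integral_q[OF A F F0])
  finally show ?thesis .
qed

text \<open>By \<open>cond_q\<close> the two conditional laws inside the divergence coincide almost
  surely.\<close>

lemma zeta_q_eq_0:
  assumes "two_kernels q pXZ C K CK a Ca" shows "two_kernels.zeta q pXZ a = 0"
proof -
  interpret two_kernels q pXZ C K CK a Ca by fact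
  have "AE w in J3.\<nu>. T (snd w) * a (snd w) = 0"
    using J3.AE_slice_pos
  proof eventually_elim
    case (elim w)
    have "ball_divergence_sq P P = 0" for P :: "'x measure" by (simp add: ball_divergence_sq_def)
    then show ?case unfolding T_def cond_q[OF elim] by simp
  qed
  then have "(\<integral>w. T (snd w) * a (snd w) \<partial>J3.\<nu>) = (\<integral>w. 0 \<partial>J3.\<nu>)"
    by (intro integral_cong_AE) measurable
  then show ?thesis unfolding zeta_def by simp
qed

text \<open>By contradiction. The weight is positive where the density of (Y, Z) is, so
  \<open>zeta\<close> = 0 makes T vanish there almost everywhere. Zero divergence identifies the two
  conditional densities, hence p(., v) with q(., v), and equal slices give the
  factorization.\<close>

lemma zeta_p_pos:
  assumes "two_kernels p pXZ C K CK a Ca" and pos: "\<And>v. 0 < J1.slice UNIV v \<Longrightarrow> 0 < a v"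
    and nfac: "\<not> kappa_factorizes"
  shows "0 < two_kernels.zeta p pXZ a"
proof -
  interpret two_kernels p pXZ C K CK a Ca by fact
  interpret N: prob_space J1.\<nu> by (rule J1.prob_space_\<nu>)
  have z: "zeta = (\<integral>v. (T v * a v) * J1.slice UNIV v \<partial>lborel)"
    unfolding zeta_def using J1.integral_\<nu>[of UNIV "\<lambda>v. T v * a v"] T_bounds(1) a0 by simp
  have nn: "0 \<le> (T v * a v) * J1.slice UNIV v" for v
    by (intro mult_nonneg_nonneg T_bounds a0 J1.slice_nonneg)
  have "zeta \<noteq> 0"
  proof
    assume "zeta = 0"
    have i: "integrable lborel (\<lambda>v. (T v * a v) * J1.slice UNIV v)"
    proof (rule Bochner_Integration.integrable_bound)
      show "integrable lborel (\<lambda>v. (2 * Ca) * J1.slice UNIV v)" by (intro integrable_mult_right J1.integrable_slice) simp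
      show "AE v in lborel. norm ((T v * a v) * J1.slice UNIV v) \<le> norm ((2 * Ca) * J1.slice UNIV v)"
      proof (rule AE_I2)
        fix v
        have "(T v * a v) * J1.slice UNIV v \<le> (2 * Ca) * J1.slice UNIV v"
          using T_bounds a0 a_le J1.slice_nonneg Ca by (intro mult_mono mult_nonneg_nonneg) auto
        then show "norm ((T v * a v) * J1.slice UNIV v) \<le> norm ((2 * Ca) * J1.slice UNIV v)"
          using nn[of v] by simp
      qed
    qed measurable
    have "AE v in lborel. (T v * a v) * J1.slice UNIV v = 0"
      using \<open>zeta = 0\<close> z integral_nonneg_eq_0_iff_AE[OF i] nn by simp
    then have T0: "AE v in lborel. 0 < J1.slice UNIV v \<longrightarrow> T v = 0"
      by eventually_elim (use pos in force)
    \<comment> \<open>Almost everywhere, a positive density of (Y, Z) forces a positive density of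
      Z. Without this the second conditional law could be the null measure instead of a
      probability.\<close>
    have m: "(\<lambda>v :: 'y \<times> 'z. J2.slice UNIV (snd v)) \<in> borel_measurable borel"
      by (rule measurable_compose[OF borel_snd J2.slice_measurable]) simp
    have "(\<integral>\<^sup>+w. indicator UNIV (fst w) * indicator {v. J2.slice UNIV (snd v) = 0} (snd w) \<partial>J1.\<nu>) = (\<integral>\<^sup>+w. 0 \<partial>J1.\<nu>)"
    proof (rule nn_integral_cong_AE)
      show "AE w in J1.\<nu>. indicator UNIV (fst w) * indicator {v. J2.slice UNIV (snd v) = 0} (snd w) = (0 :: ennreal)"
        using AE_slice_Z_pos by eventually_elim auto
    qed
    moreover have S0: "{v :: 'y \<times> 'z. J2.slice UNIV (snd v) = 0} \<in> sets borel"
      using measurable_sets[OF m, of "{0}"] by (simp add: vimage_def)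
    ultimately have "(\<integral>\<^sup>+v. indicator {v. J2.slice UNIV (snd v) = 0} v * ennreal (J1.slice UNIV v) \<partial>lborel) = 0"
      by (subst (asm) J1.nn_integral_\<nu>) auto
    then have "AE v in lborel. indicator {v. J2.slice UNIV (snd v) = 0} v * ennreal (J1.slice UNIV v) = 0"
      using S0 by (subst (asm) nn_integral_0_iff_AE) auto
    then have Z0: "AE v in lborel. 0 < J1.slice UNIV v \<longrightarrow> 0 < J2.slice UNIV (snd v)"
      by eventually_elim (use J2.slice_nonneg[of UNIV] in \<open>auto simp: indicator_def less_le split: if_splits\<close>)
    \<comment> \<open>One null set of v serves all A simultaneously, because for each good v the
      densities themselves agree in x.\<close>
    have slices: "AE v in lborel. \<forall>A\<in>sets borel. J1.slice A v = J3.slice A v"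
      using T0 Z0
    proof eventually_elim
      case (elim v)
      show ?case
      proof (cases "0 < J1.slice UNIV v")
        case False
        then have g: "J1.slice UNIV v = 0" using J1.slice_nonneg[of UNIV v] by simp
        then have "J1.slice A v = 0" if "A \<in> sets borel" for A
          using J1.slice_mono[of A UNIV v] J1.slice_nonneg[of A v] that by simp
        then show ?thesis using g by (simp add: slice_q)
      next
        case True
        define g where "g = J1.slice UNIV v" define gZ where "gZ = J2.slice UNIV (snd v)"
        have g: "0 < g" "0 < gZ" using True elim(2) by (simp_all add: g_def gZ_def)
        have [measurable]: "(\<lambda>x. p (x, v)) \<in> borel_measurable borel" "(\<lambda>x. pXZ (x, snd v)) \<in> borel_measurable borel"
          using measurable_compose[OF _ J1.meas, of "\<lambda>x. (x, v)"] measurable_compose[OF _ pXZ_measurable, of "\<lambda>x. (x, snd v)"] by simp_all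
        have one: "(\<integral>\<^sup>+x. ennreal (p (x, v) / g) \<partial>lborel) = 1"
          using J1.emeasure_cond[of UNIV v] g by (simp add: J1.cond_def emeasure_density g_def)
        have two: "(\<integral>\<^sup>+x. ennreal (pXZ (x, snd v) / gZ) \<partial>lborel) = 1"
          using J2.emeasure_cond[of UNIV "snd v"] g by (simp add: J2.cond_def emeasure_density gZ_def)
        have "AE x in lborel. p (x, v) / g = pXZ (x, snd v) / gZ"
        proof (rule densities_eq_of_ball_divergence_0[OF _ _ _ _ one two])
          show "ball_divergence_sq (density lborel (\<lambda>x. ennreal (p (x, v) / g))) (density lborel (\<lambda>x. ennreal (pXZ (x, snd v) / gZ))) = 0"
            using elim(1) True unfolding T_def J1.cond_def J2.cond_def g_def gZ_def by simp
        qed (use g J1.nonneg pXZ_nonneg in auto)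
        then have "AE x in lborel. p (x, v) = q (x, v)"
          by eventually_elim (use g in \<open>simp add: q_def g_def[symmetric] gZ_def[symmetric] field_simps\<close>)
        then have "J1.slice A v = J3.slice A v" if "A \<in> sets borel" for A
        proof -
          have "(\<lambda>x. q (x, v)) \<in> borel_measurable borel"
            using measurable_compose[OF _ q_measurable, of "\<lambda>x. (x, v)"] by simp
          then show ?thesis unfolding J1.slice_def J3.slice_def using \<open>AE x in lborel. p (x, v) = q (x, v)\<close> that
            by (intro integral_cong_AE) auto
        qed
        then show ?thesis by blast
      qed
    qed
    have kappa_factorizes
      unfolding kappa_factorizes_def
    proof (intro ballI)
      fix A :: "'x set" and B :: "'y set" and D :: "'z set"
      assume A: "A \<in> sets borel" and B: "B \<in> sets borel" and D: "D \<in> sets borel"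
      have BD: "B \<times> D \<in> sets borel" using B D by (simp add: borel_prod[symmetric])
      show "(\<integral>w. indicator D (snd (snd w)) * (indicator A (fst w) * indicator B (fst (snd w))) \<partial>J1.\<nu>) =
        (\<integral>w. indicator D (snd (snd w)) * (measure (\<kappa> (snd (snd w))) A * indicator B (fst (snd w))) \<partial>J1.\<nu>)"
        unfolding rect_eq[OF A B D]
      proof (rule integral_cong_AE)
        show "AE v in lborel. indicator (B \<times> D) v * J1.slice A v = indicator (B \<times> D) v * J3.slice A v"
          using slices by eventually_elim (use A in simp)
      qed (use A BD in auto)
    qed
    with nfac show False ..
  qed
  moreover have "0 \<le> zeta" unfolding z by (intro integral_nonneg_AE AE_I2 nn)
  ultimately show ?thesis by simp
qed

end

section \<open>Exchangeability of the resamples\<close>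

text \<open>Among the indices counted, take one with the smallest value of T. All of them count
  towards its rank, so their number is at most that rank, which is below c.\<close>

lemma count_small_ranks:
  fixes T :: "nat \<Rightarrow> real"
  assumes c: "0 \<le> c"
  shows "real (card {j. j < m \<and> (\<Sum>l<m. of_bool (T j \<le> T l)) < c}) \<le> c"
proof (cases "{j. j < m \<and> (\<Sum>l<m. of_bool (T j \<le> T l)) < c} = {}")
  case True then show ?thesis using c by (simp only: card.empty)
next
  case False
  define J where "J = {j. j < m \<and> (\<Sum>l<m. of_bool (T j \<le> T l)) < c}"
  have J: "finite J" "J \<noteq> {}" using False by (auto simp: J_def)
  have "Min (T ` J) \<in> T ` J" using J by (intro Min_in) auto
  then obtain j where j: "j \<in> J" "T j = Min (T ` J)" by auto
  have min: "T j \<le> T l" if "l \<in> J" for l using J that j(2) by simp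
  have "real (card J) = (\<Sum>l\<in>J. of_bool (T j \<le> T l))" using min by simp
  also have "\<dots> \<le> (\<Sum>l<m. of_bool (T j \<le> T l))"
    by (rule sum_mono2) (auto simp: J_def)
  also have "\<dots> < c" using j(1) by (simp add: J_def)
  finally show ?thesis unfolding J_def by simp
qed

lemma iid_sampleI:
  assumes "joint_density r C" "prob_space M" "prob_space.indep_vars M (\<lambda>_. borel) W {..<n}"
    and W: "\<And>i. i < n \<Longrightarrow> distr M borel (W i) = joint_density.\<nu> r"
  shows "iid_sample r C M W n"
proof -
  interpret joint_density r C by fact
  interpret prob_space M by fact
  have m: "W i \<in> borel_measurable M" if "i < n" for i
    using assms(3) that by (auto simp: indep_vars_def)
  show ?thesis
  proof
    show "indep_vars (\<lambda>_. borel) W {..<n}" by fact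
    show "distributed M lborel (W i) (\<lambda>w. ennreal (r w))" if "i < n" for i
      unfolding distributed_def
    proof (intro conjI)
      have "distr M lborel (W i) = distr M borel (W i)" by (rule distr_cong) auto
      then show "distr M lborel (W i) = density lborel (\<lambda>w. ennreal (r w))" using W[OF that] by (simp add: \<nu>_def)
    qed (use m[OF that] in auto)
  qed
qed

lemma iid_sample_compose:
  assumes s: "iid_sample r C M W n" and r': "joint_density r' C'"
    and f: "f \<in> borel_measurable borel" and law: "distr (joint_density.\<nu> r) borel f = joint_density.\<nu> r'"
  shows "iid_sample r' C' M (\<lambda>i \<omega>. f (W i \<omega>)) n"
proof -
  interpret iid_sample r C M W n by fact
  show ?thesis
  proof (rule iid_sampleI[OF r'])
    show "prob_space M" by unfold_locales
    show "indep_vars (\<lambda>_. borel) (\<lambda>i \<omega>. f (W i \<omega>)) {..<n}"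
      by (rule indep_vars_compose2[OF indep]) (rule f)
    show "distr M borel (\<lambda>\<omega>. f (W i \<omega>)) = joint_density.\<nu> r'" if "i < n" for i
      unfolding law[symmetric] distr_W[OF that, symmetric]
      by (subst distr_distr[OF f W_meas[OF that]]) (simp add: comp_def)
  qed
qed

section \<open>The joint law of the data and the resamples\<close>

locale crt_sample = crt_model p C \<kappa> + prob_space \<Omega>
  for p :: "'x::euclidean_space \<times> 'y::euclidean_space \<times> 'z::euclidean_space \<Rightarrow> real" and C \<kappa>
    and \<Omega> :: "'w measure" +
  fixes M n :: nat and W :: "nat \<Rightarrow> 'w \<Rightarrow> 'x \<times> 'y \<times> 'z" and X' :: "nat \<Rightarrow> nat \<Rightarrow> 'w \<Rightarrow> 'x"
  assumes n: "1 \<le> n" and exp: "crt_experiment \<Omega> p \<kappa> M n W X'"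
begin

lemma W_indep: "indep_vars (\<lambda>_. borel) W {..<n}"
  using exp by (simp add: crt_experiment_def)

lemma X'_measurable: "j < M \<Longrightarrow> i < n \<Longrightarrow> X' j i \<in> borel_measurable \<Omega>"
  using exp by (simp add: crt_experiment_def)

sublocale W: iid_sample p C \<Omega> W n
  by unfold_locales (use exp in \<open>auto simp: crt_experiment_def\<close>)

text \<open>Regroups the experiment by observation. Given the data, the probability of the
  resampling event is a product over i and j; the integrand thus has one factor per observation, and
  the observations are independent.\<close>

lemma product_formula:
  fixes A :: "nat \<Rightarrow> 'x set" and V :: "nat \<Rightarrow> ('y \<times> 'z) set" and B :: "nat \<Rightarrow> nat \<Rightarrow> 'x set"
  assumes A: "\<And>i. i < n \<Longrightarrow> A i \<in> sets borel" and V: "\<And>i. i < n \<Longrightarrow> V i \<in> sets borel"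
    and B: "\<And>j i. j < M \<Longrightarrow> i < n \<Longrightarrow> B j i \<in> sets borel"
  shows "measure \<Omega> {\<omega> \<in> space \<Omega>. \<forall>i<n. fst (W i \<omega>) \<in> A i \<and> snd (W i \<omega>) \<in> V i \<and> (\<forall>j<M. X' j i \<omega> \<in> B j i)} =
    (\<Prod>i<n. \<integral>w. indicator (A i) (fst w) * (indicator (V i) (snd w) * (\<Prod>j<M. measure (\<kappa> (snd (snd w))) (B j i))) \<partial>J1.\<nu>)"
proof -
  let ?E = "\<Pi>\<^sub>E i\<in>{..<n}. A i \<times> V i"
  let ?f = "\<lambda>i w. indicator (A i) (fst w) * (indicator (V i) (snd w) * (\<Prod>j<M. measure (\<kappa> (snd (snd w))) (B j i))) :: real"
  have E: "?E \<in> sets (PiM {..<n} (\<lambda>_. borel))"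
    by (intro sets_PiM_I_finite) (use A V in \<open>auto simp: borel_prod[symmetric]\<close>)
  have mem: "(\<lambda>i\<in>{..<n}. W i \<omega>) \<in> ?E \<longleftrightarrow> (\<forall>i<n. fst (W i \<omega>) \<in> A i \<and> snd (W i \<omega>) \<in> V i)" for \<omega>
    unfolding PiE_iff Ball_def lessThan_iff mem_Times_iff by simp
  have f: "?f i \<in> borel_measurable borel" if i: "i < n" for i
  proof -
    have "(\<lambda>w :: 'x \<times> 'y \<times> 'z. measure (\<kappa> (snd (snd w))) (B j i)) \<in> borel_measurable borel" if "j < M" for j
      by (rule measurable_compose[OF measurable_compose[OF borel_snd borel_snd] kappa_measurable[OF B[OF that i]]])
    then show ?thesis
      by (intro borel_measurable_times borel_measurable_prod measurable_compose[OF borel_fst borel_measurable_indicator[OF A[OF i]]]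
        measurable_compose[OF borel_snd borel_measurable_indicator[OF V[OF i]]]) auto
  qed
  have f1: "\<bar>?f i w\<bar> \<le> 1" for i w
  proof -
    have "0 \<le> (\<Prod>j<M. measure (\<kappa> (snd (snd w))) (B j i))" "(\<Prod>j<M. measure (\<kappa> (snd (snd w))) (B j i)) \<le> 1"
      by (auto intro!: prod_nonneg prod_le_1 kappa_bounds)
    then show ?thesis by (auto simp: indicator_def)
  qed
  have "measure \<Omega> {\<omega> \<in> space \<Omega>. \<forall>i<n. fst (W i \<omega>) \<in> A i \<and> snd (W i \<omega>) \<in> V i \<and> (\<forall>j<M. X' j i \<omega> \<in> B j i)} =
      measure \<Omega> {\<omega> \<in> space \<Omega>. (\<lambda>i\<in>{..<n}. W i \<omega>) \<in> ?E \<and> (\<forall>j<M. \<forall>i<n. X' j i \<omega> \<in> B j i)}"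
    unfolding mem by (intro arg_cong[where f = "measure \<Omega>"]) blast
  also have "\<dots> = (\<integral>\<omega>. indicator ?E (\<lambda>i\<in>{..<n}. W i \<omega>) * (\<Prod>j<M. \<Prod>i<n. measure (\<kappa> (snd (snd (W i \<omega>)))) (B j i)) \<partial>\<Omega>)"
    by (rule exp[unfolded crt_experiment_def, THEN conjunct2, THEN conjunct2, THEN conjunct2, THEN conjunct2,
          THEN bspec, OF E, THEN spec, THEN mp]) (use B in simp)
  also have "\<dots> = (\<integral>\<omega>. (\<Prod>i<n. ?f i (W i \<omega>)) \<partial>\<Omega>)"
  proof (intro Bochner_Integration.integral_cong refl)
    fix \<omega>
    have ind: "indicator ?E (\<lambda>i\<in>{..<n}. W i \<omega>) = (\<Prod>i<n. indicator (A i) (fst (W i \<omega>)) * indicator (V i) (snd (W i \<omega>)) :: real)"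
    proof (cases "\<forall>i<n. fst (W i \<omega>) \<in> A i \<and> snd (W i \<omega>) \<in> V i")
      case True
      then have "(\<lambda>i\<in>{..<n}. W i \<omega>) \<in> ?E" by (simp only: mem)
      then have "indicator ?E (\<lambda>i\<in>{..<n}. W i \<omega>) = (1::real)" by (rule indicator_simps(1))
      moreover have "(\<Prod>i<n. indicator (A i) (fst (W i \<omega>)) * indicator (V i) (snd (W i \<omega>)) :: real) = 1"
        using True by (intro prod.neutral) simp
      ultimately show ?thesis by simp
    next
      case False
      then obtain i where i: "i < n" "\<not> (fst (W i \<omega>) \<in> A i \<and> snd (W i \<omega>) \<in> V i)" by blast
      have "(\<lambda>i\<in>{..<n}. W i \<omega>) \<notin> ?E" using False unfolding mem .
      then have "indicator ?E (\<lambda>i\<in>{..<n}. W i \<omega>) = (0::real)" by (rule indicator_simps(2))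
      moreover have "(\<Prod>i<n. indicator (A i) (fst (W i \<omega>)) * indicator (V i) (snd (W i \<omega>)) :: real) = 0"
        by (rule prod_zero) (use i in \<open>auto simp: indicator_def intro!: bexI[of _ i]\<close>)
      ultimately show ?thesis by simp
    qed
    show "indicator ?E (\<lambda>i\<in>{..<n}. W i \<omega>) * (\<Prod>j<M. \<Prod>i<n. measure (\<kappa> (snd (snd (W i \<omega>)))) (B j i)) = (\<Prod>i<n. ?f i (W i \<omega>))"
      unfolding ind by (subst prod.swap) (simp add: prod.distrib mult.assoc)
  qed
  also have "\<dots> = (\<Prod>i<n. \<integral>\<omega>. ?f i (W i \<omega>) \<partial>\<Omega>)"
  proof (rule indep_vars_lebesgue_integral)
    show "indep_vars (\<lambda>_. borel) (\<lambda>i \<omega>. ?f i (W i \<omega>)) {..<n}"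
      by (rule indep_vars_compose2[OF W_indep]) (use f in simp)
    show "integrable \<Omega> (\<lambda>\<omega>. ?f i (W i \<omega>))" if "i \<in> {..<n}" for i
    proof (rule integrable_const_bound[of _ 1])
      show "(\<lambda>\<omega>. ?f i (W i \<omega>)) \<in> borel_measurable \<Omega>"
        using that by (intro measurable_compose[OF W.W_meas f]) auto
    qed (use f1 in auto)
  qed simp
  also have "\<dots> = (\<Prod>i<n. \<integral>w. ?f i w \<partial>J1.\<nu>)"
    by (intro prod.cong refl W.integral_W f) auto
  finally show ?thesis .
qed

definition D' :: "nat \<Rightarrow> nat \<Rightarrow> 'w \<Rightarrow> 'x \<times> 'y \<times> 'z" where
  "D' j i \<omega> = (X' j i \<omega>, snd (W i \<omega>))"

lemma D'_measurable: "j < M \<Longrightarrow> i < n \<Longrightarrow> D' j i \<in> borel_measurable \<Omega>"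
  unfolding D'_def[abs_def]
  by (intro borel_measurable_Pair X'_measurable measurable_compose[OF W.W_meas borel_snd]) auto

text \<open>Under \<open>product_formula\<close> each observation contributes the mass of a
  rectangle under the law with density q, by \<open>integral_q\<close>;
  \<open>iid_of_rectangles\<close> then applies.\<close>

lemma D'_iid:
  assumes j: "j < M" shows "iid_sample q C \<Omega> (D' j) n"
proof -
  have rect: "measure \<Omega> {\<omega> \<in> space \<Omega>. \<forall>i<n. D' j i \<omega> \<in> A i \<times> B i} = (\<Prod>i<n. measure J3.\<nu> (A i \<times> B i))"
    if A: "\<And>i. i < n \<Longrightarrow> A i \<in> sets borel" and B: "\<And>i. i < n \<Longrightarrow> B i \<in> sets borel"
    for A :: "nat \<Rightarrow> 'x set" and B :: "nat \<Rightarrow> ('y \<times> 'z) set"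
  proof -
    \<comment> \<open>The other resamples are left unconstrained and contribute the factor 1, the
      total mass of \<kappa>.\<close>
    let ?C = "\<lambda>j' i. if j' = j then A i else UNIV"
    have "measure \<Omega> {\<omega> \<in> space \<Omega>. \<forall>i<n. D' j i \<omega> \<in> A i \<times> B i} =
      measure \<Omega> {\<omega> \<in> space \<Omega>. \<forall>i<n. fst (W i \<omega>) \<in> UNIV \<and> snd (W i \<omega>) \<in> B i \<and> (\<forall>j'<M. X' j' i \<omega> \<in> ?C j' i)}"
      using j by (intro arg_cong[where f = "measure \<Omega>"]) (auto simp: D'_def)
    also have "\<dots> = (\<Prod>i<n. \<integral>w. indicator UNIV (fst w) * (indicator (B i) (snd w) * (\<Prod>j'<M. measure (\<kappa> (snd (snd w))) (?C j' i))) \<partial>J1.\<nu>)"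
      by (rule product_formula) (use A B in auto)
    also have "\<dots> = (\<Prod>i<n. measure J3.\<nu> (A i \<times> B i))"
    proof (intro prod.cong refl)
      fix i assume "i \<in> {..<n}" then have i: "i < n" by simp
      have pr: "(\<Prod>j'<M. measure (\<kappa> z) (?C j' i)) = measure (\<kappa> z) (A i)" for z
      proof -
        have "(\<Prod>j'<M. measure (\<kappa> z) (?C j' i)) = (\<Prod>j'<M. if j' = j then measure (\<kappa> z) (A i) else 1)"
          by (intro prod.cong) (auto simp: kappa_bounds)
        also have "\<dots> = measure (\<kappa> z) (A i)" using j by simp
        finally show ?thesis .
      qed
      have "(\<integral>w. indicator UNIV (fst w) * (indicator (B i) (snd w) * (\<Prod>j'<M. measure (\<kappa> (snd (snd w))) (?C j' i))) \<partial>J1.\<nu>) =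
          (\<integral>w. measure (\<kappa> (snd (snd w))) (A i) * indicator (B i) (snd w) \<partial>J1.\<nu>)"
        unfolding pr by (simp add: mult.commute)
      also have "\<dots> = (\<integral>w. indicator (A i) (fst w) * indicator (B i) (snd w) \<partial>J3.\<nu>)"
        using A[OF i] B[OF i] by (intro integral_q[symmetric]) auto
      also have "\<dots> = (\<integral>w. indicator (A i \<times> B i) w \<partial>J3.\<nu>)"
        by (intro Bochner_Integration.integral_cong) (auto simp: indicator_def)
      also have "\<dots> = measure J3.\<nu> (A i \<times> B i)" by simp
      finally show "(\<integral>w. indicator UNIV (fst w) * (indicator (B i) (snd w) * (\<Prod>j'<M. measure (\<kappa> (snd (snd w))) (?C j' i))) \<partial>J1.\<nu>) =
          measure J3.\<nu> (A i \<times> B i)" .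
    qed
    finally show ?thesis .
  qed
  have n0: "0 < n" using n by simp
  have "indep_vars (\<lambda>_. borel) (D' j) {..<n}"
    by (rule iid_of_rectangles(1)[OF n0 D'_measurable[OF j] J3.prob_space_\<nu> J3.sets_\<nu> rect])
  moreover have "distr \<Omega> borel (D' j i) = J3.\<nu>" if "i < n" for i
    by (rule iid_of_rectangles(2)[OF n0 D'_measurable[OF j] J3.prob_space_\<nu> J3.sets_\<nu> rect that])
  ultimately show ?thesis
    by (intro iid_sampleI J3.joint_density_axioms prob_space_axioms)
qed

lemma XZ_measurable: "(\<lambda>w. (fst w, snd (snd w))) \<in> borel_measurable (borel :: ('x \<times> 'y \<times> 'z) measure)"
  by (intro borel_measurable_Pair) measurable

text \<open>Resampling preserves the law of (X, Z), so the estimator given Z has the same limit for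
  a resample as for the data.\<close>

lemma law_XZ_q: "distr J3.\<nu> borel (\<lambda>w. (fst w, snd (snd w))) = J2.\<nu>"
proof (rule measure_eqI_rectangles)
  interpret N3: prob_space J3.\<nu> by (rule J3.prob_space_\<nu>)
  interpret N2: prob_space J2.\<nu> by (rule J2.prob_space_\<nu>)
  have m: "(\<lambda>w. (fst w, snd (snd w))) \<in> measurable J3.\<nu> (borel :: ('x \<times> 'z) measure)"
    using XZ_measurable by simp
  show "finite_measure (distr J3.\<nu> borel (\<lambda>w. (fst w, snd (snd w))))"
    using N3.prob_space_distr[OF m] by (simp add: prob_space.finite_measure)
  fix A :: "'x set" and B :: "'z set" assume A[measurable]: "A \<in> sets borel" and B[measurable]: "B \<in> sets borel"
  have AB: "A \<times> B \<in> sets borel" using A B by (simp add: borel_prod[symmetric])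
  have r: "{w :: 'x \<times> 'y \<times> 'z. fst w \<in> A \<and> snd (snd w) \<in> B} \<in> sets borel" by (rule rect_XZ_measurable[OF A B])
  have vm: "(\<lambda>w. (fst w, snd (snd w))) -` (A \<times> B) = {w :: 'x \<times> 'y \<times> 'z. fst w \<in> A \<and> snd (snd w) \<in> B}" by auto
  have "measure J3.\<nu> {w. fst w \<in> A \<and> snd (snd w) \<in> B} = (\<integral>w. indicator {w. fst w \<in> A \<and> snd (snd w) \<in> B} w \<partial>J3.\<nu>)"
    using r by simp
  also have "\<dots> = (\<integral>w. indicator A (fst w) * indicator B (snd (snd w)) \<partial>J3.\<nu>)"
    by (intro Bochner_Integration.integral_cong) (auto simp: indicator_def)
  also have "\<dots> = (\<integral>w. measure (\<kappa> (snd (snd w))) A * indicator B (snd (snd w)) \<partial>J1.\<nu>)"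
    by (rule integral_q) auto
  also have "\<dots> = measure J1.\<nu> {w. fst w \<in> A \<and> snd (snd w) \<in> B}"
    unfolding \<kappa>_law[OF A B] by (simp add: mult.commute)
  also have "\<dots> = measure J2.\<nu> (A \<times> B)"
    unfolding law_XZ[symmetric] using AB XZ_measurable by (subst measure_distr) (auto simp: vm)
  finally show "emeasure (distr J3.\<nu> borel (\<lambda>w. (fst w, snd (snd w)))) (A \<times> B) = emeasure J2.\<nu> (A \<times> B)"
    using AB m by (subst emeasure_distr) (auto simp: vm N3.emeasure_eq_measure N2.emeasure_eq_measure)
qed simp_all

lemma W_XZ_iid: "iid_sample pXZ C \<Omega> (\<lambda>i \<omega>. (fst (W i \<omega>), snd (snd (W i \<omega>)))) n"
  by (rule iid_sample_compose[OF W.iid_sample_axioms J2.joint_density_axioms XZ_measurable law_XZ])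

lemma D'_XZ_iid: "j < M \<Longrightarrow> iid_sample pXZ C \<Omega> (\<lambda>i \<omega>. (fst (D' j i \<omega>), snd (snd (D' j i \<omega>)))) n"
  by (rule iid_sample_compose[OF D'_iid J2.joint_density_axioms XZ_measurable law_XZ_q])

definition copy :: "nat \<Rightarrow> nat \<Rightarrow> 'w \<Rightarrow> 'x \<times> 'y \<times> 'z" where
  "copy j = (case j of 0 \<Rightarrow> W | Suc j' \<Rightarrow> D' j')"

lemma copy_simps[simp]: "copy 0 = W" "copy (Suc j) = D' j"
  by (simp_all add: copy_def)

lemma copy_snd: "snd (copy j i \<omega>) = snd (W i \<omega>)"
  by (cases j) (simp_all add: D'_def)

lemma copy_measurable: "j < Suc M \<Longrightarrow> i < n \<Longrightarrow> copy j i \<in> borel_measurable \<Omega>"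
  by (cases j) (auto intro: D'_measurable W.W_meas)

abbreviation idx :: "(nat \<times> nat) set" where "idx \<equiv> {..<Suc M} \<times> {..<n}"

text \<open>The \<open>M + 1\<close> data sets, permuted by \<open>\<pi>\<close>; index 0 is the original sample.\<close>

definition config :: "(nat \<Rightarrow> nat) \<Rightarrow> 'w \<Rightarrow> nat \<times> nat \<Rightarrow> 'x \<times> 'y \<times> 'z" where
  "config \<pi> \<omega> = (\<lambda>(j, i)\<in>idx. copy (\<pi> j) i \<omega>)"

lemma config_measurable:
  assumes "\<And>j. j < Suc M \<Longrightarrow> \<pi> j < Suc M"
  shows "config \<pi> \<in> measurable \<Omega> (PiM idx (\<lambda>_. borel))"
  unfolding config_def[abs_def]
  by (rule measurable_restrict) (use assms copy_measurable in auto)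

text \<open>All copies share the pair (Y_i, Z_i), so the constraints V intersect. The factorization
  replaces the indicator of X_i by its \<kappa>-probability; the data then enter exactly as the
  resamples do, and the formula is symmetric in j.\<close>

lemma copy_box_measure:
  assumes fac: kappa_factorizes
    and A: "\<And>j i. j < Suc M \<Longrightarrow> i < n \<Longrightarrow> A j i \<in> sets borel"
    and V: "\<And>j i. j < Suc M \<Longrightarrow> i < n \<Longrightarrow> V j i \<in> sets borel"
  shows "measure \<Omega> {\<omega> \<in> space \<Omega>. \<forall>j<Suc M. \<forall>i<n. copy j i \<omega> \<in> A j i \<times> V j i} =
    (\<Prod>i<n. \<integral>w. indicator (\<Inter>j<Suc M. V j i) (snd w) * (\<Prod>j<Suc M. measure (\<kappa> (snd (snd w))) (A j i)) \<partial>J1.\<nu>)"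
proof -
  let ?V = "\<lambda>i. \<Inter>j<Suc M. V j i"
  have Vm: "?V i \<in> sets borel" if "i < n" for i using V that by (intro sets.finite_INT) auto
  have "(\<forall>j<Suc M. \<forall>i<n. copy j i \<omega> \<in> A j i \<times> V j i) \<longleftrightarrow>
      (\<forall>i<n. fst (W i \<omega>) \<in> A 0 i \<and> snd (W i \<omega>) \<in> ?V i \<and> (\<forall>j<M. X' j i \<omega> \<in> A (Suc j) i))" for \<omega>
    unfolding mem_Times_iff copy_snd All_less_Suc2 by (auto simp: D'_def All_less_Suc2 lessThan_Suc_eq_insert_0)
  then have "measure \<Omega> {\<omega> \<in> space \<Omega>. \<forall>j<Suc M. \<forall>i<n. copy j i \<omega> \<in> A j i \<times> V j i} =
      measure \<Omega> {\<omega> \<in> space \<Omega>. \<forall>i<n. fst (W i \<omega>) \<in> A 0 i \<and> snd (W i \<omega>) \<in> ?V i \<and> (\<forall>j<M. X' j i \<omega> \<in> A (Suc j) i)}"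
    by (simp only:)
  also have "\<dots> = (\<Prod>i<n. \<integral>w. indicator (A 0 i) (fst w) * (indicator (?V i) (snd w) * (\<Prod>j<M. measure (\<kappa> (snd (snd w))) (A (Suc j) i))) \<partial>J1.\<nu>)"
    by (rule product_formula) (use A Vm in auto)
  also have "\<dots> = (\<Prod>i<n. \<integral>w. indicator (?V i) (snd w) * (\<Prod>j<Suc M. measure (\<kappa> (snd (snd w))) (A j i)) \<partial>J1.\<nu>)"
  proof (intro prod.cong refl)
    fix i assume "i \<in> {..<n}" then have i: "i < n" by simp
    let ?F = "\<lambda>v. indicator (?V i) v * (\<Prod>j<M. measure (\<kappa> (snd v)) (A (Suc j) i)) :: real"
    have F: "?F \<in> borel_measurable borel"
      by (intro borel_measurable_times borel_measurable_indicator Vm i borel_measurable_prod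
          measurable_compose[OF borel_snd kappa_measurable] A) auto
    have F0: "0 \<le> ?F v" for v by (intro mult_nonneg_nonneg prod_nonneg kappa_bounds) (auto simp: kappa_bounds)
    have "(\<integral>w. indicator (A 0 i) (fst w) * ?F (snd w) \<partial>J1.\<nu>) = (\<integral>w. measure (\<kappa> (snd (snd w))) (A 0 i) * ?F (snd w) \<partial>J1.\<nu>)"
      by (rule integral_factorizes[OF fac A F F0]) (use i in auto)
    also have "\<dots> = (\<integral>w. indicator (?V i) (snd w) * (\<Prod>j<Suc M. measure (\<kappa> (snd (snd w))) (A j i)) \<partial>J1.\<nu>)"
      unfolding prod.lessThan_Suc_shift comp_def by (intro Bochner_Integration.integral_cong refl) (simp only: mult_ac)
    finally show "(\<integral>w. indicator (A 0 i) (fst w) * (indicator (?V i) (snd w) * (\<Prod>j<M. measure (\<kappa> (snd (snd w))) (A (Suc j) i))) \<partial>J1.\<nu>) =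
      (\<integral>w. indicator (?V i) (snd w) * (\<Prod>j<Suc M. measure (\<kappa> (snd (snd w))) (A j i)) \<partial>J1.\<nu>)" .
  qed
  finally show ?thesis .
qed

text \<open>The transposition puts the k-th data set in the place of the original one, which is all
  that comparing ranks requires. On boxes it merely reindexes the intersection and the product in
  \<open>copy_box_measure\<close>.\<close>

lemma config_exchangeable:
  assumes fac: kappa_factorizes and k: "k < Suc M"
  shows "distr \<Omega> (PiM idx (\<lambda>_. borel)) (config (Transposition.transpose 0 k)) = distr \<Omega> (PiM idx (\<lambda>_. borel)) (config id)"
proof -
  let ?t = "Transposition.transpose 0 k"
  have t: "?t j < Suc M" if "j < Suc M" for j using that k by (auto simp: Transposition.transpose_def)
  have tt: "?t (?t j) = j" for j by simp
  have bij: "bij_betw ?t {..<Suc M} {..<Suc M}"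
    by (rule bij_betwI[where g = ?t]) (use t in auto)
  have mt: "config ?t \<in> measurable \<Omega> (PiM idx (\<lambda>_. borel))" by (rule config_measurable[OF t])
  have mi: "config id \<in> measurable \<Omega> (PiM idx (\<lambda>_. borel))" by (rule config_measurable) simp
  have box: "emeasure (distr \<Omega> (PiM idx (\<lambda>_. borel)) (config \<pi>)) (\<Pi>\<^sub>E x\<in>idx. A x \<times> V x) =
      emeasure \<Omega> {\<omega> \<in> space \<Omega>. \<forall>j<Suc M. \<forall>i<n. copy (\<pi> j) i \<omega> \<in> A (j, i) \<times> V (j, i)}"
    if m: "config \<pi> \<in> measurable \<Omega> (PiM idx (\<lambda>_. borel))"
      and AV: "\<And>x. x \<in> idx \<Longrightarrow> A x \<in> sets borel" "\<And>x. x \<in> idx \<Longrightarrow> V x \<in> sets borel"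
    for \<pi> and A :: "nat \<times> nat \<Rightarrow> 'x set" and V :: "nat \<times> nat \<Rightarrow> ('y \<times> 'z) set"
  proof -
    have s: "(\<Pi>\<^sub>E x\<in>idx. A x \<times> V x) \<in> sets (PiM idx (\<lambda>_. borel))"
      by (intro sets_PiM_I_finite) (use AV in \<open>auto simp: borel_prod[symmetric]\<close>)
    have "config \<pi> \<omega> \<in> (\<Pi>\<^sub>E x\<in>idx. A x \<times> V x) \<longleftrightarrow> (\<forall>j<Suc M. \<forall>i<n. copy (\<pi> j) i \<omega> \<in> A (j, i) \<times> V (j, i))" for \<omega>
      unfolding config_def PiE_iff by (simp add: Ball_def) blast
    then have "config \<pi> -` (\<Pi>\<^sub>E x\<in>idx. A x \<times> V x) \<inter> space \<Omega> = {\<omega> \<in> space \<Omega>. \<forall>j<Suc M. \<forall>i<n. copy (\<pi> j) i \<omega> \<in> A (j, i) \<times> V (j, i)}"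
      unfolding vimage_def by blast
    then show ?thesis by (simp only: emeasure_distr[OF m s])
  qed
  show ?thesis
  proof (rule measure_eqI_PiM_rectangles)
    show "finite_measure (distr \<Omega> (PiM idx (\<lambda>_. borel)) (config ?t))"
      using prob_space_distr[OF mt] by (simp add: prob_space.finite_measure)
    fix A :: "nat \<times> nat \<Rightarrow> 'x set" and V :: "nat \<times> nat \<Rightarrow> ('y \<times> 'z) set"
    assume A: "\<And>x. x \<in> idx \<Longrightarrow> A x \<in> sets borel" and V: "\<And>x. x \<in> idx \<Longrightarrow> V x \<in> sets borel"
    have "(\<forall>j<Suc M. \<forall>i<n. copy (?t j) i \<omega> \<in> A (j, i) \<times> V (j, i)) \<longleftrightarrow>
        (\<forall>j<Suc M. \<forall>i<n. copy j i \<omega> \<in> A (?t j, i) \<times> V (?t j, i))" for \<omega>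
      using t tt by metis
    then have "measure \<Omega> {\<omega> \<in> space \<Omega>. \<forall>j<Suc M. \<forall>i<n. copy (?t j) i \<omega> \<in> A (j, i) \<times> V (j, i)} =
        measure \<Omega> {\<omega> \<in> space \<Omega>. \<forall>j<Suc M. \<forall>i<n. copy j i \<omega> \<in> A (?t j, i) \<times> V (?t j, i)}" by (simp only:)
    also have "\<dots> = (\<Prod>i<n. \<integral>w. indicator (\<Inter>j<Suc M. V (?t j, i)) (snd w) * (\<Prod>j<Suc M. measure (\<kappa> (snd (snd w))) (A (?t j, i))) \<partial>J1.\<nu>)"
      by (rule copy_box_measure[OF fac]) (use A V t in auto)
    also have "\<dots> = (\<Prod>i<n. \<integral>w. indicator (\<Inter>j<Suc M. V (j, i)) (snd w) * (\<Prod>j<Suc M. measure (\<kappa> (snd (snd w))) (A (j, i))) \<partial>J1.\<nu>)"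
    proof -
      have "(\<Inter>j<Suc M. V (?t j, i)) = (\<Inter>j<Suc M. V (j, i))" for i
      proof -
        have "(\<Inter>j<Suc M. V (?t j, i)) = \<Inter> ((\<lambda>j. V (j, i)) ` (?t ` {..<Suc M}))" by (simp only: image_image)
        then show ?thesis by (simp only: bij_betw_imp_surj_on[OF bij])
      qed
      moreover have "(\<Prod>j<Suc M. measure (\<kappa> z) (A (?t j, i))) = (\<Prod>j<Suc M. measure (\<kappa> z) (A (j, i)))" for z i
        by (rule prod.reindex_bij_betw[OF bij])
      ultimately show ?thesis by (simp only:)
    qed
    also have "\<dots> = measure \<Omega> {\<omega> \<in> space \<Omega>. \<forall>j<Suc M. \<forall>i<n. copy (id j) i \<omega> \<in> A (j, i) \<times> V (j, i)}"
      unfolding id_apply by (rule copy_box_measure[OF fac, symmetric]) (use A V in auto)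
    finally have "emeasure \<Omega> {\<omega> \<in> space \<Omega>. \<forall>j<Suc M. \<forall>i<n. copy (?t j) i \<omega> \<in> A (j, i) \<times> V (j, i)} =
        emeasure \<Omega> {\<omega> \<in> space \<Omega>. \<forall>j<Suc M. \<forall>i<n. copy (id j) i \<omega> \<in> A (j, i) \<times> V (j, i)}"
      unfolding emeasure_eq_measure by (rule arg_cong)
    from trans[OF box[OF mt A V] trans[OF this box[OF mi A V, symmetric]]]
    show "emeasure (distr \<Omega> (PiM idx (\<lambda>_. borel)) (config ?t)) (\<Pi>\<^sub>E x\<in>idx. A x \<times> V x) =
        emeasure (distr \<Omega> (PiM idx (\<lambda>_. borel)) (config id)) (\<Pi>\<^sub>E x\<in>idx. A x \<times> V x)" .
  qed simp_all
qed

text \<open>The 1 added in the numerator of the p-value is the comparison of the data with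
  themselves, so the numerator is the rank of the data among all M + 1 data sets.\<close>

lemma crt_reject_eq:
  "crt_reject \<Omega> T \<alpha> M W X' =
    {\<omega> \<in> space \<Omega>. (\<Sum>l<Suc M. of_bool (T (\<lambda>i. copy 0 i \<omega>) \<le> T (\<lambda>i. copy l i \<omega>))) < \<alpha> * real (Suc M)}"
proof -
  have "(1 + s) / (1 + real M) < \<alpha> \<longleftrightarrow> 1 + s < \<alpha> * real (Suc M)" for s :: real
    by (simp add: pos_divide_less_eq add.commute)
  then show ?thesis
    unfolding crt_reject_def phi_CRT_def p_CRT_def sum.lessThan_Suc_shift comp_def
    by (simp add: D'_def)
qed

text \<open>Let \<open>R k\<close> be the event that data set k has rank below \<alpha> (M + 1).
  These events have equal probability by exchangeability, and at each outcome at most \<alpha> (M +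
  1) of them occur by \<open>count_small_ranks\<close>. Taking expectations and dividing by M + 1
  gives the bound.\<close>

lemma type_I_error:
  assumes fac: kappa_factorizes and \<alpha>: "0 < \<alpha>"
    and Tm: "\<And>j. j < Suc M \<Longrightarrow> (\<lambda>\<xi>. T (\<lambda>i. \<xi> (j, i))) \<in> borel_measurable (PiM idx (\<lambda>_. borel))"
    and Tc: "\<And>D D'. (\<And>i. i < n \<Longrightarrow> D i = D' i) \<Longrightarrow> T D = T D'"
  shows "measure \<Omega> (crt_reject \<Omega> T \<alpha> M W X') \<le> \<alpha>"
proof -
  let ?c = "\<alpha> * real (Suc M)"
  define R where "R k = {\<omega> \<in> space \<Omega>. (\<Sum>l<Suc M. of_bool (T (\<lambda>i. copy k i \<omega>) \<le> T (\<lambda>i. copy l i \<omega>))) < ?c}" for k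
  define E where "E = {\<xi> \<in> space (PiM idx (\<lambda>_. borel)). (\<Sum>l<Suc M. of_bool (T (\<lambda>i. \<xi> (0, i)) \<le> T (\<lambda>i. \<xi> (l, i)))) < ?c}"
  have E: "E \<in> sets (PiM idx (\<lambda>_. borel))"
  proof -
    have "(\<lambda>\<xi>. of_bool (T (\<lambda>i. \<xi> (0, i)) \<le> T (\<lambda>i. \<xi> (l, i))) :: real) \<in> borel_measurable (PiM idx (\<lambda>_. borel))"
      if l: "l < Suc M" for l
      unfolding of_bool_def using Tm[of 0] Tm[OF l] by measurable
    then have "(\<lambda>\<xi>. \<Sum>l<Suc M. of_bool (T (\<lambda>i. \<xi> (0, i)) \<le> T (\<lambda>i. \<xi> (l, i))) :: real) \<in> borel_measurable (PiM idx (\<lambda>_. borel))"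
      by (intro borel_measurable_sum) simp
    then show ?thesis unfolding E_def by measurable
  qed
  \<comment> \<open>\<open>config\<close> is undefined outside \<open>idx\<close>, so it reproduces
    a data set only in its first n entries; \<open>Tc\<close> bridges the difference.\<close>
  have Tconf: "T (\<lambda>i. config \<pi> \<omega> (l, i)) = T (\<lambda>i. copy (\<pi> l) i \<omega>)" if "l < Suc M" for l \<pi> \<omega>
    by (rule Tc) (use that in \<open>simp add: config_def\<close>)
  have vE: "config \<pi> -` E \<inter> space \<Omega> =
      {\<omega> \<in> space \<Omega>. (\<Sum>l<Suc M. of_bool (T (\<lambda>i. copy (\<pi> 0) i \<omega>) \<le> T (\<lambda>i. copy (\<pi> l) i \<omega>))) < ?c}"
    if m: "config \<pi> \<in> measurable \<Omega> (PiM idx (\<lambda>_. borel))" for \<pi>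
  proof (rule set_eqI)
    fix \<omega>
    have sp: "config \<pi> \<omega> \<in> space (PiM idx (\<lambda>_. borel))" if "\<omega> \<in> space \<Omega>" using measurable_space[OF m that] .
    have eq: "(\<Sum>l<Suc M. of_bool (T (\<lambda>i. config \<pi> \<omega> (0, i)) \<le> T (\<lambda>i. config \<pi> \<omega> (l, i))) :: real) =
        (\<Sum>l<Suc M. of_bool (T (\<lambda>i. copy (\<pi> 0) i \<omega>) \<le> T (\<lambda>i. copy (\<pi> l) i \<omega>)))"
    proof (intro sum.cong refl)
      fix l assume "l \<in> {..<Suc M}"
      then have l: "l < Suc M" by simp
      show "of_bool (T (\<lambda>i. config \<pi> \<omega> (0, i)) \<le> T (\<lambda>i. config \<pi> \<omega> (l, i))) =
          (of_bool (T (\<lambda>i. copy (\<pi> 0) i \<omega>) \<le> T (\<lambda>i. copy (\<pi> l) i \<omega>)) :: real)"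
        unfolding Tconf[OF zero_less_Suc] Tconf[OF l] ..
    qed
    show "\<omega> \<in> config \<pi> -` E \<inter> space \<Omega> \<longleftrightarrow>
      \<omega> \<in> {\<omega> \<in> space \<Omega>. (\<Sum>l<Suc M. of_bool (T (\<lambda>i. copy (\<pi> 0) i \<omega>) \<le> T (\<lambda>i. copy (\<pi> l) i \<omega>))) < ?c}"
      unfolding E_def Int_iff vimage_eq mem_Collect_eq eq using sp by blast
  qed
  have mi: "config id \<in> measurable \<Omega> (PiM idx (\<lambda>_. borel))" by (rule config_measurable) simp
  have R: "measure \<Omega> (R k) = measure \<Omega> (R 0)" "R k \<in> sets \<Omega>" if k: "k < Suc M" for k
  proof -
    let ?t = "Transposition.transpose 0 k"
    have t: "?t j < Suc M" if "j < Suc M" for j using that k by (auto simp: Transposition.transpose_def)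
    have bij: "bij_betw ?t {..<Suc M} {..<Suc M}" by (rule bij_betwI[where g = ?t]) (use t in auto)
    have mt: "config ?t \<in> measurable \<Omega> (PiM idx (\<lambda>_. borel))" by (rule config_measurable[OF t])
    have "(\<Sum>l<Suc M. of_bool (T (\<lambda>i. copy (?t 0) i \<omega>) \<le> T (\<lambda>i. copy (?t l) i \<omega>)) :: real) =
        (\<Sum>l<Suc M. of_bool (T (\<lambda>i. copy k i \<omega>) \<le> T (\<lambda>i. copy l i \<omega>)))" for \<omega>
      using sum.reindex_bij_betw[OF bij, of "\<lambda>l. of_bool (T (\<lambda>i. copy k i \<omega>) \<le> T (\<lambda>i. copy l i \<omega>)) :: real"] by simp
    then have Rk: "R k = config ?t -` E \<inter> space \<Omega>" unfolding vE[OF mt] R_def by (simp only:)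
    then show "R k \<in> sets \<Omega>" using measurable_sets[OF mt E] by simp
    have "measure \<Omega> (R k) = measure (distr \<Omega> (PiM idx (\<lambda>_. borel)) (config ?t)) E"
      unfolding Rk by (rule measure_distr[OF mt E, symmetric])
    also have "\<dots> = measure (distr \<Omega> (PiM idx (\<lambda>_. borel)) (config id)) E"
      by (simp only: config_exchangeable[OF fac k])
    also have "\<dots> = measure \<Omega> (R 0)"
      unfolding measure_distr[OF mi E] vE[OF mi] R_def by simp
    finally show "measure \<Omega> (R k) = measure \<Omega> (R 0)" .
  qed
  have "real (Suc M) * measure \<Omega> (R 0) = (\<Sum>k<Suc M. measure \<Omega> (R k))"
  proof -
    have "(\<Sum>k<Suc M. measure \<Omega> (R k)) = (\<Sum>k<Suc M. measure \<Omega> (R 0))"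
      by (intro sum.cong refl R(1)) simp
    then show ?thesis by (simp only: sum_constant card_lessThan)
  qed
  also have "\<dots> = (\<Sum>k<Suc M. (\<integral>\<omega>. indicator (R k) \<omega> \<partial>\<Omega>))"
  proof (intro sum.cong refl)
    fix k assume "k \<in> {..<Suc M}"
    then have "R k \<in> sets \<Omega>" using R(2) by simp
    then show "measure \<Omega> (R k) = (\<integral>\<omega>. indicator (R k) \<omega> \<partial>\<Omega>)" by simp
  qed
  also have "\<dots> = (\<integral>\<omega>. (\<Sum>k<Suc M. indicator (R k) \<omega>) \<partial>\<Omega>)"
    by (rule Bochner_Integration.integral_sum[symmetric]) (use R(2) in \<open>auto simp: emeasure_finite less_top[symmetric]\<close>)
  also have "\<dots> \<le> (\<integral>\<omega>. ?c \<partial>\<Omega>)"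
  proof (rule integral_mono)
    show "integrable \<Omega> (\<lambda>\<omega>. (\<Sum>k<Suc M. indicator (R k) \<omega>) :: real)"
      by (intro Bochner_Integration.integrable_sum integrable_real_indicator) (use R(2) in \<open>auto simp: emeasure_finite less_top[symmetric]\<close>)
    fix \<omega> assume "\<omega> \<in> space \<Omega>"
    let ?J = "{j. j < Suc M \<and> (\<Sum>l<Suc M. of_bool (T (\<lambda>i. copy j i \<omega>) \<le> T (\<lambda>i. copy l i \<omega>))) < ?c}"
    have "(\<Sum>k<Suc M. indicator (R k) \<omega> :: real) = (\<Sum>k\<in>?J. 1)"
    proof (rule sum.mono_neutral_cong_right)
      show "indicator (R k) \<omega> = (1::real)" if "k \<in> ?J" for k
        using that \<open>\<omega> \<in> space \<Omega>\<close> by (intro indicator_simps(1)) (simp only: R_def mem_Collect_eq)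
      show "\<forall>k\<in>{..<Suc M} - ?J. indicator (R k) \<omega> = (0::real)"
      proof
        fix k assume k: "k \<in> {..<Suc M} - ?J"
        then have "\<omega> \<notin> R k" unfolding R_def by blast
        then show "indicator (R k) \<omega> = (0::real)" by (rule indicator_simps(2))
      qed
    qed auto
    also have "\<dots> \<le> ?c" using count_small_ranks[of ?c "Suc M" "\<lambda>j. T (\<lambda>i. copy j i \<omega>)"] \<alpha> by simp
    finally show "(\<Sum>k<Suc M. indicator (R k) \<omega>) \<le> ?c" .
  qed simp
  also have "\<dots> = ?c" using prob_space by simp
  finally have "real (Suc M) * measure \<Omega> (R 0) \<le> real (Suc M) * \<alpha>" by (simp only: mult.commute)
  then have "measure \<Omega> (R 0) \<le> \<alpha>" by (rule mult_left_le_imp_le) simp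
  then show ?thesis unfolding crt_reject_eq R_def .
qed

text \<open>The rank of the data is then 1, and 1 < \<alpha> (M + 1) is the same as M > (1 -
  \<alpha>) / \<alpha>.\<close>

lemma reject_if_larger:
  assumes \<alpha>: "(1 - \<alpha>) / \<alpha> < real M" "0 < \<alpha>" and \<omega>: "\<omega> \<in> space \<Omega>"
    and lt: "\<And>j. j < M \<Longrightarrow> T (\<lambda>i. D' j i \<omega>) < T (\<lambda>i. W i \<omega>)"
  shows "\<omega> \<in> crt_reject \<Omega> T \<alpha> M W X'"
proof -
  have "(\<Sum>l<M. of_bool (T (\<lambda>i. W i \<omega>) \<le> T (\<lambda>i. D' l i \<omega>)) :: real) = 0"
    using lt by (intro sum.neutral) (auto simp: not_le)
  then have "(\<Sum>l<Suc M. of_bool (T (\<lambda>i. copy 0 i \<omega>) \<le> T (\<lambda>i. copy l i \<omega>)) :: real) = 1"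
    unfolding sum.lessThan_Suc_shift comp_def by simp
  moreover have "1 < \<alpha> * real (Suc M)" using \<alpha> by (simp add: pos_divide_less_eq algebra_simps)
  ultimately show ?thesis unfolding crt_reject_eq using \<omega> by simp
qed

end

lemma (in crt_sample) crt_reject_measurable:
  assumes T: "\<And>l. l < Suc M \<Longrightarrow> (\<lambda>\<omega>. T (\<lambda>i. copy l i \<omega>)) \<in> borel_measurable \<Omega>"
  shows "crt_reject \<Omega> T \<alpha> M W X' \<in> sets \<Omega>"
proof -
  have "(\<lambda>\<omega>. of_bool (T (\<lambda>i. copy 0 i \<omega>) \<le> T (\<lambda>i. copy l i \<omega>)) :: real) \<in> borel_measurable \<Omega>" if l: "l < Suc M" for l
    unfolding of_bool_def using T[of 0] T[OF l] by measurable
  then have "(\<lambda>\<omega>. \<Sum>l<Suc M. of_bool (T (\<lambda>i. copy 0 i \<omega>) \<le> T (\<lambda>i. copy l i \<omega>)) :: real) \<in> borel_measurable \<Omega>"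
    by (intro borel_measurable_sum) simp
  then show ?thesis unfolding crt_reject_eq by measurable
qed

text \<open>The quotient of n h^(d + 4) by n h^d is h^4, so the two rate conditions force the
  bandwidth itself to 0.\<close>

lemma bandwidth_tendsto_0:
  fixes h :: "nat \<Rightarrow> real"
  assumes h: "\<And>n. 0 < h n" and "filterlim (\<lambda>n. real n * h n ^ d) at_top sequentially"
    and "(\<lambda>n. real n * h n ^ (d + 4)) \<longlonglongrightarrow> 0"
  shows "h \<longlonglongrightarrow> 0"
proof -
  have "(\<lambda>n. (real n * h n ^ (d + 4)) * inverse (real n * h n ^ d)) \<longlonglongrightarrow> 0 * 0"
    by (intro tendsto_mult assms(3) tendsto_inverse_0_at_top assms(2))
  moreover have "\<forall>\<^sub>F n in sequentially. (real n * h n ^ (d + 4)) * inverse (real n * h n ^ d) = h n ^ 4"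
    using eventually_ge_at_top[of "1::nat"]
  proof eventually_elim
    case (elim n)
    have nz: "real n * h n ^ d \<noteq> 0" using elim h[of n] by simp
    have cancel: "x * c * inverse c = x" if "c \<noteq> 0" for x c :: real using that by (simp add: mult.assoc)
    have "real n * h n ^ (d + 4) = h n ^ 4 * (real n * h n ^ d)" by (simp add: power_add)
    then show ?case using cancel[OF nz] by metis
  qed
  ultimately have "(\<lambda>n. h n ^ 4) \<longlonglongrightarrow> 0" using tendsto_cong[of "\<lambda>n. (real n * h n ^ (d + 4)) * inverse (real n * h n ^ d)" "\<lambda>n. h n ^ 4" sequentially 0] by simp
  then have "(\<lambda>n. root 4 (h n ^ 4)) \<longlonglongrightarrow> root 4 0" by (intro tendsto_real_root)
  then show ?thesis using h by (simp add: real_root_power_cancel less_imp_le)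
qed

lemma kernel_statistic_measurable:
  fixes D :: "'c \<Rightarrow> nat \<Rightarrow> 'x::euclidean_space \<times> 'y::euclidean_space \<times> 'z::euclidean_space"
  assumes K1: "radial_kernel TYPE('y \<times> 'z) K CK" and K2: "radial_kernel TYPE('z) K CK"
    and a: "a \<in> borel_measurable borel" and h: "0 < h1" "0 < h2"
    and D: "\<And>i. i < n \<Longrightarrow> (\<lambda>\<xi>. D \<xi> i) \<in> borel_measurable N"
  shows "(\<lambda>\<xi>. zeta_hat K h1 h2 a n (D \<xi>)) \<in> borel_measurable N"
proof (rule zeta_hat_measurable[OF radial_kernel.K_nonneg[OF K1] a])
  fix i j assume ij: "i < n" "j < n"
  note m = measurable_compose[OF D[OF ij(1)] borel_snd] measurable_compose[OF D[OF ij(2)] borel_snd]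
  show "(\<lambda>\<xi>. K (norm (dYZ (D \<xi>) i - dYZ (D \<xi>) j) / h1)) \<in> borel_measurable N"
    by (rule radial_kernel.K_dist_measurable[OF K1 h(1) m])
  show "(\<lambda>\<xi>. K (norm (dZ (D \<xi>) i - dZ (D \<xi>) j) / h2)) \<in> borel_measurable N"
    by (rule radial_kernel.K_dist_measurable[OF K2 h(2) measurable_compose[OF m(1) borel_snd] measurable_compose[OF m(2) borel_snd]])
qed (rule D)

section \<open>Size and power of the test\<close>

theorem proposition4p1:
  fixes S :: "'s measure"
    and X :: "'s \<Rightarrow> 'x::euclidean_space"
    and Y :: "'s \<Rightarrow> 'y::euclidean_space"
    and Z :: "'s \<Rightarrow> 'z::euclidean_space"
    and p :: "'x \<times> 'y \<times> 'z \<Rightarrow> real"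
    and \<kappa> :: "'z \<Rightarrow> 'x measure"
    and K :: "real \<Rightarrow> real" and h1 h2 :: "nat \<Rightarrow> real"
    and a :: "'y \<times> 'z \<Rightarrow> real" and \<alpha> :: real and M :: nat
    and \<Omega> :: "nat \<Rightarrow> 'w measure"
    and W :: "nat \<Rightarrow> nat \<Rightarrow> 'w \<Rightarrow> 'x \<times> 'y \<times> 'z"
    and X' :: "nat \<Rightarrow> nat \<Rightarrow> nat \<Rightarrow> 'w \<Rightarrow> 'x"
  assumes "prob_space S"
    and "\<And>w. 0 \<le> p w"
    and "distributed S lborel (\<lambda>\<omega>. (X \<omega>, Y \<omega>, Z \<omega>)) (\<lambda>w. ennreal (p w))"
    and "cond_distribution S X Z \<kappa>"
    and "assumption_A1 p"
    and "assumption_A2 TYPE('y) TYPE('z) K"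
    and "assumption_A3 (DIM('y) + DIM('z)) DIM('z) h1 h2"
    and "weight_function p a"
    and "0 < \<alpha>" and "\<alpha> < 1"
    and "\<And>n. n \<ge> 1 \<Longrightarrow> crt_experiment (\<Omega> n) p \<kappa> M n (W n) (X' n)"
  shows "(cond_indep S X Y Z \<longrightarrow>
            (\<forall>n\<ge>1. measure (\<Omega> n)
               (crt_reject (\<Omega> n) (zeta_hat K (h1 n) (h2 n) a n) \<alpha> M (W n) (X' n)) \<le> \<alpha>)) \<and>
         (\<not> cond_indep S X Y Z \<and> real M > (1 - \<alpha>) / \<alpha> \<longrightarrow>
            (\<lambda>n. measure (\<Omega> n)
               (crt_reject (\<Omega> n) (zeta_hat K (h1 n) (h2 n) a n) \<alpha> M (W n) (X' n))) \<longlonglongrightarrow> 1)"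
proof -
  interpret S: prob_space S by fact
  note dist = assms(3) and \<kappa> = assms(4)
  obtain C0 where C0: "\<And>y z. (\<integral>\<^sup>+x. ennreal (p (x, y, z)) \<partial>lborel) \<le> ennreal C0"
    "\<And>x z. (\<integral>\<^sup>+y. ennreal (p (x, y, z)) \<partial>lborel) \<le> ennreal C0"
    "\<And>z. (\<integral>\<^sup>+(x, y). ennreal (p (x, y, z)) \<partial>lborel) \<le> ennreal C0"
    using assms(5) unfolding assumption_A1_def bounded_with_marginals_def by blast
  \<comment> \<open>\<open>ennreal\<close> reads a negative bound as 0, whereas
    \<open>joint_density\<close> asks for a nonnegative real.\<close>
  define C where "C = max C0 0"
  have CC: "ennreal C0 \<le> ennreal C" by (simp add: C_def ennreal_leI)
  have p[measurable]: "p \<in> borel_measurable borel"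
    using distributed_real_measurable[OF _ dist] assms(2) by simp
  have mXYZ: "(\<lambda>\<omega>. (X \<omega>, Y \<omega>, Z \<omega>)) \<in> borel_measurable S" using distributed_measurable[OF dist] by simp
  have mX: "X \<in> borel_measurable S" using measurable_compose[OF mXYZ borel_fst] by simp
  have mY: "Y \<in> borel_measurable S" using measurable_compose[OF measurable_compose[OF mXYZ borel_snd] borel_fst] by simp
  have mZ: "Z \<in> borel_measurable S" using measurable_compose[OF measurable_compose[OF mXYZ borel_snd] borel_snd] by simp
  have law: "distr S borel (\<lambda>\<omega>. (X \<omega>, Y \<omega>, Z \<omega>)) = density lborel (\<lambda>w. ennreal (p w))"
    using distributed_distr_eq_density[OF dist] by (simp cong: distr_cong)
  interpret J: joint_density p C
  proof
    interpret D: prob_space "distr S borel (\<lambda>\<omega>. (X \<omega>, Y \<omega>, Z \<omega>))" by (rule S.prob_space_distr[OF mXYZ])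
    show "(\<integral>\<^sup>+w. ennreal (p w) \<partial>lborel) = 1"
      using D.emeasure_space_1 unfolding law by (simp add: emeasure_density)
    show "(\<integral>\<^sup>+x. ennreal (p (x, u)) \<partial>lborel) \<le> ennreal C" for u
      using C0(1)[of "fst u" "snd u"] CC by simp
  qed (use assms(2) in \<open>auto simp: C_def\<close>)
  have \<nu>: "J.\<nu> = distr S borel (\<lambda>\<omega>. (X \<omega>, Y \<omega>, Z \<omega>))" unfolding J.\<nu>_def law ..
  have int_\<nu>: "(\<integral>w. f w \<partial>J.\<nu>) = (\<integral>\<omega>. f (X \<omega>, Y \<omega>, Z \<omega>) \<partial>S)" if "f \<in> borel_measurable borel" for f :: "_ \<Rightarrow> real"
    unfolding \<nu> by (rule integral_distr[OF mXYZ that])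
  have \<kappa>m: "\<kappa> \<in> measurable borel (prob_algebra borel)" using \<kappa> by (simp add: cond_distribution_def)
  have \<kappa>A: "(\<lambda>w :: 'x \<times> 'y \<times> 'z. measure (\<kappa> (snd (snd w))) A) \<in> borel_measurable borel" if "A \<in> sets borel" for A
    unfolding measure_def
    by (intro measurable_compose[OF measurable_compose[OF measurable_compose[OF borel_snd borel_snd]
        measurable_compose[OF measurable_prob_algebraD[OF \<kappa>m] measurable_emeasure_subprob_algebra[OF that]]] borel_measurable_enn2real]) simp
  have zB: "(\<lambda>w :: 'x \<times> 'y \<times> 'z. indicator B (snd (snd w)) :: real) \<in> borel_measurable borel" if "B \<in> sets borel" for B
    by (rule measurable_compose[OF measurable_compose[OF borel_snd borel_snd] borel_measurable_indicator[OF that]])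
  have yB: "(\<lambda>w :: 'x \<times> 'y \<times> 'z. indicator B (fst (snd w)) :: real) \<in> borel_measurable borel" if "B \<in> sets borel" for B
    by (rule measurable_compose[OF measurable_compose[OF borel_snd borel_fst] borel_measurable_indicator[OF that]])
  have xB: "(\<lambda>w :: 'x \<times> 'y \<times> 'z. indicator B (fst w) :: real) \<in> borel_measurable borel" if "B \<in> sets borel" for B
    by (rule measurable_compose[OF borel_fst borel_measurable_indicator[OF that]])
  interpret CM: crt_model p C \<kappa>
  proof
    show "\<kappa> \<in> measurable borel (prob_algebra borel)" by (rule \<kappa>m)
    show "(\<integral>\<^sup>+y. ennreal (p (x, y, z)) \<partial>lborel) \<le> ennreal C" for x z using C0(2)[of x z] CC by simp
    show "(\<integral>\<^sup>+w. ennreal (p (fst w, snd w, z)) \<partial>lborel) \<le> ennreal C" for z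
      using C0(3)[of z] CC by (simp add: split_beta')
    fix A :: "'x set" and B :: "'z set" assume A: "A \<in> sets borel" and B: "B \<in> sets borel"
    have "{w :: 'x \<times> 'y \<times> 'z. fst w \<in> A \<and> snd (snd w) \<in> B} = fst -` A \<inter> (\<lambda>w. snd (snd w)) -` B" by auto
    moreover have "fst -` A \<in> sets (borel :: ('x \<times> 'y \<times> 'z) measure)"
      using measurable_sets[OF borel_fst A] by simp
    moreover have "(\<lambda>w :: 'x \<times> 'y \<times> 'z. snd (snd w)) -` B \<in> sets borel"
      using measurable_sets[OF measurable_compose[OF borel_snd borel_snd] B] by simp
    ultimately have AB: "{w :: 'x \<times> 'y \<times> 'z. fst w \<in> A \<and> snd (snd w) \<in> B} \<in> sets borel" by auto
    have "measure J.\<nu> {w. fst w \<in> A \<and> snd (snd w) \<in> B} = measure S {\<omega> \<in> space S. X \<omega> \<in> A \<and> Z \<omega> \<in> B}"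
      unfolding \<nu> measure_distr[OF mXYZ AB] by (intro arg_cong[where f = "measure S"]) auto
    also have "\<dots> = (\<integral>\<omega>. indicator B (Z \<omega>) * measure (\<kappa> (Z \<omega>)) A \<partial>S)"
      using \<kappa> A B by (simp add: cond_distribution_def)
    also have "\<dots> = (\<integral>w. indicator B (snd (snd w)) * measure (\<kappa> (snd (snd w))) A \<partial>J.\<nu>)"
      by (subst int_\<nu>) (use zB[OF B] \<kappa>A[OF A] in auto)
    finally show "measure J.\<nu> {w. fst w \<in> A \<and> snd (snd w) \<in> B} =
      (\<integral>w. indicator B (snd (snd w)) * measure (\<kappa> (snd (snd w))) A \<partial>J.\<nu>)" .
  qed
  have CI: "cond_indep S X Y Z \<longleftrightarrow> CM.kappa_factorizes"
    unfolding cond_indep_iff[OF assms(1) mX mY mZ \<kappa>] CM.kappa_factorizes_def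
  proof (intro ball_cong refl)
    fix A :: "'x set" and B :: "'y set" and D :: "'z set"
    assume A: "A \<in> sets borel" and B: "B \<in> sets borel" and D: "D \<in> sets borel"
    have "(\<integral>w. indicator D (snd (snd w)) * (indicator A (fst w) * indicator B (fst (snd w))) \<partial>J.\<nu>) =
        (\<integral>\<omega>. indicator D (Z \<omega>) * (indicator A (X \<omega>) * indicator B (Y \<omega>)) \<partial>S :: real)"
      by (subst int_\<nu>) (use zB[OF D] xB[OF A] yB[OF B] in auto)
    moreover have "(\<integral>w. indicator D (snd (snd w)) * (measure (\<kappa> (snd (snd w))) A * indicator B (fst (snd w))) \<partial>J.\<nu>) =
        (\<integral>\<omega>. indicator D (Z \<omega>) * (measure (\<kappa> (Z \<omega>)) A * indicator B (Y \<omega>)) \<partial>S)"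
      by (subst int_\<nu>) (use zB[OF D] \<kappa>A[OF A] yB[OF B] in auto)
    ultimately show "((\<integral>\<omega>. indicator D (Z \<omega>) * (indicator A (X \<omega>) * indicator B (Y \<omega>)) \<partial>S) =
        (\<integral>\<omega>. indicator D (Z \<omega>) * (measure (\<kappa> (Z \<omega>)) A * indicator B (Y \<omega>)) \<partial>S)) \<longleftrightarrow>
      ((\<integral>w. indicator D (snd (snd w)) * (indicator A (fst w) * indicator B (fst (snd w))) \<partial>J.\<nu>) =
        (\<integral>w. indicator D (snd (snd w)) * (measure (\<kappa> (snd (snd w))) A * indicator B (fst (snd w))) \<partial>J.\<nu>))" by simp
  qed
  obtain CK where K: "\<And>t. 0 \<le> K t" "\<And>t. K t \<le> CK"
    and K1: "has_bochner_integral lborel (\<lambda>u::'y \<times> 'z. K (norm u)) 1"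
    and K2: "has_bochner_integral lborel (\<lambda>u::'z. K (norm u)) 1"
    using assms(6) unfolding assumption_A2_def kernel_moments_def by blast
  interpret R1: radial_kernel K CK "TYPE('y \<times> 'z)" by unfold_locales (use K K1 in auto)
  interpret R2: radial_kernel K CK "TYPE('z)" by unfold_locales (use K K2 in auto)
  obtain Ca0 where a: "a \<in> borel_measurable borel" "\<And>v. 0 \<le> a v" "\<And>v. a v \<le> Ca0"
    "\<And>y z. 0 < marg_YZ p y z \<Longrightarrow> 0 < a (y, z)"
    using assms(8) unfolding weight_function_def by blast
  have h1: "\<And>n. 0 < h1 n" "filterlim (\<lambda>n. real n * h1 n ^ DIM('y \<times> 'z)) at_top sequentially" "h1 \<longlonglongrightarrow> 0"
    and h2: "\<And>n. 0 < h2 n" "filterlim (\<lambda>n. real n * h2 n ^ DIM('z)) at_top sequentially" "h2 \<longlonglongrightarrow> 0"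
    using assms(7) bandwidth_tendsto_0[of h1 "DIM('y) + DIM('z)"] bandwidth_tendsto_0[of h2 "DIM('z)"]
    unfolding assumption_A3_def by (simp_all add: add.assoc)
  have CS: "crt_sample p C \<kappa> (\<Omega> n) M n (W n) (X' n)" if n: "1 \<le> n" for n
  proof -
    interpret prob_space "\<Omega> n" using assms(11)[OF n] by (simp add: crt_experiment_def)
    show ?thesis by unfold_locales (use n assms(11)[OF n] in auto)
  qed
  note statistic_measurable = kernel_statistic_measurable[OF R1.radial_kernel_axioms R2.radial_kernel_axioms a(1) h1(1) h2(1)]
  show ?thesis
  proof (intro conjI impI allI)
    fix n :: nat assume ci: "cond_indep S X Y Z" and n: "1 \<le> n"
    interpret crt_sample p C \<kappa> "\<Omega> n" M n "W n" "X' n" by (rule CS[OF n])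
    show "measure (\<Omega> n) (crt_reject (\<Omega> n) (zeta_hat K (h1 n) (h2 n) a n) \<alpha> M (W n) (X' n)) \<le> \<alpha>"
    proof (rule type_I_error[OF _ assms(9)])
      show CM.kappa_factorizes using ci CI by simp
      show "(\<lambda>\<xi>. zeta_hat K (h1 n) (h2 n) a n (\<lambda>i. \<xi> (j, i))) \<in> borel_measurable (PiM ({..<Suc M} \<times> {..<n}) (\<lambda>_. borel))"
        if "j < Suc M" for j
        by (rule statistic_measurable) (use that in \<open>auto intro: measurable_component_singleton\<close>)
      show "zeta_hat K (h1 n) (h2 n) a n D = zeta_hat K (h1 n) (h2 n) a n D'" if "\<And>i. i < n \<Longrightarrow> D i = D' i" for D D'
        by (rule zeta_hat_cong[OF K(1) that])
    qed
  next
    assume alt: "\<not> cond_indep S X Y Z \<and> real M > (1 - \<alpha>) / \<alpha>"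
    \<comment> \<open>The bound on the weight is made positive, since it occurs as a denominator in
      \<open>zeta_hat_tendsto\<close>.\<close>
    define Ca where "Ca = max Ca0 1"
    have TK1: "two_kernels p CM.pXZ C K CK a Ca"
      by unfold_locales (use a(1-3) in \<open>auto simp: Ca_def intro: max.coboundedI1\<close>)
    have TK2: "two_kernels CM.q CM.pXZ C K CK a Ca"
      by unfold_locales (use a(1-3) in \<open>auto simp: Ca_def intro: max.coboundedI1\<close>)
    define z where "z = two_kernels.zeta p CM.pXZ a"
    have z: "0 < z" unfolding z_def
    proof (rule CM.zeta_p_pos[OF TK1])
      show "\<not> CM.kappa_factorizes" using alt CI by simp
      show "0 < a v" if "0 < J.slice UNIV v" for v
        using a(4)[of "fst v" "snd v"] that unfolding marg_YZ_def J.slice_def by simp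
    qed
    \<comment> \<open>The resamples of all n in one function. The locale version is available for
      each n \<ge> 1 separately, whereas the limit theorem takes a whole sequence of
      samples.\<close>
    define D' where "D' n j i \<omega> = (X' n j i \<omega>, snd (W n i \<omega>))" for n j i \<omega>
    have D': "crt_sample.D' (W n) (X' n) = D' n" if "1 \<le> n" for n
      unfolding D'_def crt_sample.D'_def[OF CS[OF that]] by (intro ext) simp
    interpret TS: two_samples p CM.pXZ C K CK a Ca \<Omega> W h1 h2
    proof (intro two_samples.intro two_samples_axioms.intro TK1 h1 h2)
      fix n :: nat assume n: "1 \<le> n"
      interpret crt_sample p C \<kappa> "\<Omega> n" M n "W n" "X' n" by (rule CS[OF n])
      show "iid_sample p C (\<Omega> n) (W n) n" by (rule W.iid_sample_axioms)
      show "iid_sample CM.pXZ C (\<Omega> n) (\<lambda>i \<omega>. (fst (W n i \<omega>), snd (snd (W n i \<omega>)))) n" by (rule W_XZ_iid)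
    qed
    have TS': "two_samples CM.q CM.pXZ C K CK a Ca \<Omega> (\<lambda>n. D' n j) h1 h2" if j: "j < M" for j
    proof (intro two_samples.intro two_samples_axioms.intro TK2 h1 h2)
      fix n :: nat assume n: "1 \<le> n"
      interpret crt_sample p C \<kappa> "\<Omega> n" M n "W n" "X' n" by (rule CS[OF n])
      show "iid_sample CM.q C (\<Omega> n) (D' n j) n" using D'_iid[OF j] D'[OF n] by simp
      show "iid_sample CM.pXZ C (\<Omega> n) (\<lambda>i \<omega>. (fst (D' n j i \<omega>), snd (snd (D' n j i \<omega>)))) n"
        using D'_XZ_iid[OF j] D'[OF n] by simp
    qed
    let ?T = "\<lambda>n. zeta_hat K (h1 n) (h2 n) a n"
    \<comment> \<open>The threshold z / 2 separates the limit z for the data from the limit 0 for a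
      resample. Outside these M + 1 bad events the data exceed z / 2 and all resamples stay below
      it. Since M is fixed, the union bound tends to 0.\<close>
    let ?B = "\<lambda>n. {\<omega> \<in> space (\<Omega> n). z / 2 \<le> \<bar>?T n (\<lambda>i. W n i \<omega>) - z\<bar>}"
    let ?B' = "\<lambda>n j. {\<omega> \<in> space (\<Omega> n). z / 2 \<le> \<bar>?T n (\<lambda>i. D' n j i \<omega>)\<bar>}"
    have lim0: "(\<lambda>n. measure (\<Omega> n) (?B n)) \<longlonglongrightarrow> 0"
      using TS.zeta_hat_tendsto[of "z / 2"] z unfolding z_def by simp
    have lim1: "(\<lambda>n. measure (\<Omega> n) (?B' n j)) \<longlonglongrightarrow> 0" if "j < M" for j
      using two_samples.zeta_hat_tendsto[OF TS'[OF that], of "z / 2"] z CM.zeta_q_eq_0[OF TK2] by simp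
    show "(\<lambda>n. measure (\<Omega> n) (crt_reject (\<Omega> n) (?T n) \<alpha> M (W n) (X' n))) \<longlonglongrightarrow> 1"
    proof (rule tendsto_sandwich[OF _ _ _ tendsto_const])
      have "(\<lambda>n. 1 - (measure (\<Omega> n) (?B n) + (\<Sum>j<M. measure (\<Omega> n) (?B' n j)))) \<longlonglongrightarrow> 1 - (0 + (\<Sum>j<M. 0))"
        by (intro tendsto_diff tendsto_const tendsto_add lim0 tendsto_sum lim1) simp
      then show "(\<lambda>n. 1 - (measure (\<Omega> n) (?B n) + (\<Sum>j<M. measure (\<Omega> n) (?B' n j)))) \<longlonglongrightarrow> 1" by simp
      show "\<forall>\<^sub>F n in sequentially. measure (\<Omega> n) (crt_reject (\<Omega> n) (?T n) \<alpha> M (W n) (X' n)) \<le> 1"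
        using eventually_ge_at_top[of "1::nat"]
      proof eventually_elim
        case (elim n)
        interpret prob_space "\<Omega> n" using assms(11)[OF elim] by (simp add: crt_experiment_def)
        show ?case by (rule prob_le_1)
      qed
      show "\<forall>\<^sub>F n in sequentially. 1 - (measure (\<Omega> n) (?B n) + (\<Sum>j<M. measure (\<Omega> n) (?B' n j))) \<le>
          measure (\<Omega> n) (crt_reject (\<Omega> n) (?T n) \<alpha> M (W n) (X' n))"
        using eventually_ge_at_top[of "1::nat"]
      proof eventually_elim
        case (elim n)
        interpret CR: crt_sample p C \<kappa> "\<Omega> n" M n "W n" "X' n" by (rule CS[OF elim])
        let ?R = "crt_reject (\<Omega> n) (?T n) \<alpha> M (W n) (X' n)"
        have Tm: "(\<lambda>\<omega>. ?T n (\<lambda>i. CR.copy l i \<omega>)) \<in> borel_measurable (\<Omega> n)" if "l < Suc M" for l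
          by (rule statistic_measurable) (rule CR.copy_measurable[OF that])
        have R: "?R \<in> sets (\<Omega> n)" by (rule CR.crt_reject_measurable[OF Tm])
        have TW: "(\<lambda>\<omega>. ?T n (\<lambda>i. W n i \<omega>)) \<in> borel_measurable (\<Omega> n)" using Tm[of 0] by simp
        have TD: "(\<lambda>\<omega>. ?T n (\<lambda>i. D' n j i \<omega>)) \<in> borel_measurable (\<Omega> n)" if "j < M" for j
          using Tm[of "Suc j"] that D'[OF elim] by simp
        have B: "?B n \<in> sets (\<Omega> n)" using TW by measurable
        have B': "?B' n j \<in> sets (\<Omega> n)" if "j < M" for j using TD[OF that] by measurable
        have sub: "space (\<Omega> n) \<subseteq> ?R \<union> (?B n \<union> (\<Union>j<M. ?B' n j))"
        proof
          fix \<omega> assume \<omega>: "\<omega> \<in> space (\<Omega> n)"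
          show "\<omega> \<in> ?R \<union> (?B n \<union> (\<Union>j<M. ?B' n j))"
          proof (cases "\<omega> \<in> ?B n \<union> (\<Union>j<M. ?B' n j)")
            case False
            then have w: "\<bar>?T n (\<lambda>i. W n i \<omega>) - z\<bar> < z / 2" and d: "\<And>j. j < M \<Longrightarrow> \<bar>?T n (\<lambda>i. D' n j i \<omega>)\<bar> < z / 2"
              using \<omega> by (auto simp: not_le)
            have "\<omega> \<in> ?R"
            proof (rule CR.reject_if_larger[OF _ assms(9) \<omega>])
              show "(1 - \<alpha>) / \<alpha> < real M" using alt by simp
              fix j assume "j < M"
              from d[OF this] w have "?T n (\<lambda>i. D' n j i \<omega>) < ?T n (\<lambda>i. W n i \<omega>)" by linarith
              then show "?T n (\<lambda>i. CR.D' j i \<omega>) < ?T n (\<lambda>i. W n i \<omega>)" by (simp only: D'[OF elim])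
            qed
            then show ?thesis by simp
          qed simp
        qed
        have "1 = measure (\<Omega> n) (space (\<Omega> n))" by (simp only: CR.prob_space)
        also have "\<dots> \<le> measure (\<Omega> n) (?R \<union> (?B n \<union> (\<Union>j<M. ?B' n j)))"
          by (rule CR.finite_measure_mono[OF sub]) (use R B B' in auto)
        also have "\<dots> \<le> measure (\<Omega> n) ?R + measure (\<Omega> n) (?B n \<union> (\<Union>j<M. ?B' n j))"
          by (rule measure_Un_le) (use R B B' in auto)
        also have "measure (\<Omega> n) (?B n \<union> (\<Union>j<M. ?B' n j)) \<le> measure (\<Omega> n) (?B n) + measure (\<Omega> n) (\<Union>j<M. ?B' n j)"
          by (rule measure_Un_le) (use B B' in auto)
        also have "measure (\<Omega> n) (\<Union>j<M. ?B' n j) \<le> (\<Sum>j<M. measure (\<Omega> n) (?B' n j))"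
          by (rule measure_UNION_le) (use B' in auto)
        finally show ?case by simp
      qed
    qed
  qed
qed

end
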